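(* Let $(\mathfrak g,\mathfrak l,\tau)$ be a super-symmetric triple whose decorated Dynkin diagram is a graded Satake diagram (i.e. it obeys the selection rules listed in the context). Then, with an appropriate normalization of the root vectors $e_\alpha\in\mathfrak g_\alpha\setminus\{0\}$ and $f_{\tilde\alpha}\in\mathfrak g_{-\tilde\alpha}\setminus\{0\}$, $\alpha\in\bar\Pi_{\mathfrak l}$, for every vector $\vec c=(c_\alpha)_{\alpha\in\bar\Pi_{\mathfrak l}}$ of non-zero complex numbers (mixture parameters) subject to $c_{\tau(\alpha)}=c_\alpha$ for all $\alpha\in\bar\Pi_{\mathfrak l}$, the spherical Lie superalgebra $\mathfrak k=\mathfrak k(\vec c)\subset\mathfrak g$ generated by $\mathfrak l$ and by $$x_\alpha=e_\alpha+c_\alpha f_{\tilde\alpha},\qquad y_\alpha=h_\alpha-h_{\tilde\alpha},\qquad \alpha\in\bar\Pi_{\mathfrak l},$$ is non-trivial, i.e. it is a proper subalgebra: $\mathfrak k\neq\mathfrak g$.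
   Context: Everything is over $\mathbb C$. The Lie superalgebras. Let $V=\bigoplus_{i=1}^N\mathbb C v_i$ be a $\mathbb Z_2$-graded space, $\deg v_i=\bar i\in\{0,1\}$, $i'=N+1-i$. The Cartan subalgebra $\mathfrak h$ consists of the diagonal matrices in $\mathfrak g$, $\zeta_i\in\mathfrak h^*$ is the weight of $v_i$, and $\mathfrak g_+$ ($\mathfrak g_-$) consists of the strictly upper (lower) triangular matrices in $\mathfrak g$. $\mathfrak g$ is one of the following. - Shape A: $\mathfrak g=\mathfrak{gl}(V)$ with any grading; simple roots $\alpha_i=\zeta_i-\zeta_{i+1}$, $1\le i\le N-1$. Put $n=N-1$. - Ortho-symplectic: $n=[N/2]$, $\bar i=\overline{i'}$ for all $i$, and if $N$ is odd $\deg v_{n+1}=0$; $\mathfrak g\subset\mathrm{End}(V)$ preserves an even nondegenerate bilinear form that pairs $v_i$ non-trivially only with $v_{i'}$ and satisfies $b(v_{i'},v_i)=\epsilon_i b(v_i,v_{i'})$, $i\le n$, with $\epsilon_i=\pm1$, $\epsilon_i\epsilon_k=(-1)^{\bar i+\bar k}$. Then $\zeta_{i'}=-\zeta_i$. Shape B: $N$ odd, $\epsilon_i=(-1)^{\bar i}$, simple roots $\alpha_i=\zeta_i-\zeta_{i+1}$ ($i<n$), $\alpha_n=\zeta_n$. Shape C: $N$ even, $\epsilon_n=-1$, $\alpha_i=\zeta_i-\zeta_{i+1}$ ($i<n$), $\alpha_n=2\zeta_n$. Shape D: $N$ even, $n\ge2$, $\epsilon_n=1$, $\alpha_i=\zeta_i-\zeta_{i+1}$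 ($i<n$), $\alpha_n=\zeta_{n-1}+\zeta_n$. $\Pi$ is the set of simple roots, $\mathrm R=\mathrm R^+\cup\mathrm R^-$ the root system. The inner product on $\mathfrak h^*$ is given by $(\zeta_i,\zeta_j)=\delta_{ij}(-1)^{\bar i}$ ($i,j\le N$ for $\mathfrak{gl}$; $i,j\le n$ otherwise); $h_\lambda\in\mathfrak h$ is defined by $\mu(h_\lambda)=(\mu,\lambda)$. A root is even/odd according to the parity of its root vector. An odd root $\beta$ is isotropic if $(\beta,\beta)=0$. Two simple roots are linked in the Dynkin diagram $D$ if their inner product is non-zero. Triples. For $\Pi_{\mathfrak l}\subset\Pi$ put $\bar\Pi_{\mathfrak l}=\Pi\setminus\Pi_{\mathfrak l}$ and let $\mathfrak l\subset\mathfrak g$ be the subalgebra generated by the root vectors $e_\alpha,f_\alpha$ of roots $\pm\alpha$, $\alpha\in\Pi_{\mathfrak l}$. For $\alpha\in\bar\Pi_{\mathfrak l}$ let $V^+_\alpha\subset\mathfrak g$ be the $\mathfrak l$-submodule (adjoint action) generated by $\mathfrak g_\alpha$. Let $\tau$ be a permutation of $\bar\Pi_{\mathfrak l}$ and let $\tilde\alpha\in\mathrm R^+$ be the highest weight of $V^+_{\tau(\alpha)}$ (the weight $\lambda$ such that $\lambda-\mu\in\mathbb Z_{\ge0}\Pi_{\mathfrak l}$ for every weight $\mu$ of the module). The triple $(\mathfrak g,\mathfrak l,\tau)$ is super-symmetric if $\alpha$ and $\tilde\alpha$ have the same parity for all $\alpha\in\bar\Pi_{\mathfrak l}$ and $(\mu+\tilde\mu,\alpha)=0$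 for all $\mu\in\bar\Pi_{\mathfrak l},\alpha\in\Pi_{\mathfrak l}$; $(\mu+\tilde\mu,\nu-\tilde\nu)=0$ for all $\mu,\nu\in\bar\Pi_{\mathfrak l}$. A subalgebra $\mathfrak k\subset\mathfrak g$ is spherical if $\mathfrak g=\mathfrak k+\mathfrak b$ for the Borel subalgebra $\mathfrak b=\mathfrak h\oplus\mathfrak g_+$. Decorated Dynkin diagram: the Dynkin diagram $D$ of $\mathfrak g$ with nodes of $\Pi_{\mathfrak l}$ painted black, nodes of $\bar\Pi_{\mathfrak l}$ white, together with $\tau$. For a white node $\alpha$, $D(\alpha)$ is the full sub-graph on $\alpha$, $\tau(\alpha)$ and all connected components of the black sub-graph that are linked to $\alpha$ or $\tau(\alpha)$. Selection rules. The diagram obeys the selection rules (is a graded Satake diagram) if none of the following occurs (sub-graphs are meant up to isomorphism of the corresponding subalgebras, regardless of orientation; a "single link" is a link as between neighbouring roots of a shape A diagram): (1) a white $\beta$ with $D(\beta)=\{\alpha,\beta\}$, $\alpha$ black, $\alpha$ and $\beta$ joined by a single link, except when $\beta$ is odd and $\alpha$ is even; (2) a white odd isotropic $\beta$ with $D(\beta)=\{\beta\}$ and a white node $\alpha\ne\beta$ with $(\alpha,\beta)\neq0$; (3) a white odd $\beta$ with $D(\beta)=\{\alpha,\beta,\gamma\}$, where $\alpha,\gamma$ are black and even, and $\alpha-\beta-\gamma$ is a chain with single links, together with a white $\sigma\neq\beta$ (of any parity) such that $(\gamma,\sigma)\ne0$, $\tau(\sigma)=\sigma$, $\alpha\notin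 D(\sigma)$; (4) shape D, $\alpha_{n-4}$ black even, $\alpha_{n-3}$ white odd, $\alpha_{n-2}$ black even, $\alpha_{n-1},\alpha_n$ white even and interchanged by $\tau$, with $D(\alpha_{n-3})=\{\alpha_{n-4},\alpha_{n-3},\alpha_{n-2}\}$ and $D(\alpha_n)=\{\alpha_{n-2},\alpha_{n-1},\alpha_n\}$; (5) shape D, $\alpha_{n-3}$ black even, $\alpha_{n-2}$ white odd, $\alpha_{n-1},\alpha_n$ even, one of them black and the other white, and $D(\alpha_{n-2})$ consists of $\alpha_{n-3},\alpha_{n-2}$ and the black node among $\alpha_{n-1},\alpha_n$.
   Formalization: Two cases where k = g are excluded: Π_l = Π for ortho-symplectic g (no white nodes, k = l = g), and selection rule (4) is also imposed when the interchanged white nodes α_{n-1}, α_n are odd (e.g. n = 5, parities 0,0,1,1,0). *)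

theory Defs
  imports Complex_Main "Jordan_Normal_Form.Matrix"
begin

text \<open>
  Indices are 0-based throughout: the basis of \<open>V\<close> is \<open>v\<^sub>0, \<dots>, v\<^sub>N\<^sub>-\<^sub>1\<close>, the involution on indices is
  \<open>i' = N - 1 - i\<close>, and the nodes of the Dynkin diagram are \<open>\<alpha>\<^sub>0, \<dots>, \<alpha>\<^sub>n\<^sub>-\<^sub>1\<close>.
\<close>

datatype shape = ShapeA | ShapeB | ShapeC | ShapeD

text \<open>\<open>form G $$ (i, j)\<close> is \<open>b(v\<^sub>i, v\<^sub>j)\<close>; it plays no role for shape A.\<close>

record super_data =
  shape :: shape
  dimV :: nat
  par :: "nat \<Rightarrow> nat"
  form :: "complex mat"

definition nodes :: "super_data \<Rightarrow> nat" where
  "nodes G = (if shape G = ShapeA then dimV G - 1 else dimV G div 2)"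

definition ortho_symplectic :: "super_data \<Rightarrow> bool" where
  "ortho_symplectic G \<longleftrightarrow>
     (let N = dimV G; n = nodes G; b = form G in
      (\<forall>i<N. par G i = par G (N - 1 - i)) \<and>
      b \<in> carrier_mat N N \<and>
      (\<forall>i<N. \<forall>j<N. b $$ (i, j) \<noteq> 0 \<longleftrightarrow> j = N - 1 - i) \<and>
      (\<exists>\<epsilon> :: nat \<Rightarrow> complex.
         (\<forall>i<n. \<epsilon> i \<in> {1, -1} \<and> b $$ (N - 1 - i, i) = \<epsilon> i * b $$ (i, N - 1 - i)) \<and>
         (\<forall>i<n. \<forall>k<n. \<epsilon> i * \<epsilon> k = (-1) ^ (par G i + par G k)) \<and>
         (shape G = ShapeB \<longrightarrow> odd N \<and> par G n = 0 \<and> (\<forall>i<n. \<epsilon> i = (-1) ^ par G i)) \<and>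
         (shape G = ShapeC \<longrightarrow> even N \<and> \<epsilon> (n - 1) = -1) \<and>
         (shape G = ShapeD \<longrightarrow> even N \<and> n \<ge> 2 \<and> \<epsilon> (n - 1) = 1)))"

definition admissible :: "super_data \<Rightarrow> bool" where
  "admissible G \<longleftrightarrow> dimV G > 0 \<and> (\<forall>i<dimV G. par G i \<in> {0, 1}) \<and>
     (shape G \<noteq> ShapeA \<longrightarrow> ortho_symplectic G)"

definition even_part :: "super_data \<Rightarrow> complex mat \<Rightarrow> complex mat" where
  "even_part G X = mat (dimV G) (dimV G) (\<lambda>(i, j). if par G i = par G j then X $$ (i, j) else 0)"

definition odd_part :: "super_data \<Rightarrow> complex mat \<Rightarrow> complex mat" where
  "odd_part G X = mat (dimV G) (dimV G) (\<lambda>(i, j). if par G i \<noteq> par G j then X $$ (i, j) else 0)"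

text \<open>
  The bilinear extension of \<open>[X, Y] = X Y - (-1)\<^bsup>|X||Y|\<^esup> Y X\<close>: with \<open>X = X\<^sub>0 + X\<^sub>1\<close>, \<open>Y = Y\<^sub>0 + Y\<^sub>1\<close>
  the product \<open>Y X = Y X\<^sub>0 + Y\<^sub>0 X\<^sub>1 + Y\<^sub>1 X\<^sub>1\<close> enters with a sign change in the last summand only.
\<close>

definition sbracket :: "super_data \<Rightarrow> complex mat \<Rightarrow> complex mat \<Rightarrow> complex mat" where
  "sbracket G X Y =
     X * Y - (Y * even_part G X + even_part G Y * odd_part G X - odd_part G Y * odd_part G X)"

text \<open>
  The identity \<open>b(X v, w) + (-1)\<^bsup>|X||v|\<^esup> b(v, X w) = 0\<close> on \<open>v = v\<^sub>i\<close>, \<open>w = v\<^sub>j\<close>, extended linearly in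
  \<open>X\<close>; the matrix unit at position \<open>(k, j)\<close> has degree \<open>par k + par j\<close>.
\<close>

definition preserves_form :: "super_data \<Rightarrow> complex mat \<Rightarrow> bool" where
  "preserves_form G X \<longleftrightarrow>
     (\<forall>i<dimV G. \<forall>j<dimV G.
        (\<Sum>k<dimV G. X $$ (k, i) * form G $$ (k, j)) +
        (\<Sum>k<dimV G. (-1) ^ ((par G k + par G j) * par G i) * X $$ (k, j) * form G $$ (i, k)) = 0)"

definition lie_alg :: "super_data \<Rightarrow> complex mat set" where
  "lie_alg G = (if shape G = ShapeA then carrier_mat (dimV G) (dimV G)
                else {X \<in> carrier_mat (dimV G) (dimV G). preserves_form G X})"

definition cartan :: "super_data \<Rightarrow> complex mat set" where
  "cartan G = {X \<in> lie_alg G. diagonal_mat X}"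

definition pos_part :: "super_data \<Rightarrow> complex mat set" where
  "pos_part G = {X \<in> lie_alg G. \<forall>i<dimV G. \<forall>j\<le>i. X $$ (i, j) = 0}"

definition borel :: "super_data \<Rightarrow> complex mat set" where
  "borel G = {H + X |H X. H \<in> cartan G \<and> X \<in> pos_part G}"

text \<open>
  The dual of the Cartan subalgebra is identified with \<open>carrier_vec (hdim G)\<close> by means of its basis
  \<open>(\<zeta>\<^sub>i)\<close>, \<open>\<zeta>\<^sub>i(H) = H\<^sub>i\<^sub>i\<close>, where \<open>i < N\<close> for shape A and \<open>i < n\<close> otherwise.
\<close>

definition hdim :: "super_data \<Rightarrow> nat" where
  "hdim G = (if shape G = ShapeA then dimV G else nodes G)"

definition zeta :: "super_data \<Rightarrow> nat \<Rightarrow> complex vec" where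
  "zeta G i = unit_vec (hdim G) i"

definition weight_eval :: "super_data \<Rightarrow> complex vec \<Rightarrow> complex mat \<Rightarrow> complex" where
  "weight_eval G \<xi> H = (\<Sum>i<hdim G. \<xi> $ i * H $$ (i, i))"

definition inner_h :: "super_data \<Rightarrow> complex vec \<Rightarrow> complex vec \<Rightarrow> complex" where
  "inner_h G \<xi> \<mu> = (\<Sum>i<hdim G. (-1) ^ par G i * \<xi> $ i * \<mu> $ i)"

definition h_vec :: "super_data \<Rightarrow> complex vec \<Rightarrow> complex mat" where
  "h_vec G \<xi> = (THE H. H \<in> cartan G \<and>
     (\<forall>\<mu>\<in>carrier_vec (hdim G). weight_eval G \<mu> H = inner_h G \<mu> \<xi>))"

definition root_space :: "super_data \<Rightarrow> complex vec \<Rightarrow> complex mat set" where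
  "root_space G \<xi> =
     {X \<in> lie_alg G. \<forall>H\<in>cartan G. sbracket G H X = weight_eval G \<xi> H \<cdot>\<^sub>m X}"

definition odd_root :: "super_data \<Rightarrow> complex vec \<Rightarrow> bool" where
  "odd_root G \<alpha> \<longleftrightarrow> (\<exists>X\<in>root_space G \<alpha>. X \<noteq> 0\<^sub>m (dimV G) (dimV G) \<and> odd_part G X = X)"

definition simple_root :: "super_data \<Rightarrow> nat \<Rightarrow> complex vec" where
  "simple_root G i =
     (if i + 1 < hdim G then zeta G i - zeta G (i + 1)
      else case shape G of
             ShapeB \<Rightarrow> zeta G i
           | ShapeC \<Rightarrow> 2 \<cdot>\<^sub>v zeta G i
           | ShapeD \<Rightarrow> zeta G (i - 1) + zeta G i)"

definition simple_roots :: "super_data \<Rightarrow> complex vec set" where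
  "simple_roots G = simple_root G ` {..<nodes G}"

text \<open>Subspaces, subalgebras and submodules are understood as \<open>\<int>\<^sub>2\<close>-graded.\<close>

definition graded_subspace :: "super_data \<Rightarrow> complex mat set \<Rightarrow> bool" where
  "graded_subspace G M \<longleftrightarrow> M \<subseteq> lie_alg G \<and> 0\<^sub>m (dimV G) (dimV G) \<in> M \<and>
     (\<forall>X\<in>M. \<forall>Y\<in>M. X + Y \<in> M) \<and> (\<forall>a. \<forall>X\<in>M. a \<cdot>\<^sub>m X \<in> M) \<and> (\<forall>X\<in>M. even_part G X \<in> M)"

definition subalgebra :: "super_data \<Rightarrow> complex mat set \<Rightarrow> bool" where
  "subalgebra G S \<longleftrightarrow> graded_subspace G S \<and> (\<forall>X\<in>S. \<forall>Y\<in>S. sbracket G X Y \<in> S)"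

definition generated_subalgebra :: "super_data \<Rightarrow> complex mat set \<Rightarrow> complex mat set" where
  "generated_subalgebra G A = \<Inter>{S. subalgebra G S \<and> A \<subseteq> S}"

definition ad_submodule :: "super_data \<Rightarrow> complex mat set \<Rightarrow> complex mat set \<Rightarrow> bool" where
  "ad_submodule G L M \<longleftrightarrow> graded_subspace G M \<and> (\<forall>X\<in>L. \<forall>Y\<in>M. sbracket G X Y \<in> M)"

definition spherical :: "super_data \<Rightarrow> complex mat set \<Rightarrow> bool" where
  "spherical G K \<longleftrightarrow> lie_alg G = {X + Y |X Y. X \<in> K \<and> Y \<in> borel G}"

text \<open>In what follows \<open>P\<close> is the set of simple roots of the subalgebra \<open>\<ll>\<close> (the black nodes).\<close>

abbreviation white :: "super_data \<Rightarrow> complex vec set \<Rightarrow> complex vec set" where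
  "white G P \<equiv> simple_roots G - P"

definition levi :: "super_data \<Rightarrow> complex vec set \<Rightarrow> complex mat set" where
  "levi G P = generated_subalgebra G (\<Union>\<alpha>\<in>P. root_space G \<alpha> \<union> root_space G (- \<alpha>))"

definition V_plus :: "super_data \<Rightarrow> complex vec set \<Rightarrow> complex vec \<Rightarrow> complex mat set" where
  "V_plus G P \<alpha> = \<Inter>{M. ad_submodule G (levi G P) M \<and> root_space G \<alpha> \<subseteq> M}"

definition weights :: "super_data \<Rightarrow> complex mat set \<Rightarrow> complex vec set" where
  "weights G M = {\<xi> \<in> carrier_vec (hdim G). \<exists>X \<in> M \<inter> root_space G \<xi>. X \<noteq> 0\<^sub>m (dimV G) (dimV G)}"

definition nonneg_comb :: "super_data \<Rightarrow> complex vec set \<Rightarrow> complex vec set" where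
  "nonneg_comb G P = {v \<in> carrier_vec (hdim G).
     \<exists>k :: complex vec \<Rightarrow> nat. \<forall>i<hdim G. v $ i = (\<Sum>\<alpha>\<in>P. of_nat (k \<alpha>) * \<alpha> $ i)}"

definition highest_weight :: "super_data \<Rightarrow> complex vec set \<Rightarrow> complex mat set \<Rightarrow> complex vec" where
  "highest_weight G P M =
     (THE \<xi>. \<xi> \<in> weights G M \<and> (\<forall>\<mu>\<in>weights G M. \<xi> - \<mu> \<in> nonneg_comb G P))"

definition tilde ::
  "super_data \<Rightarrow> complex vec set \<Rightarrow> (complex vec \<Rightarrow> complex vec) \<Rightarrow> complex vec \<Rightarrow> complex vec" where
  "tilde G P \<tau> \<alpha> = highest_weight G P (V_plus G P (\<tau> \<alpha>))"

definition super_symmetric ::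
  "super_data \<Rightarrow> complex vec set \<Rightarrow> (complex vec \<Rightarrow> complex vec) \<Rightarrow> bool" where
  "super_symmetric G P \<tau> \<longleftrightarrow>
     (\<forall>\<alpha>\<in>white G P. odd_root G \<alpha> \<longleftrightarrow> odd_root G (tilde G P \<tau> \<alpha>)) \<and>
     (\<forall>\<mu>\<in>white G P. \<forall>\<alpha>\<in>P. inner_h G (\<mu> + tilde G P \<tau> \<mu>) \<alpha> = 0) \<and>
     (\<forall>\<mu>\<in>white G P. \<forall>\<nu>\<in>white G P.
        inner_h G (\<mu> + tilde G P \<tau> \<mu>) (\<nu> - tilde G P \<tau> \<nu>) = 0)"

definition black_links :: "super_data \<Rightarrow> complex vec set \<Rightarrow> (complex vec \<times> complex vec) set" where
  "black_links G P = {(\<alpha>, \<beta>). \<alpha> \<in> P \<and> \<beta> \<in> P \<and> inner_h G \<alpha> \<beta> \<noteq> 0}"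

definition D_graph ::
  "super_data \<Rightarrow> complex vec set \<Rightarrow> (complex vec \<Rightarrow> complex vec) \<Rightarrow> complex vec \<Rightarrow> complex vec set" where
  "D_graph G P \<tau> \<alpha> = {\<alpha>, \<tau> \<alpha>} \<union>
     {\<beta>. \<exists>\<gamma>\<in>P. (inner_h G \<alpha> \<gamma> \<noteq> 0 \<or> inner_h G (\<tau> \<alpha>) \<gamma> \<noteq> 0) \<and> (\<gamma>, \<beta>) \<in> (black_links G P)\<^sup>*}"

text \<open>
  A link as between neighbouring roots \<open>\<zeta>\<^sub>1 - \<zeta>\<^sub>2\<close> and \<open>\<zeta>\<^sub>2 - \<zeta>\<^sub>3\<close> of a shape A diagram, where \<open>s, t, u\<close>
  are the squares of \<open>\<zeta>\<^sub>1, \<zeta>\<^sub>2, \<zeta>\<^sub>3\<close>.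
\<close>

definition single_link :: "super_data \<Rightarrow> complex vec \<Rightarrow> complex vec \<Rightarrow> bool" where
  "single_link G \<alpha> \<beta> \<longleftrightarrow> (\<exists>s\<in>{1, -1}. \<exists>t\<in>{1, -1}. \<exists>u\<in>{1, -1}.
     inner_h G \<alpha> \<alpha> = s + t \<and> inner_h G \<alpha> \<beta> = - t \<and> inner_h G \<beta> \<beta> = t + u)"

definition config1 :: "super_data \<Rightarrow> complex vec set \<Rightarrow> (complex vec \<Rightarrow> complex vec) \<Rightarrow> bool" where
  "config1 G P \<tau> \<longleftrightarrow> (\<exists>\<beta>\<in>white G P. \<exists>\<alpha>\<in>P.
     D_graph G P \<tau> \<beta> = {\<alpha>, \<beta>} \<and> single_link G \<alpha> \<beta> \<and> \<not> (odd_root G \<beta> \<and> \<not> odd_root G \<alpha>))"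

definition config2 :: "super_data \<Rightarrow> complex vec set \<Rightarrow> (complex vec \<Rightarrow> complex vec) \<Rightarrow> bool" where
  "config2 G P \<tau> \<longleftrightarrow> (\<exists>\<beta>\<in>white G P. \<exists>\<alpha>\<in>white G P.
     odd_root G \<beta> \<and> inner_h G \<beta> \<beta> = 0 \<and> D_graph G P \<tau> \<beta> = {\<beta>} \<and> \<alpha> \<noteq> \<beta> \<and> inner_h G \<alpha> \<beta> \<noteq> 0)"

definition config3 :: "super_data \<Rightarrow> complex vec set \<Rightarrow> (complex vec \<Rightarrow> complex vec) \<Rightarrow> bool" where
  "config3 G P \<tau> \<longleftrightarrow> (\<exists>\<beta>\<in>white G P. \<exists>\<alpha>\<in>P. \<exists>\<gamma>\<in>P. \<exists>\<sigma>\<in>white G P.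
     odd_root G \<beta> \<and> \<alpha> \<noteq> \<gamma> \<and> \<not> odd_root G \<alpha> \<and> \<not> odd_root G \<gamma> \<and>
     D_graph G P \<tau> \<beta> = {\<alpha>, \<beta>, \<gamma>} \<and>
     single_link G \<alpha> \<beta> \<and> single_link G \<beta> \<gamma> \<and> inner_h G \<alpha> \<gamma> = 0 \<and>
     \<sigma> \<noteq> \<beta> \<and> inner_h G \<gamma> \<sigma> \<noteq> 0 \<and> \<tau> \<sigma> = \<sigma> \<and> \<alpha> \<notin> D_graph G P \<tau> \<sigma>)"

text \<open>
  \<open>tail_odd\<close> is the common parity of the two white end nodes interchanged by \<open>\<tau>\<close>. The selection rules
  mention even end nodes only, but \<open>\<kk> = \<gg>\<close> for odd ones as well. Indeed, number the last five
  \<open>\<zeta>\<close>'s by \<open>1, \<dots>, 5\<close>. Up to a nonzero factor, the bracket of \<open>x\<close> at the node \<open>\<zeta>\<^sub>2 - \<zeta>\<^sub>3\<close> with its image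
  under the root vectors of \<open>\<zeta>\<^sub>1 - \<zeta>\<^sub>2\<close> and \<open>\<zeta>\<^sub>3 - \<zeta>\<^sub>4\<close> is the \<open>I \<in> \<hh>\<close> with \<open>\<zeta>\<^sub>1(I) = \<dots> = \<zeta>\<^sub>4(I) = 1\<close>,
  \<open>\<zeta>\<^sub>5(I) = 0\<close>. At the end nodes \<open>ad I\<close> has eigenvalues \<open>1, -1\<close> on the two terms of
  \<open>x = e + c f\<close>, so \<open>\<kk>\<close> contains both terms, hence the root vectors of \<open>\<plusminus>(\<zeta>\<^sub>4 \<plusminus> \<zeta>\<^sub>5)\<close>, and these split
  the \<open>x\<close> at \<open>\<zeta>\<^sub>2 - \<zeta>\<^sub>3\<close> in turn. Therefore \<open>config4 True\<close> has to be excluded separately.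
\<close>

definition config4 ::
  "bool \<Rightarrow> super_data \<Rightarrow> complex vec set \<Rightarrow> (complex vec \<Rightarrow> complex vec) \<Rightarrow> bool" where
  "config4 tail_odd G P \<tau> \<longleftrightarrow> shape G = ShapeD \<and> nodes G \<ge> 5 \<and>
     (let n = nodes G; \<alpha> = simple_root G in
        \<alpha> (n - 5) \<in> P \<and> \<not> odd_root G (\<alpha> (n - 5)) \<and>
        \<alpha> (n - 4) \<notin> P \<and> odd_root G (\<alpha> (n - 4)) \<and>
        \<alpha> (n - 3) \<in> P \<and> \<not> odd_root G (\<alpha> (n - 3)) \<and>
        \<alpha> (n - 2) \<notin> P \<and> (odd_root G (\<alpha> (n - 2)) \<longleftrightarrow> tail_odd) \<and>
        \<alpha> (n - 1) \<notin> P \<and> (odd_root G (\<alpha> (n - 1)) \<longleftrightarrow> tail_odd) \<and>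
        \<tau> (\<alpha> (n - 2)) = \<alpha> (n - 1) \<and> \<tau> (\<alpha> (n - 1)) = \<alpha> (n - 2) \<and>
        D_graph G P \<tau> (\<alpha> (n - 4)) = {\<alpha> (n - 5), \<alpha> (n - 4), \<alpha> (n - 3)} \<and>
        D_graph G P \<tau> (\<alpha> (n - 1)) = {\<alpha> (n - 3), \<alpha> (n - 2), \<alpha> (n - 1)})"

definition config5 :: "super_data \<Rightarrow> complex vec set \<Rightarrow> (complex vec \<Rightarrow> complex vec) \<Rightarrow> bool" where
  "config5 G P \<tau> \<longleftrightarrow> shape G = ShapeD \<and> nodes G \<ge> 4 \<and>
     (let n = nodes G; \<alpha> = simple_root G in
        \<alpha> (n - 4) \<in> P \<and> \<not> odd_root G (\<alpha> (n - 4)) \<and>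
        \<alpha> (n - 3) \<notin> P \<and> odd_root G (\<alpha> (n - 3)) \<and>
        \<not> odd_root G (\<alpha> (n - 2)) \<and> \<not> odd_root G (\<alpha> (n - 1)) \<and>
        (\<exists>\<beta> \<gamma>. {\<beta>, \<gamma>} = {\<alpha> (n - 2), \<alpha> (n - 1)} \<and> \<beta> \<in> P \<and> \<gamma> \<notin> P \<and>
           D_graph G P \<tau> (\<alpha> (n - 3)) = {\<alpha> (n - 4), \<alpha> (n - 3), \<beta>}))"

definition graded_satake ::
  "super_data \<Rightarrow> complex vec set \<Rightarrow> (complex vec \<Rightarrow> complex vec) \<Rightarrow> bool" where
  "graded_satake G P \<tau> \<longleftrightarrow>
     \<not> config1 G P \<tau> \<and> \<not> config2 G P \<tau> \<and> \<not> config3 G P \<tau> \<and> \<not> config4 False G P \<tau> \<and> \<not> config5 G P \<tau>"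

definition k_alg ::
  "super_data \<Rightarrow> complex vec set \<Rightarrow> (complex vec \<Rightarrow> complex vec) \<Rightarrow>
   (complex vec \<Rightarrow> complex mat) \<Rightarrow> (complex vec \<Rightarrow> complex mat) \<Rightarrow> (complex vec \<Rightarrow> complex) \<Rightarrow>
   complex mat set" where
  "k_alg G P \<tau> e f c = generated_subalgebra G (levi G P \<union>
     {e \<alpha> + c \<alpha> \<cdot>\<^sub>m f (tilde G P \<tau> \<alpha>) |\<alpha>. \<alpha> \<in> white G P} \<union>
     {h_vec G \<alpha> - h_vec G (tilde G P \<tau> \<alpha>) |\<alpha>. \<alpha> \<in> white G P})"

end

theory Submission
  imports Defs
begin

text \<open>
  The generators \<open>e\<^sub>\<alpha> + c\<^sub>\<alpha> f\<close> produce all negative root vectors modulo the sum of \<open>\<kk>\<close> and the Borel subalgebra,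
  by induction on the height; hence \<open>\<kk>\<close> is spherical. For \<open>\<gg>\<ll>\<close> all generators have supertrace \<open>0\<close>.

  In the ortho-symplectic case the condition of super-symmetry forces \<open>\<tau>\<close> to fix all white nodes or to
  interchange the end nodes of shape D, and it bounds the size of the black blocks (apart from the one at
  the end of the diagram) by two; the exceptions live in rank four. The selection rules then determine the parities of
  adjacent blocks: the white node between two of them is odd if and only if the sizes differ. This is precisely what is
  needed for \<open>\<kk>\<close> to stabilise a subspace \<open>W\<close> of \<open>V\<close>, the graph of a map that sends \<open>v\<^sub>k\<close> to a multiple of
  \<open>v\<^sub>l'\<close>, where \<open>l\<close> is the mirror image of \<open>k\<close> in its block. The algebra \<open>\<gg>\<close> does not stabilise \<open>W\<close>.

  The exceptions are \<open>\<ss>\<oo>(8)\<close> with the algebra \<open>\<ss>\<pp>\<ii>\<nn>(7)\<close> and with a triality twist of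
  \<open>\<ss>\<oo>(5) \<oplus> \<ss>\<oo>(3)\<close>, both contained in explicit subspaces that are closed under the bracket.
\<close>

section \<open>The Lie superalgebra\<close>

text \<open>On black roots, super-symmetry says that the highest weight of the module at
  \<open>\<tau> \<mu>\<close> is minus the lowest weight of the module at \<open>\<mu>\<close>. A
  chain node fixed by \<open>\<tau>\<close> has the standard module of its block as a tensor factor,
  and this is self-dual only up to size two; the exterior square of C^4 and the triality permutation
  are the coincidences that escape.

  A white generator between two blocks preserves the graph if two equations for the coefficients
  hold. One is solved recursively along the diagram for arbitrary mixture parameters. The other is
  then a pure sign, a product of duality factors around a square of indices, and it comes out right
  exactly under the parity rule for adjacent blocks. A common factor of all coefficients stays free.
  It absorbs the generator of the last white node: linearly if a middle vector or further basis
  vectors follow, by a square root at the last node of shapes C and D. If \<open>\<tau>\<close>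
  interchanges the end nodes, two generators compete for one factor; this is why the root vectors
  need a normalization and the parameters have to be \<open>\<tau>\<close>-invariant.\<close>

lemma neg_one_power_mult_self: "(-1::complex) ^ m * (-1) ^ m = 1"
  by (simp flip: power_add)

lemma sbracket_carrier [simp]:
  assumes "X \<in> carrier_mat (dimV G) (dimV G)" "Y \<in> carrier_mat (dimV G) (dimV G)"
  shows "sbracket G X Y \<in> carrier_mat (dimV G) (dimV G)"
  using assms by (auto simp: sbracket_def even_part_def odd_part_def)

lemma even_part_carrier [simp]: "even_part G X \<in> carrier_mat (dimV G) (dimV G)"
  and odd_part_carrier [simp]: "odd_part G X \<in> carrier_mat (dimV G) (dimV G)"
  by (auto simp: even_part_def odd_part_def)

lemma sum_left_unit:
  fixes f :: "nat \<Rightarrow> complex"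
  assumes "finite A" "c \<in> A" "\<And>x. x \<in> A \<Longrightarrow> x \<noteq> c \<Longrightarrow> f x = 0"
  shows "sum f A = f c"
proof -
  have "sum f A = sum f {c}"
    by (rule sum.mono_neutral_right) (use assms in auto)
  then show ?thesis by simp
qed

locale super_algebra =
  fixes G :: super_data
  assumes adm: "admissible G"
begin

abbreviation N :: nat where "N \<equiv> dimV G"
abbreviation n :: nat where "n \<equiv> nodes G"
abbreviation pr :: "nat \<Rightarrow> nat" where "pr \<equiv> par G"
abbreviation os :: bool where "os \<equiv> shape G \<noteq> ShapeA"

lemma N_pos [simp]: "N > 0"
  using adm by (simp add: admissible_def)

definition bar :: "nat \<Rightarrow> nat" where "bar i = N - 1 - i"

lemma bar_less [simp]: "i < N \<Longrightarrow> bar i < N"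
  and bar_bar [simp]: "i < N \<Longrightarrow> bar (bar i) = i"
  and bar_inject: "i < N \<Longrightarrow> j < N \<Longrightarrow> bar i = bar j \<longleftrightarrow> i = j"
  by (auto simp: bar_def)

lemma pr_cases: "i < N \<Longrightarrow> pr i = 0 \<or> pr i = 1"
  using adm by (auto simp: admissible_def)

text \<open>The matrix unit at (i, k) has degree \<open>pr i + pr k\<close>, so this is the sign for
  exchanging the units at (i, k) and (k, j). Attaching the sign to index triples instead of matrices
  makes one formula for the bracket serve matrices of mixed parity.\<close>

definition sg :: "nat \<Rightarrow> nat \<Rightarrow> nat \<Rightarrow> complex" where
  "sg i k j = (-1) ^ ((pr i + pr k) * (pr k + pr j))"

lemma sbracket_index:
  assumes "X \<in> carrier_mat N N" "Y \<in> carrier_mat N N" "i < N" "j < N"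
  shows "sbracket G X Y $$ (i, j) =
    (\<Sum>k<N. X $$ (i, k) * Y $$ (k, j) - sg i k j * (Y $$ (i, k) * X $$ (k, j)))"
proof -
  have c: "even_part G X \<in> carrier_mat N N" "even_part G Y \<in> carrier_mat N N"
    "odd_part G X \<in> carrier_mat N N" "odd_part G Y \<in> carrier_mat N N" by simp_all
  have mult: "(A * B) $$ (i, j) = (\<Sum>k<N. A $$ (i, k) * B $$ (k, j))"
    if "A \<in> carrier_mat N N" "B \<in> carrier_mat N N" for A B :: "complex mat"
    using that assms(3,4) by (auto simp: scalar_prod_def atLeast0LessThan intro!: sum.cong)
  have "sbracket G X Y $$ (i, j) = (X * Y) $$ (i, j) - ((Y * even_part G X) $$ (i, j) +
    (even_part G Y * odd_part G X) $$ (i, j) - (odd_part G Y * odd_part G X) $$ (i, j))"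
    unfolding sbracket_def using assms c
    by (simp add: carrier_matD[OF assms(1)] carrier_matD[OF assms(2)] carrier_matD[OF c(1)]
        carrier_matD[OF c(2)] carrier_matD[OF c(3)] carrier_matD[OF c(4)] del: index_mult_mat(1))
  also have "\<dots> = (\<Sum>k<N. X $$ (i, k) * Y $$ (k, j)) -
    ((\<Sum>k<N. Y $$ (i, k) * even_part G X $$ (k, j)) +
     (\<Sum>k<N. even_part G Y $$ (i, k) * odd_part G X $$ (k, j)) -
     (\<Sum>k<N. odd_part G Y $$ (i, k) * odd_part G X $$ (k, j)))"
    using assms(1,2) c by (simp only: mult)
  also have "\<dots> = (\<Sum>k<N. X $$ (i, k) * Y $$ (k, j) - (Y $$ (i, k) * even_part G X $$ (k, j) +
     even_part G Y $$ (i, k) * odd_part G X $$ (k, j) - odd_part G Y $$ (i, k) * odd_part G X $$ (k, j)))"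
    by (simp add: sum_subtractf sum.distrib)
  also have "\<dots> = (\<Sum>k<N. X $$ (i, k) * Y $$ (k, j) - sg i k j * (Y $$ (i, k) * X $$ (k, j)))"
  proof (intro sum.cong refl)
    fix k assume "k \<in> {..<N}"
    then have k: "k < N" by simp
    have ev: "even_part G Z $$ (a, b) = (if pr a = pr b then Z $$ (a, b) else 0)"
      and od: "odd_part G Z $$ (a, b) = (if pr a \<noteq> pr b then Z $$ (a, b) else 0)"
      if "a < N" "b < N" for a b Z
      using that by (simp_all add: even_part_def odd_part_def)
    show "X $$ (i, k) * Y $$ (k, j) - (Y $$ (i, k) * even_part G X $$ (k, j) +
        even_part G Y $$ (i, k) * odd_part G X $$ (k, j) - odd_part G Y $$ (i, k) * odd_part G X $$ (k, j)) =
      X $$ (i, k) * Y $$ (k, j) - sg i k j * (Y $$ (i, k) * X $$ (k, j))"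
      unfolding ev[OF k assms(4)] od[OF k assms(4)] ev[OF assms(3) k] od[OF assms(3) k] sg_def
      using pr_cases[OF assms(3)] pr_cases[OF assms(4)] pr_cases[OF k] by (elim disjE) simp_all
  qed
  finally show ?thesis .
qed

text \<open>Invariance of the form couples each entry of a matrix with a single other one, at the
  position reflected in the antidiagonal. This is the ratio of the reflected entry to the entry at
  (i, j).\<close>

definition t :: "nat \<Rightarrow> nat \<Rightarrow> complex" where
  "t i j = - ((-1) ^ ((pr i + pr j) * pr i)) * form G $$ (bar i, i) / form G $$ (bar j, j)"

definition eps :: "nat \<Rightarrow> complex" where
  "eps i = form G $$ (bar i, i) / form G $$ (i, bar i)"

lemma os_data:
  assumes os
  shows "\<exists>e :: nat \<Rightarrow> complex.
    (\<forall>i<n. e i \<in> {1, -1} \<and> form G $$ (bar i, i) = e i * form G $$ (i, bar i)) \<and>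
    (\<forall>i<n. \<forall>k<n. e i * e k = (-1) ^ (pr i + pr k)) \<and>
    (shape G = ShapeB \<longrightarrow> odd N \<and> pr n = 0 \<and> (\<forall>i<n. e i = (-1) ^ pr i)) \<and>
    (shape G = ShapeC \<longrightarrow> even N \<and> e (n - 1) = -1) \<and>
    (shape G = ShapeD \<longrightarrow> even N \<and> n \<ge> 2 \<and> e (n - 1) = 1)"
proof -
  have "ortho_symplectic G" using adm assms by (simp add: admissible_def)
  then show ?thesis unfolding ortho_symplectic_def Let_def bar_def by (elim conjE)
qed

lemma osD: "os \<Longrightarrow> ortho_symplectic G"
  using adm by (simp add: admissible_def)

lemma pr_bar: "os \<Longrightarrow> i < N \<Longrightarrow> pr (bar i) = pr i"
  using osD unfolding ortho_symplectic_def Let_def bar_def by metis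

lemma form_nz_iff: "os \<Longrightarrow> i < N \<Longrightarrow> j < N \<Longrightarrow> form G $$ (i, j) \<noteq> 0 \<longleftrightarrow> j = bar i"
  using osD unfolding ortho_symplectic_def Let_def bar_def by blast

lemma form_nz: "os \<Longrightarrow> i < N \<Longrightarrow> form G $$ (i, bar i) \<noteq> 0" "os \<Longrightarrow> i < N \<Longrightarrow> form G $$ (bar i, i) \<noteq> 0"
  by (simp_all add: form_nz_iff)

lemma nodes_os: "os \<Longrightarrow> n = N div 2"
  by (simp add: nodes_def)

lemma nodes_A: "\<not> os \<Longrightarrow> n = N - 1"
  by (simp add: nodes_def)

lemma hdim_os: "os \<Longrightarrow> hdim G = n"
  by (simp add: hdim_def)

lemma hdim_A: "\<not> os \<Longrightarrow> hdim G = N"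
  by (simp add: hdim_def)

lemma shape_B_N: "shape G = ShapeB \<Longrightarrow> N = 2 * n + 1"
proof -
  assume a: "shape G = ShapeB"
  then have os by simp
  have "odd N" using os_data[OF \<open>os\<close>] a by blast
  then show ?thesis using nodes_os \<open>os\<close> by (simp add: odd_two_times_div_two_succ)
qed

lemma shape_CD_N:
  assumes "shape G = ShapeC \<or> shape G = ShapeD"
  shows "N = 2 * n"
proof -
  have os: os using assms by auto
  have "even N" using os_data[OF os] assms by blast
  then show ?thesis using nodes_os os by simp
qed

lemma shape_D_n:
  assumes "shape G = ShapeD"
  shows "n \<ge> 2"
proof -
  have os: os using assms by simp
  show ?thesis using os_data[OF os] assms by blast
qed

lemma shape_C_n: "shape G = ShapeC \<Longrightarrow> n \<ge> 1"
  using shape_CD_N N_pos by (metis One_nat_def Suc_leI gr0I mult_0_right less_irrefl)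

lemma os_shape: "os \<Longrightarrow> shape G = ShapeB \<or> shape G = ShapeC \<or> shape G = ShapeD"
  by (cases "shape G") auto

lemma os_index_cases:
  assumes os "i < N"
  obtains "i < n" | "bar i < n" "n \<le> i" | "shape G = ShapeB" "i = n" "bar i = i"
proof -
  consider "shape G = ShapeB" "N = 2 * n + 1" | "N = 2 * n"
    using os_shape[OF assms(1)] shape_B_N shape_CD_N by blast
  then show ?thesis
    using that assms(2) unfolding bar_def by cases (force+)
qed

text \<open>The definition supplies signs only for the first n indices. Reflection inverts the
  quotient \<open>eps\<close>, which does not change a sign, and the middle vector of shape B has
  quotient 1. The product rule extends to it because in shape B the signs are
  \<open>(-1) ^ pr i\<close> and the middle vector is even.\<close>

lemma eps_props:
  assumes os
  shows "\<And>i. i < N \<Longrightarrow> eps i \<in> {1, -1}"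
    and "\<And>i k. i < N \<Longrightarrow> k < N \<Longrightarrow> eps i * eps k = (-1) ^ (pr i + pr k)"
    and "shape G = ShapeB \<Longrightarrow> eps n = 1"
    and "shape G = ShapeC \<Longrightarrow> eps (n - 1) = -1"
    and "shape G = ShapeD \<Longrightarrow> eps (n - 1) = 1"
    and "\<And>i. i < N \<Longrightarrow> eps (bar i) = eps i"
proof -
  obtain e :: "nat \<Rightarrow> complex" where e':
    "\<forall>i<n. e i \<in> {1, -1} \<and> form G $$ (bar i, i) = e i * form G $$ (i, bar i)"
    "\<forall>i<n. \<forall>k<n. e i * e k = (-1) ^ (pr i + pr k)"
    "shape G = ShapeB \<longrightarrow> odd N \<and> pr n = 0 \<and> (\<forall>i<n. e i = (-1) ^ pr i)"
    "shape G = ShapeC \<longrightarrow> even N \<and> e (n - 1) = -1"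
    "shape G = ShapeD \<longrightarrow> even N \<and> n \<ge> 2 \<and> e (n - 1) = 1"
    using os_data[OF assms] by (elim exE conjE)
  have e: "\<And>i. i < n \<Longrightarrow> e i \<in> {1, -1}"
    "\<And>i. i < n \<Longrightarrow> form G $$ (bar i, i) = e i * form G $$ (i, bar i)"
    "\<And>i k. i < n \<Longrightarrow> k < n \<Longrightarrow> e i * e k = (-1) ^ (pr i + pr k)"
    "shape G = ShapeB \<Longrightarrow> odd N \<and> pr n = 0 \<and> (\<forall>i<n. e i = (-1) ^ pr i)"
    "shape G = ShapeC \<Longrightarrow> even N \<and> e (n - 1) = -1"
    "shape G = ShapeD \<Longrightarrow> even N \<and> n \<ge> 2 \<and> e (n - 1) = 1"
    using e'(1) apply blast using e'(1) apply blast using e'(2) apply blast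
    using e'(3) apply blast using e'(4) apply blast using e'(5) by blast
  have lt: "i < N" if "i < n" for i using that nodes_os[OF assms] by simp
  have 1: "eps i = e i" if "i < n" for i
    using that e(2)[OF that] form_nz[OF assms lt[OF that]] by (simp add: eps_def)
  have 2: "eps (bar i) = eps i" if "i < N" for i
  proof -
    have "eps i = inverse (eps (bar i))" if "i < N" for i
      using that by (simp add: eps_def)
    moreover have "inverse (eps i) = eps i" if "i < n" for i
      using 1[OF that] e(1)[OF that] by auto
    ultimately have *: "i < n \<or> bar i < n \<Longrightarrow> eps (bar i) = eps i"
      using that \<open>i < N\<close> by (metis inverse_inverse_eq)
    show ?thesis by (rule os_index_cases[OF assms \<open>i < N\<close>]) (use * in auto)
  qed
  have 3: "eps n = 1" if "shape G = ShapeB"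
    using shape_B_N[OF that] form_nz(1)[OF assms, of n] by (simp add: eps_def bar_def)
  have 4: "eps i = (if i < n then e i else if bar i < n then e (bar i) else 1)" if "i < N" for i
    by (rule os_index_cases[OF assms that]) (use 1 2[OF that] 3 1[of "bar i"] in auto)
  have 5: "pr i = (if i < n then pr i else if bar i < n then pr (bar i) else 0)" if "i < N" for i
    by (rule os_index_cases[OF assms that]) (use pr_bar[OF assms that] e(4) in auto)
  have B: "shape G = ShapeB" if "i < N" "\<not> i < n" "\<not> bar i < n" for i
    by (rule os_index_cases[OF assms that(1)]) (use that in auto)
  show "eps i \<in> {1, -1}" if "i < N" for i using 4[OF that] e(1) by auto
  show "eps i * eps k = (-1) ^ (pr i + pr k)" if "i < N" "k < N" for i k
  proof -
    define q where "q i = (if i < n then pr i else if bar i < n then pr (bar i) else 0)" for i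
    have q: "pr i = q i" "pr k = q k" unfolding q_def by (rule 5[OF that(1)], rule 5[OF that(2)])
    have "eps i * eps k = (-1) ^ (q i + q k)"
      unfolding 4[OF that(1)] 4[OF that(2)] q_def
      using e(3) B that e(4)[THEN conjunct2, THEN conjunct2] by auto
    then show ?thesis unfolding q .
  qed
  show "shape G = ShapeB \<Longrightarrow> eps n = 1" by (rule 3)
  show "shape G = ShapeC \<Longrightarrow> eps (n - 1) = -1"
    using 1[of "n - 1"] e(5) shape_C_n by force
  show "shape G = ShapeD \<Longrightarrow> eps (n - 1) = 1"
    using 1[of "n - 1"] e(6) by force
  show "\<And>i. i < N \<Longrightarrow> eps (bar i) = eps i" by (rule 2)
qed

lemma t_nz: "os \<Longrightarrow> i < N \<Longrightarrow> j < N \<Longrightarrow> t i j \<noteq> 0"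
  using form_nz by (simp add: t_def)

lemma t_self: "os \<Longrightarrow> i < N \<Longrightarrow> t i i = -1"
  using form_nz(1)[of i] form_nz(2)[of i] by (simp add: t_def)

lemma t_bar: "os \<Longrightarrow> i < N \<Longrightarrow> t i (bar i) = - eps i"
  by (simp add: t_def eps_def pr_bar)

text \<open>Reflection reverses the order of a product. The factor \<open>- sg i k j\<close> is what
  turns the first summand of the bracket into the second and conversely, so that the bracket is
  compatible with the duality of entries.\<close>

lemma t_mult:
  assumes os "i < N" "k < N" "j < N"
  shows "t i k * t k j = - sg i k j * t i j"
  using form_nz[OF assms(1,3)] pr_cases[OF assms(2)] pr_cases[OF assms(3)] pr_cases[OF assms(4)]
  by (auto simp: t_def sg_def)

text \<open>Reflecting twice returns to the original entry; this is where the relation between the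
  symmetry signs and the parities enters.\<close>

lemma t_dual:
  assumes os "i < N" "j < N"
  shows "t (bar j) (bar i) * t i j = 1"
proof -
  have "eps i * eps j = (-1) ^ (pr i + pr j)" using eps_props[OF assms(1)] assms by simp
  then have h: "form G $$ (bar i, i) * form G $$ (bar j, j) =
      (-1) ^ (pr i + pr j) * (form G $$ (i, bar i) * form G $$ (j, bar j))"
    using form_nz[OF assms(1,2)] form_nz[OF assms(1,3)] by (simp add: eps_def field_simps)
  have h2: "form G $$ (j, bar j) * form G $$ (i, bar i) * (-1) ^ (pr i + pr j) = form G $$ (bar j, j) * form G $$ (bar i, i)"
    using h by (simp add: mult_ac)
  have "t (bar j) (bar i) * t i j = (-1) ^ ((pr j + pr i) * pr j) * (-1) ^ ((pr i + pr j) * pr i) *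
     (form G $$ (j, bar j) * form G $$ (bar i, i)) / (form G $$ (i, bar i) * form G $$ (bar j, j))"
    using assms by (simp add: t_def pr_bar)
  also have "\<dots> = 1"
  proof -
    have "eps i * eps i = 1" "eps j * eps j = 1" using eps_props(1)[OF assms(1)] assms by fastforce+
    have "form G $$ (bar i, i) = eps i * form G $$ (i, bar i)" "form G $$ (bar j, j) = eps j * form G $$ (j, bar j)"
      using form_nz[OF assms(1,2)] form_nz[OF assms(1,3)] by (simp_all add: eps_def)
    then show ?thesis
      using form_nz[OF assms(1,2)] form_nz[OF assms(1,3)] pr_cases[OF assms(2)] pr_cases[OF assms(3)]
        \<open>eps i * eps j = _\<close> eps_props(1)[OF assms(1,2)] eps_props(1)[OF assms(1,3)] by auto
  qed
  finally show ?thesis .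
qed

text \<open>The form is antidiagonal, so each of the two sums in the invariance condition has one
  non-zero term. The condition for the pair (\<open>bar i\<close>, j) of basis vectors concerns the
  entry at (i, j).\<close>

lemma preserves_form_iff:
  assumes os "X \<in> carrier_mat N N"
  shows "preserves_form G X \<longleftrightarrow> (\<forall>i<N. \<forall>j<N. X $$ (bar j, bar i) = t i j * X $$ (i, j))"
proof -
  have *: "((\<Sum>k<N. X $$ (k, i) * form G $$ (k, j)) +
     (\<Sum>k<N. (-1) ^ ((pr k + pr j) * pr i) * X $$ (k, j) * form G $$ (i, k)) = 0) \<longleftrightarrow>
     X $$ (bar j, i) = t (bar i) j * X $$ (bar i, j)" if "i < N" "j < N" for i j
  proof -
    have 1: "(\<Sum>k<N. X $$ (k, i) * form G $$ (k, j)) = X $$ (bar j, i) * form G $$ (bar j, j)"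
      by (rule sum_left_unit) (use that form_nz_iff[OF assms(1)] in auto)
    have 2: "(\<Sum>k<N. (-1) ^ ((pr k + pr j) * pr i) * X $$ (k, j) * form G $$ (i, k)) =
        (-1) ^ ((pr (bar i) + pr j) * pr i) * X $$ (bar i, j) * form G $$ (i, bar i)"
      by (rule sum_left_unit) (use that form_nz_iff[OF assms(1)] in auto)
    have 3: "u * a + s * v * c = 0 \<longleftrightarrow> u = - s * c / a * v" if "a \<noteq> 0" for u a s v c :: complex
      using that by (simp add: field_simps add_eq_0_iff2)
    show ?thesis unfolding 1 2 3[OF form_nz(2)[OF assms(1) that(2)]] t_def using that
      by (simp add: pr_bar[OF assms(1)])
  qed
  have "preserves_form G X \<longleftrightarrow> (\<forall>i<N. \<forall>j<N. X $$ (bar j, i) = t (bar i) j * X $$ (bar i, j))"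
    unfolding preserves_form_def using * by auto
  also have "\<dots> \<longleftrightarrow> (\<forall>i<N. \<forall>j<N. X $$ (bar j, bar i) = t i j * X $$ (i, j))"
  proof safe
    fix i j assume h: "\<forall>i<N. \<forall>j<N. X $$ (bar j, i) = t (bar i) j * X $$ (bar i, j)" and "i < N" "j < N"
    then show "X $$ (bar j, bar i) = t i j * X $$ (i, j)" using h[rule_format, of "bar i" j] by simp
  next
    fix i j assume h: "\<forall>i<N. \<forall>j<N. X $$ (bar j, bar i) = t i j * X $$ (i, j)" and "i < N" "j < N"
    then show "X $$ (bar j, i) = t (bar i) j * X $$ (bar i, j)" using h[rule_format, of "bar i" j] by simp
  qed
  finally show ?thesis .
qed

lemma lie_alg_iff:
  "X \<in> lie_alg G \<longleftrightarrow> X \<in> carrier_mat N N \<and>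
     (os \<longrightarrow> (\<forall>i<N. \<forall>j<N. X $$ (bar j, bar i) = t i j * X $$ (i, j)))"
  by (auto simp: lie_alg_def preserves_form_iff)

lemma lie_alg_carrier [simp]: "X \<in> lie_alg G \<Longrightarrow> X \<in> carrier_mat N N"
  by (simp add: lie_alg_iff)

lemma lie_alg_dual: "X \<in> lie_alg G \<Longrightarrow> os \<Longrightarrow> i < N \<Longrightarrow> j < N \<Longrightarrow> X $$ (bar j, bar i) = t i j * X $$ (i, j)"
  by (simp add: lie_alg_iff)

lemma sum_bar: "(\<Sum>k<N. f k) = (\<Sum>k<N. f (bar k))" for f :: "nat \<Rightarrow> complex"
  by (rule sum.reindex_bij_witness[where i = bar and j = bar]) auto

lemma lie_alg_graded: "graded_subspace G (lie_alg G)"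
  unfolding graded_subspace_def
proof (intro conjI ballI allI)
  show "0\<^sub>m N N \<in> lie_alg G" by (simp add: lie_alg_iff)
  show "X + Y \<in> lie_alg G" if "X \<in> lie_alg G" "Y \<in> lie_alg G" for X Y
    using that by (auto simp: lie_alg_iff algebra_simps)
  show "a \<cdot>\<^sub>m X \<in> lie_alg G" if "X \<in> lie_alg G" for X a
    using that by (auto simp: lie_alg_iff algebra_simps)
  show "even_part G X \<in> lie_alg G" if "X \<in> lie_alg G" for X
    using that by (auto simp: lie_alg_iff even_part_def pr_bar)
qed simp

lemma sbracket_lie_alg:
  assumes "X \<in> lie_alg G" "Y \<in> lie_alg G"
  shows "sbracket G X Y \<in> lie_alg G"
proof -
  have c: "X \<in> carrier_mat N N" "Y \<in> carrier_mat N N" using assms by simp_all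
  have "sbracket G X Y $$ (bar j, bar i) = t i j * sbracket G X Y $$ (i, j)" if os "i < N" "j < N" for i j
  proof -
    have "sbracket G X Y $$ (bar j, bar i) = (\<Sum>k<N. X $$ (bar j, bar k) * Y $$ (bar k, bar i) -
       sg (bar j) (bar k) (bar i) * (Y $$ (bar j, bar k) * X $$ (bar k, bar i)))"
      using that by (subst sbracket_index[OF c], simp, simp, subst sum_bar, simp)
    also have "\<dots> = (\<Sum>k<N. t i j * (X $$ (i, k) * Y $$ (k, j) - sg i k j * (Y $$ (i, k) * X $$ (k, j))))"
    proof (intro sum.cong refl)
      fix k assume "k \<in> {..<N}"
      then have k: "k < N" by simp
      have s: "sg (bar j) (bar k) (bar i) = sg i k j"
        using that k by (simp add: sg_def pr_bar add.commute mult.commute)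
      have d: "X $$ (bar j, bar k) = t k j * X $$ (k, j)" "Y $$ (bar k, bar i) = t i k * Y $$ (i, k)"
        "Y $$ (bar j, bar k) = t k j * Y $$ (k, j)" "X $$ (bar k, bar i) = t i k * X $$ (i, k)"
        using assms that k by (auto intro: lie_alg_dual)
      have m: "t i k * t k j = - sg i k j * t i j" using t_mult that k by simp
      have s2: "sg i k j * sg i k j = 1" unfolding sg_def by (rule neg_one_power_mult_self)
      have "X $$ (bar j, bar k) * Y $$ (bar k, bar i) -
          sg (bar j) (bar k) (bar i) * (Y $$ (bar j, bar k) * X $$ (bar k, bar i))
        = (t i k * t k j) * (X $$ (k, j) * Y $$ (i, k) - sg i k j * (Y $$ (k, j) * X $$ (i, k)))"
        unfolding s d by (simp add: algebra_simps)
      also have "\<dots> = t i j * (- sg i k j * (X $$ (k, j) * Y $$ (i, k)) + (sg i k j * sg i k j) * (Y $$ (k, j) * X $$ (i, k)))"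
        unfolding m by (simp add: algebra_simps)
      also have "\<dots> = t i j * (X $$ (i, k) * Y $$ (k, j) - sg i k j * (Y $$ (i, k) * X $$ (k, j)))"
        unfolding s2 by (simp add: algebra_simps)
      finally show "X $$ (bar j, bar k) * Y $$ (bar k, bar i) -
          sg (bar j) (bar k) (bar i) * (Y $$ (bar j, bar k) * X $$ (bar k, bar i)) =
          t i j * (X $$ (i, k) * Y $$ (k, j) - sg i k j * (Y $$ (i, k) * X $$ (k, j)))" .
    qed
    also have "\<dots> = t i j * sbracket G X Y $$ (i, j)"
      using that by (simp add: sbracket_index[OF c] sum_distrib_left)
    finally show ?thesis .
  qed
  then show ?thesis using c by (simp add: lie_alg_iff)
qed

lemma lie_alg_subalgebra: "subalgebra G (lie_alg G)"
  using lie_alg_graded sbracket_lie_alg by (simp add: subalgebra_def)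

text \<open>The assumption puts \<open>lie_alg G\<close> into the family that is intersected; an
  empty intersection would be the whole type.\<close>

lemma generated_subalgebra_props:
  assumes "A \<subseteq> lie_alg G"
  shows "subalgebra G (generated_subalgebra G A)" "A \<subseteq> generated_subalgebra G A"
    "\<And>S. subalgebra G S \<Longrightarrow> A \<subseteq> S \<Longrightarrow> generated_subalgebra G A \<subseteq> S"
proof -
  define \<F> where "\<F> = {S. subalgebra G S \<and> A \<subseteq> S}"
  have ne: "lie_alg G \<in> \<F>" using assms lie_alg_subalgebra by (simp add: \<F>_def)
  have K: "generated_subalgebra G A = \<Inter>\<F>" by (simp add: generated_subalgebra_def \<F>_def)
  have D: "0\<^sub>m N N \<in> S" "\<And>X Y. X \<in> S \<Longrightarrow> Y \<in> S \<Longrightarrow> X + Y \<in> S"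
    "\<And>X a. X \<in> S \<Longrightarrow> a \<cdot>\<^sub>m X \<in> S" "\<And>X. X \<in> S \<Longrightarrow> even_part G X \<in> S"
    "\<And>X Y. X \<in> S \<Longrightarrow> Y \<in> S \<Longrightarrow> sbracket G X Y \<in> S" if "S \<in> \<F>" for S
    using that unfolding \<F>_def subalgebra_def graded_subspace_def by blast+
  show "subalgebra G (generated_subalgebra G A)"
    unfolding K subalgebra_def graded_subspace_def
  proof (intro conjI ballI allI InterI)
    show "\<Inter>\<F> \<subseteq> lie_alg G" using ne by (rule Inter_lower)
  qed (use D in \<open>simp_all\<close>)
  show "A \<subseteq> generated_subalgebra G A" unfolding K by (auto simp: \<F>_def)
  show "generated_subalgebra G A \<subseteq> S" if "subalgebra G S" "A \<subseteq> S" for S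
    unfolding K by (rule Inter_lower) (use that in \<open>simp add: \<F>_def\<close>)
qed

end

section \<open>Weights, the Cartan subalgebra and root vectors\<close>

context super_algebra
begin

abbreviation rk :: nat where "rk \<equiv> hdim G"

text \<open>Defined for all indices of the basis of V. In the ortho-symplectic case the second
  indicator yields the negative of the reflected weight beyond the first \<open>rk\<close> indices,
  and the middle vector of shape B gets 0 since neither indicator meets a coordinate.\<close>

definition wt :: "nat \<Rightarrow> complex vec" where
  "wt i = vec rk (\<lambda>k. of_bool (k = i) - of_bool (os \<and> k = bar i))"

lemma wt_carrier [simp]: "wt i \<in> carrier_vec rk"
  and wt_dim [simp]: "dim_vec (wt i) = rk"
  by (simp_all add: wt_def)

lemma wt_index: "k < rk \<Longrightarrow> wt i $ k = of_bool (k = i) - of_bool (os \<and> k = bar i)"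
  by (simp add: wt_def)

lemma bar_ge: "os \<Longrightarrow> i < n \<Longrightarrow> n \<le> bar i"
  using nodes_os by (auto simp: bar_def)

lemma rk_le_N: "rk \<le> N"
  using hdim_os hdim_A nodes_os by (cases os) auto

lemma rk_bar: "os \<Longrightarrow> i < rk \<Longrightarrow> k < rk \<Longrightarrow> k \<noteq> bar i"
  using bar_ge[of i] hdim_os by force

lemma rk_bar_less: "os \<Longrightarrow> i < rk \<Longrightarrow> \<not> bar i < rk"
  using rk_bar by blast

lemma rk_bar_A: "i < rk \<Longrightarrow> bar i < rk \<Longrightarrow> shape G = ShapeA"
  using rk_bar by blast

lemma wt_eq_zeta: "i < rk \<Longrightarrow> wt i = zeta G i"
  by (rule eq_vecI) (auto simp: wt_def zeta_def rk_bar rk_bar_less unit_vec_def)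

lemma wt_bar: "os \<Longrightarrow> i < N \<Longrightarrow> wt (bar i) = - wt i"
  by (rule eq_vecI) (auto simp: wt_def)

lemma inner_h_add_left:
  "x \<in> carrier_vec rk \<Longrightarrow> y \<in> carrier_vec rk \<Longrightarrow> inner_h G (x + y) z = inner_h G x z + inner_h G y z"
  by (simp add: inner_h_def algebra_simps sum.distrib)

lemma inner_h_add_right:
  "x \<in> carrier_vec rk \<Longrightarrow> y \<in> carrier_vec rk \<Longrightarrow> inner_h G z (x + y) = inner_h G z x + inner_h G z y"
  by (simp add: inner_h_def algebra_simps sum.distrib)

lemma inner_h_minus_left:
  "x \<in> carrier_vec rk \<Longrightarrow> y \<in> carrier_vec rk \<Longrightarrow> inner_h G (x - y) z = inner_h G x z - inner_h G y z"
  by (simp add: inner_h_def algebra_simps sum_subtractf)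

lemma inner_h_minus_right:
  "x \<in> carrier_vec rk \<Longrightarrow> y \<in> carrier_vec rk \<Longrightarrow> inner_h G z (x - y) = inner_h G z x - inner_h G z y"
  by (simp add: inner_h_def algebra_simps sum_subtractf)

lemma inner_h_uminus_left: "x \<in> carrier_vec rk \<Longrightarrow> inner_h G (- x) z = - inner_h G x z"
  by (simp add: inner_h_def sum_negf)

lemma inner_h_uminus_right: "x \<in> carrier_vec rk \<Longrightarrow> inner_h G z (- x) = - inner_h G z x"
  by (simp add: inner_h_def sum_negf)

lemma inner_h_smult_left: "x \<in> carrier_vec rk \<Longrightarrow> inner_h G (a \<cdot>\<^sub>v x) z = a * inner_h G x z"
  by (simp add: inner_h_def sum_distrib_left mult_ac)

lemma inner_h_smult_right: "x \<in> carrier_vec rk \<Longrightarrow> inner_h G z (a \<cdot>\<^sub>v x) = a * inner_h G z x"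
  by (simp add: inner_h_def sum_distrib_left mult_ac)

lemma inner_h_sym: "inner_h G x y = inner_h G y x"
  by (simp add: inner_h_def mult_ac)

lemmas inner_h_linear = inner_h_add_left inner_h_add_right inner_h_minus_left inner_h_minus_right
  inner_h_uminus_left inner_h_uminus_right inner_h_smult_left inner_h_smult_right

lemma inner_h_wt_left: "i < rk \<Longrightarrow> inner_h G (wt i) x = (-1) ^ pr i * x $ i"
  unfolding inner_h_def
  by (subst sum_left_unit[where c = i]) (auto simp: wt_index rk_bar intro: rk_bar_A dest: rk_bar_A)

lemma inner_h_wt: "i < rk \<Longrightarrow> j < rk \<Longrightarrow> inner_h G (wt i) (wt j) = (if i = j then (-1) ^ pr i else 0)"
  by (auto simp: inner_h_wt_left wt_index rk_bar_less dest: rk_bar)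

definition hmat :: "complex vec \<Rightarrow> complex mat" where
  "hmat \<xi> = mat N N (\<lambda>(i, j). if i = j then inner_h G (wt i) \<xi> else 0)"

lemma hmat_cartan: "hmat \<xi> \<in> cartan G"
proof -
  have "hmat \<xi> $$ (bar j, bar i) = t i j * hmat \<xi> $$ (i, j)" if os "i < N" "j < N" for i j
    using that t_self[of i] by (auto simp: hmat_def bar_inject wt_bar inner_h_uminus_left)
  then show ?thesis
    by (auto simp: cartan_def lie_alg_iff diagonal_mat_def) (auto simp: hmat_def)
qed

lemma weight_eval_hmat: "weight_eval G \<mu> (hmat \<xi>) = inner_h G \<mu> \<xi>"
  unfolding weight_eval_def inner_h_def
  using rk_le_N by (intro sum.cong) (auto simp: hmat_def inner_h_wt_left)

lemma cartan_entry:
  assumes "H \<in> cartan G" "i < N" "j < N"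
  shows "H $$ (i, j) = (if i = j then weight_eval G (wt i) H else 0)"
proof -
  have H: "H \<in> lie_alg G" "diagonal_mat H" "H \<in> carrier_mat N N"
    using assms(1) by (auto simp: cartan_def)
  have "weight_eval G (wt i) H = H $$ (i, i)"
  proof (cases os)
    case False
    then show ?thesis unfolding weight_eval_def using assms(2)
      by (subst sum_left_unit[where c = i]) (auto simp: wt_index hdim_A)
  next
    case True
    have d: "H $$ (bar i, bar i) = - H $$ (i, i)"
      using lie_alg_dual[OF H(1) True assms(2) assms(2)] t_self[OF True assms(2)] by simp
    have dd: "weight_eval G (wt k) H = H $$ (k, k)" if "k < rk" for k
      unfolding weight_eval_def using that
      by (subst sum_left_unit[where c = k]) (auto simp: wt_index rk_bar intro: rk_bar_A dest: rk_bar_A)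
    have db: "weight_eval G (- wt i) H = - weight_eval G (wt i) H"
      by (simp add: weight_eval_def sum_negf)
    show ?thesis
    proof (rule os_index_cases[OF True assms(2)])
      assume "i < n" then show ?thesis using dd hdim_os[OF True] by simp
    next
      assume "bar i < n"
      then have "weight_eval G (wt (bar i)) H = H $$ (bar i, bar i)" using dd hdim_os[OF True] by simp
      then show ?thesis using d db by (simp add: wt_bar[OF True assms(2)])
    next
      assume "bar i = i"
      then have "wt i = - wt i" "H $$ (i, i) = - H $$ (i, i)" using wt_bar[OF True assms(2)] d by simp_all
      then show ?thesis using db by simp
    qed
  qed
  then show ?thesis using H assms by (auto simp: diagonal_mat_def)
qed

lemma weight_eval_ext:
  assumes "\<xi> \<in> carrier_vec rk" "\<eta> \<in> carrier_vec rk"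
    and "\<And>H. H \<in> cartan G \<Longrightarrow> weight_eval G \<xi> H = weight_eval G \<eta> H"
  shows "\<xi> = \<eta>"
proof (rule eq_vecI)
  fix i assume "i < dim_vec \<eta>"
  then have i: "i < rk" using assms(2) by simp
  have "inner_h G \<xi> (wt i) = inner_h G \<eta> (wt i)"
    using assms(3)[OF hmat_cartan] by (simp add: weight_eval_hmat)
  then show "\<xi> $ i = \<eta> $ i" using i by (simp add: inner_h_sym[of _ "wt i"] inner_h_wt_left)
qed (use assms in auto)

lemma h_vec_eq: "h_vec G \<xi> = hmat \<xi>"
  unfolding h_vec_def
proof (rule the_equality)
  show "hmat \<xi> \<in> cartan G \<and> (\<forall>\<mu>\<in>carrier_vec rk. weight_eval G \<mu> (hmat \<xi>) = inner_h G \<mu> \<xi>)"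
    by (simp add: hmat_cartan weight_eval_hmat)
next
  fix H assume H: "H \<in> cartan G \<and> (\<forall>\<mu>\<in>carrier_vec rk. weight_eval G \<mu> H = inner_h G \<mu> \<xi>)"
  then have c: "H \<in> carrier_mat N N" by (simp add: cartan_def)
  show "H = hmat \<xi>"
    by (rule eq_matI) (use H c in \<open>auto simp: cartan_entry hmat_def\<close>)
qed

lemma weight_eval_minus: "x \<in> carrier_vec rk \<Longrightarrow> y \<in> carrier_vec rk \<Longrightarrow>
    weight_eval G (x - y) H = weight_eval G x H - weight_eval G y H"
  by (simp add: weight_eval_def algebra_simps sum_subtractf)

lemma sg_simps [simp]: "sg i i j = 1" "sg i j j = 1"
  by (simp_all add: sg_def flip: mult_2)

lemma sg_sq: "sg i k j * sg i k j = 1"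
  unfolding sg_def by (rule neg_one_power_mult_self)

lemma sbracket_cartan:
  assumes "H \<in> cartan G" "X \<in> carrier_mat N N" "i < N" "j < N"
  shows "sbracket G H X $$ (i, j) = weight_eval G (wt i - wt j) H * X $$ (i, j)"
proof -
  have H: "H \<in> carrier_mat N N" using assms by (simp add: cartan_def)
  have 1: "(\<Sum>k<N. H $$ (i, k) * X $$ (k, j)) = H $$ (i, i) * X $$ (i, j)"
    by (rule sum_left_unit) (use assms in \<open>auto simp: cartan_entry\<close>)
  have 2: "(\<Sum>k<N. sg i k j * (X $$ (i, k) * H $$ (k, j))) = sg i j j * (X $$ (i, j) * H $$ (j, j))"
    by (rule sum_left_unit) (use assms in \<open>auto simp: cartan_entry\<close>)
  show ?thesis
    unfolding sbracket_index[OF H assms(2-4)] sum_subtractf 1 2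
    using assms by (simp add: cartan_entry weight_eval_minus algebra_simps)
qed

lemma lie_alg_dims [simp]: "X \<in> lie_alg G \<Longrightarrow> dim_row X = N" "X \<in> lie_alg G \<Longrightarrow> dim_col X = N"
  using carrier_matD[OF lie_alg_carrier] by blast+

text \<open>The matrices \<open>hmat\<close> separate weights, so the eigenvector condition becomes
  a condition on the support of X. From here on root spaces can be handled through supports.\<close>

lemma root_space_iff:
  assumes "\<xi> \<in> carrier_vec rk"
  shows "X \<in> root_space G \<xi> \<longleftrightarrow>
    X \<in> lie_alg G \<and> (\<forall>i<N. \<forall>j<N. X $$ (i, j) \<noteq> 0 \<longrightarrow> \<xi> = wt i - wt j)"
proof (intro iffI conjI allI impI)
  assume X: "X \<in> root_space G \<xi>"
  then show Xl: "X \<in> lie_alg G" by (simp add: root_space_def)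
  fix i j assume ij: "i < N" "j < N" "X $$ (i, j) \<noteq> 0"
  show "\<xi> = wt i - wt j"
  proof (rule weight_eval_ext[OF assms])
    fix H assume H: "H \<in> cartan G"
    have "sbracket G H X $$ (i, j) = (weight_eval G \<xi> H \<cdot>\<^sub>m X) $$ (i, j)"
      using X H by (simp add: root_space_def)
    then show "weight_eval G \<xi> H = weight_eval G (wt i - wt j) H"
      using ij Xl by (simp add: sbracket_cartan[OF H])
  qed simp
next
  assume X: "X \<in> lie_alg G \<and> (\<forall>i<N. \<forall>j<N. X $$ (i, j) \<noteq> 0 \<longrightarrow> \<xi> = wt i - wt j)"
  then have c: "X \<in> carrier_mat N N" by simp
  have "sbracket G H X = weight_eval G \<xi> H \<cdot>\<^sub>m X" if H: "H \<in> cartan G" for H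
  proof (rule eq_matI)
    fix i j assume "i < dim_row (weight_eval G \<xi> H \<cdot>\<^sub>m X)" "j < dim_col (weight_eval G \<xi> H \<cdot>\<^sub>m X)"
    then have ij: "i < N" "j < N" using c by auto
    then show "sbracket G H X $$ (i, j) = (weight_eval G \<xi> H \<cdot>\<^sub>m X) $$ (i, j)"
      using X c by (auto simp: sbracket_cartan[OF H c])
  qed (use c H in \<open>auto simp: cartan_def intro!: carrier_matD[OF sbracket_carrier]\<close>)
  then show "X \<in> root_space G \<xi>" using X by (simp add: root_space_def)
qed

lemma root_space_lie_alg: "X \<in> root_space G \<xi> \<Longrightarrow> X \<in> lie_alg G"
  by (simp add: root_space_def)

lemma wt_diff_add: "(wt i - wt k) + (wt k - wt j) = wt i - wt j"
  by (rule eq_vecI) auto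

lemma wt_inject:
  assumes "i < N" "j < N" "wt i = wt j"
  shows "i = j"
proof (cases os)
  case False
  have "wt i $ i = wt j $ i" using assms(3) by simp
  then show ?thesis using assms(1,2) False hdim_A by (simp add: wt_index split: if_splits)
next
  case True
  have e: "of_bool (k = i) - of_bool (k = bar i) = (of_bool (k = j) - of_bool (k = bar j) :: complex)" if "k < n" for k
    using arg_cong[OF assms(3), of "\<lambda>v. v $ k"] that True hdim_os by (simp add: wt_index)
  show ?thesis
  proof (rule os_index_cases[OF True assms(1)])
    assume "i < n"
    then show ?thesis using e[of i] bar_ge[OF True, of i] bar_ge[OF True, of j] by (force split: if_splits simp: of_bool_def)
  next
    assume i: "bar i < n"
    have "bar i \<noteq> i" using bar_ge[OF True i] i assms by auto
    then have "bar i = bar j" using e[OF i] by (auto split: if_splits simp: of_bool_def)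
    then show ?thesis using assms bar_inject by simp
  next
    assume a: "bar i = i" "i = n"
    show ?thesis
    proof (rule os_index_cases[OF True assms(2)])
      assume "j < n" then show ?thesis using e[of j] bar_ge[OF True, of j] a by (auto split: if_splits simp: of_bool_def)
    next
      assume j: "bar j < n"
      have "bar j \<noteq> j" using bar_ge[OF True j] j assms by auto
      then show ?thesis using e[OF j] a j by (auto split: if_splits simp: of_bool_def)
    qed (use a in simp)
  qed
qed

lemma bar_fixed_unique: "i < N \<Longrightarrow> j < N \<Longrightarrow> bar i = i \<Longrightarrow> bar j = j \<Longrightarrow> i = j"
  by (auto simp: bar_def)

text \<open>Compares the coordinate that belongs to i or to its reflection, where
  \<open>wt i\<close> is non-zero because i is not the middle index. Passing to integer coordinates
  leaves a finite case distinction.\<close>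

lemma wt_diff_eq_aux:
  assumes os "i < N" "j < N" "k < N" "l < N" "i \<noteq> j" "wt i - wt j = wt k - wt l" "bar i \<noteq> i"
  shows "k = i \<or> l = bar i"
proof -
  define g :: "nat \<Rightarrow> nat \<Rightarrow> int" where "g x a = of_bool (x = a) - of_bool (x = bar a)" for x a
  have e: "g x i - g x j = g x k - g x l" if "x < n" for x
  proof -
    have "wt a $ x = complex_of_int (g x a)" for a
      using that assms(1) hdim_os by (simp add: wt_index g_def)
    then have "complex_of_int (g x i - g x j) = complex_of_int (g x k - g x l)"
      using arg_cong[OF assms(7), of "\<lambda>v. v $ x"] that assms(1) hdim_os by simp
    then show ?thesis by (simp only: of_int_eq_iff)
  qed
  show ?thesis
  proof (rule os_index_cases[OF assms(1,2)])
    assume "i < n"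
    from e[OF this] show ?thesis using assms unfolding g_def
      by (auto simp: of_bool_def bar_inject split: if_splits)
  next
    assume "bar i < n"
    from e[OF this] show ?thesis using assms unfolding g_def
      by (auto simp: of_bool_def bar_inject split: if_splits)
  qed (use assms in auto)
qed

text \<open>If i is the middle index, the auxiliary lemma is applied to the reflected pair
  (\<open>bar j\<close>, \<open>bar i\<close>), which has the same weight difference and whose first
  index is not the middle one.\<close>

lemma wt_diff_eq:
  assumes os "i < N" "j < N" "k < N" "l < N" "i \<noteq> j" "wt i - wt j = wt k - wt l"
  shows "(k = i \<and> l = j) \<or> (k = bar j \<and> l = bar i)"
proof -
  have can: "a = b" if "x - a = x - b" "x \<in> carrier_vec rk" "a \<in> carrier_vec rk" "b \<in> carrier_vec rk"
    for x a b :: "complex vec"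
  proof (rule eq_vecI)
    fix m assume "m < dim_vec b"
    then show "a $ m = b $ m"
      using arg_cong[OF that(1), of "\<lambda>v. v $ m"] carrier_vecD[OF that(2)] carrier_vecD[OF that(3)]
        carrier_vecD[OF that(4)] by simp
  qed (use that in auto)
  have dual: "wt (bar a) - wt (bar b) = wt b - wt a" if "a < N" "b < N" for a b
    by (rule eq_vecI) (use that assms(1) in \<open>auto simp: wt_bar\<close>)
  have fin: "?thesis" if "i0 < N" "j0 < N" "k0 < N" "l0 < N" "i0 \<noteq> j0"
      "wt i0 - wt j0 = wt k0 - wt l0" "bar i0 \<noteq> i0"
      "i0 = i \<and> j0 = j \<and> k0 = k \<and> l0 = l \<or> i0 = bar j \<and> j0 = bar i \<and> k0 = bar l \<and> l0 = bar k" for i0 j0 k0 l0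
  proof -
    from wt_diff_eq_aux[OF assms(1) that(1-7)] show ?thesis
    proof
      assume "k0 = i0"
      then have "wt j0 = wt l0" using can[of "wt i0" "wt j0" "wt l0"] that by simp
      then have "j0 = l0" using wt_inject that by blast
      then show ?thesis using \<open>k0 = i0\<close> that(8) assms(2-5) by (auto simp: bar_inject)
    next
      assume l: "l0 = bar i0"
      then have "wt i0 - wt j0 = wt i0 - wt (bar k0)"
        using that(6) dual[of k0 l0] that by (metis bar_bar bar_less dual)
      then have "wt j0 = wt (bar k0)" using can[of "wt i0" "wt j0" "wt (bar k0)"] by simp
      then have "j0 = bar k0" using wt_inject that by simp
      then show ?thesis using l that(1-4,8) assms(2-5) by (auto simp: bar_inject)
    qed
  qed
  show ?thesis
  proof (cases "bar i = i")
    case False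
    then show ?thesis using fin[of i j k l] assms by simp
  next
    case True
    then have "bar j \<noteq> j" using assms bar_fixed_unique by blast
    then show ?thesis using fin[of "bar j" "bar i" "bar l" "bar k"] assms dual by (simp add: bar_inject)
  qed
qed

text \<open>The matrix unit at (i, j), corrected by its reflection so that it lies in the algebra.
  If \<open>j = bar i\<close> in the ortho-symplectic case, both terms sit at the same entry and add
  up to \<open>1 - eps i\<close>: the result is twice the matrix unit or zero.\<close>

definition F :: "nat \<Rightarrow> nat \<Rightarrow> complex mat" where
  "F i j = mat N N (\<lambda>(a, b). of_bool (a = i \<and> b = j) +
     (if os \<and> a = bar j \<and> b = bar i then t i j else 0))"

lemma F_carrier [simp]: "F i j \<in> carrier_mat N N"
  by (simp add: F_def)

lemma F_dims [simp]: "dim_row (F i j) = N" "dim_col (F i j) = N"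
  by (simp_all add: F_def)

lemma F_index: "a < N \<Longrightarrow> b < N \<Longrightarrow> F i j $$ (a, b) =
    of_bool (a = i \<and> b = j) + (if os \<and> a = bar j \<and> b = bar i then t i j else 0)"
  by (simp add: F_def)

lemma F_support: "a < N \<Longrightarrow> b < N \<Longrightarrow> F i j $$ (a, b) \<noteq> 0 \<Longrightarrow>
    (a = i \<and> b = j) \<or> (os \<and> a = bar j \<and> b = bar i)"
  by (subst (asm) F_index) (auto split: if_splits)

lemma F_lie_alg [simp]:
  assumes "i < N" "j < N"
  shows "F i j \<in> lie_alg G"
proof -
  have "F i j $$ (bar b, bar a) = t a b * F i j $$ (a, b)" if os "a < N" "b < N" for a b
  proof -
    have 1: "(bar b = i \<and> bar a = j) = (a = bar j \<and> b = bar i)" using that assms by auto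
    have 2: "(bar b = bar j \<and> bar a = bar i) = (a = i \<and> b = j)" using that assms by (auto simp: bar_inject)
    have 3: "a = i \<and> b = j \<Longrightarrow> t a b = t i j" "a = bar j \<and> b = bar i \<Longrightarrow> t a b * t i j = 1"
      using t_dual[OF that(1) assms] by auto
    have L: "F i j $$ (bar b, bar a) = of_bool (a = bar j \<and> b = bar i) + (if a = i \<and> b = j then t i j else 0)"
      unfolding F_index[OF bar_less[OF that(3)] bar_less[OF that(2)]] 1 2 using that(1) by simp
    have R: "F i j $$ (a, b) = of_bool (a = i \<and> b = j) + (if a = bar j \<and> b = bar i then t i j else 0)"
      unfolding F_index[OF that(2,3)] using that(1) by simp
    have "t a b * (if a = bar j \<and> b = bar i then t i j else 0) = of_bool (a = bar j \<and> b = bar i)"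
      using 3(2) by (simp only: of_bool_def split: if_split) simp
    moreover have "t a b * of_bool (a = i \<and> b = j) = (if a = i \<and> b = j then t i j else 0)"
      using 3(1) by simp
    ultimately show ?thesis unfolding L R distrib_left by simp
  qed
  then show ?thesis by (simp add: lie_alg_iff)
qed

lemma F_diag_entry: "i < N \<Longrightarrow> j < N \<Longrightarrow> F i j $$ (i, j) = (if os \<and> j = bar i then 1 - eps i else 1)"
  by (auto simp: F_index t_bar)

lemma F_nonzero_iff:
  assumes "i < N" "j < N"
  shows "F i j \<noteq> 0\<^sub>m N N \<longleftrightarrow> F i j $$ (i, j) \<noteq> 0"
proof
  assume nz: "F i j \<noteq> 0\<^sub>m N N"
  show "F i j $$ (i, j) \<noteq> 0"
  proof
    assume "F i j $$ (i, j) = 0"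
    then have z: os "j = bar i" "t i (bar i) = -1"
      using assms by (auto simp: F_diag_entry t_bar split: if_splits)
    have "F i j = 0\<^sub>m N N"
    proof (rule eq_matI)
      fix a b assume "a < dim_row (0\<^sub>m N N :: complex mat)" "b < dim_col (0\<^sub>m N N :: complex mat)"
      then show "F i j $$ (a, b) = 0\<^sub>m N N $$ (a, b)"
        unfolding z(2) using z(1,3) assms(1) by (simp add: F_index)
    qed (simp_all add: F_def)
    then show False using nz by simp
  qed
next
  assume "F i j $$ (i, j) \<noteq> 0"
  then show "F i j \<noteq> 0\<^sub>m N N" using assms by (metis index_zero_mat(1))
qed

lemma F_nonzero: "i < N \<Longrightarrow> j < N \<Longrightarrow> \<not> (os \<and> j = bar i) \<Longrightarrow> F i j \<noteq> 0\<^sub>m N N"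
  by (subst F_nonzero_iff) (auto simp: F_diag_entry)

lemma F_nonzero_bar: "os \<Longrightarrow> i < N \<Longrightarrow> F i (bar i) \<noteq> 0\<^sub>m N N \<longleftrightarrow> eps i = -1"
  using eps_props(1)[of i] by (auto simp: F_nonzero_iff F_diag_entry)

lemma F_root_space [simp]: "i < N \<Longrightarrow> j < N \<Longrightarrow> F i j \<in> root_space G (wt i - wt j)"
proof -
  assume ij: "i < N" "j < N"
  have "wt (bar j) - wt (bar i) = wt i - wt j" if os
    by (rule eq_vecI) (use that ij in \<open>auto simp: wt_bar\<close>)
  then show ?thesis using ij by (subst root_space_iff) (auto simp: F_index of_bool_def split: if_splits)
qed

text \<open>A root vector can be supported only at (i, j) and at the reflected position, and duality
  ties these two entries together; hence the root space is at most a line.\<close>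

lemma root_space_unique:
  assumes "i < N" "j < N" "i \<noteq> j" "X \<in> root_space G (wt i - wt j)"
  shows "F i j \<noteq> 0\<^sub>m N N \<Longrightarrow> X = (X $$ (i, j) / F i j $$ (i, j)) \<cdot>\<^sub>m F i j"
    and "X \<noteq> 0\<^sub>m N N \<Longrightarrow> F i j \<noteq> 0\<^sub>m N N"
    and "X \<noteq> 0\<^sub>m N N \<Longrightarrow> X $$ (i, j) \<noteq> 0"
proof -
  have X: "X \<in> lie_alg G" "\<And>a b. a < N \<Longrightarrow> b < N \<Longrightarrow> X $$ (a, b) \<noteq> 0 \<Longrightarrow> wt i - wt j = wt a - wt b"
    using assms(4) by (auto simp: root_space_iff)
  have supp: "(a = i \<and> b = j) \<or> (os \<and> a = bar j \<and> b = bar i)" if "a < N" "b < N" "X $$ (a, b) \<noteq> 0" for a b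
  proof (cases os)
    case True
    then show ?thesis using wt_diff_eq[OF True assms(1,2) that(1,2) assms(3) X(2)[OF that]] by blast
  next
    case False
    then have h: "rk = N" by (rule hdim_A)
    have "(wt i - wt j) $ x = (wt a - wt b) $ x" for x using X(2)[OF that] by simp
    from this[of i] this[of j] show ?thesis
      using False assms that h by (auto simp: wt_index of_bool_def split: if_splits)
  qed
  show 1: "X = (X $$ (i, j) / F i j $$ (i, j)) \<cdot>\<^sub>m F i j" if "F i j \<noteq> 0\<^sub>m N N"
  proof (rule eq_matI)
    have nz: "F i j $$ (i, j) \<noteq> 0" using that assms F_nonzero_iff by simp
    fix a b assume "a < dim_row ((X $$ (i, j) / F i j $$ (i, j)) \<cdot>\<^sub>m F i j)"
      "b < dim_col ((X $$ (i, j) / F i j $$ (i, j)) \<cdot>\<^sub>m F i j)"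
    then have ab: "a < N" "b < N" by (simp_all add: F_def)
    consider "a = i" "b = j" | "os" "a = bar j" "b = bar i" "\<not> (a = i \<and> b = j)" |
      "\<not> (a = i \<and> b = j)" "\<not> (os \<and> a = bar j \<and> b = bar i)" by blast
    then show "X $$ (a, b) = ((X $$ (i, j) / F i j $$ (i, j)) \<cdot>\<^sub>m F i j) $$ (a, b)"
    proof cases
      case 1 then show ?thesis using nz ab by (simp add: F_def)
    next
      case 2
      then have "X $$ (a, b) = t i j * X $$ (i, j)" "F i j $$ (a, b) = t i j * F i j $$ (i, j)"
        using lie_alg_dual[OF X(1)] lie_alg_dual[OF F_lie_alg] assms by auto
      then show ?thesis using nz ab by simp
    next
      case 3
      then have "X $$ (a, b) = 0" using supp[OF ab] by blast
      moreover have "F i j $$ (a, b) = 0" unfolding F_index[OF ab] using 3 by (simp only: of_bool_def if_False if_not_P) simp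
      ultimately show ?thesis using ab by simp
    qed
  qed (use X(1) in \<open>simp_all add: F_def carrier_matD[OF lie_alg_carrier[OF X(1)]]\<close>)
  show 3: "X $$ (i, j) \<noteq> 0" if "X \<noteq> 0\<^sub>m N N"
  proof
    assume z: "X $$ (i, j) = 0"
    have "X = 0\<^sub>m N N"
    proof (rule eq_matI)
      fix a b assume "a < dim_row (0\<^sub>m N N :: complex mat)" "b < dim_col (0\<^sub>m N N :: complex mat)"
      then have ab: "a < N" "b < N" by simp_all
      then show "X $$ (a, b) = 0\<^sub>m N N $$ (a, b)"
        using supp[OF ab] z lie_alg_dual[OF X(1), of i j] assms by auto
    qed (use X(1) in \<open>simp_all add: carrier_matD[OF lie_alg_carrier[OF X(1)]]\<close>)
    then show False using that by simp
  qed
  show "F i j \<noteq> 0\<^sub>m N N" if "X \<noteq> 0\<^sub>m N N"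
  proof (cases "os \<and> j = bar i")
    case True
    have "X $$ (i, j) \<noteq> 0" using 3 that .
    then have "t i j = 1" using lie_alg_dual[OF X(1), of i j] True assms by simp
    then have "- eps i = 1" using True assms t_bar by simp
    then have "eps i = -1" by (metis minus_minus)
    then show ?thesis using True assms F_nonzero_bar by simp
  qed (use F_nonzero assms in blast)
qed

lemma sbracket_root_space:
  assumes "X \<in> root_space G \<xi>" "Y \<in> root_space G \<eta>" "\<xi> \<in> carrier_vec rk" "\<eta> \<in> carrier_vec rk"
  shows "sbracket G X Y \<in> root_space G (\<xi> + \<eta>)"
proof -
  have XY: "X \<in> lie_alg G" "Y \<in> lie_alg G" using assms by (auto simp: root_space_def)
  have "\<xi> + \<eta> = wt i - wt j" if ij: "i < N" "j < N" "sbracket G X Y $$ (i, j) \<noteq> 0" for i j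
  proof -
    obtain k where k: "k < N" "X $$ (i, k) * Y $$ (k, j) - sg i k j * (Y $$ (i, k) * X $$ (k, j)) \<noteq> 0"
      using ij XY by (metis (no_types, lifting) sbracket_index lie_alg_carrier sum.neutral lessThan_iff)
    then consider "X $$ (i, k) \<noteq> 0" "Y $$ (k, j) \<noteq> 0" | "Y $$ (i, k) \<noteq> 0" "X $$ (k, j) \<noteq> 0"
      by fastforce
    then show ?thesis
    proof cases
      case 1
      then show ?thesis using assms k ij wt_diff_add by (auto simp: root_space_iff)
    next
      case 2
      then have "\<xi> = wt k - wt j" "\<eta> = wt i - wt k" using assms k ij by (auto simp: root_space_iff)
      then show ?thesis using wt_diff_add[of i k j]
        by (metis comm_add_vec minus_carrier_vec wt_carrier)
    qed
  qed
  then show ?thesis using XY sbracket_lie_alg assms by (simp add: root_space_iff)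
qed

text \<open>The entry at (k, j) decides. One product contributes only through the index i. The other
  contributes only if \<open>k = bar j\<close>, through \<open>bar i\<close>, and the duality
  factors then make the total proportional to \<open>1 + t k j\<close>, which is the entry of
  \<open>F k j\<close> itself. So the bracket cannot vanish unless \<open>F k j\<close>
  does.\<close>

lemma sbracket_F:
  assumes "k < N" "i < N" "j < N" "k \<noteq> i" "i \<noteq> j" "k \<noteq> j"
    and "F k i \<noteq> 0\<^sub>m N N" "F i j \<noteq> 0\<^sub>m N N" "F k j \<noteq> 0\<^sub>m N N"
  shows "\<exists>a. a \<noteq> 0 \<and> sbracket G (F k i) (F i j) = a \<cdot>\<^sub>m F k j"
proof -
  let ?Z = "sbracket G (F k i) (F i j)"
  have Z: "?Z \<in> root_space G (wt k - wt j)"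
    using sbracket_root_space[of "F k i" "wt k - wt i" "F i j" "wt i - wt j"] assms wt_diff_add by simp
  have nz: "F k i $$ (k, i) \<noteq> 0" "F i j $$ (i, j) \<noteq> 0" "F k j $$ (k, j) \<noteq> 0"
    using assms F_nonzero_iff by simp_all
  have 1: "(\<Sum>m<N. F k i $$ (k, m) * F i j $$ (m, j)) = F k i $$ (k, i) * F i j $$ (i, j)"
  proof (rule sum_left_unit)
    fix m assume m: "m \<in> {..<N}" "m \<noteq> i"
    have "F k i $$ (k, m) = 0"
    proof (rule ccontr)
      assume "F k i $$ (k, m) \<noteq> 0"
      then have "k = bar i" "m = bar k" using F_support[of k m k i] m assms by auto
      then show False using m assms by simp
    qed
    then show "F k i $$ (k, m) * F i j $$ (m, j) = 0" by simp
  qed (use assms in auto)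
  have 2: "(\<Sum>m<N. sg k m j * (F i j $$ (k, m) * F k i $$ (m, j))) =
      (if os \<and> k = bar j then - t k j * F k i $$ (k, i) * F i j $$ (i, j) else 0)"
  proof (cases "os \<and> k = bar j")
    case True
    have "(\<Sum>m<N. sg k m j * (F i j $$ (k, m) * F k i $$ (m, j))) =
       sg k (bar i) j * (F i j $$ (k, bar i) * F k i $$ (bar i, j))"
    proof (rule sum_left_unit)
      fix m assume m: "m \<in> {..<N}" "m \<noteq> bar i"
      then have "F i j $$ (k, m) = 0" using F_support[of k m i j] assms(1,4) by fastforce
      then show "sg k m j * (F i j $$ (k, m) * F k i $$ (m, j)) = 0" by simp
    qed (use assms in auto)
    also have "\<dots> = sg k (bar i) j * ((t i j * F i j $$ (i, j)) * (t k i * F k i $$ (k, i)))"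
      using lie_alg_dual[OF F_lie_alg, of i j i j] lie_alg_dual[OF F_lie_alg, of k i k i] True assms by simp
    also have "\<dots> = sg k i j * ((t k i * t i j) * F k i $$ (k, i) * F i j $$ (i, j))"
      using True assms by (simp add: sg_def pr_bar)
    also have "\<dots> = - (sg k i j * sg k i j) * t k j * F k i $$ (k, i) * F i j $$ (i, j)"
      using t_mult[of k i j] True assms by simp
    finally show ?thesis using True by (simp add: sg_sq)
  next
    case False
    then have "\<And>m. m < N \<Longrightarrow> F i j $$ (k, m) = 0" using F_support[of k _ i j] assms(1,4) by blast
    then show ?thesis using False by auto
  qed
  have e: "?Z $$ (k, j) = F k i $$ (k, i) * F i j $$ (i, j) * F k j $$ (k, j)"
  proof -
    have "(k = bar j) = (j = bar k)" using assms by auto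
    then show ?thesis
      unfolding sbracket_index[OF F_carrier F_carrier assms(1,3)] sum_subtractf 1 2 F_diag_entry[OF assms(1,3)]
      using t_bar[OF _ assms(1)] by (cases os; cases "j = bar k") (simp_all add: algebra_simps)
  qed
  have "?Z = (?Z $$ (k, j) / F k j $$ (k, j)) \<cdot>\<^sub>m F k j"
    by (rule root_space_unique(1)[OF assms(1,3,6) Z assms(9)])
  moreover have "?Z $$ (k, j) / F k j $$ (k, j) \<noteq> 0" using e nz by simp
  ultimately show ?thesis by blast
qed

lemma odd_root_iff:
  assumes "i < N" "j < N" "i \<noteq> j" "F i j \<noteq> 0\<^sub>m N N"
  shows "odd_root G (wt i - wt j) \<longleftrightarrow> pr i \<noteq> pr j"
proof
  assume "odd_root G (wt i - wt j)"
  then obtain X where X: "X \<in> root_space G (wt i - wt j)" "X \<noteq> 0\<^sub>m N N" "odd_part G X = X"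
    by (auto simp: odd_root_def)
  then have "X $$ (i, j) \<noteq> 0" using root_space_unique(3) assms by blast
  moreover have "odd_part G X $$ (i, j) = (if pr i \<noteq> pr j then X $$ (i, j) else 0)"
    using assms by (simp add: odd_part_def)
  ultimately show "pr i \<noteq> pr j" using X(3) by (auto split: if_splits)
next
  assume "pr i \<noteq> pr j"
  then have "odd_part G (F i j) = F i j"
    by (intro eq_matI) (use assms in \<open>auto simp: odd_part_def F_def pr_bar\<close>)
  then show "odd_root G (wt i - wt j)" using assms F_root_space by (auto simp: odd_root_def)
qed

text \<open>Writes each simple root as a difference of two weights of V, so that its root vector is
  an \<open>F\<close>: \<open>wt n\<close> is 0 in shape B, and in shapes C and D the index n is the
  reflection of \<open>n - 1\<close>.\<close>

definition ed :: "nat \<Rightarrow> nat \<times> nat" where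
  "ed j = (if shape G = ShapeD \<and> j = n - 1 then (n - 2, n) else (j, j + 1))"

lemma ed_less: "j < n \<Longrightarrow> fst (ed j) < snd (ed j) \<and> snd (ed j) < N"
proof -
  assume j: "j < n"
  consider "shape G = ShapeA" "n = N - 1" | "shape G = ShapeB" "N = 2 * n + 1" |
    "shape G = ShapeC" "N = 2 * n" | "shape G = ShapeD" "N = 2 * n" "n \<ge> 2"
    using nodes_A shape_B_N shape_CD_N shape_D_n by (cases "shape G") blast+
  then show ?thesis by cases (use j in \<open>auto simp: ed_def\<close>)
qed

lemma wt_mid: "os \<Longrightarrow> i < N \<Longrightarrow> bar i = i \<Longrightarrow> wt i = 0\<^sub>v rk"
  by (rule eq_vecI) (auto simp: wt_def)

lemma simple_root_eq:
  assumes "j < n"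
  shows "simple_root G j = wt (fst (ed j)) - wt (snd (ed j))"
proof -
  consider (chain) "j + 1 < rk" | (B) "shape G = ShapeB" "j = n - 1" | (C) "shape G = ShapeC" "j = n - 1" |
    (D) "shape G = ShapeD" "j = n - 1"
  proof -
    have "j + 1 < rk \<or> j = n - 1 \<and> os"
    proof (cases os)
      case True then show ?thesis using assms hdim_os[OF True] by linarith
    next
      case False then show ?thesis using assms hdim_A nodes_A by simp
    qed
    then show ?thesis using that os_shape by blast
  qed
  then show ?thesis
  proof cases
    case chain
    then have "\<not> (shape G = ShapeD \<and> j = n - 1)" using hdim_os by auto
    then have "ed j = (j, j + 1)" by (auto simp: ed_def)
    then show ?thesis using chain by (simp add: simple_root_def wt_eq_zeta)
  next
    case B
    then have "bar n = n" "n < N" using shape_B_N by (auto simp: bar_def)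
    then have "wt n = 0\<^sub>v rk" using wt_mid B by simp
    then show ?thesis using B assms hdim_os
      by (intro eq_vecI) (auto simp: simple_root_def ed_def wt_eq_zeta zeta_def)
  next
    case C
    then have "bar (n - 1) = n" "n - 1 < N" using shape_CD_N assms by (auto simp: bar_def)
    then have "wt n = - wt (n - 1)" using wt_bar[of "n - 1"] C by simp
    then show ?thesis using C assms hdim_os
      by (intro eq_vecI) (auto simp: simple_root_def ed_def wt_eq_zeta zeta_def)
  next
    case D
    then have "bar (n - 1) = n" "n - 1 < N" "n \<ge> 2" using shape_CD_N shape_D_n assms by (auto simp: bar_def)
    then have "wt n = - wt (n - 1)" using wt_bar[of "n - 1"] D by simp
    then show ?thesis using D assms hdim_os \<open>n \<ge> 2\<close>
      by (intro eq_vecI) (auto simp: simple_root_def ed_def wt_eq_zeta zeta_def numeral_2_eq_2)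
  qed
qed

text \<open>Only in shape C does a simple root vector lie on the antidiagonal, and there
  \<open>eps\<close> is -1.\<close>

lemma F_ed_nonzero: "j < n \<Longrightarrow> F (fst (ed j)) (snd (ed j)) \<noteq> 0\<^sub>m N N"
proof (cases "os \<and> snd (ed j) = bar (fst (ed j))")
  case True
  assume j: "j < n"
  have "shape G = ShapeC \<and> fst (ed j) = n - 1"
  proof -
    consider "shape G = ShapeB" "N = 2 * n + 1" |
      "shape G = ShapeC" "N = 2 * n" | "shape G = ShapeD" "N = 2 * n" "n \<ge> 2"
      using os_shape shape_B_N shape_CD_N shape_D_n True by blast
    then show ?thesis
      by cases (use True j in \<open>auto simp: ed_def bar_def split: if_splits\<close>)
  qed
  then show ?thesis using True j F_nonzero_bar[of "n - 1"] eps_props(4) ed_less[OF j] by auto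
next
  case False
  assume "j < n"
  then show ?thesis using False ed_less F_nonzero by (meson less_trans)
qed

end

section \<open>Brackets of root vectors and subspaces given by supports\<close>

context super_algebra
begin

lemma wt_diff_cases:
  assumes "i < N" "j < N" "k < N" "l < N" "i \<noteq> j" "wt i - wt j = wt k - wt l"
  shows "(k = i \<and> l = j) \<or> (os \<and> k = bar j \<and> l = bar i)"
proof (cases os)
  case True
  then show ?thesis using wt_diff_eq assms by blast
next
  case False
  then have h: "rk = N" by (rule hdim_A)
  have "(wt i - wt j) $ x = (wt k - wt l) $ x" for x using assms(6) by simp
  from this[of i] this[of j] show ?thesis
    using False assms(1-5) h by (auto simp: wt_index of_bool_def split: if_splits)
qed

lemma wt_bars: "os \<Longrightarrow> i < N \<Longrightarrow> j < N \<Longrightarrow> wt (bar j) - wt (bar i) = wt i - wt j"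
  by (rule eq_vecI) (auto simp: wt_bar)

lemma F_nonzero_swap: "i < N \<Longrightarrow> j < N \<Longrightarrow> F i j \<noteq> 0\<^sub>m N N \<Longrightarrow> F j i \<noteq> 0\<^sub>m N N"
  using F_nonzero[of j i] F_nonzero_bar[of i] F_nonzero_bar[of j] eps_props(6)[of j]
  by (cases "os \<and> i = bar j") auto

lemma F_nonzero_bars: "os \<Longrightarrow> i < N \<Longrightarrow> j < N \<Longrightarrow> F (bar j) (bar i) \<noteq> 0\<^sub>m N N \<longleftrightarrow> F i j \<noteq> 0\<^sub>m N N"
  by (cases "j = bar i") (auto simp: F_nonzero F_nonzero_bar eps_props(6))

lemma F_bars:
  assumes os "i < N" "j < N"
  shows "F (bar j) (bar i) = t (bar j) (bar i) \<cdot>\<^sub>m F i j"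
proof (rule eq_matI)
  fix a b assume "a < dim_row (t (bar j) (bar i) \<cdot>\<^sub>m F i j)" "b < dim_col (t (bar j) (bar i) \<cdot>\<^sub>m F i j)"
  then have ab: "a < N" "b < N" by simp_all
  define p q where "p \<longleftrightarrow> a = i \<and> b = j" and "q \<longleftrightarrow> a = bar j \<and> b = bar i"
  have "F (bar j) (bar i) $$ (a, b) = of_bool q + (if p then t (bar j) (bar i) else 0)"
    unfolding F_index[OF ab] p_def q_def using assms by simp
  moreover have "F i j $$ (a, b) = of_bool p + (if q then t i j else 0)"
    unfolding F_index[OF ab] p_def q_def using assms by simp
  ultimately show "F (bar j) (bar i) $$ (a, b) = (t (bar j) (bar i) \<cdot>\<^sub>m F i j) $$ (a, b)"
    using t_dual[OF assms] ab by (cases p; cases q) (simp_all add: distrib_left)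
qed simp_all

lemma sum_nonzeroE:
  fixes f :: "nat \<Rightarrow> complex"
  assumes "sum f {..<m} \<noteq> 0"
  obtains k where "k < m" "f k \<noteq> 0"
  using assms by (metis sum.neutral lessThan_iff)

lemma sbracket_nonzeroE:
  assumes "X \<in> carrier_mat N N" "Y \<in> carrier_mat N N" "i < N" "j < N" "sbracket G X Y $$ (i, j) \<noteq> 0"
  obtains k where "k < N" "X $$ (i, k) \<noteq> 0" "Y $$ (k, j) \<noteq> 0" | k where "k < N" "Y $$ (i, k) \<noteq> 0" "X $$ (k, j) \<noteq> 0"
proof -
  obtain k where k: "k < N" "X $$ (i, k) * Y $$ (k, j) - sg i k j * (Y $$ (i, k) * X $$ (k, j)) \<noteq> 0"
    using assms(5) unfolding sbracket_index[OF assms(1-4)] by (rule sum_nonzeroE)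
  then show ?thesis using that by (metis diff_zero mult_eq_0_iff)
qed

lemma sbracket_add_left:
  assumes "X \<in> carrier_mat N N" "Y \<in> carrier_mat N N" "Z \<in> carrier_mat N N"
  shows "sbracket G (X + Y) Z = sbracket G X Z + sbracket G Y Z"
  by (rule eq_matI)
    (use assms in \<open>auto simp: sbracket_index carrier_matD[OF sbracket_carrier] algebra_simps sum.distrib sum_subtractf\<close>)

lemma sbracket_add_right:
  assumes "X \<in> carrier_mat N N" "Y \<in> carrier_mat N N" "Z \<in> carrier_mat N N"
  shows "sbracket G Z (X + Y) = sbracket G Z X + sbracket G Z Y"
  by (rule eq_matI)
    (use assms in \<open>auto simp: sbracket_index carrier_matD[OF sbracket_carrier] algebra_simps sum.distrib sum_subtractf\<close>)

lemma F_parity: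
  assumes "i < N" "j < N" "a < N" "b < N" "F i j $$ (a, b) \<noteq> 0"
  shows "pr a + pr b = pr i + pr j"
  using F_support[OF assms(3,4,5)] assms pr_bar by auto

text \<open>At every entry where a product of the two matrices is non-zero, \<open>sg\<close> equals
  the sign formed from the parities of the two factors.\<close>

lemma sbracket_F_skew:
  assumes "i < N" "j < N" "k < N" "l < N"
  shows "sbracket G (F i j) (F k l) = (- ((-1) ^ ((pr i + pr j) * (pr k + pr l)))) \<cdot>\<^sub>m sbracket G (F k l) (F i j)"
proof (rule eq_matI)
  let ?s = "(-1) ^ ((pr i + pr j) * (pr k + pr l)) :: complex"
  fix a b assume "a < dim_row (- ?s \<cdot>\<^sub>m sbracket G (F k l) (F i j))" "b < dim_col (- ?s \<cdot>\<^sub>m sbracket G (F k l) (F i j))"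
  then have ab: "a < N" "b < N" by (simp_all add: carrier_matD[OF sbracket_carrier])
  have ss: "?s * ?s = 1" by (rule neg_one_power_mult_self)
  have "F i j $$ (a, m) * F k l $$ (m, b) - sg a m b * (F k l $$ (a, m) * F i j $$ (m, b)) =
      - ?s * (F k l $$ (a, m) * F i j $$ (m, b) - sg a m b * (F i j $$ (a, m) * F k l $$ (m, b)))" if m: "m < N" for m
  proof -
    have 1: "F k l $$ (a, m) * F i j $$ (m, b) \<noteq> 0 \<Longrightarrow> sg a m b = ?s"
      using F_parity[OF assms(3,4) ab(1) m] F_parity[OF assms(1,2) m ab(2)] by (simp add: sg_def mult.commute)
    have 2: "F i j $$ (a, m) * F k l $$ (m, b) \<noteq> 0 \<Longrightarrow> sg a m b = ?s"
      using F_parity[OF assms(1,2) ab(1) m] F_parity[OF assms(3,4) m ab(2)] by (simp add: sg_def)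
    have z1: "sg a m b * (F k l $$ (a, m) * F i j $$ (m, b)) = ?s * (F k l $$ (a, m) * F i j $$ (m, b))"
      using 1 by (metis mult_zero_right)
    have z2: "sg a m b * (F i j $$ (a, m) * F k l $$ (m, b)) = ?s * (F i j $$ (a, m) * F k l $$ (m, b))"
      using 2 by (metis mult_zero_right)
    have "?s * (?s * x) = x" for x using ss by (simp add: mult.assoc[symmetric])
    then show ?thesis unfolding z1 z2 by (simp add: right_diff_distrib)
  qed
  then show "sbracket G (F i j) (F k l) $$ (a, b) = (- ?s \<cdot>\<^sub>m sbracket G (F k l) (F i j)) $$ (a, b)"
    using ab by (simp add: sbracket_index carrier_matD[OF sbracket_carrier] sum_distrib_left)
qed (simp_all add: carrier_matD[OF sbracket_carrier])

lemma sbracket_F':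
  assumes "k < N" "i < N" "j < N" "k \<noteq> i" "i \<noteq> j" "k \<noteq> j"
    and "F k i \<noteq> 0\<^sub>m N N" "F i j \<noteq> 0\<^sub>m N N" "F k j \<noteq> 0\<^sub>m N N"
  shows "\<exists>a. a \<noteq> 0 \<and> sbracket G (F i j) (F k i) = a \<cdot>\<^sub>m F k j"
proof -
  obtain a where a: "a \<noteq> 0" "sbracket G (F k i) (F i j) = a \<cdot>\<^sub>m F k j" using sbracket_F[OF assms] by blast
  show ?thesis
    unfolding sbracket_F_skew[OF assms(2,3,1,2)] a(2) using a(1)
    by (intro exI[of _ "- ((-1) ^ ((pr i + pr j) * (pr k + pr i))) * a"] conjI eq_matI) auto
qed

text \<open>Transitive relations give subalgebras. The Levi subalgebra, the modules generated by
  root vectors and the height filtration are all bounded or described by such subspaces.\<close>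

definition supp_in :: "(nat \<Rightarrow> nat \<Rightarrow> bool) \<Rightarrow> complex mat set" where
  "supp_in R = {X \<in> lie_alg G. \<forall>i<N. \<forall>j<N. X $$ (i, j) \<noteq> 0 \<longrightarrow> R i j}"

lemma supp_in_graded: "graded_subspace G (supp_in R)"
  unfolding graded_subspace_def
proof (intro conjI ballI allI)
  note L = lie_alg_graded[unfolded graded_subspace_def]
  show "supp_in R \<subseteq> lie_alg G" by (auto simp: supp_in_def)
  show "0\<^sub>m N N \<in> supp_in R" using L by (auto simp: supp_in_def)
  fix X assume X: "X \<in> supp_in R"
  then have Xl: "X \<in> lie_alg G" and XR: "\<And>i j. i < N \<Longrightarrow> j < N \<Longrightarrow> X $$ (i, j) \<noteq> 0 \<Longrightarrow> R i j"
    by (auto simp: supp_in_def)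
  show "even_part G X \<in> supp_in R"
    using L Xl XR by (auto simp: supp_in_def even_part_def split: if_splits)
  show "a \<cdot>\<^sub>m X \<in> supp_in R" for a
    using L Xl XR by (auto simp: supp_in_def)
  fix Y assume Y: "Y \<in> supp_in R"
  then have Yl: "Y \<in> lie_alg G" and YR: "\<And>i j. i < N \<Longrightarrow> j < N \<Longrightarrow> Y $$ (i, j) \<noteq> 0 \<Longrightarrow> R i j"
    by (auto simp: supp_in_def)
  have "X + Y \<in> lie_alg G" using L Xl Yl by blast
  moreover have "(X + Y) $$ (i, j) = X $$ (i, j) + Y $$ (i, j)" if "i < N" "j < N" for i j
    using that Yl by simp
  ultimately show "X + Y \<in> supp_in R"
    using XR YR unfolding supp_in_def by (auto; metis add_0)
qed

lemma supp_in_sbracket: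
  assumes "X \<in> supp_in R" "Y \<in> supp_in S"
    and "\<And>i k j. i < N \<Longrightarrow> k < N \<Longrightarrow> j < N \<Longrightarrow> R i k \<Longrightarrow> S k j \<Longrightarrow> T i j"
    and "\<And>i k j. i < N \<Longrightarrow> k < N \<Longrightarrow> j < N \<Longrightarrow> S i k \<Longrightarrow> R k j \<Longrightarrow> T i j"
  shows "sbracket G X Y \<in> supp_in T"
proof -
  have XY: "X \<in> lie_alg G" "Y \<in> lie_alg G" using assms by (auto simp: supp_in_def)
  have "T i j" if ij: "i < N" "j < N" and nz: "sbracket G X Y $$ (i, j) \<noteq> 0" for i j
    by (rule sbracket_nonzeroE[OF lie_alg_carrier[OF XY(1)] lie_alg_carrier[OF XY(2)] ij nz])
      (use assms ij in \<open>auto simp: supp_in_def\<close>)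
  then show ?thesis using XY sbracket_lie_alg by (auto simp: supp_in_def)
qed

lemma supp_in_subalgebra:
  assumes "\<And>i k j. R i k \<Longrightarrow> R k j \<Longrightarrow> R i j"
  shows "subalgebra G (supp_in R)"
  using supp_in_graded supp_in_sbracket[of _ R _ R R] assms by (fastforce simp: subalgebra_def)

text \<open>Induction on the number of non-zero entries: subtracting a multiple of
  \<open>F i j\<close> clears the entry at (i, j) and, by duality, its reflection, and changes no
  other entry.\<close>

lemma lie_alg_span:
  assumes "X \<in> supp_in R"
    and add: "\<And>X Y. X \<in> T \<Longrightarrow> Y \<in> T \<Longrightarrow> X + Y \<in> T" and smult: "\<And>a X. X \<in> T \<Longrightarrow> a \<cdot>\<^sub>m X \<in> T"
    and zero: "0\<^sub>m N N \<in> T"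
    and F: "\<And>i j. i < N \<Longrightarrow> j < N \<Longrightarrow> R i j \<Longrightarrow> F i j \<noteq> 0\<^sub>m N N \<Longrightarrow> F i j \<in> T"
  shows "X \<in> T"
  using assms(1)
proof (induction "card {(i, j). i < N \<and> j < N \<and> X $$ (i, j) \<noteq> 0}" arbitrary: X rule: less_induct)
  case less
  then have X: "X \<in> lie_alg G" by (simp add: supp_in_def)
  show ?case
  proof (cases "\<exists>i<N. \<exists>j<N. X $$ (i, j) \<noteq> 0")
    case False
    then have "X = 0\<^sub>m N N" using X by (intro eq_matI) auto
    then show ?thesis using zero by simp
  next
    case True
    then obtain i j where ij: "i < N" "j < N" "X $$ (i, j) \<noteq> 0" by blast
    have R: "R i j" using less.prems ij by (simp add: supp_in_def)
    have nz: "F i j $$ (i, j) \<noteq> 0"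
    proof (cases "os \<and> j = bar i")
      case True
      then have "t i (bar i) = 1" using lie_alg_dual[OF X, of i j] ij by simp
      then have "- eps i = 1" using t_bar True ij by simp
      then have "eps i = -1" by (metis minus_minus)
      then show ?thesis using F_nonzero_bar F_nonzero_iff True ij by auto
    qed (use ij F_nonzero F_nonzero_iff in auto)
    define c where "c = X $$ (i, j) / F i j $$ (i, j)"
    define X' where "X' = X + (- c) \<cdot>\<^sub>m F i j"
    have X'i: "X' $$ (a, b) = X $$ (a, b) - c * F i j $$ (a, b)" if "a < N" "b < N" for a b
      using that X by (simp add: X'_def)
    have X'l: "X' \<in> lie_alg G"
      using X F_lie_alg[OF ij(1,2)] lie_alg_graded unfolding X'_def graded_subspace_def by blast
    have z1: "X' $$ (i, j) = 0" using nz ij by (simp add: X'i c_def)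
    have z2: "X' $$ (bar j, bar i) = 0" if os
      using lie_alg_dual[OF X'l that ij(1,2)] z1 by simp
    have sub: "X $$ (a, b) \<noteq> 0" if "a < N" "b < N" "X' $$ (a, b) \<noteq> 0" for a b
      using that z1 z2 F_support[OF that(1,2), of i j] X'i[OF that(1,2)] by (auto simp: minus_equation_iff)
    have "{(a, b). a < N \<and> b < N \<and> X' $$ (a, b) \<noteq> 0} \<subset> {(a, b). a < N \<and> b < N \<and> X $$ (a, b) \<noteq> 0}"
      using sub z1 ij by blast
    moreover have "finite {(a, b). a < N \<and> b < N \<and> X $$ (a, b) \<noteq> 0}"
      by (rule finite_subset[of _ "{..<N} \<times> {..<N}"]) auto
    ultimately have "card {(a, b). a < N \<and> b < N \<and> X' $$ (a, b) \<noteq> 0} < card {(a, b). a < N \<and> b < N \<and> X $$ (a, b) \<noteq> 0}"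
      by (rule psubset_card_mono[rotated])
    moreover have "X' \<in> supp_in R" using sub X'l less.prems by (auto simp: supp_in_def)
    ultimately have "X' \<in> T" by (rule less.hyps)
    moreover have "F i j \<in> T" using F[OF ij(1,2) R] nz F_nonzero_iff ij by blast
    ultimately have "X' + c \<cdot>\<^sub>m F i j \<in> T" using add smult by blast
    moreover have "X' + c \<cdot>\<^sub>m F i j = X"
      by (rule eq_matI) (use X in \<open>auto simp: X'_def\<close>)
    ultimately show ?thesis by simp
  qed
qed

end

section \<open>Levi subalgebras and highest weights\<close>

locale levi_data = super_algebra +
  fixes P :: "complex vec set"
  assumes P_sub: "P \<subseteq> simple_roots G"
begin

text \<open>Black arrows on the basis of V: \<open>F k l\<close> is then a black raising vector, and
  it maps the basis vector with index l to a non-zero multiple of the one with index k.\<close>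

definition bs :: "nat \<Rightarrow> nat \<Rightarrow> bool" where
  "bs k l \<longleftrightarrow> k < N \<and> l < N \<and> wt k - wt l \<in> P"

lemma bs_edge:
  assumes "bs k l"
  obtains j where "j < n" "simple_root G j \<in> P" "k = fst (ed j)" "l = snd (ed j)" |
    j where os "j < n" "simple_root G j \<in> P" "k = bar (snd (ed j))" "l = bar (fst (ed j))"
proof -
  obtain j where j: "j < n" "simple_root G j \<in> P" "wt k - wt l = simple_root G j"
    using assms P_sub by (auto simp: bs_def simple_roots_def)
  then have "wt (fst (ed j)) - wt (snd (ed j)) = wt k - wt l" by (simp add: simple_root_eq)
  then show ?thesis
    using wt_diff_cases[of "fst (ed j)" "snd (ed j)" k l] ed_less[OF j(1)] assms j that
    by (auto simp: bs_def)
qed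

lemma bs_less: "bs k l \<Longrightarrow> k < N \<and> l < N"
  by (simp add: bs_def)

lemma bs_F: "bs k l \<Longrightarrow> k \<noteq> l \<and> F k l \<noteq> 0\<^sub>m N N"
proof (erule bs_edge)
  fix j assume "j < n" "k = fst (ed j)" "l = snd (ed j)"
  then show ?thesis using ed_less[of j] F_ed_nonzero[of j] by simp
next
  fix j assume j: os "j < n" "k = bar (snd (ed j))" "l = bar (fst (ed j))"
  have l: "fst (ed j) < N" "snd (ed j) < N" "fst (ed j) \<noteq> snd (ed j)" using ed_less[OF j(2)] by auto
  show ?thesis unfolding j(3,4) using F_nonzero_bars[OF j(1) l(1,2)] F_ed_nonzero[OF j(2)] bar_inject l by simp
qed

lemma bs_bar: "os \<Longrightarrow> bs k l \<Longrightarrow> bs (bar l) (bar k)"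
  unfolding bs_def using wt_bars by simp

lemma wt_minus_uminus: "- (wt i - wt j) = wt j - wt i"
  by (rule eq_vecI) auto

lemma levi_gen_sub: "(\<Union>\<alpha>\<in>P. root_space G \<alpha> \<union> root_space G (- \<alpha>)) \<subseteq> lie_alg G"
  by (auto simp: root_space_def)

lemma levi_F:
  assumes "bs k l"
  shows "F k l \<in> levi G P" "F l k \<in> levi G P"
proof -
  have kl: "k < N" "l < N" "wt k - wt l \<in> P" using assms by (simp_all add: bs_def)
  have "F k l \<in> root_space G (wt k - wt l)" "F l k \<in> root_space G (- (wt k - wt l))"
    unfolding wt_minus_uminus using kl F_root_space by simp_all
  note this kl(3)
  then show "F k l \<in> levi G P" "F l k \<in> levi G P"
    unfolding levi_def by (blast intro: subsetD[OF generated_subalgebra_props(2)[OF levi_gen_sub]])+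
qed

lemma simple_root_carrier: "\<alpha> \<in> simple_roots G \<Longrightarrow> \<alpha> \<in> carrier_vec rk"
  by (auto simp: simple_roots_def simple_root_eq)

lemma levi_least:
  assumes "subalgebra G S"
    and "\<And>k l. bs k l \<Longrightarrow> F k l \<in> S \<and> F l k \<in> S"
  shows "levi G P \<subseteq> S"
  unfolding levi_def
proof (rule generated_subalgebra_props(3)[OF levi_gen_sub assms(1)], rule subsetI)
  fix X assume "X \<in> (\<Union>\<alpha>\<in>P. root_space G \<alpha> \<union> root_space G (- \<alpha>))"
  then obtain \<alpha> where \<alpha>: "\<alpha> \<in> P" "X \<in> root_space G \<alpha> \<or> X \<in> root_space G (- \<alpha>)" by blast
  then obtain j where j: "j < n" "\<alpha> = simple_root G j" using P_sub by (auto simp: simple_roots_def)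
  define k l where "k = fst (ed j)" "l = snd (ed j)"
  then have kl: "\<alpha> = wt k - wt l" "k < N" "l < N" "k \<noteq> l" "F k l \<noteq> 0\<^sub>m N N"
    using simple_root_eq[OF j(1)] ed_less[OF j(1)] F_ed_nonzero[OF j(1)] j by auto
  then have "bs k l" using \<alpha> by (simp add: bs_def)
  note S = assms(2)[OF this]
  have sm: "a \<cdot>\<^sub>m Y \<in> S" if "Y \<in> S" for a Y
    using assms(1) that unfolding subalgebra_def graded_subspace_def by blast
  from \<alpha>(2) show "X \<in> S"
  proof
    assume "X \<in> root_space G \<alpha>"
    then have "X = (X $$ (k, l) / F k l $$ (k, l)) \<cdot>\<^sub>m F k l"
      unfolding kl(1) by (rule root_space_unique(1)[OF kl(2-4) _ kl(5)])
    then show ?thesis using sm S by metis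
  next
    assume "X \<in> root_space G (- \<alpha>)"
    then have "X = (X $$ (l, k) / F l k $$ (l, k)) \<cdot>\<^sub>m F l k"
      unfolding kl(1) wt_minus_uminus
      by (rule root_space_unique(1)[OF kl(3,2) kl(4)[symmetric] _ F_nonzero_swap[OF kl(2,3,5)]])
    then show ?thesis using sm S by metis
  qed
qed

lemma levi_lie: "levi G P \<subseteq> lie_alg G"
  unfolding levi_def by (rule generated_subalgebra_props(3)[OF levi_gen_sub lie_alg_subalgebra levi_gen_sub])

text \<open>One application of a black raising vector to the root vector \<open>F i j\<close>,
  moving the first index by multiplication from the left or the second one from the right. The
  non-vanishing conditions make sure that the bracket is not zero.\<close>

definition step :: "nat \<times> nat \<Rightarrow> nat \<times> nat \<Rightarrow> bool" where
  "step p q \<longleftrightarrow> (case (p, q) of ((i, j), (k, l)) \<Rightarrow> i < N \<and> j < N \<and> i \<noteq> j \<and> k \<noteq> l \<and>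
     F i j \<noteq> 0\<^sub>m N N \<and> F k l \<noteq> 0\<^sub>m N N \<and> (bs k i \<and> l = j \<or> bs j l \<and> k = i))"

text \<open>The second part runs a step backwards on the opposite root vectors: the same black
  raising vector leads from the lower root vector of the target to that of the source. It is needed
  to come from \<open>f\<close> at the highest weight back to the negative simple root.\<close>

lemma step_sbracket:
  assumes "step (i, j) (k, l)"
  shows "\<exists>Z\<in>levi G P. \<exists>a. a \<noteq> 0 \<and> sbracket G Z (F i j) = a \<cdot>\<^sub>m F k l"
    and "\<exists>k' l'. bs k' l' \<and> (\<exists>a. a \<noteq> 0 \<and> sbracket G (F k' l') (F l k) = a \<cdot>\<^sub>m F j i)"
proof -
  have s: "i < N" "j < N" "i \<noteq> j" "k \<noteq> l" "F i j \<noteq> 0\<^sub>m N N" "F k l \<noteq> 0\<^sub>m N N"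
    and d: "bs k i \<and> l = j \<or> bs j l \<and> k = i" using assms by (auto simp: step_def)
  have "k < N \<and> l < N" using d bs_less s(1,2) by metis
  then have s': "F j i \<noteq> 0\<^sub>m N N" "k < N" "l < N" using F_nonzero_swap[OF s(1,2,5)] by blast+
  have s'': "F l k \<noteq> 0\<^sub>m N N" by (rule F_nonzero_swap[OF s'(2,3) s(6)])
  show "\<exists>Z\<in>levi G P. \<exists>a. a \<noteq> 0 \<and> sbracket G Z (F i j) = a \<cdot>\<^sub>m F k l"
    using d
  proof
    assume "bs k i \<and> l = j"
    then show ?thesis using sbracket_F[of k i j] s s' bs_F levi_F by (metis (no_types))
  next
    assume "bs j l \<and> k = i"
    then show ?thesis using sbracket_F'[of i j l] s s' bs_F levi_F by (metis (no_types))
  qed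
  show "\<exists>k' l'. bs k' l' \<and> (\<exists>a. a \<noteq> 0 \<and> sbracket G (F k' l') (F l k) = a \<cdot>\<^sub>m F j i)"
    using d
  proof
    assume "bs k i \<and> l = j"
    then show ?thesis using sbracket_F'[of j k i] s s' s'' bs_F by (metis (no_types))
  next
    assume "bs j l \<and> k = i"
    then show ?thesis using sbracket_F[of j l i] s s' s'' bs_F by (metis (no_types))
  qed
qed

lemma mat_inverse_smult: "a \<noteq> 0 \<Longrightarrow> (inverse a) \<cdot>\<^sub>m (a \<cdot>\<^sub>m X) = (X :: complex mat)"
  by (rule eq_matI) auto

lemma V_plus_steps:
  assumes "step\<^sup>*\<^sup>* (k, l) (a, b)" "k < N" "l < N" "\<beta> = wt k - wt l"
  shows "F a b \<in> V_plus G P \<beta>"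
  unfolding V_plus_def
proof (rule InterI, clarify)
  fix M assume M: "ad_submodule G (levi G P) M" "root_space G \<beta> \<subseteq> M"
  have "case q of (i, j) \<Rightarrow> F i j \<in> M" if "step\<^sup>*\<^sup>* (k, l) q" for q
    using that
  proof (induction rule: rtranclp_induct)
    case base
    then show ?case using M(2) F_root_space[OF assms(2,3)] assms(4) by auto
  next
    case (step p q)
    obtain i j x y where pq: "p = (i, j)" "q = (x, y)" by fastforce
    obtain Z c where Z: "Z \<in> levi G P" "c \<noteq> 0" "sbracket G Z (F i j) = c \<cdot>\<^sub>m F x y"
      using step_sbracket(1) step(2) unfolding pq by blast
    have "c \<cdot>\<^sub>m F x y \<in> M" using M(1) Z step(3) unfolding ad_submodule_def pq by (metis case_prod_conv)
    then have "inverse c \<cdot>\<^sub>m (c \<cdot>\<^sub>m F x y) \<in> M" using M(1) unfolding ad_submodule_def graded_subspace_def by blast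
    then show ?case using mat_inverse_smult[OF Z(2)] pq by simp
  qed
  from this[OF assms(1)] show "F a b \<in> M" by simp
qed

lemma finite_P: "finite P"
  using P_sub by (rule finite_subset) (simp add: simple_roots_def)

lemma nonneg_comb_P: "\<alpha> \<in> P \<Longrightarrow> \<alpha> \<in> nonneg_comb G P"
  using finite_P P_sub simple_root_carrier unfolding nonneg_comb_def
  by (auto intro!: exI[of _ "\<lambda>\<beta>. of_bool (\<beta> = \<alpha>)"] simp: sum.remove[of P \<alpha>])

lemma nonneg_comb_add:
  assumes "x \<in> nonneg_comb G P" "y \<in> nonneg_comb G P"
  shows "x + y \<in> nonneg_comb G P"
proof -
  obtain k l :: "complex vec \<Rightarrow> nat" where
    kl: "\<forall>i<rk. x $ i = (\<Sum>\<alpha>\<in>P. of_nat (k \<alpha>) * \<alpha> $ i)" "\<forall>i<rk. y $ i = (\<Sum>\<alpha>\<in>P. of_nat (l \<alpha>) * \<alpha> $ i)"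
    using assms by (auto simp: nonneg_comb_def)
  have c: "x \<in> carrier_vec rk" "y \<in> carrier_vec rk" using assms by (auto simp: nonneg_comb_def)
  have "\<forall>i<rk. (x + y) $ i = (\<Sum>\<alpha>\<in>P. of_nat (k \<alpha> + l \<alpha>) * \<alpha> $ i)"
  proof (intro allI impI)
    fix i assume i: "i < rk"
    have "(x + y) $ i = x $ i + y $ i" using c i by simp
    then show "(x + y) $ i = (\<Sum>\<alpha>\<in>P. of_nat (k \<alpha> + l \<alpha>) * \<alpha> $ i)"
      using kl i by (simp only: of_nat_add distrib_right sum.distrib)
  qed
  moreover have "x + y \<in> carrier_vec rk" using c by simp
  ultimately show ?thesis unfolding nonneg_comb_def
    by (intro CollectI conjI exI[of _ "\<lambda>\<alpha>. k \<alpha> + l \<alpha>"])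
qed

lemma nonneg_comb_zero: "0\<^sub>v rk \<in> nonneg_comb G P"
  by (auto simp: nonneg_comb_def intro!: exI[of _ "\<lambda>_. 0"])

lemma nonneg_comb_path: "bs\<^sup>*\<^sup>* x y \<Longrightarrow> wt x - wt y \<in> nonneg_comb G P"
proof (induction rule: rtranclp_induct)
  case base
  have "wt x - wt x = 0\<^sub>v rk" by (rule eq_vecI) auto
  then show ?case by (simp only: nonneg_comb_zero)
next
  case (step y z)
  then show ?case using nonneg_comb_add[OF step(3) nonneg_comb_P] wt_diff_add by (metis bs_def)
qed

text \<open>A linear functional with positive integer values on all simple roots: 1 along the chain,
  and 1, 2 or 3 at the end node of shape B, C or D. It makes the order defined by
  \<open>nonneg_comb\<close> antisymmetric, hence highest weights unique.\<close>

definition vht :: "complex vec \<Rightarrow> complex" where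
  "vht v = (\<Sum>i<rk. of_nat (rk - i) * v $ i)"

lemma vht_simple_root:
  assumes "\<alpha> \<in> simple_roots G"
  obtains m :: nat where "m > 0" "vht \<alpha> = of_nat m"
proof -
  have z: "vht (zeta G i) = of_nat (rk - i)" if "i < rk" for i
    unfolding vht_def zeta_def using that by (subst sum_left_unit[where c = i]) auto
  have add: "vht (x + y) = vht x + vht y" "vht (x - y) = vht x - vht y" "vht (2 \<cdot>\<^sub>v x) = 2 * vht x"
    if "x \<in> carrier_vec rk" "y \<in> carrier_vec rk" for x y
    using that unfolding vht_def
    by (simp_all add: distrib_left right_diff_distrib sum.distrib sum_subtractf sum_distrib_left mult.left_commute)
  have zc: "zeta G i \<in> carrier_vec rk" for i by (simp add: zeta_def)
  obtain j where j: "j < n" "\<alpha> = simple_root G j" using assms by (auto simp: simple_roots_def)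
  show ?thesis
  proof (cases "j + 1 < rk")
    case True
    then have "\<alpha> = zeta G j - zeta G (j + 1)" using j by (simp add: simple_root_def)
    then have "vht \<alpha> = vht (zeta G j) - vht (zeta G (j + 1))" using add(2)[OF zc zc] by simp
    also have "\<dots> = of_nat (rk - j) - of_nat (rk - (j + 1))" using z True by (metis add_lessD1)
    also have "rk - j = Suc (rk - (j + 1))" using True by linarith
    finally have "vht \<alpha> = of_nat 1" by simp
    then show ?thesis using that[of 1] by simp
  next
    case False
    then have os: os using j hdim_A nodes_A by (cases os) auto
    then have r: "rk = n" "rk = j + 1" using False j hdim_os by auto
    have "j < rk" "rk - j = 1" using r(2) by simp_all
    then have zj1: "vht (zeta G j) = of_nat 1" using z by metis
    have "j - 1 < rk" "j > 0 \<Longrightarrow> rk - (j - 1) = 2" using r(2) by linarith+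
    then have zj2: "j > 0 \<Longrightarrow> vht (zeta G (j - 1)) = of_nat 2" using z by metis
    note zj = zj1 zj2
    consider "shape G = ShapeB" | "shape G = ShapeC" | "shape G = ShapeD" "n \<ge> 2" using os_shape os shape_D_n by blast
    then show ?thesis
    proof cases
      case 1
      then have "vht \<alpha> = of_nat 1" using j False zj by (simp add: simple_root_def)
      then show ?thesis using that[of 1] by simp
    next
      case 2
      then have "vht \<alpha> = of_nat 2" using j False zj add(3)[OF zc zc] by (simp add: simple_root_def)
      then show ?thesis using that[of 2] by simp
    next
      case 3
      then have "vht \<alpha> = of_nat 3" using j False zj add(1)[OF zc zc] r by (simp add: simple_root_def)
      then show ?thesis using that[of 3] by simp
    qed
  qed
qed

lemma nonneg_comb_antisym:
  assumes "x - y \<in> nonneg_comb G P" "y - x \<in> nonneg_comb G P" "x \<in> carrier_vec rk" "y \<in> carrier_vec rk"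
  shows "x = y"
proof -
  obtain k l :: "complex vec \<Rightarrow> nat" where
    k: "\<forall>i<rk. (x - y) $ i = (\<Sum>\<alpha>\<in>P. of_nat (k \<alpha>) * \<alpha> $ i)" and
    l: "\<forall>i<rk. (y - x) $ i = (\<Sum>\<alpha>\<in>P. of_nat (l \<alpha>) * \<alpha> $ i)"
    using assms by (auto simp: nonneg_comb_def)
  have "\<forall>\<alpha>\<in>P. \<exists>m::nat. m > 0 \<and> vht \<alpha> = of_nat m" using vht_simple_root P_sub by (metis subsetD)
  then obtain h :: "complex vec \<Rightarrow> nat" where h: "\<And>\<alpha>. \<alpha> \<in> P \<Longrightarrow> h \<alpha> > 0 \<and> vht \<alpha> = of_nat (h \<alpha>)" by metis
  have "0 = (\<Sum>i<rk. of_nat (rk - i) * ((x - y) $ i + (y - x) $ i))"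
    using assms by simp
  also have "\<dots> = (\<Sum>i<rk. \<Sum>\<alpha>\<in>P. of_nat (k \<alpha> + l \<alpha>) * (of_nat (rk - i) * \<alpha> $ i))"
  proof (rule sum.cong)
    fix i assume "i \<in> {..<rk}"
    then have "(x - y) $ i + (y - x) $ i = (\<Sum>\<alpha>\<in>P. of_nat (k \<alpha> + l \<alpha>) * \<alpha> $ i)"
      using k l by (simp only: lessThan_iff of_nat_add distrib_right sum.distrib)
    then show "of_nat (rk - i) * ((x - y) $ i + (y - x) $ i) =
        (\<Sum>\<alpha>\<in>P. of_nat (k \<alpha> + l \<alpha>) * (of_nat (rk - i) * \<alpha> $ i))"
      by (simp only: sum_distrib_left mult.left_commute)
  qed simp
  also have "\<dots> = (\<Sum>\<alpha>\<in>P. of_nat (k \<alpha> + l \<alpha>) * vht \<alpha>)"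
    unfolding vht_def by (subst sum.swap) (simp add: sum_distrib_left)
  also have "\<dots> = of_nat (\<Sum>\<alpha>\<in>P. (k \<alpha> + l \<alpha>) * h \<alpha>)" using h by simp
  finally have "(\<Sum>\<alpha>\<in>P. (k \<alpha> + l \<alpha>) * h \<alpha>) = 0" by (metis of_nat_eq_0_iff)
  then have "\<forall>\<alpha>\<in>P. (k \<alpha> + l \<alpha>) * h \<alpha> = 0" using finite_P by (simp only: sum_eq_0_iff)
  then have "\<forall>\<alpha>\<in>P. k \<alpha> = 0" using h by (metis add_is_0 mult_is_0 less_irrefl)
  then have z: "\<forall>i<rk. (x - y) $ i = 0" using k by simp
  show ?thesis
  proof (rule eq_vecI)
    fix i assume "i < dim_vec y"
    then show "x $ i = y $ i" using z assms(3,4) by auto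
  qed (use assms in auto)
qed

text \<open>C and D are unions of components of the black arrows. Matrices that respect these
  components form a subalgebra containing the Levi subalgebra, and those supported in C x D and its
  reflection form a module over it, so every weight of \<open>V_plus\<close> is a difference over C
  x D. The path shows that the weight at (a, b) is attained, and \<open>bound\<close> that it
  dominates.\<close>

lemma highest_weight_V_plus:
  assumes kl: "k < N" "l < N" "\<beta> = wt k - wt l" "k \<in> C" "l \<in> D"
    and cl: "\<And>x y. bs x y \<Longrightarrow> (x \<in> C \<longleftrightarrow> y \<in> C) \<and> (x \<in> D \<longleftrightarrow> y \<in> D)"
    and disj: "C \<inter> D = {}"
    and path: "step\<^sup>*\<^sup>* (k, l) (a, b)"
    and ab: "a < N" "b < N" "F a b \<noteq> 0\<^sub>m N N"
    and bound: "\<And>x y. x < N \<Longrightarrow> y < N \<Longrightarrow> x \<in> C \<Longrightarrow> y \<in> D \<Longrightarrow> F x y \<noteq> 0\<^sub>m N N \<Longrightarrow>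
      (wt a - wt b) - (wt x - wt y) \<in> nonneg_comb G P"
  shows "highest_weight G P (V_plus G P \<beta>) = wt a - wt b"
proof -
  define R where "R i j \<longleftrightarrow> (i \<in> C \<longleftrightarrow> j \<in> C) \<and> (i \<in> D \<longleftrightarrow> j \<in> D) \<and>
     (os \<longrightarrow> (bar i \<in> C \<longleftrightarrow> bar j \<in> C) \<and> (bar i \<in> D \<longleftrightarrow> bar j \<in> D))" for i j
  define S where "S i j \<longleftrightarrow> (i \<in> C \<and> j \<in> D) \<or> (os \<and> bar j \<in> C \<and> bar i \<in> D)" for i j
  have R: "R k l" "R l k" if "bs k l" for k l
    using cl[OF that] cl[OF bs_bar[OF _ that]] by (auto simp: R_def)
  have Rsub: "subalgebra G (supp_in R)" by (rule supp_in_subalgebra) (auto simp: R_def)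
  have RF: "F k l \<in> supp_in R \<and> F l k \<in> supp_in R" if "bs k l" for k l
  proof -
    have b: "R (bar l) (bar k)" "R (bar k) (bar l)" if os using R[OF bs_bar[OF that \<open>bs k l\<close>]] .
    show ?thesis
      using F_support[of _ _ k l] F_support[of _ _ l k] R[OF that] b bs_less[OF that]
      unfolding supp_in_def by auto
  qed
  have L: "levi G P \<subseteq> supp_in R" by (rule levi_least[OF Rsub RF])
  have M: "ad_submodule G (levi G P) (supp_in S)"
    unfolding ad_submodule_def using supp_in_graded
    by (auto intro!: supp_in_sbracket[of _ R _ S S] dest!: subsetD[OF L]) (auto simp: R_def S_def)
  have \<beta>S: "root_space G \<beta> \<subseteq> supp_in S"
  proof
    fix X assume X: "X \<in> root_space G \<beta>"
    have kl': "k \<noteq> l" using disj kl by blast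
    have "S i j" if ij: "i < N" "j < N" "X $$ (i, j) \<noteq> 0" for i j
    proof -
      have "wt k - wt l = wt i - wt j" using X ij kl(3) by (simp add: root_space_iff)
      from wt_diff_cases[OF kl(1,2) ij(1,2) kl' this] show ?thesis using kl by (auto simp: S_def)
    qed
    then show "X \<in> supp_in S" using X by (simp add: supp_in_def root_space_lie_alg)
  qed
  have w: "wt a - wt b \<in> weights G (V_plus G P \<beta>)"
    using V_plus_steps[OF path kl(1-3)] ab F_root_space by (auto simp: weights_def)
  have up: "(wt a - wt b) - \<mu> \<in> nonneg_comb G P" if \<mu>: "\<mu> \<in> weights G (V_plus G P \<beta>)" for \<mu>
  proof -
    obtain X where X: "X \<in> V_plus G P \<beta>" "X \<in> root_space G \<mu>" "X \<noteq> 0\<^sub>m N N" and c: "\<mu> \<in> carrier_vec rk"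
      using \<mu> by (auto simp: weights_def)
    have XS: "X \<in> supp_in S" using X(1) M \<beta>S by (auto simp: V_plus_def)
    then have Xl: "X \<in> lie_alg G" by (simp add: supp_in_def)
    obtain i j where ij: "i < N" "j < N" "X $$ (i, j) \<noteq> 0"
    proof (rule ccontr)
      assume "\<not> thesis"
      then have "X = 0\<^sub>m N N" using that Xl by (intro eq_matI) auto
      then show False using X by simp
    qed
    then have \<mu>e: "\<mu> = wt i - wt j" using X(2) root_space_iff[OF c] by blast
    have "S i j" using XS ij by (simp add: supp_in_def)
    have ne: "i \<noteq> j" using \<open>S i j\<close> disj by (auto simp: S_def)
    have Fnz: "F i j \<noteq> 0\<^sub>m N N" using root_space_unique(2)[OF ij(1,2) ne] X(2,3) \<mu>e by simp
    from \<open>S i j\<close> show ?thesis unfolding S_def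
    proof
      assume "i \<in> C \<and> j \<in> D"
      then show ?thesis using bound[OF ij(1,2) _ _ Fnz] \<mu>e by simp
    next
      assume a: "os \<and> bar j \<in> C \<and> bar i \<in> D"
      then have "F (bar j) (bar i) \<noteq> 0\<^sub>m N N" using F_nonzero_bars[of i j] ij Fnz by simp
      then show ?thesis using bound[of "bar j" "bar i"] a ij \<mu>e wt_bars by simp
    qed
  qed
  show ?thesis
    unfolding highest_weight_def
  proof (rule the_equality)
    show "wt a - wt b \<in> weights G (V_plus G P \<beta>) \<and>
        (\<forall>\<mu>\<in>weights G (V_plus G P \<beta>). wt a - wt b - \<mu> \<in> nonneg_comb G P)"
      using w up by blast
  next
    fix \<xi> assume \<xi>: "\<xi> \<in> weights G (V_plus G P \<beta>) \<and>
        (\<forall>\<mu>\<in>weights G (V_plus G P \<beta>). \<xi> - \<mu> \<in> nonneg_comb G P)"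
    then show "\<xi> = wt a - wt b"
      using nonneg_comb_antisym[of \<xi> "wt a - wt b"] w up by (auto simp: weights_def)
  qed
qed

end

lemma mat_cancel_middle:
  assumes "X \<in> carrier_mat r c" "Y \<in> carrier_mat r c" "Z \<in> carrier_mat r c"
  shows "((X + Y) + (-1 :: complex) \<cdot>\<^sub>m Y) + Z = X + Z" "(X + Y) + (-1 :: complex) \<cdot>\<^sub>m Y = X"
    "(Y + X) + (-1 :: complex) \<cdot>\<^sub>m Y = X"
  by (rule eq_matI; use assms in auto)+

section \<open>Heights and the factorisation of negative root vectors\<close>

context super_algebra
begin

text \<open>In shape D the indices \<open>n - 1\<close> and n lie on the same level, because no
  simple root joins them. The shift by one gives every simple root, including the last one, height
  1.\<close>

definition ht :: "nat \<Rightarrow> int" where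
  "ht i = (if shape G = ShapeD \<and> n \<le> i then 1 - int i else - int i)"

definition nn :: "int \<Rightarrow> complex mat set" where
  "nn h = supp_in (\<lambda>i j. h \<le> ht i - ht j)"

lemma ht_bar:
  assumes os "i < N" "j < N"
  shows "ht (bar j) - ht (bar i) = ht i - ht j"
proof (cases "shape G = ShapeD")
  case True
  then have "N = 2 * n" "n \<ge> 2" using shape_CD_N shape_D_n by auto
  then show ?thesis using assms by (auto simp: ht_def bar_def True)
next
  case False
  then show ?thesis using assms by (auto simp: ht_def bar_def)
qed

lemma F_nn: "i < N \<Longrightarrow> j < N \<Longrightarrow> h \<le> ht i - ht j \<Longrightarrow> F i j \<in> nn h"
proof -
  assume a: "i < N" "j < N" "h \<le> ht i - ht j"
  have "h \<le> ht x - ht y" if "x < N" "y < N" "F i j $$ (x, y) \<noteq> 0" for x y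
    using F_support[OF that] ht_bar[OF _ a(1,2)] a(3) by (elim disjE conjE) simp_all
  then show ?thesis using a by (simp add: nn_def supp_in_def)
qed

lemma nn_mono: "h \<le> h' \<Longrightarrow> nn h' \<subseteq> nn h"
  by (force simp: nn_def supp_in_def)

lemma nn_sbracket: "X \<in> nn a \<Longrightarrow> Y \<in> nn b \<Longrightarrow> sbracket G X Y \<in> nn (a + b)"
  unfolding nn_def by (rule supp_in_sbracket[of _ "\<lambda>i j. a \<le> ht i - ht j" _ "\<lambda>i j. b \<le> ht i - ht j"]) auto

lemma nn_lie: "X \<in> nn h \<Longrightarrow> X \<in> lie_alg G"
  by (simp add: nn_def supp_in_def)

lemma nn_add: "X \<in> nn h \<Longrightarrow> Y \<in> nn h \<Longrightarrow> X + Y \<in> nn h"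
  and nn_smult: "X \<in> nn h \<Longrightarrow> a \<cdot>\<^sub>m X \<in> nn h"
  and nn_zero: "0\<^sub>m N N \<in> nn h"
  using supp_in_graded unfolding nn_def graded_subspace_def by blast+

text \<open>In shape D the entry at (n, \<open>n - 1\<close>) is the only one below the diagonal
  whose height is not negative. It vanishes because it lies on the antidiagonal and
  \<open>eps\<close> is 1 there.\<close>

lemma nn_borel: "nn 0 \<subseteq> borel G"
proof
  fix X assume X: "X \<in> nn 0"
  then have Xl: "X \<in> lie_alg G" by (rule nn_lie)
  define H where "H = mat N N (\<lambda>(i, j). if i = j then X $$ (i, j) else 0)"
  define U where "U = mat N N (\<lambda>(i, j). if i = j then 0 else X $$ (i, j))"
  have HX: "X = H + U" by (rule eq_matI) (use Xl in \<open>auto simp: H_def U_def\<close>)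
  have Hl: "H \<in> lie_alg G" "U \<in> lie_alg G"
    using Xl by (auto simp: lie_alg_iff H_def U_def bar_inject)
  then have "H \<in> cartan G" by (auto simp: cartan_def diagonal_mat_def H_def)
  moreover have "U $$ (i, j) = 0" if ij: "i < N" "j \<le> i" for i j
  proof (rule ccontr)
    assume "U $$ (i, j) \<noteq> 0"
    then have ne: "i \<noteq> j" "X $$ (i, j) \<noteq> 0" using ij by (auto simp: U_def split: if_splits)
    then have "ht i \<ge> ht j" using X ij by (simp add: nn_def supp_in_def)
    then have D: "shape G = ShapeD" "i = n" "j = n - 1" using ij ne(1) by (auto simp: ht_def split: if_splits)
    then have N: "N = 2 * n" "n \<ge> 2" using shape_CD_N shape_D_n by auto
    then have b: "bar (n - 1) = n" "bar n = n - 1" "n < N" "n - 1 < N" by (auto simp: bar_def)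
    have "eps n = 1" using eps_props(5) eps_props(6)[of "n - 1"] D b by simp
    then have "t n (n - 1) = -1" using t_bar[of n] b D by simp
    then show False using lie_alg_dual[OF Xl, of n "n - 1"] D b ne by simp
  qed
  ultimately show "X \<in> borel G" using Hl(2) HX by (auto simp: borel_def pos_part_def)
qed

lemma borel_lie: "borel G \<subseteq> lie_alg G"
  using lie_alg_graded by (auto simp: borel_def cartan_def pos_part_def graded_subspace_def)

text \<open>Peels a simple root off a negative root: going from i to m raises the height by one and
  is realised by a simple root or by its reflected copy. Of the two index pairs of a root,
  \<open>i + j < N\<close> selects the one with \<open>j \<le> bar i\<close>; then
  \<open>j = bar m\<close> is impossible for \<open>m < i\<close>, so that \<open>F m j\<close>
  cannot vanish.\<close>

lemma lower_root_factor:
  assumes ij: "j < i" "i < N" and os: "os \<longrightarrow> i + j < N" and nz: "F i j \<noteq> 0\<^sub>m N N"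
  shows "(\<exists>k<n. i = snd (ed k) \<and> j = fst (ed k)) \<or>
    (\<exists>k<n. \<exists>m. i = snd (ed k) \<and> m = fst (ed k) \<and> ht m = ht i + 1 \<and> ht m < ht j \<and> m \<noteq> j \<and> F m j \<noteq> 0\<^sub>m N N) \<or>
    (\<exists>k<n. \<exists>m<N. os \<and> i = bar (fst (ed k)) \<and> m = bar (snd (ed k)) \<and> ht m = ht i + 1 \<and> ht m < ht j \<and> m \<noteq> j \<and> F m j \<noteq> 0\<^sub>m N N)"
proof (cases os)
  case False
  then have n: "n = N - 1" by (rule nodes_A)
  have A: "shape G = ShapeA" using False by simp
  show ?thesis
  proof (cases "j = i - 1")
    case True
    then show ?thesis using ij n A by (intro disjI1 exI[of _ j]) (auto simp: ed_def)
  next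
    case False
    then show ?thesis using ij n A F_nonzero[of "i - 1" j]
      by (intro disjI2 disjI1 exI[of _ "i - 1"]) (auto simp: ed_def ht_def)
  qed
next
  case True
  note osT = True
  have s: "i + j < N" using assms(3) True by simp
  have jb: "j \<noteq> bar m" if "m < i" for m using that s ij by (auto simp: bar_def)
  have Fm: "F m j \<noteq> 0\<^sub>m N N" if "m < i" for m using F_nonzero[of m j] jb[OF that] ij that by simp
  consider (D) "shape G = ShapeD" "n \<le> i" | (le) "i < n \<or> (i = n \<and> shape G \<noteq> ShapeD)" | (gt) "i > n" "shape G \<noteq> ShapeD" by linarith
  then show ?thesis
  proof cases
    case D
    have N: "N = 2 * n" "n \<ge> 2" using D shape_CD_N shape_D_n by auto
    have "i \<noteq> n \<or> j \<noteq> n - 1"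
    proof (rule ccontr)
      assume "\<not> ?thesis"
      then have e: "i = n" "j = n - 1" by auto
      have "n < N" "bar n = n - 1" "bar (n - 1) = n" using N by (auto simp: bar_def)
      moreover have "eps n = 1" using eps_props(5) eps_props(6)[of "n - 1"] D calculation by auto
      ultimately show False using nz F_nonzero_bar[OF True, of n] e by auto
    qed
    consider "i = n" "j = n - 2" | "i = n" "j < n - 2" | "i = n + 1" | "i > n + 1"
      using D s N ij \<open>i \<noteq> n \<or> j \<noteq> n - 1\<close> by linarith
    then show ?thesis
    proof cases
      case 1
      then show ?thesis using D N by (intro disjI1 exI[of _ "n - 1"]) (auto simp: ed_def)
    next
      case 2
      then show ?thesis using D N Fm[of "n - 2"]
        by (intro disjI2 disjI1 exI[of _ "n - 1"]) (auto simp: ed_def ht_def)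
    next
      case 3
      have b: "bar (n - 2) = n + 1" "bar (n - 1) = n" using N by (auto simp: bar_def)
      have "ed (n - 2) = (n - 2, n - 1)" using N by (auto simp: ed_def)
      then show ?thesis using 3 D N Fm[of n] s b
        by (intro disjI2 exI[of _ "n - 2"] conjI exI[of _ n]) (auto simp: ht_def True)
    next
      case 4
      define k where "k = bar i"
      have k: "k < n - 1" "bar k = i" "bar (k + 1) = i - 1" using 4 N ij by (auto simp: k_def bar_def)
      then have "ed k = (k, k + 1)" by (auto simp: ed_def)
      then show ?thesis using 4 D N Fm[of "i - 1"] s k ij
        by (intro disjI2 exI[of _ k] conjI exI[of _ "i - 1"]) (auto simp: ht_def True)
    qed
  next
    case le
    then have e: "ed (i - 1) = (i - 1, i)" "i - 1 < n" using ij by (auto simp: ed_def)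
    show ?thesis
    proof (cases "j = i - 1")
      case True
      then show ?thesis using e by (intro disjI1 exI[of _ "i - 1"]) auto
    next
      case False
      then have "j < i - 1" "i - 1 < i" using ij by auto
      moreover have "ht (i - 1) = ht i + 1" "ht (i - 1) < ht j"
        using le ij \<open>j < i - 1\<close> by (auto simp: ht_def)
      ultimately show ?thesis using e Fm[of "i - 1"]
        by (intro disjI2 disjI1 exI[of _ "i - 1"]) simp
    qed
  next
    case gt
    define k where "k = bar i"
    have nN: "N = 2 * n \<or> N = 2 * n + 1" using nodes_os[OF True] by linarith
    then have k: "k < n" "bar k = i" "bar (k + 1) = i - 1" using gt ij by (auto simp: k_def bar_def)
    then have "ed k = (k, k + 1)" using gt by (auto simp: ed_def)
    moreover have j: "j < i - 1" "i - 1 < i" "i - 1 < N" using s gt nN ij by auto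
    moreover have "ht (i - 1) = ht i + 1" "ht (i - 1) < ht j" using gt j by (auto simp: ht_def)
    ultimately show ?thesis using Fm[of "i - 1"] k True
      by (intro disjI2 exI[of _ k] conjI exI[of _ "i - 1"]) simp_all
  qed
qed

end

section \<open>Sphericity\<close>

context levi_data
begin

lemma lie_alg_eq_K_plus_borel:
  assumes K: "subalgebra G K" "levi G P \<subseteq> K"
    and white: "\<And>k. k < n \<Longrightarrow> simple_root G k \<notin> P \<Longrightarrow> \<exists>U\<in>nn 0. F (snd (ed k)) (fst (ed k)) + U \<in> K"
  shows "spherical G K"
proof -
  have Kl: "K \<subseteq> lie_alg G" and Kadd: "\<And>X Y. X \<in> K \<Longrightarrow> Y \<in> K \<Longrightarrow> X + Y \<in> K"
    and Ksm: "\<And>X a. X \<in> K \<Longrightarrow> a \<cdot>\<^sub>m X \<in> K" and K0: "0\<^sub>m N N \<in> K"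
    and Kbr: "\<And>X Y. X \<in> K \<Longrightarrow> Y \<in> K \<Longrightarrow> sbracket G X Y \<in> K"
    using K(1) unfolding subalgebra_def graded_subspace_def by blast+
  define T where "T = {X + Y |X Y. X \<in> K \<and> Y \<in> nn 0}"
  have c: "X \<in> carrier_mat N N" if "X \<in> K \<or> X \<in> nn h" for X h using that Kl nn_lie lie_alg_carrier by blast
  have TI: "X + Y \<in> T" if "X \<in> K" "Y \<in> nn 0" for X Y using that by (auto simp: T_def)
  have KT: "X \<in> T" if "X \<in> K" for X using TI[OF that nn_zero] c that by (metis right_add_zero_mat)
  have nT: "X \<in> T" if "X \<in> nn 0" for X using TI[OF K0 that] c that by (metis left_add_zero_mat)
  have Tadd: "X + Y \<in> T" if "X \<in> T" "Y \<in> T" for X Y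
  proof -
    obtain A B A' B' where e: "X = A + B" "Y = A' + B'" and AB: "A \<in> K" "A' \<in> K" "B \<in> nn 0" "B' \<in> nn 0"
      using \<open>X \<in> T\<close> \<open>Y \<in> T\<close> by (auto simp: T_def)
    have "X + Y = (A + A') + (B + B')"
      unfolding e using AB Kl nn_lie by (intro eq_matI) (auto dest!: subsetD[OF Kl])
    then show ?thesis using TI Kadd nn_add AB by simp
  qed
  have Tsm: "a \<cdot>\<^sub>m X \<in> T" if "X \<in> T" for X a
  proof -
    obtain A B where e: "X = A + B" and AB: "A \<in> K" "B \<in> nn 0" using \<open>X \<in> T\<close> by (auto simp: T_def)
    have "a \<cdot>\<^sub>m X = a \<cdot>\<^sub>m A + a \<cdot>\<^sub>m B"
      unfolding e using AB c by (metis add_smult_distrib_left_mat)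
    then show ?thesis using TI Ksm nn_smult AB by simp
  qed
  have T0: "0\<^sub>m N N \<in> T" using nT nn_zero by blast
  have simple: "\<exists>U\<in>nn 0. F (snd (ed k)) (fst (ed k)) + U \<in> K" if "k < n" for k
  proof (cases "simple_root G k \<in> P")
    case True
    then have "bs (fst (ed k)) (snd (ed k))"
      using simple_root_eq[OF that] ed_less[OF that] by (simp add: bs_def)
    then have "F (snd (ed k)) (fst (ed k)) \<in> K" using levi_F K(2) by blast
    then show ?thesis using nn_zero by (intro bexI[of _ "0\<^sub>m N N"]) simp_all
  qed (use white that in blast)
  have simple': "\<exists>U\<in>nn 0. F (bar (fst (ed k))) (bar (snd (ed k))) + U \<in> K" if "k < n" os for k
  proof -
    obtain U where U: "U \<in> nn 0" "F (snd (ed k)) (fst (ed k)) + U \<in> K" using simple \<open>k < n\<close> by blast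
    have l: "fst (ed k) < N" "snd (ed k) < N" using ed_less[OF \<open>k < n\<close>] by auto
    let ?a = "t (bar (fst (ed k))) (bar (snd (ed k)))"
    have "F (bar (fst (ed k))) (bar (snd (ed k))) + ?a \<cdot>\<^sub>m U = ?a \<cdot>\<^sub>m (F (snd (ed k)) (fst (ed k)) + U)"
      unfolding F_bars[OF \<open>os\<close> l(2,1)] using c U(1)
      by (metis F_carrier add_smult_distrib_left_mat)
    then show ?thesis using Ksm[OF U(2)] nn_smult[OF U(1)] by metis
  qed
  have main: "nn (- int h) \<subseteq> T" for h
  proof (induction h)
    case 0
    then show ?case using nT by auto
  next
    case (Suc h)
    have br: "F i j \<in> T" if "F i m \<in> nn (-1)" "U \<in> nn 0" "F i m + U \<in> K" "F m j \<in> nn (- int h)" "h > 0"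
        "i < N" "m < N" "j < N" "i \<noteq> m" "m \<noteq> j" "i \<noteq> j"
        "F i m \<noteq> 0\<^sub>m N N" "F m j \<noteq> 0\<^sub>m N N" "F i j \<noteq> 0\<^sub>m N N" for i m j U
    proof -
      obtain A B where e: "F m j = A + B" and AB: "A \<in> K" "B \<in> nn 0"
        using Suc \<open>F m j \<in> nn (- int h)\<close> by (auto simp: T_def)
      have "A = F m j + (-1) \<cdot>\<^sub>m B" unfolding e
        by (rule mat_cancel_middle(2)[symmetric, of _ N N]) (use AB c in auto)
      moreover have "(-1) \<cdot>\<^sub>m B \<in> nn (- int h)" using nn_smult[OF AB(2)] nn_mono[of "- int h" 0] by auto
      ultimately have A: "A \<in> nn (- int h)" using nn_add \<open>F m j \<in> nn (- int h)\<close> by simp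
      have 1: "sbracket G (F i m + U) A \<in> T" using Kbr AB that KT by simp
      have "sbracket G U A \<in> nn (0 + (- int h))" using nn_sbracket A that by blast
      then have 2: "sbracket G U A \<in> T" using Suc by auto
      have "sbracket G (F i m) B \<in> nn (-1 + 0)" using nn_sbracket AB that by blast
      then have 3: "sbracket G (F i m) B \<in> T" using Suc nn_mono[of "- int h" "-1"] \<open>h > 0\<close> by auto
      have cc: "F i m \<in> carrier_mat N N" "U \<in> carrier_mat N N" "A \<in> carrier_mat N N" "B \<in> carrier_mat N N"
        using c AB that by auto
      \<comment> \<open>Both factors are available in K only modulo \<open>nn 0\<close>. The first
        term lies in K; the two corrections have height at least \<open>- h\<close> and at least -1,
        so the induction hypothesis covers them because \<open>h > 0\<close>.\<close>
      have "sbracket G (F i m) (F m j) = (sbracket G (F i m + U) A + (-1) \<cdot>\<^sub>m sbracket G U A) + sbracket G (F i m) B"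
        unfolding e sbracket_add_right[OF cc(3,4,1)] sbracket_add_left[OF cc(1,2,3)]
        by (rule mat_cancel_middle(1)[symmetric, of _ N N]) (use cc in simp_all)
      then have "sbracket G (F i m) (F m j) \<in> T" using 1 2 3 Tadd Tsm by simp
      moreover have "\<exists>a. a \<noteq> 0 \<and> sbracket G (F i m) (F m j) = a \<cdot>\<^sub>m F i j"
        by (rule sbracket_F[OF that(6-14)])
      then obtain a where "a \<noteq> 0" "sbracket G (F i m) (F m j) = a \<cdot>\<^sub>m F i j" by blast
      ultimately have "inverse a \<cdot>\<^sub>m (a \<cdot>\<^sub>m F i j) \<in> T" using Tsm by simp
      then show ?thesis using mat_inverse_smult \<open>a \<noteq> 0\<close> by simp
    qed
    have sT: "F i j \<in> T" if "F i j + U \<in> K" "U \<in> nn 0" for i j U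
    proof -
      have "F i j = (F i j + U) + (-1) \<cdot>\<^sub>m U"
        by (rule mat_cancel_middle(2)[symmetric, of _ N N]) (use c that in auto)
      then show ?thesis using KT[OF that(1)] nT[OF nn_smult[OF that(2)]] Tadd by metis
    qed
    have low: "F i j \<in> T" if ij: "j < i" "i < N" "os \<longrightarrow> i + j < N" "F i j \<noteq> 0\<^sub>m N N" "ht i - ht j \<ge> - int (Suc h)" for i j
      using lower_root_factor[OF ij(1-4)]
    proof (elim disjE exE conjE)
      fix k assume "k < n" "i = snd (ed k)" "j = fst (ed k)"
      then show ?thesis using simple[of k] sT by blast
    next
      fix k m assume k: "k < n" "i = snd (ed k)" "m = fst (ed k)" "ht m = ht i + 1" "ht m < ht j" "m \<noteq> j" "F m j \<noteq> 0\<^sub>m N N"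
      then obtain U where U: "U \<in> nn 0" "F i m + U \<in> K" using simple by blast
      have m: "m < N" "i \<noteq> m" using ed_less[OF k(1)] k by auto
      have "F i m \<noteq> 0\<^sub>m N N" using F_nonzero_swap[of m i] F_ed_nonzero[OF k(1)] m ij k by simp
      moreover have "h > 0" using k ij by linarith
      ultimately show ?thesis using br[OF _ U, of j] F_nn[of i m "-1"] F_nn[of m j "- int h"] k m ij by simp
    next
      fix k m assume k: "k < n" "m < N" os "i = bar (fst (ed k))" "m = bar (snd (ed k))" "ht m = ht i + 1" "ht m < ht j" "m \<noteq> j" "F m j \<noteq> 0\<^sub>m N N"
      then obtain U where U: "U \<in> nn 0" "F i m + U \<in> K" using simple' by blast
      have l: "fst (ed k) < N" "snd (ed k) < N" "fst (ed k) \<noteq> snd (ed k)" using ed_less[OF k(1)] by auto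
      then have m: "i \<noteq> m" using k bar_inject by metis
      have "F i m \<noteq> 0\<^sub>m N N"
        using F_nonzero_bars[OF k(3) l(2,1)] F_nonzero_swap[OF l(1,2)] F_ed_nonzero[OF k(1)] k by simp
      moreover have "h > 0" using k ij by linarith
      ultimately show ?thesis using br[OF _ U, of j] F_nn[of i m "-1"] F_nn[of m j "- int h"] k m ij by simp
    qed
    show ?case
    proof
      fix X assume "X \<in> nn (- int (Suc h))"
      then show "X \<in> T" unfolding nn_def
      proof (rule lie_alg_span[OF _ Tadd Tsm T0])
        fix i j assume ij: "i < N" "j < N" "- int (Suc h) \<le> ht i - ht j" "F i j \<noteq> 0\<^sub>m N N"
        show "F i j \<in> T"
        proof (cases "ht i - ht j \<ge> 0")
          case True
          then show ?thesis using F_nn nT ij by blast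
        next
          case False
          then have lt: "j < i" by (auto simp: ht_def split: if_splits)
          show ?thesis
          proof (cases "os \<longrightarrow> i + j < N")
            case True
            then show ?thesis using low lt ij by blast
          next
            case False
            then have osT: os and ge: "i + j \<ge> N" by auto
            have "bar i < bar j" "bar j + bar i < N" using lt ge ij by (auto simp: bar_def)
            then have "F (bar j) (bar i) \<in> T"
              using low[of "bar i" "bar j"] F_nonzero_bars[OF osT ij(1,2)] ht_bar[OF osT ij(1,2)] ij by simp
            then have "t i j \<cdot>\<^sub>m F (bar j) (bar i) \<in> T" using Tsm by blast
            then show ?thesis using F_bars[OF osT, of "bar j" "bar i"] ij by simp
          qed
        qed
      qed
    qed
  qed
  have "lie_alg G \<subseteq> nn (- int N)"
    by (auto simp: nn_def supp_in_def ht_def)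
  then have "lie_alg G \<subseteq> T" using main by blast
  then have "lie_alg G \<subseteq> {X + Y |X Y. X \<in> K \<and> Y \<in> borel G}" using nn_borel unfolding T_def by blast
  moreover have "{X + Y |X Y. X \<in> K \<and> Y \<in> borel G} \<subseteq> lie_alg G"
    using Kl borel_lie lie_alg_graded unfolding graded_subspace_def by blast
  ultimately show ?thesis unfolding spherical_def by blast
qed

text \<open>Brackets with black raising vectors carry \<open>F b a\<close> back along the path to
  \<open>F l k\<close>. The error term stays in \<open>nn 0\<close> because these vectors have
  non-negative height.\<close>

lemma white_lower_in_K:
  assumes path: "step\<^sup>*\<^sup>* (k, l) (a, b)" and kl: "k < N" "l < N"
    and K: "subalgebra G K" "levi G P \<subseteq> K" and Y: "Y \<in> nn 0" "F b a + Y \<in> K"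
  shows "\<exists>U\<in>nn 0. F l k + U \<in> K"
proof -
  have Ksm: "\<And>X a. X \<in> K \<Longrightarrow> a \<cdot>\<^sub>m X \<in> K" and Kbr: "\<And>X Y. X \<in> K \<Longrightarrow> Y \<in> K \<Longrightarrow> sbracket G X Y \<in> K"
    using K(1) unfolding subalgebra_def graded_subspace_def by blast+
  have bs0: "F x y \<in> nn 0" if "bs x y" for x y
  proof -
    have e: "fst (ed j) < N \<and> snd (ed j) < N \<and> ht (fst (ed j)) \<ge> ht (snd (ed j))" if "j < n" for j
      using ed_less[OF that] by (auto simp: ht_def)
    from \<open>bs x y\<close> have "ht x \<ge> ht y"
    proof (cases rule: bs_edge)
      case (1 j) then show ?thesis using e by simp
    next
      case (2 j) then show ?thesis using e[of j] ht_bar[of "snd (ed j)" "fst (ed j)"] ht_bar[of "fst (ed j)" "snd (ed j)"] by simp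
    qed
    then show ?thesis using F_nn bs_less[OF that] by simp
  qed
  have "\<exists>U\<in>nn 0. F (snd p) (fst p) + U \<in> K" if "step\<^sup>*\<^sup>* p (a, b)" for p
    using that
  proof (induction rule: converse_rtranclp_induct)
    case base
    then show ?case using Y by auto
  next
    case (step p q)
    obtain U where U: "U \<in> nn 0" "F (snd q) (fst q) + U \<in> K" using step(3) by blast
    obtain x y c where x: "bs x y" "c \<noteq> 0" "sbracket G (F x y) (F (snd q) (fst q)) = c \<cdot>\<^sub>m F (snd p) (fst p)"
      using step_sbracket(2)[of "fst p" "snd p" "fst q" "snd q"] step(1) by auto
    have "sbracket G (F x y) (F (snd q) (fst q) + U) \<in> K" using Kbr U levi_F x K(2) by blast
    then have "inverse c \<cdot>\<^sub>m (c \<cdot>\<^sub>m F (snd p) (fst p) + sbracket G (F x y) U) \<in> K"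
      using Ksm sbracket_add_right[of "F (snd q) (fst q)" U "F x y"] x U nn_lie by simp
    moreover have "inverse c \<cdot>\<^sub>m (c \<cdot>\<^sub>m F (snd p) (fst p) + sbracket G (F x y) U) =
        F (snd p) (fst p) + inverse c \<cdot>\<^sub>m sbracket G (F x y) U"
      using x(2) U nn_lie by (intro eq_matI) (auto simp: carrier_matD[OF sbracket_carrier] distrib_left)
    moreover have "inverse c \<cdot>\<^sub>m sbracket G (F x y) U \<in> nn 0"
      using nn_sbracket[OF bs0[OF x(1)] U(1)] nn_smult by simp
    ultimately show ?case by auto
  qed
  from this[OF path] show ?thesis by simp
qed

end

section \<open>Highest weights from pairs of black components\<close>

context levi_data
begin

lemma step_right:
  assumes "(\<lambda>y z. bs y z \<and> y \<in> D \<and> z \<in> D)\<^sup>*\<^sup>* y z" "k < N"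
    and D: "\<And>y. y \<in> D \<Longrightarrow> y < N \<and> k \<noteq> y \<and> F k y \<noteq> 0\<^sub>m N N"
  shows "step\<^sup>*\<^sup>* (k, y) (k, z)"
  using assms(1)
proof (induction rule: rtranclp_induct)
  case (step y z)
  then have "step (k, y) (k, z)" using D assms(2) by (simp add: step_def)
  then show ?case using step by simp
qed simp

lemma step_left:
  assumes "(\<lambda>y z. bs y z \<and> y \<in> C \<and> z \<in> C)\<^sup>*\<^sup>* x y" "l < N"
    and C: "\<And>x. x \<in> C \<Longrightarrow> x < N \<and> x \<noteq> l \<and> F x l \<noteq> 0\<^sub>m N N"
  shows "step\<^sup>*\<^sup>* (y, l) (x, l)"
  using assms(1)
proof (induction rule: converse_rtranclp_induct)
  case (step x z)
  then have "step (z, l) (x, l)" using C assms(2) by (simp add: step_def)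
  then show ?case using step by simp
qed simp

lemma bs_restrict:
  assumes "bs\<^sup>*\<^sup>* x y" "x \<in> C" "\<And>x y. bs x y \<Longrightarrow> (x \<in> C \<longleftrightarrow> y \<in> C)"
  shows "(\<lambda>y z. bs y z \<and> y \<in> C \<and> z \<in> C)\<^sup>*\<^sup>* x y"
proof -
  have "(\<lambda>y z. bs y z \<and> y \<in> C \<and> z \<in> C)\<^sup>*\<^sup>* x y \<and> y \<in> C"
    using assms(1)
  proof (induction rule: rtranclp_induct)
    case (step y z)
    then have "bs y z \<and> y \<in> C \<and> z \<in> C" using assms(3) by blast
    then show ?case using step.IH by (blast intro: rtranclp.rtrancl_into_rtrancl)
  qed (use assms(2) in simp)
  then show ?thesis ..
qed

text \<open>Here V+ behaves like the tensor product of the module on C with the dual of the module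
  on D. The index a is the top of C and b the bottom of D, and since no \<open>F x y\<close>
  vanishes, the two indices can be moved independently.\<close>

lemma highest_weight_components:
  assumes kl: "k \<in> C" "l \<in> D" and ab: "a \<in> C" "b \<in> D" and disj: "C \<inter> D = {}"
    and C: "\<And>x y. bs x y \<Longrightarrow> (x \<in> C \<longleftrightarrow> y \<in> C)" "\<And>x. x \<in> C \<Longrightarrow> x < N \<and> bs\<^sup>*\<^sup>* a x"
    and D: "\<And>x y. bs x y \<Longrightarrow> (x \<in> D \<longleftrightarrow> y \<in> D)" "\<And>y. y \<in> D \<Longrightarrow> y < N \<and> bs\<^sup>*\<^sup>* y b"
    and F: "\<And>x y. x \<in> C \<Longrightarrow> y \<in> D \<Longrightarrow> F x y \<noteq> 0\<^sub>m N N"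
  shows "step\<^sup>*\<^sup>* (k, l) (a, b)" "highest_weight G P (V_plus G P (wt k - wt l)) = wt a - wt b"
proof -
  have ne: "x \<noteq> y" if "x \<in> C" "y \<in> D" for x y using disj that by blast
  have N: "k < N" "l < N" "a < N" "b < N" using kl ab C D by auto
  have 1: "step\<^sup>*\<^sup>* (k, l) (a, l)"
    using step_left[OF bs_restrict[OF _ ab(1) C(1)] N(2), of k] C(2) F ne kl by blast
  have 2: "step\<^sup>*\<^sup>* (a, l) (a, b)"
    using step_right[OF bs_restrict[OF _ kl(2) D(1)] N(3), of b] D(2) F ne kl ab by blast
  show 3: "step\<^sup>*\<^sup>* (k, l) (a, b)" using 1 2 by simp
  show "highest_weight G P (V_plus G P (wt k - wt l)) = wt a - wt b"
  proof (rule highest_weight_V_plus[OF N(1,2) refl kl _ disj 3 N(3,4)])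
    show "F a b \<noteq> 0\<^sub>m N N" using F ab by blast
    fix x y assume xy: "x \<in> C" "y \<in> D"
    have "(wt a - wt x) + (wt y - wt b) \<in> nonneg_comb G P"
      using nonneg_comb_add nonneg_comb_path C(2)[OF xy(1)] D(2)[OF xy(2)] by blast
    moreover have "(wt a - wt x) + (wt y - wt b) = wt a - wt b - (wt x - wt y)"
      by (rule eq_vecI) auto
    ultimately show "wt a - wt b - (wt x - wt y) \<in> nonneg_comb G P" by simp
  qed (use C(1) D(1) in blast)
qed

end

section \<open>Chains of simple roots\<close>

text \<open>
  In shape D the flip \<open>\<zeta>\<^sub>n \<mapsto> - \<zeta>\<^sub>n\<close>, which interchanges the two end nodes, is used to arrange that the node
  \<open>n - 1\<close> is black only if \<open>n - 2\<close> is.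
\<close>

locale chain = levi_data +
  fixes \<Phi> :: "nat set"
  assumes fl: "nodes G - 1 \<in> \<Phi> \<Longrightarrow> shape G = ShapeD"
begin

abbreviation fl :: bool where "fl \<equiv> n - 1 \<in> \<Phi>"

text \<open>Under the flip the last weight becomes its negative, which is the weight of the basis
  vector with index n. \<open>\<rho>\<close> and \<open>ced\<close> are the corresponding
  renumberings of the nodes and of their index pairs.\<close>

definition cc :: "nat \<Rightarrow> nat" where
  "cc k = (if fl \<and> k = n - 1 then n else k)"

definition \<rho> :: "nat \<Rightarrow> nat" where
  "\<rho> j = (if fl \<and> j = n - 1 then n - 2 else if fl \<and> j = n - 2 then n - 1 else j)"

definition Z :: "nat \<Rightarrow> complex vec" where "Z k = wt (cc k)"

definition sr :: "nat \<Rightarrow> complex vec" where "sr j = simple_root G (\<rho> j)"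

definition Bl :: "nat set" where "Bl = {j. j < n \<and> sr j \<in> P}"

definition ced :: "nat \<Rightarrow> nat \<times> nat" where
  "ced j = (if j + 1 < rk then (cc j, cc (j + 1))
    else if shape G = ShapeD then (cc (n - 2), bar (cc (n - 1))) else (n - 1, n))"

definition sn :: "nat \<Rightarrow> complex" where "sn k = (-1) ^ pr (cc k)"

lemma sn_cases: "k < rk \<Longrightarrow> sn k = 1 \<or> sn k = -1"
  unfolding sn_def by (metis neg_one_even_power neg_one_odd_power)

lemma D_facts: "shape G = ShapeD \<Longrightarrow> N = 2 * n \<and> n \<ge> 2 \<and> bar n = n - 1 \<and> bar (n - 1) = n \<and> rk = n"
  using shape_CD_N shape_D_n hdim_os by (auto simp: bar_def)

lemma cc_less: "k < rk \<Longrightarrow> cc k < N"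
  using rk_le_N fl D_facts by (force simp: cc_def)

lemma cc_inj: "k < rk \<Longrightarrow> j < rk \<Longrightarrow> cc k = cc j \<longleftrightarrow> k = j"
  using fl D_facts by (auto simp: cc_def)

lemma cc_bar: "os \<Longrightarrow> k < rk \<Longrightarrow> j < rk \<Longrightarrow> cc k \<noteq> bar (cc j)"
proof
  assume a: os "k < rk" "j < rk" "cc k = bar (cc j)"
  have r: "rk = n" using a hdim_os by simp
  have ge: "n \<le> bar i" if "i < n" for i using bar_ge a(1) that by blast
  show False
  proof (cases fl)
    case True
    note D = D_facts[OF fl[OF True]]
    show False using a(2-4) D True by (auto simp: cc_def bar_def split: if_splits)
  next
    case False
    then show False using a ge[of j] r by (simp add: cc_def)
  qed
qed

lemma Z_carrier [simp]: "Z k \<in> carrier_vec rk"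
  by (simp add: Z_def)

lemma inner_Z: "k < rk \<Longrightarrow> j < rk \<Longrightarrow> inner_h G (Z k) (Z j) = (if k = j then sn k else 0)"
proof (cases fl)
  case True
  assume kj: "k < rk" "j < rk"
  note D = D_facts[OF fl[OF True]]
  have os: os using fl True by simp
  have l: "n - 1 < N" "n - 1 < rk" "bar (n - 1) = n" using D by linarith+
  have w: "wt n = - wt (n - 1)" using wt_bar[OF os l(1)] l(3) by simp
  have p: "pr n = pr (n - 1)" using pr_bar[OF os l(1)] l(3) by simp
  show ?thesis
    using kj l(2) True w p
    by (auto simp: Z_def cc_def sn_def inner_h_wt inner_h_uminus_left inner_h_uminus_right)
next
  case False
  assume "k < rk" "j < rk"
  then show ?thesis using False by (simp add: Z_def cc_def sn_def inner_h_wt)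
qed

lemma \<rho>_less: "j < n \<Longrightarrow> \<rho> j < n"
  using fl D_facts by (auto simp: \<rho>_def)

lemma \<rho>_\<rho>: "j < n \<Longrightarrow> \<rho> (\<rho> j) = j"
  using fl D_facts by (auto simp: \<rho>_def)

lemma simple_roots_sr: "simple_roots G = sr ` {..<n}"
proof -
  have "simple_roots G \<subseteq> sr ` {..<n}"
    unfolding simple_roots_def sr_def using \<rho>_less \<rho>_\<rho> by (metis (no_types, lifting) image_subsetI imageI lessThan_iff)
  moreover have "sr ` {..<n} \<subseteq> simple_roots G"
    unfolding simple_roots_def sr_def using \<rho>_less by auto
  ultimately show ?thesis by blast
qed

lemma ced_less: "j < n \<Longrightarrow> fst (ced j) < N \<and> snd (ced j) < N \<and> fst (ced j) \<noteq> snd (ced j)"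
proof -
  assume j: "j < n"
  consider "j + 1 < rk" | "shape G = ShapeD" "\<not> j + 1 < rk" | "shape G \<noteq> ShapeD" "\<not> j + 1 < rk" "os"
    using j hdim_A nodes_A by (cases os) auto
  then show ?thesis
  proof cases
    case 1 then show ?thesis using cc_less cc_inj[of j "j + 1"] by (simp add: ced_def)
  next
    case 2
    then have "n - 2 < rk" "n - 1 < rk" "n - 2 \<noteq> n - 1" using D_facts by fastforce+
    then show ?thesis using 2 cc_less[of "n - 2"] cc_less[of "n - 1"] cc_bar[of "n - 2" "n - 1"] by (simp add: ced_def)
  next
    case 3
    then have "2 * n \<le> N" using nodes_os by simp
    then have "n - 1 < N" "n < N" "n - 1 \<noteq> n" using j by linarith+
    then show ?thesis using 3 j by (simp add: ced_def)
  qed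
qed

lemma sr_ced:
  assumes "j < n"
  shows "sr j = wt (fst (ced j)) - wt (snd (ced j))"
proof (cases fl)
  case False
  have "ced j = ed j"
  proof (cases "j + 1 < rk")
    case True
    then show ?thesis using False D_facts by (auto simp: ced_def ed_def cc_def)
  next
    case False2: False
    have os: os using False2 assms hdim_A nodes_A by (cases os) auto
    then have "j = n - 1" using False2 assms hdim_os by simp
    then show ?thesis using False False2 D_facts assms by (auto simp: ced_def ed_def cc_def)
  qed
  then show ?thesis using False assms simple_root_eq by (simp add: sr_def \<rho>_def)
next
  case True
  note D = D_facts[OF fl[OF True]]
  have os: os using fl True by simp
  have sh: "shape G = ShapeD" using fl True by simp
  consider "j + 1 < n - 1" | "j = n - 2" | "j = n - 1" using assms by linarith
  then show ?thesis
  proof cases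
    case 1
    then have "ced j = (j, j + 1)" "ed j = (j, j + 1)" "\<rho> j = j" using D by (auto simp: ced_def ed_def cc_def \<rho>_def)
    then show ?thesis using simple_root_eq[OF assms] by (simp add: sr_def)
  next
    case 2
    then have "ced j = (n - 2, n)" "ed (n - 1) = (n - 2, n)" "\<rho> j = n - 1" using D True sh
      by (auto simp: ced_def ed_def cc_def \<rho>_def)
    then show ?thesis using simple_root_eq[of "n - 1"] D by (simp add: sr_def)
  next
    case 3
    then have "ced j = (n - 2, n - 1)" "ed (n - 2) = (n - 2, n - 1)" "\<rho> j = n - 2" using D True sh
      by (auto simp: ced_def ed_def cc_def \<rho>_def)
    then show ?thesis using simple_root_eq[of "n - 2"] D by (simp add: sr_def)
  qed
qed

lemma sr_chain: "j + 1 < rk \<Longrightarrow> j < n \<Longrightarrow> sr j = Z j - Z (j + 1)"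
  by (simp add: sr_ced ced_def Z_def)

lemma sr_end:
  assumes "j < n" "\<not> j + 1 < rk"
  shows "os" "j = n - 1" "rk = n"
    "shape G = ShapeB \<Longrightarrow> sr j = Z (n - 1)"
    "shape G = ShapeC \<Longrightarrow> sr j = Z (n - 1) + Z (n - 1)"
    "shape G = ShapeD \<Longrightarrow> sr j = Z (n - 2) + Z (n - 1)"
proof -
  show os: os using assms hdim_A nodes_A by (cases os) auto
  show r: "rk = n" using hdim_os os by simp
  show j: "j = n - 1" using assms r by simp
  show "sr j = Z (n - 1)" if B: "shape G = ShapeB"
  proof -
    have "bar n = n" "n < N" using shape_B_N[OF B] by (auto simp: bar_def)
    then have "wt n = 0\<^sub>v rk" using wt_mid os by simp
    moreover have "\<not> fl" using fl B by auto
    ultimately show ?thesis using assms B j r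
      by (auto simp: sr_ced ced_def Z_def cc_def)
  qed
  show "sr j = Z (n - 1) + Z (n - 1)" if C: "shape G = ShapeC"
  proof -
    have "bar (n - 1) = n" "n - 1 < N" using shape_CD_N C assms by (auto simp: bar_def)
    then have "wt n = - wt (n - 1)" using wt_bar[OF os, of "n - 1"] by simp
    moreover have "\<not> fl" using fl C by auto
    ultimately show ?thesis using assms C j r
      by (intro eq_vecI) (auto simp: sr_ced ced_def Z_def cc_def)
  qed
  show "sr j = Z (n - 2) + Z (n - 1)" if D: "shape G = ShapeD"
  proof -
    have "wt (bar (cc (n - 1))) = - wt (cc (n - 1))" using wt_bar[OF os cc_less] D_facts[OF D] by simp
    then show ?thesis using assms D j r
      by (intro eq_vecI) (auto simp: sr_ced ced_def Z_def)
  qed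
qed

lemma sr_inj:
  assumes "i < n" "j < n" "sr i = sr j"
  shows "i = j"
proof -
  have ed_inj: "k = l" if "k < n" "l < n" "simple_root G k = simple_root G l" for k l
  proof -
    have "wt (fst (ed k)) - wt (snd (ed k)) = wt (fst (ed l)) - wt (snd (ed l))"
      using that simple_root_eq by simp
    then have c: "(fst (ed l) = fst (ed k) \<and> snd (ed l) = snd (ed k)) \<or>
        (os \<and> fst (ed l) = bar (snd (ed k)) \<and> snd (ed l) = bar (fst (ed k)))"
      using wt_diff_cases[of "fst (ed k)" "snd (ed k)" "fst (ed l)" "snd (ed l)"] ed_less[OF that(1)] ed_less[OF that(2)] by simp
    show "k = l"
    proof (cases "fst (ed l) = fst (ed k) \<and> snd (ed l) = snd (ed k)")
      case True
      then show ?thesis using that D_facts by (auto simp: ed_def split: if_splits)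
    next
      case False
      then have b: os "fst (ed l) = bar (snd (ed k))" using c by auto
      have "snd (ed k) \<le> n" "fst (ed l) < n" using that D_facts by (auto simp: ed_def)
      moreover have "N = 2 * n + 1 \<or> N = 2 * n" using nodes_os b by linarith
      ultimately have "snd (ed k) = n" "bar n = n - 1" using b(2) that by (auto simp: bar_def)
      then have "fst (ed l) = n - 1" "shape G \<noteq> ShapeD \<and> k = n - 1 \<or> shape G = ShapeD" using b
        by (auto simp: ed_def split: if_splits)
      then show ?thesis using b that D_facts \<open>snd (ed k) = n\<close> c False
        by (auto simp: ed_def split: if_splits)
    qed
  qed
  have "\<rho> i = \<rho> j" using ed_inj[OF \<rho>_less[OF assms(1)] \<rho>_less[OF assms(2)]] assms(3) by (simp add: sr_def)
  then show ?thesis using \<rho>_\<rho> assms by metis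
qed

lemma bs_ced: "j \<in> Bl \<Longrightarrow> bs (fst (ced j)) (snd (ced j))"
  using sr_ced[of j, symmetric] ced_less[of j] by (simp add: bs_def Bl_def)

lemma bs_cedE:
  assumes "bs k l"
  obtains j where "j \<in> Bl" "k = fst (ced j)" "l = snd (ced j)" |
    j where os "j \<in> Bl" "k = bar (snd (ced j))" "l = bar (fst (ced j))"
proof -
  obtain j where j: "j < n" "sr j \<in> P" "wt k - wt l = sr j"
    using assms P_sub by (auto simp: bs_def simple_roots_sr)
  then have "wt (fst (ced j)) - wt (snd (ced j)) = wt k - wt l" by (simp add: sr_ced)
  then show ?thesis
    using wt_diff_cases[of "fst (ced j)" "snd (ced j)" k l] ced_less[OF j(1)] assms j that
    by (auto simp: bs_def Bl_def)
qed

text \<open>Node j joins the weights j and \<open>j + 1\<close>, so a block is a run of weights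
  \<open>a..b\<close> whose nodes \<open>a..<b\<close> are black. For a white node i,
  \<open>{lo i..i}\<close> is the block that ends at i and \<open>{i + 1..hi (i + 1)}\<close> the
  one that begins after it. In the ortho-symplectic case the value n of \<open>hi\<close> means that
  the black nodes run to the end of the diagram.\<close>

definition lo :: "nat \<Rightarrow> nat" where
  "lo i = (LEAST a. a \<le> i \<and> {a..<i} \<subseteq> Bl)"

definition hi :: "nat \<Rightarrow> nat" where
  "hi i = (LEAST b. i \<le> b \<and> b \<notin> Bl)"

lemma lo_le: "lo i \<le> i" and lo_black: "{lo i..<i} \<subseteq> Bl"
  using LeastI[of "\<lambda>a. a \<le> i \<and> {a..<i} \<subseteq> Bl" i] unfolding lo_def by auto

lemma lo_white: "lo i > 0 \<Longrightarrow> lo i - 1 \<notin> Bl"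
proof
  assume a: "lo i > 0" "lo i - 1 \<in> Bl"
  have "{lo i - 1..<i} \<subseteq> Bl"
    using lo_black[of i] a lo_le[of i] by (auto simp: subset_iff) (metis Suc_pred le_antisym not_less_eq_eq)
  then have "lo i \<le> lo i - 1" unfolding lo_def[of i]
    by (intro Least_le) (use a lo_le[of i] in \<open>auto simp: lo_def\<close>)
  then show False using a by simp
qed

lemma n_notin_Bl: "n \<notin> Bl"
  by (simp add: Bl_def)

lemma hi_ge: "i \<le> n \<Longrightarrow> i \<le> hi i" and hi_white: "i \<le> n \<Longrightarrow> hi i \<notin> Bl" and hi_le: "i \<le> n \<Longrightarrow> hi i \<le> n"
  and hi_black: "i \<le> n \<Longrightarrow> {i..<hi i} \<subseteq> Bl"
proof -
  assume i: "i \<le> n"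
  have "i \<le> n \<and> n \<notin> Bl" using i n_notin_Bl by simp
  from LeastI[of "\<lambda>b. i \<le> b \<and> b \<notin> Bl", OF this] Least_le[of "\<lambda>b. i \<le> b \<and> b \<notin> Bl", OF this]
  show "i \<le> hi i" "hi i \<notin> Bl" "hi i \<le> n" unfolding hi_def by auto
  show "{i..<hi i} \<subseteq> Bl"
  proof
    fix k assume "k \<in> {i..<hi i}"
    then show "k \<in> Bl" using not_less_Least[of k "\<lambda>b. i \<le> b \<and> b \<notin> Bl"] by (auto simp: hi_def)
  qed
qed

lemma bs_chain_in: "{p..<q} \<subseteq> Bl \<Longrightarrow> p \<le> q \<Longrightarrow> q < rk \<Longrightarrow> cc ` {p..q} \<subseteq> A \<Longrightarrow>
    (\<lambda>y z. bs y z \<and> y \<in> A \<and> z \<in> A)\<^sup>*\<^sup>* (cc p) (cc q)"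
proof (induction q)
  case (Suc q)
  show ?case
  proof (cases "p = Suc q")
    case False
    then have q: "p \<le> q" "{p..<q} \<subseteq> {p..<Suc q}" "q \<in> {p..<Suc q}" "cc ` {p..q} \<subseteq> cc ` {p..Suc q}"
      using Suc.prems by auto
    then have "(\<lambda>y z. bs y z \<and> y \<in> A \<and> z \<in> A)\<^sup>*\<^sup>* (cc p) (cc q)" "q \<in> Bl"
      using Suc.prems by (auto intro!: Suc.IH)
    moreover have "bs (cc q) (cc (Suc q))" using bs_ced[OF \<open>q \<in> Bl\<close>] Suc by (simp add: ced_def)
    moreover have "cc q \<in> A" "cc (Suc q) \<in> A" using Suc.prems q(1) by auto
    ultimately show ?thesis by (blast intro: rtranclp.rtrancl_into_rtrancl)
  qed simp
qed simp

lemma bs_chain_bar_in: "os \<Longrightarrow> {p..<q} \<subseteq> Bl \<Longrightarrow> p \<le> q \<Longrightarrow> q < rk \<Longrightarrow> bar ` cc ` {p..q} \<subseteq> A \<Longrightarrow>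
    (\<lambda>y z. bs y z \<and> y \<in> A \<and> z \<in> A)\<^sup>*\<^sup>* (bar (cc q)) (bar (cc p))"
proof (induction q)
  case (Suc q)
  show ?case
  proof (cases "p = Suc q")
    case False
    then have q: "p \<le> q" "{p..<q} \<subseteq> {p..<Suc q}" "q \<in> {p..<Suc q}" "bar ` cc ` {p..q} \<subseteq> bar ` cc ` {p..Suc q}"
      using Suc.prems by auto
    then have "(\<lambda>y z. bs y z \<and> y \<in> A \<and> z \<in> A)\<^sup>*\<^sup>* (bar (cc q)) (bar (cc p))" "q \<in> Bl"
      using Suc.prems by (auto intro!: Suc.IH)
    moreover have "bs (bar (cc (Suc q))) (bar (cc q))"
      using bs_bar[OF Suc.prems(1) bs_ced[OF \<open>q \<in> Bl\<close>]] Suc.prems by (simp add: ced_def)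
    moreover have "bar (cc q) \<in> A" "bar (cc (Suc q)) \<in> A" using Suc.prems q(1) by auto
    ultimately show ?thesis by (blast intro: converse_rtranclp_into_rtranclp)
  qed simp
qed simp

lemma rtranclp_conj: "(\<lambda>y z. R y z \<and> Q y z)\<^sup>*\<^sup>* x y \<Longrightarrow> R\<^sup>*\<^sup>* x y"
  by (rule rtranclp_mono[THEN predicate2D, rotated]) auto

lemma bs_chain: "{p..<q} \<subseteq> Bl \<Longrightarrow> p \<le> q \<Longrightarrow> q < rk \<Longrightarrow> bs\<^sup>*\<^sup>* (cc p) (cc q)"
  using rtranclp_conj[OF bs_chain_in[of p q UNIV]] by simp

lemma bs_chain_bar: "os \<Longrightarrow> {p..<q} \<subseteq> Bl \<Longrightarrow> p \<le> q \<Longrightarrow> q < rk \<Longrightarrow> bs\<^sup>*\<^sup>* (bar (cc q)) (bar (cc p))"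
  using rtranclp_conj[OF bs_chain_bar_in[of p q UNIV]] by simp

end

locale good_chain = chain +
  assumes nb: "shape G = ShapeD \<Longrightarrow> n - 1 \<in> Bl \<Longrightarrow> n - 2 \<in> Bl"
begin

text \<open>Only the end node could link a block to reflected indices. In shape D that node involves
  the weight \<open>n - 2\<close>, and \<open>nb\<close> rules out that a block ends there while the
  end node is black.\<close>

lemma block_closed:
  assumes "p \<le> q" "q < rk" "q \<notin> Bl" "p > 0 \<Longrightarrow> p - 1 \<notin> Bl" "bs x y"
  shows "x \<in> cc ` {p..q} \<longleftrightarrow> y \<in> cc ` {p..q}" "os \<Longrightarrow> x \<in> bar ` cc ` {p..q} \<longleftrightarrow> y \<in> bar ` cc ` {p..q}"
proof -
  have mem: "cc j \<in> cc ` {p..q} \<longleftrightarrow> p \<le> j \<and> j \<le> q" if "j < rk" for j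
    using cc_inj[OF that] assms(2) by (auto simp: image_iff)
  have nmem: "bar (cc j) \<notin> cc ` {p..q}" if "j < rk" os for j
    using cc_bar[OF that(2) _ that(1)] assms(2) by (auto simp: image_iff) (metis le_less_trans)
  have edge: "fst (ced j) \<in> cc ` {p..q} \<longleftrightarrow> snd (ced j) \<in> cc ` {p..q}"
    "os \<Longrightarrow> bar (snd (ced j)) \<in> cc ` {p..q} \<longleftrightarrow> bar (fst (ced j)) \<in> cc ` {p..q}" if j: "j \<in> Bl" for j
  proof -
    have jn: "j < n" using j by (simp add: Bl_def)
    have jq: "j \<noteq> q" "Suc j \<noteq> p" using j assms by auto
    have "(fst (ced j) \<in> cc ` {p..q} \<longleftrightarrow> snd (ced j) \<in> cc ` {p..q}) \<and>
      (os \<longrightarrow> (bar (snd (ced j)) \<in> cc ` {p..q} \<longleftrightarrow> bar (fst (ced j)) \<in> cc ` {p..q}))"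
    proof (cases "j + 1 < rk")
      case True
      then show ?thesis using jq mem[of j] mem[of "j + 1"] nmem[of j] nmem[of "j + 1"] by (auto simp: ced_def)
    next
      case False
      note E = sr_end(1-3)[OF jn False]
      have qs: "q < n - 1" using jq E assms(2) by linarith
      have nm1: "cc (n - 1) \<notin> cc ` {p..q}" using mem[of "n - 1"] qs E jn by auto
      consider "shape G = ShapeB" | "shape G = ShapeC" | "shape G = ShapeD" using os_shape E by blast
      then show ?thesis
      proof cases
        case 1
        then have f: "\<not> fl" "cc (n - 1) = n - 1" using fl by (auto simp: cc_def)
        have "bar n = n" using shape_B_N[OF 1] by (auto simp: bar_def)
        moreover have "n \<notin> cc ` {p..q}" using qs f by (auto simp: cc_def)
        ultimately show ?thesis using nm1 nmem[of "n - 1"] E f 1 jn by (simp add: ced_def)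
      next
        case 2
        then have f: "\<not> fl" "cc (n - 1) = n - 1" using fl by (auto simp: cc_def)
        have "bar (n - 1) = n" "bar n = n - 1" using shape_CD_N 2 jn by (auto simp: bar_def)
        then show ?thesis using nm1 nmem[of "n - 1"] E f 2 jn by (simp add: ced_def)
      next
        case 3
        have "n - 2 \<in> Bl" using nb 3 j E by simp
        then have "q \<noteq> n - 2" using assms by auto
        then have nm2: "cc (n - 2) \<notin> cc ` {p..q}" using mem[of "n - 2"] qs E jn by auto
        have "bar (bar (cc (n - 1))) = cc (n - 1)" using cc_less E jn by simp
        then show ?thesis using nm1 nm2 nmem[of "n - 1"] nmem[of "n - 2"] E 3 jn by (simp add: ced_def)
      qed
    qed
    then show "fst (ced j) \<in> cc ` {p..q} \<longleftrightarrow> snd (ced j) \<in> cc ` {p..q}"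
      "os \<Longrightarrow> bar (snd (ced j)) \<in> cc ` {p..q} \<longleftrightarrow> bar (fst (ced j)) \<in> cc ` {p..q}" by blast+
  qed
  have *: "x \<in> cc ` {p..q} \<longleftrightarrow> y \<in> cc ` {p..q}" if "bs x y" for x y
    using that
  proof (cases rule: bs_cedE)
    case (1 j) then show ?thesis using edge(1)[of j] by simp
  next
    case (2 j) then show ?thesis using edge(2)[of j] by simp
  qed
  show "x \<in> cc ` {p..q} \<longleftrightarrow> y \<in> cc ` {p..q}" using * assms(5) .
  have bm: "x \<in> bar ` A \<longleftrightarrow> bar x \<in> A" if "x < N" "A \<subseteq> {..<N}" for x A
    using that by (auto simp: image_iff subset_iff) (metis bar_bar)
  have "cc ` {p..q} \<subseteq> {..<N}" using cc_less assms(2) by auto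
  then show "x \<in> bar ` cc ` {p..q} \<longleftrightarrow> y \<in> bar ` cc ` {p..q}" if os
    using bm bs_less[OF assms(5)] *[OF bs_bar[OF that assms(5)]] by simp
qed

lemma block_reach:
  assumes "p \<le> q" "q < rk" "{p..<q} \<subseteq> Bl" "x \<in> cc ` {p..q}"
  shows "x < N \<and> bs\<^sup>*\<^sup>* (cc p) x \<and> bs\<^sup>*\<^sup>* x (cc q)"
proof -
  obtain j where j: "p \<le> j" "j \<le> q" "x = cc j" using assms by auto
  have "{p..<j} \<subseteq> Bl" "{j..<q} \<subseteq> Bl" using assms j by auto
  then show ?thesis using bs_chain[of p j] bs_chain[of j q] j assms cc_less by simp
qed

text \<open>The index pair whose weight difference is the highest weight of V+. The first index
  rises to the start of its block; the second sinks to the end of the next block, or to the lowest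
  vector of the natural module at the end. In the final case both indices come from one block and V+
  is a symmetric or exterior square: the first index is repeated if \<open>eps\<close> is -1 there,
  and otherwise its successor is used.\<close>

definition hp :: "nat \<Rightarrow> nat \<times> nat" where
  "hp j = (if j + 1 < rk then (cc (lo j), if hi (j + 1) < rk then cc (hi (j + 1)) else bar (cc (j + 1)))
     else if shape G = ShapeB then (cc (lo j), n)
     else if shape G = ShapeD \<and> n - 2 \<notin> Bl then (cc (lo (n - 2)), bar (cc (n - 1)))
     else (cc (lo j), bar (cc (if eps (cc (lo j)) = -1 then lo j else lo j + 1))))"

lemma F_cc_nonzero: "i < rk \<Longrightarrow> j < rk \<Longrightarrow> F (cc i) (cc j) \<noteq> 0\<^sub>m N N"
  using F_nonzero cc_less cc_bar by metis

lemma F_cc_bar_nonzero: "os \<Longrightarrow> i < rk \<Longrightarrow> j < rk \<Longrightarrow> i \<noteq> j \<or> eps (cc i) = -1 \<Longrightarrow> F (cc i) (bar (cc j)) \<noteq> 0\<^sub>m N N"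
  using F_nonzero[of "cc i" "bar (cc j)"] F_nonzero_bar[of "cc i"] cc_less cc_inj bar_inject by (metis bar_less)

definition good_pair :: "nat \<Rightarrow> nat \<times> nat \<Rightarrow> bool" where
  "good_pair j q \<longleftrightarrow> fst q < N \<and> snd q < N \<and> fst q \<noteq> snd q \<and> F (fst q) (snd q) \<noteq> 0\<^sub>m N N \<and>
     step\<^sup>*\<^sup>* (ced j) q \<and> highest_weight G P (V_plus G P (sr j)) = wt (fst q) - wt (snd q)"

lemma good_pairI:
  assumes "j < n" "fst (ced j) \<in> C" "snd (ced j) \<in> D" "a \<in> C" "b \<in> D" "C \<inter> D = {}"
    and "\<And>x y. bs x y \<Longrightarrow> (x \<in> C \<longleftrightarrow> y \<in> C)" "\<And>x. x \<in> C \<Longrightarrow> x < N \<and> bs\<^sup>*\<^sup>* a x"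
    and "\<And>x y. bs x y \<Longrightarrow> (x \<in> D \<longleftrightarrow> y \<in> D)" "\<And>y. y \<in> D \<Longrightarrow> y < N \<and> bs\<^sup>*\<^sup>* y b"
    and "\<And>x y. x \<in> C \<Longrightarrow> y \<in> D \<Longrightarrow> F x y \<noteq> 0\<^sub>m N N"
  shows "good_pair j (a, b)"
  unfolding good_pair_def
  using highest_weight_components[OF assms(2-11)] assms sr_ced[OF assms(1)] by auto

lemma hp_chain:
  assumes j: "j < n" "j \<notin> Bl" "j + 1 < rk" "hi (j + 1) < rk"
  shows "good_pair j (cc (lo j), cc (hi (j + 1)))"
proof -
  have jn: "j + 1 \<le> n" using j by simp
  let ?C = "cc ` {lo j..j}" and ?D = "cc ` {j + 1..hi (j + 1)}"
  show ?thesis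
  proof (rule good_pairI[where C = ?C and D = ?D])
    show "?C \<inter> ?D = {}" using cc_inj j lo_le by (auto simp: image_iff)
    show "\<And>x y. bs x y \<Longrightarrow> (x \<in> ?C \<longleftrightarrow> y \<in> ?C)"
      by (rule block_closed) (use lo_le lo_black lo_white j in auto)
    show "\<And>x y. bs x y \<Longrightarrow> (x \<in> ?D \<longleftrightarrow> y \<in> ?D)"
      by (rule block_closed) (use hi_ge hi_black hi_white jn j in auto)
    show "\<And>x. x \<in> ?C \<Longrightarrow> x < N \<and> bs\<^sup>*\<^sup>* (cc (lo j)) x"
      using block_reach[of "lo j" j] lo_le lo_black j by auto
    show "\<And>x. x \<in> ?D \<Longrightarrow> x < N \<and> bs\<^sup>*\<^sup>* x (cc (hi (j + 1)))"
      using block_reach[of "j + 1" "hi (j + 1)"] hi_ge[OF jn] hi_black[OF jn] j by auto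
    show "\<And>x y. x \<in> ?C \<Longrightarrow> y \<in> ?D \<Longrightarrow> F x y \<noteq> 0\<^sub>m N N"
      using F_cc_nonzero j by auto
  qed (use j lo_le hi_ge[OF jn] in \<open>auto simp: ced_def\<close>)
qed

text \<open>The basis of the natural module of the smaller ortho-symplectic algebra that remains
  after the first r weights and their reflections are removed.\<close>

definition tail :: "nat \<Rightarrow> nat set" where
  "tail r = {x. x < N \<and> x \<notin> cc ` {..<r} \<and> x \<notin> bar ` cc ` {..<r}}"

lemma os_cover:
  assumes os "x < N"
  shows "(\<exists>k<rk. x = cc k \<or> x = bar (cc k)) \<or> (shape G = ShapeB \<and> x = n)"
proof -
  have r: "rk = n" using assms hdim_os by simp
  have c: "cc k = k \<or> (fl \<and> k = n - 1 \<and> cc k = n)" for k by (auto simp: cc_def)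
  have d: "fl \<Longrightarrow> bar n = n - 1 \<and> bar (n - 1) = n" using D_facts fl by blast
  have a: "\<exists>k<n. y = cc k \<or> y = bar (cc k)" if "y < n" for y
    using c[of y] d that by (intro exI[of _ y]) auto
  show ?thesis
  proof (rule os_index_cases[OF assms])
    show ?thesis if "x < n" using a[OF that] r by simp
    show ?thesis if x: "bar x < n"
    proof -
      obtain k where k: "k < n" "bar x = cc k \<or> bar x = bar (cc k)" using a[OF x] by blast
      then have "x = bar (cc k) \<or> x = cc k" using assms cc_less[of k] r by (metis bar_bar)
      then show ?thesis using k r by auto
    qed
    show ?thesis if "shape G = ShapeB" "x = n" using that by simp
  qed
qed

end

section \<open>The natural module at the end of the diagram\<close>

context good_chain
begin

definition sink :: "nat \<Rightarrow> nat" where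
  "sink r = (if r < n then bar (cc r) else n)"

lemma end_edges:
  assumes "n - 1 \<in> Bl"
  shows "shape G = ShapeB \<Longrightarrow> bs (cc (n - 1)) n \<and> bs n (bar (cc (n - 1)))"
    "shape G = ShapeC \<Longrightarrow> bs (cc (n - 1)) (bar (cc (n - 1)))"
    "shape G = ShapeD \<Longrightarrow> bs (cc (n - 2)) (bar (cc (n - 1))) \<and> bs (cc (n - 1)) (bar (cc (n - 2)))"
proof -
  have n: "n > 0" "n - 1 < n" using assms by (auto simp: Bl_def)
  note b = bs_ced[OF assms]
  show "bs (cc (n - 1)) n \<and> bs n (bar (cc (n - 1)))" if B: "shape G = ShapeB"
  proof -
    have "\<not> fl" "bar n = n" "rk = n" "os" using B fl shape_B_N[OF B] hdim_os by (auto simp: bar_def)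
    then show ?thesis using b bs_bar[OF _ b] B n by (simp add: ced_def cc_def)
  qed
  show "bs (cc (n - 1)) (bar (cc (n - 1)))" if C: "shape G = ShapeC"
  proof -
    have "\<not> fl" "bar (n - 1) = n" "rk = n" "os" using C fl shape_CD_N n hdim_os by (auto simp: bar_def)
    then show ?thesis using b C n by (simp add: ced_def cc_def)
  qed
  show "bs (cc (n - 2)) (bar (cc (n - 1))) \<and> bs (cc (n - 1)) (bar (cc (n - 2)))" if D: "shape G = ShapeD"
  proof -
    have os: os using D by simp
    have l: "n - 1 < rk" "n - 2 < rk" "\<not> n - 1 + 1 < rk" using D_facts[OF D] by auto
    have e: "ced (n - 1) = (cc (n - 2), bar (cc (n - 1)))" using l D by (simp add: ced_def)
    then show ?thesis using b bs_bar[OF os b] cc_less l by simp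
  qed
qed

lemma tail_closed:
  assumes os "r \<le> n" "r > 0 \<Longrightarrow> r - 1 \<notin> Bl" "bs x y"
  shows "x \<in> tail r \<longleftrightarrow> y \<in> tail r"
proof (cases "r = 0")
  case True
  then show ?thesis using bs_less[OF assms(4)] by (simp add: tail_def)
next
  case False
  then have "{..<r} = {0..r - 1}" "r - 1 < rk" using assms hdim_os by auto
  then show ?thesis
    using block_closed[of 0 "r - 1" x y] assms False bs_less[OF assms(4)] by (simp add: tail_def)
qed

text \<open>From the upper half of the tail the black arrows descend along the chain, cross by the
  end node, and descend again through the reflected half. In shape D the crossing leads from
  \<open>n - 2\<close> or \<open>n - 1\<close> to the reflection of the other one, which needs
  \<open>r \<le> n - 2\<close>.\<close>

lemma tail_reach:
  assumes os "{r..<n} \<subseteq> Bl" "r < n \<or> shape G = ShapeB \<and> r = n" "shape G = ShapeD \<Longrightarrow> r \<le> n - 2" "y \<in> tail r"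
  shows "y < N \<and> bs\<^sup>*\<^sup>* y (sink r)"
proof
  show "y < N" using assms by (simp add: tail_def)
  have rn: "rk = n" using assms hdim_os by simp
  have nonmem: "y = cc k \<Longrightarrow> r \<le> k" "y = bar (cc k) \<Longrightarrow> r \<le> k" for k
    using assms(5) by (auto simp: tail_def not_le[symmetric])
  have sub: "{r..<k} \<subseteq> Bl" "{k..<n - 1} \<subseteq> Bl" if "r \<le> k" "k \<le> n" for k
  proof -
    have "{r..<k} \<subseteq> {r..<n}" "{k..<n - 1} \<subseteq> {r..<n}" using that by auto
    then show "{r..<k} \<subseteq> Bl" "{k..<n - 1} \<subseteq> Bl" using assms(2) by blast+
  qed
  have barp: "bs\<^sup>*\<^sup>* (bar (cc k)) (sink r)" if "r \<le> k" "k < n" for k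
    using bs_chain_bar[of r k] sub that rn assms by (simp add: sink_def)
  have last: "n - 1 \<in> Bl" if "r < n" using assms(2) that by auto
  from os_cover[OF assms(1) \<open>y < N\<close>] consider (1) k where "k < n" "y = cc k" | (2) k where "k < n" "y = bar (cc k)" |
    (3) "shape G = ShapeB" "y = n" using rn by auto
  then show "bs\<^sup>*\<^sup>* y (sink r)"
  proof cases
    case 1
    then have k: "r \<le> k" "r < n" using nonmem by (auto intro: le_less_trans)
    have up: "bs\<^sup>*\<^sup>* (cc k) (cc (n - 1))" using bs_chain[of k "n - 1"] sub(2)[OF k(1)] 1 rn by simp
    note E = end_edges[OF last[OF k(2)]]
    consider "shape G = ShapeB" | "shape G = ShapeC" | "shape G = ShapeD" using os_shape assms by blast
    then show ?thesis
    proof cases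
      case a: 1
      have "bs\<^sup>*\<^sup>* (cc k) (bar (cc (n - 1)))" using up E(1)[OF a] by (meson rtranclp.rtrancl_into_rtrancl)
      moreover have "bs\<^sup>*\<^sup>* (bar (cc (n - 1))) (sink r)" by (rule barp) (use k in linarith)+
      ultimately show ?thesis using 1 by simp
    next
      case a: 2
      have "bs\<^sup>*\<^sup>* (cc k) (bar (cc (n - 1)))" using up E(2)[OF a] by (meson rtranclp.rtrancl_into_rtrancl)
      moreover have "bs\<^sup>*\<^sup>* (bar (cc (n - 1))) (sink r)" by (rule barp) (use k in linarith)+
      ultimately show ?thesis using 1 by simp
    next
      case a: 3
      have r2: "r \<le> n - 2" "n \<ge> 2" using assms(4) a D_facts by auto
      have b2: "bs\<^sup>*\<^sup>* (bar (cc (n - 2))) (sink r)" by (rule barp) (use r2 in linarith)+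
      have b1: "bs\<^sup>*\<^sup>* (bar (cc (n - 1))) (sink r)" by (rule barp) (use r2 in linarith)+
      show ?thesis
      proof (cases "k = n - 1")
        case True
        then have "bs (cc k) (bar (cc (n - 2)))" using E(3)[OF a] by simp
        then show ?thesis using b2 1 by (metis converse_rtranclp_into_rtranclp)
      next
        case False
        then have kn: "k \<le> n - 2" "{k..<n - 2} \<subseteq> {k..<n - 1}" "k \<le> n" using 1 by auto
        have "{k..<n - 2} \<subseteq> Bl" by (rule subset_trans[OF kn(2) sub(2)[OF k(1) kn(3)]])
        then have "bs\<^sup>*\<^sup>* (cc k) (cc (n - 2))" using bs_chain[of k "n - 2"] rn 1 r2 kn by simp
        then have "bs\<^sup>*\<^sup>* (cc k) (bar (cc (n - 1)))" using E(3)[OF a] by (meson rtranclp.rtrancl_into_rtrancl)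
        then show ?thesis using b1 1 by simp
      qed
    qed
  next
    case 2
    then show ?thesis using barp nonmem by blast
  next
    case 3
    show ?thesis
    proof (cases "r < n")
      case True
      then have "bs n (bar (cc (n - 1)))" using end_edges(1)[OF last] 3 by blast
      moreover have "bs\<^sup>*\<^sup>* (bar (cc (n - 1))) (sink r)" by (rule barp) (use True in linarith)+
      ultimately show ?thesis using 3 by (metis converse_rtranclp_into_rtranclp)
    next
      case False
      then show ?thesis using 3 by (simp add: sink_def)
    qed
  qed
qed

lemma cc_lo_block:
  assumes "j < rk" "j \<notin> Bl"
  shows "\<And>x y. bs x y \<Longrightarrow> (x \<in> cc ` {lo j..j} \<longleftrightarrow> y \<in> cc ` {lo j..j})"
    "\<And>x. x \<in> cc ` {lo j..j} \<Longrightarrow> x < N \<and> bs\<^sup>*\<^sup>* (cc (lo j)) x"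
  by (rule block_closed) (use lo_le lo_black lo_white assms block_reach[of "lo j" j] in auto)

lemma hp_tail:
  assumes j: "os" "j < n" "j \<notin> Bl" "{j + 1..<n} \<subseteq> Bl" "j + 1 < n \<or> shape G = ShapeB"
  shows "good_pair j (cc (lo j), sink (j + 1))"
proof -
  have rn: "rk = n" using j hdim_os by simp
  \<comment> \<open>For \<open>j = n - 2\<close> the node \<open>n - 1\<close> would be black and
    \<open>n - 2\<close> white, against \<open>nb\<close>.\<close>
  have D: "j + 1 \<le> n - 2" if d: "shape G = ShapeD"
  proof (rule ccontr)
    assume a: "\<not> j + 1 \<le> n - 2"
    have "j + 1 < n" using j(5) d by simp
    then have "n - 1 \<in> Bl" "j = n - 2" using a j(4) by (auto simp: subset_iff)
    then show False using nb[OF d] j(3) by simp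
  qed
  let ?C = "cc ` {lo j..j}"
  show ?thesis
  proof (rule good_pairI[where C = ?C and D = "tail (j + 1)"])
    show "j < n" by fact
    show "fst (ced j) \<in> ?C"
    proof -
      have "fst (ced j) = cc j"
      proof (cases "j + 1 < n")
        case False
        then have "j = n - 1" "shape G = ShapeB" using j by auto
        moreover have "\<not> fl" using fl \<open>shape G = ShapeB\<close> by auto
        ultimately show ?thesis using False rn by (simp add: ced_def cc_def)
      qed (use rn in \<open>simp add: ced_def\<close>)
      then show ?thesis using lo_le by simp
    qed
    show "cc (lo j) \<in> ?C" using lo_le by auto
    show "?C \<inter> tail (j + 1) = {}" by (auto simp: tail_def)
    have ccr: "cc (j + 1) \<in> tail (j + 1)" "bar (cc (j + 1)) \<in> tail (j + 1)" if "j + 1 < n"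
      using that cc_less cc_inj cc_bar rn j bar_inject by (auto simp: tail_def) (metis bar_bar bar_less less_Suc_eq less_trans)+
    have Bn: "n \<in> tail (j + 1)" if B: "shape G = ShapeB"
    proof -
      have nf: "\<not> fl" using B fl by auto
      then have c: "cc k = k" for k by (simp add: cc_def)
      have n: "bar n = n" "n < N" using shape_B_N[OF B] by (auto simp: bar_def)
      have "n \<noteq> bar k" if "k < n" for k using n that bar_bar[of k] by auto
      then show ?thesis using j n by (auto simp: tail_def c)
    qed
    show "snd (ced j) \<in> tail (j + 1)"
      using j rn ccr Bn by (cases "j + 1 < n") (auto simp: ced_def)
    show "sink (j + 1) \<in> tail (j + 1)"
      using j ccr Bn by (cases "j + 1 < n") (auto simp: sink_def)
    show "\<And>x y. bs x y \<Longrightarrow> (x \<in> ?C \<longleftrightarrow> y \<in> ?C)" "\<And>x. x \<in> ?C \<Longrightarrow> x < N \<and> bs\<^sup>*\<^sup>* (cc (lo j)) x"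
      using cc_lo_block[of j] j rn by auto
    show "\<And>x y. bs x y \<Longrightarrow> (x \<in> tail (j + 1) \<longleftrightarrow> y \<in> tail (j + 1))"
      by (rule tail_closed) (use j in auto)
    show "\<And>y. y \<in> tail (j + 1) \<Longrightarrow> y < N \<and> bs\<^sup>*\<^sup>* y (sink (j + 1))"
      by (rule tail_reach) (use j D in auto)
    show "\<And>x y. x \<in> ?C \<Longrightarrow> y \<in> tail (j + 1) \<Longrightarrow> F x y \<noteq> 0\<^sub>m N N"
    proof -
      fix x y assume xy: "x \<in> ?C" "y \<in> tail (j + 1)"
      then have "y \<noteq> bar x" by (auto simp: tail_def)
      then show "F x y \<noteq> 0\<^sub>m N N" using F_nonzero[of x y] xy cc_less j rn by (auto simp: tail_def)
    qed
  qed
qed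

lemma hp_D_white:
  assumes D: "shape G = ShapeD" "n - 1 \<notin> Bl" "n - 2 \<notin> Bl"
  shows "good_pair (n - 1) (cc (lo (n - 2)), bar (cc (n - 1)))"
proof -
  note d = D_facts[OF D(1)]
  have os: os using D by simp
  have l: "n - 2 < rk" "n - 1 < rk" "n - 1 < n" "\<not> n - 1 + 1 < rk" "n - 1 - 1 = n - 2" "n - 2 < n - 1" using d by auto
  let ?C = "cc ` {lo (n - 2)..n - 2}" and ?D = "bar ` cc ` {n - 1..n - 1}"
  show ?thesis
  proof (rule good_pairI[where C = ?C and D = ?D])
    show "\<And>x y. bs x y \<Longrightarrow> (x \<in> ?C \<longleftrightarrow> y \<in> ?C)" "\<And>x. x \<in> ?C \<Longrightarrow> x < N \<and> bs\<^sup>*\<^sup>* (cc (lo (n - 2))) x"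
      using cc_lo_block[of "n - 2"] D l by auto
    show "\<And>x y. bs x y \<Longrightarrow> (x \<in> ?D \<longleftrightarrow> y \<in> ?D)"
      by (rule block_closed(2)) (use D l os in auto)
    have h: "cc x \<noteq> bar (cc (n - 1)) \<and> F (cc x) (bar (cc (n - 1))) \<noteq> 0\<^sub>m N N" if "x \<le> n - 2" for x
      using cc_bar[OF os, of x "n - 1"] F_cc_bar_nonzero[OF os, of x "n - 1"] l that by linarith
    have "bar (cc (n - 1)) \<notin> ?C"
    proof
      assume "bar (cc (n - 1)) \<in> ?C"
      then obtain x where "x \<le> n - 2" "bar (cc (n - 1)) = cc x" by auto
      then show False using h[of x] by simp
    qed
    then show "?C \<inter> ?D = {}" by auto
    show "\<And>x y. x \<in> ?C \<Longrightarrow> y \<in> ?D \<Longrightarrow> F x y \<noteq> 0\<^sub>m N N" using h by auto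
  qed (use l D lo_le cc_less in \<open>auto simp: ced_def\<close>)
qed

text \<open>\<open>highest_weight_components\<close> does not apply, because
  \<open>F x (bar x)\<close> vanishes when \<open>eps x = 1\<close>. The path raises the first index
  completely before it moves the second, which avoids the vanishing pairs, and dominance is checked
  by hand.\<close>

lemma hp_self:
  assumes j: "n - 1 \<notin> Bl" "n > 0" and sh: "shape G = ShapeC \<or> shape G = ShapeD \<and> n - 2 \<in> Bl"
  defines "a \<equiv> lo (n - 1)"
  defines "b \<equiv> (if eps (cc a) = -1 then a else a + 1)"
  shows "good_pair (n - 1) (cc a, bar (cc b))" "b \<le> n - 1"
proof -
  have os: os using sh by auto
  have rn: "rk = n" using os hdim_os by simp
  have a: "a \<le> n - 1" "{a..<n - 1} \<subseteq> Bl" "a > 0 \<Longrightarrow> a - 1 \<notin> Bl" using lo_le lo_black lo_white by (auto simp: a_def)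
  define k0 where "k0 = (if shape G = ShapeC then n - 1 else n - 2)"
  have D: "n \<ge> 2 \<and> n - 2 \<in> Bl" if "shape G = ShapeD" using that sh D_facts by auto
  have ak: "a \<le> k0"
  proof (cases "shape G = ShapeC")
    case False
    then have "shape G = ShapeD" using sh by simp
    then have "n \<ge> 2" "n - 2 \<in> Bl" using D by auto
    have "a \<noteq> n - 1"
    proof
      assume "a = n - 1"
      then have "n - 1 - 1 \<notin> Bl" using a(3) \<open>n \<ge> 2\<close> by auto
      then show False using \<open>n - 2 \<in> Bl\<close> by (simp add: numeral_2_eq_2)
    qed
    then show ?thesis using a False by (simp add: k0_def)
  qed (use a in \<open>simp add: k0_def\<close>)
  have k0: "k0 \<le> n - 1" "k0 < n" using j by (auto simp: k0_def)
  have Ceps: "eps (cc (n - 1)) = -1" if "shape G = ShapeC"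
  proof -
    have "\<not> fl" using that fl by auto
    then show ?thesis using that eps_props(4)[OF os] by (simp add: cc_def)
  qed
  have ced: "ced (n - 1) = (cc k0, bar (cc (n - 1)))"
  proof (cases "shape G = ShapeC")
    case True
    then have "\<not> fl" "bar (n - 1) = n" using fl shape_CD_N j by (auto simp: bar_def)
    then show ?thesis using True rn by (simp add: ced_def cc_def k0_def)
  next
    case False
    then have "\<not> n - 1 + 1 < rk" "shape G = ShapeD" using sh rn j by auto
    then show ?thesis by (simp add: ced_def k0_def)
  qed
  show b: "b \<le> n - 1"
  proof (cases "eps (cc a) = -1")
    case False
    have "a \<noteq> n - 1"
      using Ceps False sh ak D by (auto simp: k0_def split: if_splits)
    then show ?thesis using a by (simp add: b_def)
  qed (use a in \<open>simp add: b_def\<close>)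
  have l: "n - 1 < rk" "a < rk" "b < rk" "k0 < rk" using a b k0 j rn by auto
  have ab: "a \<le> b" by (simp add: b_def)
  have lN: "cc (n - 1) < N" "cc a < N" "cc b < N" using l cc_less by auto
  let ?C = "cc ` {a..n - 1}" and ?D = "bar ` cc ` {a..n - 1}"
  have 1: "step\<^sup>*\<^sup>* (cc k0, bar (cc (n - 1))) (cc a, bar (cc (n - 1)))"
  proof (rule step_left[OF bs_chain_in[of a k0 "cc ` {a..k0}"]])
    show "{a..<k0} \<subseteq> Bl" using a(2) k0 by auto
    fix x assume "x \<in> cc ` {a..k0}"
    then obtain p where p: "p \<le> k0" "x = cc p" "p < rk" using l by auto
    have "p \<noteq> n - 1 \<or> eps (cc p) = -1" using p Ceps k0 sh D by (auto simp: k0_def split: if_splits)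
    then show "x < N \<and> x \<noteq> bar (cc (n - 1)) \<and> F x (bar (cc (n - 1))) \<noteq> 0\<^sub>m N N"
      using F_cc_bar_nonzero[OF os p(3) l(1)] p cc_less[OF p(3)] cc_bar[OF os p(3) l(1)] by simp
  qed (use ak l lN in auto)
  have bD: "{b..<n - 1} \<subseteq> Bl" using a(2) ab by auto
  have 2: "step\<^sup>*\<^sup>* (cc a, bar (cc (n - 1))) (cc a, bar (cc b))"
  proof (rule step_right[OF bs_chain_bar_in[OF os bD b l(1) subset_refl]])
    fix y assume "y \<in> bar ` cc ` {b..n - 1}"
    then obtain q where q: "b \<le> q" "y = bar (cc q)" "q < rk" using l by auto
    have "a \<noteq> q \<or> eps (cc a) = -1" using q by (auto simp: b_def split: if_splits)
    then show "y < N \<and> cc a \<noteq> y \<and> F (cc a) y \<noteq> 0\<^sub>m N N"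
      using F_cc_bar_nonzero[OF os l(2) q(3)] q cc_less[OF q(3)] cc_bar[OF os l(2) q(3)] by simp
  qed (use lN in auto)
  have Fab: "F (cc a) (bar (cc b)) \<noteq> 0\<^sub>m N N"
    by (rule F_cc_bar_nonzero[OF os l(2,3)]) (auto simp: b_def)
  have path: "step\<^sup>*\<^sup>* (ced (n - 1)) (cc a, bar (cc b))" using 1 2 ced by simp
  have Zs: "bs\<^sup>*\<^sup>* (cc p) (cc q)" if "a \<le> p" "p \<le> q" "q \<le> n - 1" for p q
  proof -
    have "{p..<q} \<subseteq> {a..<n - 1}" using that by auto
    then show ?thesis using bs_chain[of p q] a(2) that l by (meson le_less_trans subset_trans)
  qed
  have hw: "highest_weight G P (V_plus G P (wt (cc k0) - wt (bar (cc (n - 1))))) = wt (cc a) - wt (bar (cc b))"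
  proof (rule highest_weight_V_plus[where C = ?C and D = ?D])
    show "step\<^sup>*\<^sup>* (cc k0, bar (cc (n - 1))) (cc a, bar (cc b))" using path ced by simp
    show "(x \<in> ?C \<longleftrightarrow> y \<in> ?C) \<and> (x \<in> ?D \<longleftrightarrow> y \<in> ?D)" if "bs x y" for x y
      using block_closed[of a "n - 1", OF a(1) l(1) j(1) a(3) that] os by blast
    show "?C \<inter> ?D = {}" using cc_bar[OF os] l by auto
    fix x y assume xy: "x \<in> ?C" "y \<in> ?D" "F x y \<noteq> 0\<^sub>m N N"
    then obtain p q where pq: "a \<le> p" "p \<le> n - 1" "x = cc p" "a \<le> q" "q \<le> n - 1" "y = bar (cc q)" by auto
    have lp: "p < rk" "q < rk" using pq l by auto
    have nz: "p \<noteq> q \<or> eps (cc p) = -1" using xy(3) pq lp F_nonzero_bar[OF os, of "cc p"] cc_less by auto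
    have w: "wt (bar (cc i)) = - Z i" if "i < rk" for i using wt_bar[OF os cc_less[OF that]] by (simp add: Z_def)
    \<comment> \<open>The two weights of a pair in the square are interchangeable, so the difference
      from the top can be matched in two ways. The second one is needed when \<open>q = a\<close>
      and \<open>b = a + 1\<close>.\<close>
    have e: "wt (cc a) - wt (bar (cc b)) - (wt x - wt y) = (Z a - Z p) + (Z b - Z q)"
      "wt (cc a) - wt (bar (cc b)) - (wt x - wt y) = (Z a - Z q) + (Z b - Z p)"
      unfolding pq w[OF lp(2)] w[OF l(3)] Z_def[symmetric] by (rule eq_vecI; simp add: Z_def)+
    have le: "Z i - Z k \<in> nonneg_comb G P" if "a \<le> i" "i \<le> k" "k \<le> n - 1" for i k
      unfolding Z_def using nonneg_comb_path[OF Zs[OF that]] .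
    show "wt (cc a) - wt (bar (cc b)) - (wt x - wt y) \<in> nonneg_comb G P"
    proof (cases "b \<le> q")
      case True
      then show ?thesis unfolding e(1) using nonneg_comb_add le pq ab by simp
    next
      case False
      then have "q = a" "b = a + 1" "eps (cc a) \<noteq> -1" using pq by (auto simp: b_def split: if_splits)
      then have "b \<le> p" using nz pq by auto
      then show ?thesis unfolding e(2) using nonneg_comb_add le pq ab by simp
    qed
  qed (use l lN ak k0 cc_less Fab in auto)
  show "good_pair (n - 1) (cc a, bar (cc b))"
    unfolding good_pair_def using path hw ced sr_ced[of "n - 1"] j lN Fab cc_bar[OF os l(2,3)] by simp
qed

lemma hp_good:
  assumes j: "j < n" "j \<notin> Bl"
  shows "good_pair j (hp j)"
proof (cases "j + 1 < rk")
  case True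
  show ?thesis
  proof (cases "hi (j + 1) < rk")
    case h: True
    show ?thesis using hp_chain[OF j True h] True h by (simp add: hp_def)
  next
    case False
    have jn: "j + 1 \<le> n" using j by simp
    have os: os
    proof (rule ccontr)
      assume "\<not> os"
      then show False using False hi_le[OF jn] hdim_A nodes_A N_pos by linarith
    qed
    have rn: "rk = n" using hdim_os os by simp
    have "hi (j + 1) = n" using hi_le[OF jn] False rn by simp
    then have "{j + 1..<n} \<subseteq> Bl" using hi_black[OF jn] by simp
    then show ?thesis using hp_tail[OF os j] True False rn by (simp add: hp_def sink_def)
  qed
next
  case False
  note E = sr_end(1-3)[OF j(1) False]
  consider "shape G = ShapeB" | "shape G = ShapeD" "n - 2 \<notin> Bl" | "shape G = ShapeC \<or> shape G = ShapeD \<and> n - 2 \<in> Bl"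
    using os_shape E(1) by blast
  then show ?thesis
  proof cases
    case 1
    then show ?thesis using hp_tail[OF E(1) j] False E by (simp add: hp_def sink_def)
  next
    case 2
    then show ?thesis using hp_D_white j False E by (simp add: hp_def)
  next
    case 3
    then show ?thesis using hp_self(1) j False E by (auto simp: hp_def)
  qed
qed

end

section \<open>White nodes by number and their highest weights\<close>

context good_chain
begin

definition Wh :: "nat set" where "Wh = {j. j < n \<and> j \<notin> Bl}"

definition TT :: "nat \<Rightarrow> complex vec" where "TT j = wt (fst (hp j)) - wt (snd (hp j))"

lemma WhD: "j \<in> Wh \<Longrightarrow> j < n" "j \<in> Wh \<Longrightarrow> j \<notin> Bl"
  by (auto simp: Wh_def)

lemma white_eq: "white G P = sr ` Wh"
  by (auto simp: simple_roots_sr Wh_def Bl_def)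

lemma sr_white: "j \<in> Wh \<Longrightarrow> sr j \<in> white G P"
  unfolding white_eq by simp

lemma whiteE: "\<alpha> \<in> white G P \<Longrightarrow> (\<And>j. j \<in> Wh \<Longrightarrow> \<alpha> = sr j \<Longrightarrow> thesis) \<Longrightarrow> thesis"
  unfolding white_eq by blast

lemma F_scalar:
  assumes "i < N" "j < N" "i \<noteq> j" "X \<in> root_space G (wt i - wt j)" "X \<noteq> 0\<^sub>m N N"
  obtains a where "a \<noteq> 0" "X = a \<cdot>\<^sub>m F i j"
proof -
  have "F i j \<noteq> 0\<^sub>m N N" "X $$ (i, j) \<noteq> 0" using root_space_unique(2,3) assms by blast+
  moreover have "F i j $$ (i, j) \<noteq> 0" using F_nonzero_iff calculation assms by blast
  ultimately have "X $$ (i, j) / F i j $$ (i, j) \<noteq> 0" "X = (X $$ (i, j) / F i j $$ (i, j)) \<cdot>\<^sub>m F i j"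
    using root_space_unique(1)[OF assms(1-4)] by simp_all
  then show ?thesis by (rule that)
qed

lemma ced_F_nonzero: "j < n \<Longrightarrow> F (fst (ced j)) (snd (ced j)) \<noteq> 0\<^sub>m N N"
proof -
  assume j: "j < n"
  have r: "\<rho> j < n" using \<rho>_less j by blast
  let ?X = "F (fst (ed (\<rho> j))) (snd (ed (\<rho> j)))"
  have "fst (ed (\<rho> j)) < N" "snd (ed (\<rho> j)) < N" using ed_less[OF r] by auto
  then have "?X \<in> root_space G (simple_root G (\<rho> j))"
    unfolding simple_root_eq[OF r] by (rule F_root_space)
  then have "?X \<in> root_space G (wt (fst (ced j)) - wt (snd (ced j)))"
    using sr_ced[OF j] by (simp add: sr_def)
  then show ?thesis using root_space_unique(2)[of "fst (ced j)" "snd (ced j)" ?X] ced_less[OF j] F_ed_nonzero[OF r] by simp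
qed

lemma hp_facts:
  assumes "j \<in> Wh"
  shows "fst (hp j) < N" "snd (hp j) < N" "fst (hp j) \<noteq> snd (hp j)" "F (fst (hp j)) (snd (hp j)) \<noteq> 0\<^sub>m N N"
    "step\<^sup>*\<^sup>* (ced j) (hp j)" "highest_weight G P (V_plus G P (sr j)) = TT j"
    "F (snd (hp j)) (fst (hp j)) \<noteq> 0\<^sub>m N N" "- TT j = wt (snd (hp j)) - wt (fst (hp j))"
  using hp_good[of j] assms F_nonzero_swap wt_minus_uminus by (auto simp: Wh_def good_pair_def TT_def)

end

section \<open>Decorated diagrams\<close>

locale satake = good_chain +
  fixes \<tau> :: "complex vec \<Rightarrow> complex vec"
  assumes \<tau>: "bij_betw \<tau> (white G P) (white G P)"
begin

text \<open>\<open>\<tau>\<close> transported to node numbers, where arguments by order and by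
  maximal elements are available.\<close>

definition \<pi> :: "nat \<Rightarrow> nat" where "\<pi> j = (THE i. i \<in> Wh \<and> sr i = \<tau> (sr j))"

lemma \<pi>: 
  assumes "j \<in> Wh"
  shows "\<pi> j \<in> Wh" "sr (\<pi> j) = \<tau> (sr j)"
proof -
  have "\<tau> (sr j) \<in> sr ` Wh" using bij_betwE[OF \<tau>] assms white_eq by auto
  then obtain i where "i \<in> Wh \<and> sr i = \<tau> (sr j)" by force
  then have "\<exists>!i. i \<in> Wh \<and> sr i = \<tau> (sr j)" using sr_inj WhD by (metis (no_types))
  from theI'[OF this] show "\<pi> j \<in> Wh" "sr (\<pi> j) = \<tau> (sr j)" by (auto simp: \<pi>_def)
qed

lemma \<pi>_inj: "i \<in> Wh \<Longrightarrow> j \<in> Wh \<Longrightarrow> \<pi> i = \<pi> j \<Longrightarrow> i = j"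
  using \<pi>[of i] \<pi>[of j] bij_betw_imp_inj_on[OF \<tau>] white_eq sr_inj WhD by (metis imageI inj_onD)

lemma \<pi>_surj: "i \<in> Wh \<Longrightarrow> \<exists>j\<in>Wh. \<pi> j = i"
proof -
  assume i: "i \<in> Wh"
  then have "sr i \<in> \<tau> ` sr ` Wh" using bij_betw_imp_surj_on[OF \<tau>] white_eq by auto
  then obtain j where "j \<in> Wh" "sr i = \<tau> (sr j)" by auto
  then show ?thesis using \<pi>[of j] sr_inj i WhD by (intro bexI[of _ j]) auto
qed

lemma tilde_sr: "j \<in> Wh \<Longrightarrow> tilde G P \<tau> (sr j) = TT (\<pi> j)"
  using hp_facts(6)[OF \<pi>(1)] \<pi>(2) by (simp add: tilde_def)

definition rooted :: "(complex vec \<Rightarrow> complex mat) \<Rightarrow> (complex vec \<Rightarrow> complex mat) \<Rightarrow> bool" where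
  "rooted e f \<longleftrightarrow> (\<forall>\<alpha>\<in>white G P. e \<alpha> \<in> root_space G \<alpha> - {0\<^sub>m N N} \<and>
     f (tilde G P \<tau> \<alpha>) \<in> root_space G (- tilde G P \<tau> \<alpha>) - {0\<^sub>m N N})"

lemma rooted_exists: "\<exists>e f. rooted e f"
proof -
  have "\<forall>\<alpha>\<in>white G P. \<exists>X. X \<in> root_space G \<alpha> - {0\<^sub>m N N}"
  proof
    fix \<alpha> assume "\<alpha> \<in> white G P"
    then obtain j where j: "j \<in> Wh" "\<alpha> = sr j" by (rule whiteE)
    note jn = WhD(1)[OF j(1)]
    have "F (fst (ced j)) (snd (ced j)) \<in> root_space G \<alpha>"
      unfolding j(2) sr_ced[OF jn] using ced_less[OF jn] by simp
    then show "\<exists>X. X \<in> root_space G \<alpha> - {0\<^sub>m N N}" using ced_F_nonzero[OF jn] by blast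
  qed
  then obtain e where e: "\<forall>\<alpha>\<in>white G P. e \<alpha> \<in> root_space G \<alpha> - {0\<^sub>m N N}" by (meson bchoice)
  have "\<forall>\<xi>\<in>tilde G P \<tau> ` white G P. \<exists>X. X \<in> root_space G (- \<xi>) - {0\<^sub>m N N}"
  proof
    fix \<xi> assume "\<xi> \<in> tilde G P \<tau> ` white G P"
    then obtain \<alpha> where "\<alpha> \<in> white G P" "\<xi> = tilde G P \<tau> \<alpha>" by blast
    then obtain j where j: "j \<in> Wh" "\<xi> = TT (\<pi> j)" using tilde_sr by (metis whiteE)
    note h = hp_facts[OF \<pi>(1)[OF j(1)]]
    have "F (snd (hp (\<pi> j))) (fst (hp (\<pi> j))) \<in> root_space G (- \<xi>)"
      unfolding j(2) h(8) using h(1,2) by simp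
    then show "\<exists>X. X \<in> root_space G (- \<xi>) - {0\<^sub>m N N}" using h(7) by blast
  qed
  then obtain f where f: "\<forall>\<xi>\<in>tilde G P \<tau> ` white G P. f \<xi> \<in> root_space G (- \<xi>) - {0\<^sub>m N N}" by (meson bchoice)
  have "rooted e f" unfolding rooted_def using e f by blast
  then show ?thesis by blast
qed

lemma rooted_scalars:
  assumes "rooted e f" "j \<in> Wh"
  obtains a b where "a \<noteq> 0" "b \<noteq> 0" "e (sr j) = a \<cdot>\<^sub>m F (fst (ced j)) (snd (ced j))"
    "f (TT (\<pi> j)) = b \<cdot>\<^sub>m F (snd (hp (\<pi> j))) (fst (hp (\<pi> j)))"
proof -
  have r: "e (sr j) \<in> root_space G (sr j)" "e (sr j) \<noteq> 0\<^sub>m N N"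
    "f (TT (\<pi> j)) \<in> root_space G (- TT (\<pi> j))" "f (TT (\<pi> j)) \<noteq> 0\<^sub>m N N"
    using assms(1) sr_white[OF assms(2)] unfolding rooted_def tilde_sr[OF assms(2), symmetric] by blast+
  note j = WhD(1)[OF assms(2)]
  note h = hp_facts[OF \<pi>(1)[OF assms(2)]]
  obtain a where a: "a \<noteq> 0" "e (sr j) = a \<cdot>\<^sub>m F (fst (ced j)) (snd (ced j))"
    using F_scalar r(1,2) ced_less[OF j] unfolding sr_ced[OF j] by metis
  obtain b where "b \<noteq> 0" "f (TT (\<pi> j)) = b \<cdot>\<^sub>m F (snd (hp (\<pi> j))) (fst (hp (\<pi> j)))"
    using F_scalar r(3,4) h(1-3) unfolding h(8) by metis
  then show ?thesis using that a by blast
qed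

definition gens :: "(complex vec \<Rightarrow> complex mat) \<Rightarrow> (complex vec \<Rightarrow> complex mat) \<Rightarrow> (complex vec \<Rightarrow> complex) \<Rightarrow> complex mat set" where
  "gens e f c = levi G P \<union> {e \<alpha> + c \<alpha> \<cdot>\<^sub>m f (tilde G P \<tau> \<alpha>) |\<alpha>. \<alpha> \<in> white G P} \<union>
     {h_vec G \<alpha> - h_vec G (tilde G P \<tau> \<alpha>) |\<alpha>. \<alpha> \<in> white G P}"

lemma gens_lie: "rooted e f \<Longrightarrow> gens e f c \<subseteq> lie_alg G"
proof -
  assume r: "rooted e f"
  have sm: "a \<cdot>\<^sub>m X \<in> lie_alg G" if "X \<in> lie_alg G" for a X
    using that lie_alg_graded unfolding graded_subspace_def by blast
  have ad: "X + Y \<in> lie_alg G" if "X \<in> lie_alg G" "Y \<in> lie_alg G" for X Y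
    using that lie_alg_graded unfolding graded_subspace_def by blast
  have mi: "X - Y \<in> lie_alg G" if "X \<in> lie_alg G" "Y \<in> lie_alg G" for X Y
  proof -
    have "X - Y = X + (-1) \<cdot>\<^sub>m Y" by (rule eq_matI) (use that in auto)
    then show ?thesis using ad sm that by metis
  qed
  have "h_vec G \<xi> \<in> lie_alg G" for \<xi> using hmat_cartan by (simp add: h_vec_eq cartan_def)
  then have 1: "h_vec G \<alpha> - h_vec G \<xi> \<in> lie_alg G" for \<alpha> \<xi> using mi by blast
  have 2: "e \<alpha> + c \<alpha> \<cdot>\<^sub>m f (tilde G P \<tau> \<alpha>) \<in> lie_alg G" if "\<alpha> \<in> white G P" for \<alpha>
    using r that ad sm root_space_lie_alg unfolding rooted_def by (metis DiffD1)
  show ?thesis unfolding gens_def using levi_lie 1 2 by blast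
qed

lemma k_alg_gens: "k_alg G P \<tau> e f c = generated_subalgebra G (gens e f c)"
  by (simp add: k_alg_def gens_def)

text \<open>For a white node i the generator to use is the one at its preimage j under
  \<open>\<pi>\<close>. Its lower term is a root vector for minus the highest weight at i and its
  upper term lies in \<open>nn 0\<close>; walking back along the path of i then gives the negative
  simple root vector modulo \<open>nn 0\<close>.\<close>

lemma k_alg_spherical:
  assumes r: "rooted e f" and c: "\<And>\<alpha>. \<alpha> \<in> white G P \<Longrightarrow> c \<alpha> \<noteq> 0"
  shows "subalgebra G (k_alg G P \<tau> e f c)" "spherical G (k_alg G P \<tau> e f c)"
proof -
  let ?K = "k_alg G P \<tau> e f c"
  note K = generated_subalgebra_props(1,2)[OF gens_lie[OF r, of c], folded k_alg_gens]
  show "subalgebra G ?K" by (rule K)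
  have Ksm: "\<And>X a. X \<in> ?K \<Longrightarrow> a \<cdot>\<^sub>m X \<in> ?K"
    using K(1) unfolding subalgebra_def graded_subspace_def by blast
  have lK: "levi G P \<subseteq> ?K" using K(2) by (simp add: gens_def)
  show "spherical G ?K"
  proof (rule lie_alg_eq_K_plus_borel[OF K(1) lK])
    fix k assume k: "k < n" "simple_root G k \<notin> P"
    define i where "i = \<rho> k"
    have i: "i < n" "sr i = simple_root G k" using \<rho>_less \<rho>_\<rho> k by (auto simp: i_def sr_def)
    then have iW: "i \<in> Wh" using k by (auto simp: Wh_def Bl_def)
    obtain j where j: "j \<in> Wh" "\<pi> j = i" using \<pi>_surj[OF iW] by blast
    obtain a b where ab: "a \<noteq> 0" "b \<noteq> 0" "e (sr j) = a \<cdot>\<^sub>m F (fst (ced j)) (snd (ced j))"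
      "f (TT i) = b \<cdot>\<^sub>m F (snd (hp i)) (fst (hp i))"
      using rooted_scalars[OF r j(1)] j(2) by metis
    have cj: "c (sr j) \<noteq> 0" using c sr_white[OF j(1)] by blast
    let ?z = "inverse (c (sr j) * b)"
    have x: "e (sr j) + c (sr j) \<cdot>\<^sub>m f (TT i) \<in> ?K"
      using K(2) sr_white[OF j(1)] unfolding gens_def tilde_sr[OF j(1), unfolded j(2), symmetric] by blast
    have jn: "j < n" using j WhD by blast
    have Fnn: "F (fst (ced j)) (snd (ced j)) \<in> nn 0"
    proof -
      have rj: "\<rho> j < n" using \<rho>_less jn by blast
      have eqw: "wt (fst (ed (\<rho> j))) - wt (snd (ed (\<rho> j))) = wt (fst (ced j)) - wt (snd (ced j))"
        using simple_root_eq[OF rj] sr_ced[OF jn] by (simp add: sr_def)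
      have cs: "(fst (ced j) = fst (ed (\<rho> j)) \<and> snd (ced j) = snd (ed (\<rho> j))) \<or>
          (os \<and> fst (ced j) = bar (snd (ed (\<rho> j))) \<and> snd (ced j) = bar (fst (ed (\<rho> j))))"
        by (intro wt_diff_cases[OF _ _ _ _ _ eqw]) (use ed_less[OF rj] ced_less[OF jn] in auto)
      have "ht (fst (ed (\<rho> j))) \<ge> ht (snd (ed (\<rho> j)))" "fst (ed (\<rho> j)) < N" "snd (ed (\<rho> j)) < N"
        using ed_less[OF rj] by (auto simp: ht_def)
      then have "ht (fst (ced j)) - ht (snd (ced j)) \<ge> 0"
        using cs ht_bar by (elim disjE) force+
      then show ?thesis using F_nn ced_less[OF jn] by simp
    qed
    have "?z \<cdot>\<^sub>m (e (sr j) + c (sr j) \<cdot>\<^sub>m f (TT i)) \<in> ?K" using Ksm x by blast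
    also have "?z \<cdot>\<^sub>m (e (sr j) + c (sr j) \<cdot>\<^sub>m f (TT i)) =
        F (snd (hp i)) (fst (hp i)) + (?z * a) \<cdot>\<^sub>m F (fst (ced j)) (snd (ced j))"
      unfolding ab(3,4) using ab(2) cj by (intro eq_matI) (simp_all add: field_simps)
    finally have 1: "F (snd (hp i)) (fst (hp i)) + (?z * a) \<cdot>\<^sub>m F (fst (ced j)) (snd (ced j)) \<in> ?K" .
    have "\<exists>U\<in>nn 0. F (snd (ced i)) (fst (ced i)) + U \<in> ?K"
    proof (rule white_lower_in_K[of "fst (ced i)" "snd (ced i)" "fst (hp i)" "snd (hp i)"])
      show "step\<^sup>*\<^sup>* (fst (ced i), snd (ced i)) (fst (hp i), snd (hp i))" using hp_facts(5)[OF iW] by simp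
      show "(?z * a) \<cdot>\<^sub>m F (fst (ced j)) (snd (ced j)) \<in> nn 0" using nn_smult Fnn by blast
    qed (use ced_less[OF i(1)] K(1) lK 1 in auto)
    then obtain U where U: "U \<in> nn 0" "F (snd (ced i)) (fst (ced i)) + U \<in> ?K" by blast
    have eqw: "wt (fst (ed k)) - wt (snd (ed k)) = wt (fst (ced i)) - wt (snd (ced i))"
      using simple_root_eq[OF k(1)] sr_ced[OF i(1)] i(2) by simp
    have cs: "(fst (ced i) = fst (ed k) \<and> snd (ced i) = snd (ed k)) \<or>
          (os \<and> fst (ced i) = bar (snd (ed k)) \<and> snd (ced i) = bar (fst (ed k)))"
      by (intro wt_diff_cases[OF _ _ _ _ _ eqw]) (use ed_less[OF k(1)] ced_less[OF i(1)] in auto)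
    show "\<exists>U\<in>nn 0. F (snd (ed k)) (fst (ed k)) + U \<in> ?K"
      using cs
    proof
      assume "fst (ced i) = fst (ed k) \<and> snd (ced i) = snd (ed k)"
      then show ?thesis using U by auto
    next
      assume a: "os \<and> fst (ced i) = bar (snd (ed k)) \<and> snd (ced i) = bar (fst (ed k))"
      have l: "fst (ed k) < N" "snd (ed k) < N" using ed_less[OF k(1)] by auto
      let ?s = "t (snd (ed k)) (fst (ed k))"
      have "F (snd (ed k)) (fst (ed k)) = ?s \<cdot>\<^sub>m F (snd (ced i)) (fst (ced i))"
        using F_bars[of "bar (fst (ed k))" "bar (snd (ed k))"] a l by simp
      then have "F (snd (ed k)) (fst (ed k)) + ?s \<cdot>\<^sub>m U = ?s \<cdot>\<^sub>m (F (snd (ced i)) (fst (ced i)) + U)"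
        using add_smult_distrib_left_mat[OF F_carrier lie_alg_carrier[OF nn_lie[OF U(1)]]] by metis
      then show ?thesis using Ksm[OF U(2)] nn_smult[OF U(1)] by metis
    qed
  qed
qed

lemma k_alg_subset:
  assumes r: "rooted e f" and S: "subalgebra G S" and levi: "\<And>k l. bs k l \<Longrightarrow> F k l \<in> S \<and> F l k \<in> S"
    and x: "\<And>j. j \<in> Wh \<Longrightarrow> e (sr j) + c (sr j) \<cdot>\<^sub>m f (TT (\<pi> j)) \<in> S"
    and y: "\<And>j. j \<in> Wh \<Longrightarrow> hmat (sr j) - hmat (TT (\<pi> j)) \<in> S"
  shows "k_alg G P \<tau> e f c \<subseteq> S"
  unfolding k_alg_gens
proof (rule generated_subalgebra_props(3)[OF gens_lie[OF r] S])
  show "gens e f c \<subseteq> S"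
  proof -
    have "e \<alpha> + c \<alpha> \<cdot>\<^sub>m f (tilde G P \<tau> \<alpha>) \<in> S \<and> h_vec G \<alpha> - h_vec G (tilde G P \<tau> \<alpha>) \<in> S" if "\<alpha> \<in> white G P" for \<alpha>
      using that by (rule whiteE) (simp add: tilde_sr h_vec_eq x y)
    then show ?thesis unfolding gens_def using levi_least[OF S levi] by blast
  qed
qed

end

section \<open>The supertrace for shape A\<close>

context good_chain
begin

definition str :: "complex mat \<Rightarrow> complex" where
  "str X = (\<Sum>i<N. (-1) ^ pr i * X $$ (i, i))"

text \<open>Since \<open>(-1) ^ pr i * sg i k i = (-1) ^ pr k\<close>, exchanging the two summation
  indices turns the second product of the bracket into the first.\<close>

lemma str_sbracket:
  assumes "X \<in> carrier_mat N N" "Y \<in> carrier_mat N N"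
  shows "str (sbracket G X Y) = 0"
proof -
  have "str (sbracket G X Y) = (\<Sum>i<N. \<Sum>k<N. (-1) ^ pr i * (X $$ (i, k) * Y $$ (k, i))) -
      (\<Sum>i<N. \<Sum>k<N. (-1) ^ pr i * (sg i k i * (Y $$ (i, k) * X $$ (k, i))))"
    unfolding str_def using assms
    by (simp add: sbracket_index sum_distrib_left right_diff_distrib sum_subtractf)
  also have "(\<Sum>i<N. \<Sum>k<N. (-1) ^ pr i * (sg i k i * (Y $$ (i, k) * X $$ (k, i)))) =
      (\<Sum>i<N. \<Sum>k<N. (-1) ^ pr k * (X $$ (k, i) * Y $$ (i, k)))"
  proof (intro sum.cong refl)
    fix i k assume "i \<in> {..<N}" "k \<in> {..<N}"
    then have "(-1) ^ pr i * sg i k i = (-1) ^ pr k"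
      using pr_cases[of i] pr_cases[of k] by (auto simp: sg_def)
    then show "(-1) ^ pr i * (sg i k i * (Y $$ (i, k) * X $$ (k, i))) = (-1) ^ pr k * (X $$ (k, i) * Y $$ (i, k))"
      by (simp add: mult.assoc[symmetric] mult.commute[of "Y $$ (i, k)"])
  qed
  also have "\<dots> = (\<Sum>k<N. \<Sum>i<N. (-1) ^ pr k * (X $$ (k, i) * Y $$ (i, k)))" by (rule sum.swap)
  finally show ?thesis by simp
qed

lemma str_subalgebra: "subalgebra G {X \<in> lie_alg G. str X = 0}"
proof -
  note L = lie_alg_graded[unfolded graded_subspace_def]
  have "str (X + Y) = str X + str Y" if "X \<in> lie_alg G" "Y \<in> lie_alg G" for X Y
    using that by (simp add: str_def sum.distrib distrib_left)
  moreover have "str (a \<cdot>\<^sub>m X) = a * str X" if "X \<in> lie_alg G" for X a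
    using that by (simp add: str_def sum_distrib_left mult_ac)
  moreover have "str (even_part G X) = str X" for X by (simp add: str_def even_part_def)
  moreover have "str (0\<^sub>m N N) = 0" by (simp add: str_def)
  ultimately show ?thesis unfolding subalgebra_def graded_subspace_def
    using L sbracket_lie_alg str_sbracket by auto
qed

end

context satake
begin

lemma shape_A_proper:
  assumes A: "\<not> os" and r: "rooted e f"
  shows "k_alg G P \<tau> e f c \<noteq> lie_alg G"
proof -
  let ?S = "{X \<in> lie_alg G. str X = 0}"
  have Fs: "str (F k l) = 0" if "k \<noteq> l" for k l
    using that A unfolding str_def by (intro sum.neutral) (auto simp: F_def)
  have hs: "str (hmat (wt a - wt b)) = 0" if "a < N" "b < N" for a b
  proof -
    \<comment> \<open>The sign of the inner product cancels that of the supertrace. What is left is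
      the sum of the coordinates, which is zero for a difference of two weights.\<close>
    have "str (hmat \<xi>) = (\<Sum>i<N. \<xi> $ i)" for \<xi>
      using hdim_A[OF A] by (simp add: str_def hmat_def inner_h_wt_left mult.assoc[symmetric] neg_one_power_mult_self)
    moreover have "(\<Sum>i<N. wt x $ i) = 1" if "x < N" for x
      using that A hdim_A[OF A] by (subst sum_left_unit[where c = x]) (auto simp: wt_index)
    ultimately show ?thesis using that hdim_A[OF A] by (simp add: sum_subtractf)
  qed
  have "k_alg G P \<tau> e f c \<subseteq> ?S"
  proof (rule k_alg_subset[OF r str_subalgebra])
    show "F k l \<in> ?S \<and> F l k \<in> ?S" if "bs k l" for k l
      using Fs bs_F[OF that] bs_less[OF that] by auto
    fix j assume j: "j \<in> Wh"
    note jn = WhD(1)[OF j] and h = hp_facts[OF \<pi>(1)[OF j]]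
    obtain a b where ab: "e (sr j) = a \<cdot>\<^sub>m F (fst (ced j)) (snd (ced j))"
      "f (TT (\<pi> j)) = b \<cdot>\<^sub>m F (snd (hp (\<pi> j))) (fst (hp (\<pi> j)))" using rooted_scalars[OF r j] by metis
    have "str (e (sr j) + c (sr j) \<cdot>\<^sub>m f (TT (\<pi> j))) =
        a * str (F (fst (ced j)) (snd (ced j))) + c (sr j) * b * str (F (snd (hp (\<pi> j))) (fst (hp (\<pi> j))))"
      unfolding ab by (simp add: str_def sum.distrib distrib_left sum_distrib_left mult_ac)
    moreover have "e (sr j) + c (sr j) \<cdot>\<^sub>m f (TT (\<pi> j)) \<in> gens e f c"
      using sr_white[OF j] unfolding gens_def tilde_sr[OF j, symmetric] by blast
    moreover have "str (F (fst (ced j)) (snd (ced j))) = 0" "str (F (snd (hp (\<pi> j))) (fst (hp (\<pi> j)))) = 0"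
      using Fs ced_less[OF jn] h(3) by metis+
    ultimately show "e (sr j) + c (sr j) \<cdot>\<^sub>m f (TT (\<pi> j)) \<in> ?S"
      using subsetD[OF gens_lie[OF r]] by simp
    have "str (hmat (sr j) - hmat (TT (\<pi> j))) = str (hmat (sr j)) - str (hmat (TT (\<pi> j)))"
      by (simp add: str_def sum_subtractf right_diff_distrib hmat_def)
    moreover have "hmat (sr j) - hmat (TT (\<pi> j)) \<in> gens e f c"
      using sr_white[OF j] unfolding gens_def tilde_sr[OF j, symmetric] h_vec_eq by blast
    moreover have "str (hmat (sr j)) = 0" "str (hmat (TT (\<pi> j))) = 0"
      unfolding sr_ced[OF jn] TT_def using hs ced_less[OF jn] h(1,2) by blast+
    ultimately show "hmat (sr j) - hmat (TT (\<pi> j)) \<in> ?S"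
      using subsetD[OF gens_lie[OF r]] by simp
  qed
  moreover have "str (F 0 0) = (-1) ^ pr 0"
    unfolding str_def by (subst sum_left_unit[where c = 0]) (use A in \<open>auto simp: F_def\<close>)
  then have "F 0 0 \<notin> ?S" by simp
  ultimately show ?thesis using F_lie_alg[of 0 0] N_pos by blast
qed

end

section \<open>The stabiliser of a graph\<close>

context good_chain
begin

text \<open>The reversal of each block, in a form that is correct for blocks of at most two
  elements; \<open>wstab\<close> admits no longer ones below r.\<close>

definition mir :: "nat \<Rightarrow> nat" where
  "mir k = (if k \<in> Bl then k + 1 else if 0 < k \<and> k - 1 \<in> Bl then k - 1 else k)"

definition act :: "complex mat \<Rightarrow> (nat \<Rightarrow> complex) \<Rightarrow> nat \<Rightarrow> complex" where
  "act X u i = (\<Sum>j<N. X $$ (i, j) * u j)"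

lemma act_mult:
  assumes "X \<in> carrier_mat N N" "Y \<in> carrier_mat N N" "i < N"
  shows "act (X * Y) u i = act X (act Y u) i"
proof -
  have "act (X * Y) u i = (\<Sum>j<N. (\<Sum>k<N. X $$ (i, k) * Y $$ (k, j)) * u j)"
    unfolding act_def using assms
    by (intro sum.cong refl arg_cong2[where f = "(*)"]) (auto simp: scalar_prod_def atLeast0LessThan)
  also have "\<dots> = (\<Sum>j<N. \<Sum>k<N. X $$ (i, k) * Y $$ (k, j) * u j)" by (simp add: sum_distrib_right)
  also have "\<dots> = (\<Sum>k<N. \<Sum>j<N. X $$ (i, k) * Y $$ (k, j) * u j)" by (rule sum.swap)
  also have "\<dots> = act X (act Y u) i" unfolding act_def by (simp add: sum_distrib_left mult.assoc)
  finally show ?thesis .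
qed

lemma act_add: "X \<in> carrier_mat N N \<Longrightarrow> Y \<in> carrier_mat N N \<Longrightarrow> i < N \<Longrightarrow> act (X + Y) u i = act X u i + act Y u i"
  by (simp add: act_def distrib_right sum.distrib)

lemma act_minus: "X \<in> carrier_mat N N \<Longrightarrow> Y \<in> carrier_mat N N \<Longrightarrow> i < N \<Longrightarrow> act (X - Y) u i = act X u i - act Y u i"
  by (simp add: act_def left_diff_distrib sum_subtractf)

lemma act_smult: "X \<in> carrier_mat N N \<Longrightarrow> i < N \<Longrightarrow> act (a \<cdot>\<^sub>m X) u i = a * act X u i"
  by (simp add: act_def sum_distrib_left mult.assoc)

lemma act_F:
  assumes "i < N" "j < N" "x < N"
  shows "act (F i j) u x = of_bool (x = i) * u j + (if os \<and> x = bar j then t i j * u (bar i) else 0)"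
proof -
  have "act (F i j) u x = (\<Sum>y<N. (if y = j then of_bool (x = i) * u j else 0) +
      (if y = bar i then (if os \<and> x = bar j then t i j * u (bar i) else 0) else 0))"
    unfolding act_def using assms by (intro sum.cong) (auto simp: F_index distrib_right)
  then show ?thesis using assms by (simp add: sum.distrib sum.delta)
qed

end

text \<open>The subspace W consists of the vectors that vanish on the tail and whose coordinate at
  \<open>bar (cc k)\<close> is \<open>\<kappa> k\<close> times the one at \<open>cc (mir k)\<close>.
  Equal parities inside a block make W graded, and \<open>\<kappa>blk\<close> is the condition for
  the black root vectors to preserve it.\<close>

locale wstab = good_chain +
  fixes r :: nat and \<kappa> :: "nat \<Rightarrow> complex"
  assumes osT: os
    and r: "0 < r" "r \<le> n"
    and blk: "\<And>k. k \<in> Bl \<Longrightarrow> k < r \<Longrightarrow> k + 1 < r \<and> k + 1 \<notin> Bl \<and> pr (cc (k + 1)) = pr (cc k)"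
    and \<kappa>nz: "\<And>k. k < r \<Longrightarrow> \<kappa> k \<noteq> 0"
    and \<kappa>blk: "\<And>k. k \<in> Bl \<Longrightarrow> k < r \<Longrightarrow> \<kappa> (k + 1) = t (cc k) (cc (k + 1)) * \<kappa> k"
begin

lemma rn: "rk = n" using osT hdim_os by simp

lemma cN: "k < r \<Longrightarrow> cc k < N" using cc_less r rn by simp

lemma mir_less: "k < r \<Longrightarrow> mir k < r"
  using blk by (auto simp: mir_def)

lemma mir_mir: "k < r \<Longrightarrow> mir (mir k) = k"
  using blk by (auto simp: mir_def)

lemma mir_pr: "k < r \<Longrightarrow> pr (cc (mir k)) = pr (cc k)"
  using blk[of "k - 1"] blk[of k] by (auto simp: mir_def)

definition inW :: "(nat \<Rightarrow> complex) \<Rightarrow> bool" where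
  "inW u \<longleftrightarrow> (\<forall>k<r. u (bar (cc k)) = \<kappa> k * u (cc (mir k))) \<and> (\<forall>x\<in>tail r. u x = 0)"

definition stabW :: "complex mat set" where
  "stabW = {X \<in> lie_alg G. \<forall>u. inW u \<longrightarrow> inW (act X u)}"

lemma inW_cong: "inW u \<Longrightarrow> (\<And>x. x < N \<Longrightarrow> v x = u x) \<Longrightarrow> inW v"
  unfolding inW_def using cN mir_less by (auto simp: tail_def)

lemma inW_comb: "inW u \<Longrightarrow> inW v \<Longrightarrow> inW (\<lambda>x. a * u x + b * v x)"
  unfolding inW_def by (auto simp: algebra_simps)

lemma inW_part: "inW u \<Longrightarrow> inW (\<lambda>x. if pr x = p then u x else 0)"
  unfolding inW_def using cN mir_less mir_pr pr_bar[OF osT] by auto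

text \<open>W is graded, so the parity components of a matrix that preserves W preserve it too.
  Matrices preserving W are closed under products, and the bracket is composed of these
  operations.\<close>

lemma stabW_subalgebra: "subalgebra G stabW"
proof -
  note L = lie_alg_graded[unfolded graded_subspace_def]
  have inW_Z: "inW (\<lambda>x. 0)" by (simp add: inW_def)
  let ?S = "{X \<in> carrier_mat N N. \<forall>u. inW u \<longrightarrow> inW (act X u)}"
  have add: "X + Y \<in> ?S" if "X \<in> ?S" "Y \<in> ?S" for X Y
  proof -
    have "inW (act (X + Y) u)" if "inW u" for u
      by (rule inW_cong[OF inW_comb[of "act X u" "act Y u" 1 1]])
        (use \<open>X \<in> ?S\<close> \<open>Y \<in> ?S\<close> that in \<open>auto simp: act_add\<close>)
    then show ?thesis using that by auto
  qed
  have minus: "X - Y \<in> ?S" if "X \<in> ?S" "Y \<in> ?S" for X Y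
  proof -
    have "inW (act (X - Y) u)" if "inW u" for u
      by (rule inW_cong[OF inW_comb[of "act X u" "act Y u" 1 "-1"]])
        (use \<open>X \<in> ?S\<close> \<open>Y \<in> ?S\<close> that in \<open>auto simp: act_minus\<close>)
    then show ?thesis using that by auto
  qed
  have smult: "a \<cdot>\<^sub>m X \<in> ?S" if "X \<in> ?S" for X a
  proof -
    have "inW (act (a \<cdot>\<^sub>m X) u)" if "inW u" for u
      by (rule inW_cong[OF inW_comb[of "act X u" "act X u" a 0]])
        (use \<open>X \<in> ?S\<close> that in \<open>auto simp: act_smult\<close>)
    then show ?thesis using that by auto
  qed
  have mult: "X * Y \<in> ?S" if "X \<in> ?S" "Y \<in> ?S" for X Y
  proof -
    have "inW (act (X * Y) u)" if "inW u" for u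
      by (rule inW_cong[of "act X (act Y u)"])
        (use \<open>X \<in> ?S\<close> \<open>Y \<in> ?S\<close> that in \<open>auto simp: act_mult\<close>)
    then show ?thesis using that by auto
  qed
  have even: "even_part G X \<in> ?S" if "X \<in> ?S" for X
  proof -
    have "inW (act (even_part G X) u)" if u: "inW u" for u
    proof -
      define v where "v p x = (if pr x = p then u x else 0)" for p x
      have v: "inW (\<lambda>x. if pr x = p then act X (v p) x else 0)" for p
      proof -
        have "inW (v p)" using inW_part[OF u, of p] by (simp add: v_def[abs_def])
        then have "inW (act X (v p))" using \<open>X \<in> ?S\<close> by blast
        then show ?thesis by (rule inW_part)
      qed
      have split: "act (even_part G X) u x =
          1 * (if pr x = 0 then act X (v 0) x else 0) + 1 * (if pr x = 1 then act X (v 1) x else 0)" if "x < N" for x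
        unfolding act_def v_def using pr_cases[OF that] that
        by (auto simp: even_part_def intro!: sum.cong)
      show ?thesis by (rule inW_cong[OF inW_comb[OF v[of 0] v[of 1], of 1 1]]) (rule split)
    qed
    then show ?thesis by simp
  qed
  have odd: "odd_part G X \<in> ?S" if "X \<in> ?S" for X
  proof -
    have "odd_part G X = X - even_part G X"
      by (rule eq_matI) (use that in \<open>auto simp: odd_part_def even_part_def\<close>)
    then show ?thesis using minus[OF that even[OF that]] by simp
  qed
  have br: "sbracket G X Y \<in> ?S" if "X \<in> ?S" "Y \<in> ?S" for X Y
    unfolding sbracket_def by (intro minus add mult even odd that)
  have S: "stabW = lie_alg G \<inter> ?S" by (auto simp: stabW_def)
  have "act (0\<^sub>m N N) u x = 0" if "x < N" for u x using that by (simp add: act_def)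
  then have Z: "0\<^sub>m N N \<in> ?S" using inW_cong[OF inW_Z] by simp
  show ?thesis unfolding subalgebra_def graded_subspace_def S
  proof (intro conjI ballI allI IntI Int_lower1)
    fix X assume X: "X \<in> lie_alg G \<inter> ?S"
    have X': "X \<in> lie_alg G" "X \<in> ?S" using X by (rule IntD1, rule IntD2)
    show "even_part G X \<in> lie_alg G" using L X'(1) by blast
    show "a \<cdot>\<^sub>m X \<in> lie_alg G" for a using L X'(1) by blast
    show "even_part G X \<in> ?S" by (rule even[OF X'(2)])
    show "a \<cdot>\<^sub>m X \<in> ?S" for a by (rule smult[OF X'(2)])
    fix Y assume Y: "Y \<in> lie_alg G \<inter> ?S"
    have Y': "Y \<in> lie_alg G" "Y \<in> ?S" using Y by (rule IntD1, rule IntD2)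
    show "X + Y \<in> lie_alg G" using L X'(1) Y'(1) by blast
    show "sbracket G X Y \<in> lie_alg G" by (rule sbracket_lie_alg[OF X'(1) Y'(1)])
    show "X + Y \<in> ?S" by (rule add[OF X'(2) Y'(2)])
    show "sbracket G X Y \<in> ?S" by (rule br[OF X'(2) Y'(2)])
  next
    show "0\<^sub>m N N \<in> lie_alg G" using L by blast
    show "0\<^sub>m N N \<in> ?S" by (rule Z)
  qed
qed

lemma tailD: "x \<in> tail r \<Longrightarrow> x < N \<and> bar x \<in> tail r \<and> bar x < N"
proof -
  assume x: "x \<in> tail r"
  then have xN: "x < N" by (simp add: tail_def)
  have "bar x \<noteq> cc k" "bar x \<noteq> bar (cc k)" if k: "k < r" for k
  proof -
    show "bar x \<noteq> cc k"
    proof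
      assume "bar x = cc k"
      then have "x = bar (cc k)" using xN bar_bar by metis
      then show False using x k by (auto simp: tail_def)
    qed
    show "bar x \<noteq> bar (cc k)" using x k xN cN[OF k] bar_inject by (auto simp: tail_def)
  qed
  then show ?thesis using xN by (auto simp: tail_def)
qed

lemma tail_cc: "x \<in> tail r \<Longrightarrow> k < r \<Longrightarrow> x \<noteq> cc k \<and> x \<noteq> bar (cc k) \<and> cc k \<noteq> x \<and> bar (cc k) \<noteq> x \<and> cc k \<noteq> bar x \<and> bar (cc k) \<noteq> bar x"
proof -
  have h: "y \<noteq> cc k \<and> y \<noteq> bar (cc k)" if "y \<in> tail r" "k < r" for y using that by (auto simp: tail_def)
  assume "x \<in> tail r" "k < r"
  then show ?thesis using h[of x] h[of "bar x"] tailD[of x] by metis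
qed

lemma cc_distinct:
  assumes "k < r" "i < r"
  shows "cc k = cc i \<longleftrightarrow> k = i" "bar (cc k) = bar (cc i) \<longleftrightarrow> k = i" "cc k \<noteq> bar (cc i)" "bar (cc k) \<noteq> cc i"
  using cc_inj[of k i] cc_bar[OF osT, of k i] cc_bar[OF osT, of i k] assms r rn bar_inject cN by auto

lemma stabWI:
  assumes "X \<in> lie_alg G"
    and "\<And>u k. \<lbrakk>\<And>k. k < r \<Longrightarrow> u (bar (cc k)) = \<kappa> k * u (cc (mir k)); \<And>x. x \<in> tail r \<Longrightarrow> u x = 0; k < r\<rbrakk> \<Longrightarrow>
      act X u (bar (cc k)) = \<kappa> k * act X u (cc (mir k))"
    and "\<And>u x. \<lbrakk>\<And>k. k < r \<Longrightarrow> u (bar (cc k)) = \<kappa> k * u (cc (mir k)); \<And>x. x \<in> tail r \<Longrightarrow> u x = 0; x \<in> tail r\<rbrakk> \<Longrightarrow>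
      act X u x = 0"
  shows "X \<in> stabW"
  using assms unfolding stabW_def inW_def by blast

lemma act_F_cc:
  assumes "i < r" "j < r" "k < r"
  shows "act (F (cc i) (cc j)) u (cc k) = of_bool (k = i) * u (cc j)"
    "act (F (cc i) (cc j)) u (bar (cc k)) = of_bool (k = j) * (t (cc i) (cc j) * u (bar (cc i)))"
  using assms cN osT by (auto simp: act_F cc_distinct)

lemma act_F_cc_tail:
  assumes "i < r" "j < r" "x \<in> tail r"
  shows "act (F (cc i) (cc j)) u x = 0" "act (F (cc i) (bar (cc j))) u x = 0" "act (F (bar (cc i)) (cc j)) u x = 0"
  using assms cN osT tailD[OF assms(3)] tail_cc[OF assms(3)] by (auto simp: act_F)

text \<open>Such a matrix reads only coordinates in the tail, hence it annihilates W.\<close>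

lemma stab_F_tail:
  assumes "x \<in> tail r" "y \<in> tail r"
  shows "F x y \<in> stabW"
proof (rule stabWI)
  have xy: "x < N" "y < N" using tailD assms by auto
  show "F x y \<in> lie_alg G" using xy by simp
  fix u assume u: "\<And>k. k < r \<Longrightarrow> u (bar (cc k)) = \<kappa> k * u (cc (mir k))" "\<And>x. x \<in> tail r \<Longrightarrow> u x = 0"
  have z: "u y = 0" "u (bar x) = 0" using u(2) tailD assms by auto
  then have "act (F x y) u w = 0" if "w < N" for w
    using that xy by (simp add: act_F)
  then show "\<And>k. k < r \<Longrightarrow> act (F x y) u (bar (cc k)) = \<kappa> k * act (F x y) u (cc (mir k))"
    "\<And>w. w \<in> tail r \<Longrightarrow> act (F x y) u w = 0"
    using cN mir_less tailD by auto
qed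

text \<open>Equal parities give \<open>t (cc (k + 1)) (cc k) * t (cc k) (cc (k + 1)) = 1\<close>, so
  the single relation \<open>\<kappa>blk\<close> serves both the raising and the lowering
  vector.\<close>

lemma stab_black:
  assumes k: "k \<in> Bl" "k < r"
  shows "F (cc k) (cc (k + 1)) \<in> stabW" "F (cc (k + 1)) (cc k) \<in> stabW"
proof -
  have b: "k + 1 < r" "k + 1 \<notin> Bl" "pr (cc (k + 1)) = pr (cc k)" using blk[OF k] by auto
  have m: "mir k = k + 1" "mir (k + 1) = k" using k b by (auto simp: mir_def)
  have mi: "mir j = k + 1 \<longleftrightarrow> j = k" "mir j = k \<longleftrightarrow> j = k + 1" if "j < r" for j
    using mir_mir[OF that] m by auto
  have tt: "t (cc (k + 1)) (cc k) * t (cc k) (cc (k + 1)) = 1"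
    using t_mult[OF osT cN[OF b(1)] cN[OF k(2)] cN[OF b(1)]] t_self[OF osT cN[OF b(1)]] b(3)
    by (simp add: sg_def flip: mult_2)
  have kk: "\<kappa> (k + 1) = t (cc k) (cc (k + 1)) * \<kappa> k" using \<kappa>blk[OF k] .
  have kk': "\<kappa> k = t (cc (k + 1)) (cc k) * \<kappa> (k + 1)" unfolding kk using tt by (simp add: mult.assoc[symmetric])
  show "F (cc k) (cc (k + 1)) \<in> stabW"
  proof (rule stabWI)
    fix u j assume u: "\<And>k. k < r \<Longrightarrow> u (bar (cc k)) = \<kappa> k * u (cc (mir k))" and j: "j < r"
    show "act (F (cc k) (cc (k + 1))) u (bar (cc j)) = \<kappa> j * act (F (cc k) (cc (k + 1))) u (cc (mir j))"
      using act_F_cc[OF k(2) b(1)] mir_less[OF j] j mi[OF j] u[OF k(2)] m kk by auto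
  qed (use act_F_cc_tail(1)[OF k(2) b(1)] k b cN in auto)
  show "F (cc (k + 1)) (cc k) \<in> stabW"
  proof (rule stabWI)
    fix u j assume u: "\<And>k. k < r \<Longrightarrow> u (bar (cc k)) = \<kappa> k * u (cc (mir k))" and j: "j < r"
    show "act (F (cc (k + 1)) (cc k)) u (bar (cc j)) = \<kappa> j * act (F (cc (k + 1)) (cc k)) u (cc (mir j))"
      using act_F_cc[OF b(1) k(2)] mir_less[OF j] j mi[OF j] u[OF b(1)] m kk' by auto
  qed (use act_F_cc_tail(1)[OF b(1) k(2)] k b cN in auto)
qed

lemma stab_smult: "X \<in> stabW \<Longrightarrow> a \<cdot>\<^sub>m X \<in> stabW"
  using stabW_subalgebra unfolding subalgebra_def graded_subspace_def by blast

lemma FF_lie: "i < N \<Longrightarrow> j < N \<Longrightarrow> k < N \<Longrightarrow> l < N \<Longrightarrow> F i j + C \<cdot>\<^sub>m F k l \<in> lie_alg G"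
  using lie_alg_graded F_lie_alg unfolding graded_subspace_def by blast

lemma act_FF: "i < N \<Longrightarrow> j < N \<Longrightarrow> k < N \<Longrightarrow> l < N \<Longrightarrow> x < N \<Longrightarrow>
    act (F i j + C \<cdot>\<^sub>m F k l) u x = act (F i j) u x + C * act (F k l) u x"
  by (simp add: act_add act_smult)

text \<open>The two conditions on C compare coefficients at \<open>j = i + 1\<close> and at
  \<open>j = mir i\<close>, the only indices where the relation defining W is not trivially
  satisfied by the image.\<close>

lemma stab_white:
  assumes i: "i \<notin> Bl" "i + 1 < r"
    and C: "C * \<kappa> (i + 1) = t (cc i) (cc (i + 1)) * \<kappa> i"
      "C * t (cc (mir (i + 1))) (cc (mir i)) * \<kappa> (mir (i + 1)) = \<kappa> (mir i)"
  shows "F (cc i) (cc (i + 1)) + C \<cdot>\<^sub>m F (cc (mir (i + 1))) (cc (mir i)) \<in> stabW"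
proof (rule stabWI)
  have l: "i < r" "i + 1 < r" "mir i < r" "mir (i + 1) < r" using i mir_less by auto
  show "F (cc i) (cc (i + 1)) + C \<cdot>\<^sub>m F (cc (mir (i + 1))) (cc (mir i)) \<in> lie_alg G"
    using FF_lie cN l by blast
  note a = act_FF[OF cN[OF l(1)] cN[OF l(2)] cN[OF l(4)] cN[OF l(3)]]
  fix u assume u: "\<And>k. k < r \<Longrightarrow> u (bar (cc k)) = \<kappa> k * u (cc (mir k))"
  show "act (F (cc i) (cc (i + 1)) + C \<cdot>\<^sub>m F (cc (mir (i + 1))) (cc (mir i))) u x = 0" if "x \<in> tail r" for x
    unfolding a[OF conjunct1[OF tailD[OF that]]] using act_F_cc_tail(1)[OF l(1,2) that] act_F_cc_tail(1)[OF l(4,3) that] by simp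
  fix j assume j: "j < r"
  have ne: "mir i \<noteq> i + 1" "mir (i + 1) \<noteq> i" using i by (auto simp: mir_def)
  have mm: "mir j = i \<longleftrightarrow> j = mir i" "mir j = mir (i + 1) \<longleftrightarrow> j = i + 1"
    using mir_mir[OF j] mir_mir[OF l(1)] mir_mir[OF l(2)] by metis+
  have u1: "u (bar (cc i)) = \<kappa> i * u (cc (mir i))" "u (bar (cc (mir (i + 1)))) = \<kappa> (mir (i + 1)) * u (cc (i + 1))"
    using u[OF l(1)] u[OF l(4)] mir_mir[OF l(2)] by auto
  have L: "act (F (cc i) (cc (i + 1)) + C \<cdot>\<^sub>m F (cc (mir (i + 1))) (cc (mir i))) u (bar (cc j)) =
     of_bool (j = i + 1) * (t (cc i) (cc (i + 1)) * \<kappa> i * u (cc (mir i))) +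
     of_bool (j = mir i) * (C * t (cc (mir (i + 1))) (cc (mir i)) * \<kappa> (mir (i + 1)) * u (cc (i + 1)))"
    unfolding a[OF bar_less[OF cN[OF j]]] act_F_cc(2)[OF l(1,2) j] act_F_cc(2)[OF l(4,3) j] u1
    by (cases "j = i + 1"; cases "j = mir i") simp_all
  have R: "act (F (cc i) (cc (i + 1)) + C \<cdot>\<^sub>m F (cc (mir (i + 1))) (cc (mir i))) u (cc (mir j)) =
     of_bool (j = mir i) * u (cc (i + 1)) + of_bool (j = i + 1) * (C * u (cc (mir i)))"
    unfolding a[OF cN[OF mir_less[OF j]]] act_F_cc(1)[OF l(1,2) mir_less[OF j]] act_F_cc(1)[OF l(4,3) mir_less[OF j]] mm
    by (cases "j = i + 1"; cases "j = mir i") simp_all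
  show "act (F (cc i) (cc (i + 1)) + C \<cdot>\<^sub>m F (cc (mir (i + 1))) (cc (mir i))) u (bar (cc j)) =
    \<kappa> j * act (F (cc i) (cc (i + 1)) + C \<cdot>\<^sub>m F (cc (mir (i + 1))) (cc (mir i))) u (cc (mir j))"
    unfolding L R C(2) using C(1) ne by (cases "j = i + 1"; cases "j = mir i") (auto simp: mult_ac)
qed

text \<open>On W both terms produce a multiple of the basis vector at \<open>bar l\<close>, which
  lies in the tail. Their sum must therefore vanish on W, which is one linear equation.\<close>

lemma stab_white_tail:
  assumes l: "l \<in> tail r" and C: "t (cc (r - 1)) l * \<kappa> (r - 1) + C = 0"
  shows "F (cc (r - 1)) l + C \<cdot>\<^sub>m F (bar l) (cc (mir (r - 1))) \<in> stabW"
proof (rule stabWI)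
  let ?i = "r - 1"
  have i: "?i < r" "mir ?i < r" using r mir_less by auto
  have lN: "l < N" "bar l < N" "bar l \<in> tail r" using tailD l by auto
  show "F (cc ?i) l + C \<cdot>\<^sub>m F (bar l) (cc (mir ?i)) \<in> lie_alg G" using FF_lie cN i lN by blast
  note a = act_FF[OF cN[OF i(1)] lN(1) lN(2) cN[OF i(2)]]
  fix u assume u: "\<And>k. k < r \<Longrightarrow> u (bar (cc k)) = \<kappa> k * u (cc (mir k))" "\<And>x. x \<in> tail r \<Longrightarrow> u x = 0"
  have z: "u l = 0" "u (bar l) = 0" "u (bar (bar l)) = 0" using u(2) l lN by auto
  have v: "act (F (cc ?i) l + C \<cdot>\<^sub>m F (bar l) (cc (mir ?i))) u x = of_bool (x = bar l) * ((t (cc ?i) l * \<kappa> ?i + C) * u (cc (mir ?i)))"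
    if "x < N" for x
    using a[OF that] u(1)[OF i(1)] z that lN cN[OF i(1)] cN[OF i(2)] osT by (simp add: act_F distrib_right)
  then have v0: "act (F (cc ?i) l + C \<cdot>\<^sub>m F (bar l) (cc (mir ?i))) u x = 0" if "x < N" for x
    using that C by simp
  show "\<And>k. k < r \<Longrightarrow> act (F (cc ?i) l + C \<cdot>\<^sub>m F (bar l) (cc (mir ?i))) u (bar (cc k)) =
     \<kappa> k * act (F (cc ?i) l + C \<cdot>\<^sub>m F (bar l) (cc (mir ?i))) u (cc (mir k))"
    "\<And>x. x \<in> tail r \<Longrightarrow> act (F (cc ?i) l + C \<cdot>\<^sub>m F (bar l) (cc (mir ?i))) u x = 0"
    using v0 cN mir_less tailD by auto
qed

lemma act_F_cc_bar:
  assumes "i < r" "j < r" "k < r"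
  shows "act (F (cc i) (bar (cc j))) u (cc k) = of_bool (k = i) * u (bar (cc j)) + of_bool (k = j) * (t (cc i) (bar (cc j)) * u (bar (cc i)))"
    "act (F (cc i) (bar (cc j))) u (bar (cc k)) = 0"
    "act (F (bar (cc i)) (cc j)) u (cc k) = 0"
    "act (F (bar (cc i)) (cc j)) u (bar (cc k)) = of_bool (k = i) * u (cc j) + of_bool (k = j) * (t (bar (cc i)) (cc j) * u (cc i))"
  using assms cN osT by (auto simp: act_F cc_distinct)

text \<open>
  The end generators: a root vector of \<open>Z i + Z j\<close> together with one of \<open>- Z p - Z q\<close>, where \<open>mir\<close> maps
  \<open>{i, j}\<close> to \<open>{p, q}\<close>.
\<close>

lemma stab_white_end:
  assumes l: "i < r" "j < r"
    and C: "C * 1 = \<kappa> (mir j) * (t (cc i) (bar (cc j)) * \<kappa> i)" "C * t (bar (cc (mir j))) (cc (mir i)) = \<kappa> (mir i) * \<kappa> j" "i \<noteq> j"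
  shows "F (cc i) (bar (cc j)) + C \<cdot>\<^sub>m F (bar (cc (mir j))) (cc (mir i)) \<in> stabW"
proof (rule stabWI)
  have m: "mir i < r" "mir j < r" using l mir_less by auto
  have N: "bar (cc j) < N" "bar (cc (mir j)) < N" using cN l m by auto
  show "F (cc i) (bar (cc j)) + C \<cdot>\<^sub>m F (bar (cc (mir j))) (cc (mir i)) \<in> lie_alg G" using FF_lie cN l m N by blast
  note a = act_FF[OF cN[OF l(1)] N cN[OF m(1)]]
  fix u assume u: "\<And>k. k < r \<Longrightarrow> u (bar (cc k)) = \<kappa> k * u (cc (mir k))"
  show "act (F (cc i) (bar (cc j)) + C \<cdot>\<^sub>m F (bar (cc (mir j))) (cc (mir i))) u x = 0" if "x \<in> tail r" for x
    using that tailD act_F_cc_tail l m by (simp add: a)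
  fix k assume k: "k < r"
  have mm: "mir k = i \<longleftrightarrow> k = mir i" "mir k = j \<longleftrightarrow> k = mir j" "mir i \<noteq> mir j"
    using mir_mir[OF k] mir_mir[OF l(1)] mir_mir[OF l(2)] C(3) by auto
  have L: "act (F (cc i) (bar (cc j)) + C \<cdot>\<^sub>m F (bar (cc (mir j))) (cc (mir i))) u (bar (cc k)) =
     of_bool (k = mir j) * (C * u (cc (mir i))) + of_bool (k = mir i) * (C * t (bar (cc (mir j))) (cc (mir i)) * u (cc (mir j)))"
    unfolding a[OF bar_less[OF cN[OF k]]] act_F_cc_bar(2)[OF l k] act_F_cc_bar(4)[OF m(2,1) k]
    by (simp add: distrib_left mult_ac)
  have R: "act (F (cc i) (bar (cc j)) + C \<cdot>\<^sub>m F (bar (cc (mir j))) (cc (mir i))) u (cc (mir k)) =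
     of_bool (k = mir i) * (\<kappa> j * u (cc (mir j))) + of_bool (k = mir j) * (t (cc i) (bar (cc j)) * (\<kappa> i * u (cc (mir i))))"
    unfolding a[OF cN[OF mir_less[OF k]]] act_F_cc_bar(1)[OF l mir_less[OF k]] act_F_cc_bar(3)[OF m(2,1) mir_less[OF k]]
      mm(1,2) u[OF l(1)] u[OF l(2)] by simp
  show "act (F (cc i) (bar (cc j)) + C \<cdot>\<^sub>m F (bar (cc (mir j))) (cc (mir i))) u (bar (cc k)) =
     \<kappa> k * act (F (cc i) (bar (cc j)) + C \<cdot>\<^sub>m F (bar (cc (mir j))) (cc (mir i))) u (cc (mir k))"
    unfolding L R using C mm by (cases "k = mir i"; cases "k = mir j") (auto simp: mult_ac)
qed

text \<open>For equal indices both terms of \<open>F\<close> occupy one entry and double it, so the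
  two conditions of the general end generator collapse into one.\<close>

lemma stab_white_end_C:
  assumes i: "i < r" and eps: "eps (cc i) = -1" "eps (cc (mir i)) = -1" and C: "C = \<kappa> (mir i) * \<kappa> i"
  shows "F (cc i) (bar (cc i)) + C \<cdot>\<^sub>m F (bar (cc (mir i))) (cc (mir i)) \<in> stabW"
proof (rule stabWI)
  have m: "mir i < r" using i mir_less by auto
  have N: "bar (cc i) < N" "bar (cc (mir i)) < N" using cN i m by auto
  have t1: "t (cc i) (bar (cc i)) = 1" using t_bar[OF osT cN[OF i]] eps by simp
  have t2: "t (bar (cc (mir i))) (cc (mir i)) = 1"
    using t_bar[OF osT N(2)] eps eps_props(6)[OF osT cN[OF m]] cN[OF m] by simp
  show "F (cc i) (bar (cc i)) + C \<cdot>\<^sub>m F (bar (cc (mir i))) (cc (mir i)) \<in> lie_alg G" using FF_lie cN i m N by blast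
  note a = act_FF[OF cN[OF i] N cN[OF m]]
  fix u assume u: "\<And>k. k < r \<Longrightarrow> u (bar (cc k)) = \<kappa> k * u (cc (mir k))"
  show "act (F (cc i) (bar (cc i)) + C \<cdot>\<^sub>m F (bar (cc (mir i))) (cc (mir i))) u x = 0" if "x \<in> tail r" for x
    using that tailD act_F_cc_tail i m by (simp add: a)
  fix k assume k: "k < r"
  have mm: "mir k = i \<longleftrightarrow> k = mir i" using mir_mir[OF k] mir_mir[OF i] by auto
  show "act (F (cc i) (bar (cc i)) + C \<cdot>\<^sub>m F (bar (cc (mir i))) (cc (mir i))) u (bar (cc k)) =
     \<kappa> k * act (F (cc i) (bar (cc i)) + C \<cdot>\<^sub>m F (bar (cc (mir i))) (cc (mir i))) u (cc (mir k))"
    unfolding a[OF bar_less[OF cN[OF k]]] a[OF cN[OF mir_less[OF k]]] act_F_cc_bar(2)[OF i i k]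
      act_F_cc_bar(4)[OF m m k] act_F_cc_bar(1)[OF i i mir_less[OF k]] act_F_cc_bar(3)[OF m m mir_less[OF k]]
      mm u[OF i] C t1 t2 by (cases "k = mir i") simp_all
qed

text \<open>A diagonal matrix preserves W if its eigenvalues agree on linked coordinates, and these
  have the weights \<open>Z (mir k)\<close> and \<open>- Z k\<close>.\<close>

lemma stab_cartan:
  assumes "\<And>k. k < r \<Longrightarrow> inner_h G (Z k + Z (mir k)) \<xi> = inner_h G (Z k + Z (mir k)) \<eta>"
  shows "hmat \<xi> - hmat \<eta> \<in> stabW"
proof (rule stabWI)
  have hl: "hmat \<xi> \<in> lie_alg G" for \<xi> using hmat_cartan by (simp add: cartan_def)
  have "hmat \<xi> - hmat \<eta> = hmat \<xi> + (-1) \<cdot>\<^sub>m hmat \<eta>" by (rule eq_matI) (auto simp: hmat_def)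
  then show "hmat \<xi> - hmat \<eta> \<in> lie_alg G"
    using hl lie_alg_graded unfolding graded_subspace_def by metis
  have ah: "act (hmat \<xi> - hmat \<eta>) u x = (inner_h G (wt x) \<xi> - inner_h G (wt x) \<eta>) * u x" if "x < N" for u x
    unfolding act_def by (subst sum_left_unit[where c = x]) (use that in \<open>auto simp: hmat_def\<close>)
  fix u :: "nat \<Rightarrow> complex" assume u: "\<And>k. k < r \<Longrightarrow> u (bar (cc k)) = \<kappa> k * u (cc (mir k))"
  show "act (hmat \<xi> - hmat \<eta>) u x = 0" if "\<And>x. x \<in> tail r \<Longrightarrow> u x = 0" "x \<in> tail r" for x
    using that tailD ah by simp
  fix k assume k: "k < r"
  have "inner_h G (Z k) \<xi> + inner_h G (Z (mir k)) \<xi> = inner_h G (Z k) \<eta> + inner_h G (Z (mir k)) \<eta>"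
    using assms[OF k] by (simp add: inner_h_add_left)
  then have e: "inner_h G (wt (cc (mir k))) \<xi> - inner_h G (wt (cc (mir k))) \<eta> = - (inner_h G (wt (cc k)) \<xi> - inner_h G (wt (cc k)) \<eta>)"
    by (simp add: Z_def algebra_simps)
  show "act (hmat \<xi> - hmat \<eta>) u (bar (cc k)) = \<kappa> k * act (hmat \<xi> - hmat \<eta>) u (cc (mir k))"
    using ah cN[OF k] cN[OF mir_less[OF k]] u[OF k] e wt_bar[OF osT cN[OF k]]
    by (simp add: inner_h_uminus_left)
qed

text \<open>This matrix has eigenvalue -1 at \<open>bar (cc 0)\<close>, but 1 or 0 at the coordinate
  linked to it, according to whether 0 is its own mirror image.\<close>

lemma stabW_proper: "F (cc 0) (cc 0) \<notin> stabW"
proof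
  assume "F (cc 0) (cc 0) \<in> stabW"
  define m where "m = mir 0"
  have r0: "0 < r" and m: "m < r" "mir m = 0" using r mir_less mir_mir by (auto simp: m_def)
  define u where "u x = (if x = cc m then 1 else if x = bar (cc 0) then \<kappa> 0 else 0)" for x
  have mk: "mir k = m \<longleftrightarrow> k = 0" if "k < r" for k using mir_mir[OF that] m by (auto simp: m_def)
  have "inW u"
    unfolding inW_def u_def
    using cc_distinct[OF _ r0] cc_distinct[OF _ m(1)] mk mir_less tail_cc[OF _ r0] tail_cc[OF _ m(1)] by auto
  then have "inW (act (F (cc 0) (cc 0)) u)" using \<open>F (cc 0) (cc 0) \<in> stabW\<close> by (simp add: stabW_def)
  then have "act (F (cc 0) (cc 0)) u (bar (cc 0)) = \<kappa> 0 * act (F (cc 0) (cc 0)) u (cc m)"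
    using r0 by (auto simp: inW_def m_def)
  then have "t (cc 0) (cc 0) * u (bar (cc 0)) = \<kappa> 0 * (of_bool (m = 0) * u (cc 0))"
    using act_F_cc[OF r0 r0 r0] act_F_cc(1)[OF r0 r0 m(1)] by simp
  moreover have "u (bar (cc 0)) = \<kappa> 0" using cc_distinct[OF r0 m(1)] cc_distinct(4)[OF r0 m(1)] by (simp add: u_def)
  moreover have "m = 0 \<Longrightarrow> u (cc 0) = 1" by (simp add: u_def)
  ultimately show False using t_self[OF osT cN[OF r0]] \<kappa>nz[OF r0] by (cases "m = 0") auto
qed

end

section \<open>Super-symmetric triples\<close>

lemma sym_antisym_zero:
  fixes a b c d :: complex
  assumes "a + c - (b + d) = 0" "a + b - (c + d) = 0"
  shows "a = d" "c = b"
proof -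
  have "2 * (a - d) = (a + c - (b + d)) + (a + b - (c + d))" by simp
  then show "a = d" using assms by simp
  then show "c = b" using assms by simp
qed

text \<open>
  The last assumption can be achieved by the flip; without it the exceptional permutation of
   \<open>\<ss>\<oo>(8)\<close> would occur in two versions.
\<close>

locale osat = satake +
  assumes osT: "shape G \<noteq> ShapeA"
    and SS: "super_symmetric G P \<tau>"
    and wl: "shape G = ShapeD \<Longrightarrow> nodes G - 1 \<in> Wh \<Longrightarrow> nodes G - 2 \<in> Wh \<Longrightarrow> \<pi> (nodes G - 2) < nodes G - 2 \<Longrightarrow>
      \<pi> (nodes G - 1) < nodes G - 2"
begin

abbreviation ip where "ip \<equiv> inner_h G"

lemma rn: "rk = n" using osT hdim_os by simp

lemma iZ: "k < n \<Longrightarrow> j < n \<Longrightarrow> ip (Z k) (Z j) = (if k = j then sn k else 0)"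
  using inner_Z rn by simp

lemmas ips = inner_h_linear iZ

lemma s_cases: "k < n \<Longrightarrow> sn k = 1 \<or> sn k = -1"
  using sn_cases rn by simp

lemma s_nz: "k < n \<Longrightarrow> sn k \<noteq> 0"
  using s_cases by fastforce

lemma Wh_iff: "j \<in> Wh \<longleftrightarrow> j < n \<and> j \<notin> Bl"
  by (simp add: Wh_def)

lemma Bl_less: "j \<in> Bl \<Longrightarrow> j < n"
  by (simp add: Bl_def)

lemma sr_c: "j + 1 < n \<Longrightarrow> sr j = Z j - Z (j + 1)"
  using sr_chain rn by simp

lemma sr_e:
  assumes "n > 0"
  shows "shape G = ShapeB \<Longrightarrow> sr (n - 1) = Z (n - 1)"
    "shape G = ShapeC \<Longrightarrow> sr (n - 1) = Z (n - 1) + Z (n - 1)"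
    "shape G = ShapeD \<Longrightarrow> sr (n - 1) = Z (n - 2) + Z (n - 1)"
  using sr_end[of "n - 1"] assms rn by auto

lemma wt_bar_Z: "k < n \<Longrightarrow> wt (bar (cc k)) = - Z k"
  using wt_bar[OF osT cc_less] rn by (simp add: Z_def)

lemma vec_minus_uminus: "x \<in> carrier_vec m \<Longrightarrow> y \<in> carrier_vec m \<Longrightarrow> x - - y = x + (y :: complex vec)"
  by (rule eq_vecI) auto

lemma TT_c: "u + 1 < n \<Longrightarrow> hi (u + 1) < n \<Longrightarrow> TT u = Z (lo u) - Z (hi (u + 1))"
  using rn by (simp add: TT_def hp_def Z_def)

lemma TT_t: "u + 1 < n \<Longrightarrow> \<not> hi (u + 1) < n \<Longrightarrow> TT u = Z (lo u) + Z (u + 1)"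
  using rn wt_bar_Z[of "u + 1"] vec_minus_uminus[OF Z_carrier Z_carrier]
  by (simp add: TT_def hp_def Z_def[symmetric])

lemma TT_B: "n > 0 \<Longrightarrow> shape G = ShapeB \<Longrightarrow> TT (n - 1) = Z (lo (n - 1))"
proof -
  assume B: "n > 0" "shape G = ShapeB"
  have "bar n = n" "n < N" using shape_B_N[OF B(2)] by (auto simp: bar_def)
  then have w: "wt n = 0\<^sub>v rk" using wt_mid osT by simp
  have "hp (n - 1) = (cc (lo (n - 1)), n)" using B rn by (simp add: hp_def)
  then have "TT (n - 1) = Z (lo (n - 1)) - 0\<^sub>v rk" by (simp add: TT_def w Z_def[symmetric])
  also have "\<dots> = Z (lo (n - 1))" by (rule eq_vecI) (auto simp: carrier_vecD[OF Z_carrier])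
  finally show ?thesis .
qed

lemma TT_D: "shape G = ShapeD \<Longrightarrow> n - 2 \<notin> Bl \<Longrightarrow> TT (n - 1) = Z (lo (n - 2)) + Z (n - 1)"
  using rn wt_bar_Z[of "n - 1"] vec_minus_uminus[OF Z_carrier Z_carrier] D_facts
  by (simp add: TT_def hp_def Z_def[symmetric])

lemma TT_self:
  assumes "n > 0" "n - 1 \<notin> Bl" "shape G = ShapeC \<or> shape G = ShapeD \<and> n - 2 \<in> Bl"
  shows "\<exists>b. (b = lo (n - 1) \<or> b = lo (n - 1) + 1) \<and> b < n \<and> TT (n - 1) = Z (lo (n - 1)) + Z b \<and>
    hp (n - 1) = (cc (lo (n - 1)), bar (cc b))"
proof -
  define b where "b = (if eps (cc (lo (n - 1))) = -1 then lo (n - 1) else lo (n - 1) + 1)"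
  have b: "b < n" using hp_self(2)[OF assms(2,1,3)] assms(1) by (simp add: b_def)
  have hp: "hp (n - 1) = (cc (lo (n - 1)), bar (cc b))" using assms rn by (auto simp: hp_def b_def)
  have "TT (n - 1) = Z (lo (n - 1)) + Z b"
    unfolding TT_def hp using wt_bar_Z[OF b] vec_minus_uminus[OF Z_carrier Z_carrier]
    by (simp add: Z_def[symmetric])
  then show ?thesis using b hp by (auto simp: b_def)
qed

lemma TT_carrier [simp]: "TT u \<in> carrier_vec rk" and sr_carrier: "j < n \<Longrightarrow> sr j \<in> carrier_vec rk"
  by (simp_all add: TT_def sr_ced)

lemma super_sym_black: "i \<in> Wh \<Longrightarrow> j \<in> Bl \<Longrightarrow> ip (sr i) (sr j) + ip (TT (\<pi> i)) (sr j) = 0"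
proof -
  assume a: "i \<in> Wh" "j \<in> Bl"
  then have "sr j \<in> P" by (simp add: Bl_def)
  then have "ip (sr i + TT (\<pi> i)) (sr j) = 0"
    using SS sr_white[OF a(1)] unfolding super_symmetric_def tilde_sr[OF a(1), symmetric] by blast
  then show ?thesis using sr_carrier WhD(1)[OF a(1)] by (simp add: inner_h_linear)
qed

text \<open>The condition for (i, j) and the one for (j, i) are combined. Their sum says that
  passing to the highest weights is an isometry, their difference that the mixed products are
  symmetric.\<close>

lemma super_sym_white:
  assumes a: "i \<in> Wh" "j \<in> Wh"
  shows "ip (sr i) (sr j) = ip (TT (\<pi> i)) (TT (\<pi> j))" "ip (TT (\<pi> i)) (sr j) = ip (sr i) (TT (\<pi> j))"
proof -
  have "ip (sr i + TT (\<pi> i)) (sr j - TT (\<pi> j)) = 0" "ip (sr j + TT (\<pi> j)) (sr i - TT (\<pi> i)) = 0"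
    using SS sr_white[OF a(1)] sr_white[OF a(2)] tilde_sr[OF a(1)] tilde_sr[OF a(2)]
    unfolding super_symmetric_def by metis+
  then have "ip (sr i) (sr j) + ip (TT (\<pi> i)) (sr j) - (ip (sr i) (TT (\<pi> j)) + ip (TT (\<pi> i)) (TT (\<pi> j))) = 0"
    "ip (sr i) (sr j) + ip (sr i) (TT (\<pi> j)) - (ip (TT (\<pi> i)) (sr j) + ip (TT (\<pi> i)) (TT (\<pi> j))) = 0"
    using sr_carrier[OF WhD(1)[OF a(1)]] sr_carrier[OF WhD(1)[OF a(2)]]
      inner_h_sym[of "sr j" "sr i"] inner_h_sym[of "sr j" "TT (\<pi> i)"] inner_h_sym[of "TT (\<pi> j)" "sr i"]
      inner_h_sym[of "TT (\<pi> j)" "TT (\<pi> i)"]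
    by (simp_all only: inner_h_linear TT_carrier add_carrier_vec minus_carrier_vec)
  then show "ip (sr i) (sr j) = ip (TT (\<pi> i)) (TT (\<pi> j))" "ip (TT (\<pi> i)) (sr j) = ip (sr i) (TT (\<pi> j))"
    using sym_antisym_zero by blast+
qed

lemma odd_sr_c: "j + 1 < n \<Longrightarrow> odd_root G (sr j) \<longleftrightarrow> sn j \<noteq> sn (j + 1)"
proof -
  assume j: "j + 1 < n"
  have c: "cc j < N" "cc (j + 1) < N" "cc j \<noteq> cc (j + 1)" using cc_less cc_inj j rn by auto
  have "odd_root G (sr j) \<longleftrightarrow> pr (cc j) \<noteq> pr (cc (j + 1))"
    using odd_root_iff[OF c F_cc_nonzero] sr_c[OF j] j rn by (simp add: Z_def)
  then show ?thesis using pr_cases[OF c(1)] pr_cases[OF c(2)] by (auto simp: sn_def)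
qed

lemma black_links_rtrancl:
  assumes "(\<gamma>, \<beta>) \<in> (black_links G P)\<^sup>*" "\<gamma> = sr j" "\<And>j'. j' \<in> Bl \<Longrightarrow> ip (sr j) (sr j') \<noteq> 0 \<Longrightarrow> j' = j"
  shows "\<beta> = sr j"
  using assms(1)
proof (induction rule: rtrancl_induct)
  case (step y z)
  then have "z \<in> P" "ip (sr j) z \<noteq> 0" by (auto simp: black_links_def)
  moreover then obtain j' where "j' < n" "z = sr j'" using P_sub simple_roots_sr by auto
  ultimately show ?case using assms(3)[of j'] by (auto simp: Bl_def)
qed (use assms in simp)

lemma D_graph_eq:
  assumes i: "i \<in> Wh" "\<tau> (sr i) = sr i"
    and J: "\<And>j. j \<in> Bl \<Longrightarrow> ip (sr i) (sr j) \<noteq> 0 \<longleftrightarrow> j \<in> J" "J \<subseteq> Bl"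
    and iso: "\<And>j j'. j \<in> J \<Longrightarrow> j' \<in> Bl \<Longrightarrow> ip (sr j) (sr j') \<noteq> 0 \<Longrightarrow> j' = j"
  shows "D_graph G P \<tau> (sr i) = {sr i} \<union> sr ` J"
proof
  show "D_graph G P \<tau> (sr i) \<subseteq> {sr i} \<union> sr ` J"
  proof
    fix \<beta> assume "\<beta> \<in> D_graph G P \<tau> (sr i)"
    then consider "\<beta> = sr i" | \<gamma> where "\<gamma> \<in> P" "ip (sr i) \<gamma> \<noteq> 0" "(\<gamma>, \<beta>) \<in> (black_links G P)\<^sup>*"
      using i(2) by (auto simp: D_graph_def)
    then show "\<beta> \<in> {sr i} \<union> sr ` J"
    proof cases
      case 2
      then obtain j where j: "j < n" "\<gamma> = sr j" using P_sub simple_roots_sr by auto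
      then have "j \<in> J" using J(1)[of j] 2 by (auto simp: Bl_def)
      then show ?thesis using black_links_rtrancl[OF 2(3) j(2)] iso by blast
    qed simp
  qed
  show "{sr i} \<union> sr ` J \<subseteq> D_graph G P \<tau> (sr i)"
    using J by (auto simp: D_graph_def Bl_def)
qed

lemma D_graph_single:
  assumes "i \<in> Wh" "\<tau> (sr i) = sr i" "j \<in> Bl" "\<And>k. k \<in> Bl \<Longrightarrow> ip (sr i) (sr k) \<noteq> 0 \<Longrightarrow> k = j" "ip (sr i) (sr j) \<noteq> 0"
    "\<And>k. k \<in> Bl \<Longrightarrow> ip (sr j) (sr k) \<noteq> 0 \<Longrightarrow> k = j"
  shows "D_graph G P \<tau> (sr i) = {sr j, sr i}"
  using D_graph_eq[OF assms(1,2), of "{j}"] assms by blast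

lemma hi_least: "i \<le> b \<Longrightarrow> b \<notin> Bl \<Longrightarrow> hi i \<le> b"
  unfolding hi_def by (rule Least_le) simp

lemma lo_gt: "w \<notin> Bl \<Longrightarrow> w < u \<Longrightarrow> w < lo u"
  using lo_black[of u] by (meson atLeastLessThan_iff not_le subsetD)

lemma lo_eq: "u = 0 \<or> u - 1 \<notin> Bl \<Longrightarrow> lo u = u"
  using lo_gt[of "u - 1" u] lo_le[of u] by (cases "u = 0") auto

lemma hi_eq: "u \<notin> Bl \<Longrightarrow> u \<le> n \<Longrightarrow> hi u = u"
  using hi_ge[of u] hi_least[of u u] by simp

lemma hi_between: "w < u \<Longrightarrow> u \<in> Wh \<Longrightarrow> w + 1 \<le> hi (w + 1) \<and> hi (w + 1) \<le> u \<and> hi (w + 1) < n"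
  using hi_ge[of "w + 1"] hi_least[of "w + 1" u] by (auto simp: Wh_iff)

lemma TT_w: "w < u \<Longrightarrow> u \<in> Wh \<Longrightarrow> TT w = Z (lo w) - Z (hi (w + 1))"
  using TT_c[of w] hi_between[of w u] by (auto simp: Wh_iff)

lemma lo_Bl: "w \<in> Wh \<Longrightarrow> lo w \<notin> Bl \<Longrightarrow> lo w = w"
  using lo_black[of w] lo_le[of w] by (metis atLeastLessThan_iff le_neq_implies_less order_refl subsetD)

text \<open>The highest weight at the earlier node \<open>\<pi> u\<close> involves only weights up
  to u. It is orthogonal to \<open>sr (u + 1)\<close>, so it could not compensate the non-zero
  product of \<open>sr u\<close> with that root if the latter were black.\<close>

lemma moved_next_white:
  assumes u: "u \<in> Wh" "u + 1 < n" "\<pi> u < u"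
  shows "u + 1 \<in> Wh"
proof (rule ccontr)
  assume "u + 1 \<notin> Wh"
  then have b: "u + 1 \<in> Bl" using u by (simp add: Wh_iff)
  define w where "w = \<pi> u"
  have w: "w < u" using u by (simp add: w_def)
  have T: "TT w = Z (lo w) - Z (hi (w + 1))" "lo w < u" "hi (w + 1) \<le> u"
    using TT_w[OF w u(1)] hi_between[OF w u(1)] lo_le[of w] w by auto
  have o: "ip (sr u) (sr (u + 1)) + ip (TT w) (sr (u + 1)) = 0" using super_sym_black[OF u(1) b] by (simp add: w_def)
  have su: "sr u = Z u - Z (u + 1)" using sr_c u by simp
  show False
  proof (cases "u + 2 < n")
    case True
    then show False using o T u su sr_c[of "u + 1"] s_nz[of "u + 1"] by (simp add: ips)
  next
    case False
    then have e: "u + 1 = n - 1" "u = n - 2" using u by auto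
    consider "shape G = ShapeB" | "shape G = ShapeC" | "shape G = ShapeD" using os_shape osT by blast
    then show False
    proof cases
      case 1
      then show False using o T u su sr_e(1)[OF _ 1] s_nz[of "u + 1"] e by (simp add: ips)
    next
      case 2
      then show False using o T u su sr_e(2)[OF _ 2] s_nz[of "u + 1"] e by (simp add: ips)
    next
      case 3
      then show False using nb[OF 3] b e u by (simp add: Wh_iff)
    qed
  qed
qed

text \<open>The roots \<open>sr u\<close> and \<open>sr (u + 1)\<close> are linked, while under
  \<open>T\<close> the corresponding highest weights are orthogonal; this contradicts the
  isometry.\<close>

lemma no_moved:
  assumes u: "u \<in> Wh" "u + 1 < n" "\<pi> u < u" "shape G = ShapeD \<Longrightarrow> u + 2 < n"
    and T: "\<And>k. u + 1 \<in> Wh \<Longrightarrow> k \<le> u \<Longrightarrow> ip (TT (\<pi> (u + 1))) (Z k) = 0"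
  shows False
proof -
  have v: "u + 1 \<in> Wh" by (rule moved_next_white[OF u(1-3)])
  define w where "w = \<pi> u"
  have w: "w < u" using u by (simp add: w_def)
  have Tw: "TT w = Z (lo w) - Z (hi (w + 1))" "lo w < u" "hi (w + 1) \<le> u"
    using TT_w[OF w u(1)] hi_between[OF w u(1)] lo_le[of w] w by auto
  have "ip (sr (u + 1)) (sr u) = ip (TT (\<pi> (u + 1))) (TT w)" using super_sym_white(1)[OF v u(1)] by (simp add: w_def)
  also have "\<dots> = 0" unfolding Tw(1) using T[OF v] Tw(2,3) by (simp add: inner_h_linear)
  finally have z: "ip (sr (u + 1)) (sr u) = 0" .
  have su: "sr u = Z u - Z (u + 1)" using sr_c u by simp
  show False
  proof (cases "u + 2 < n")
    case True
    then show False using z su sr_c[of "u + 1"] s_nz[of "u + 1"] by (simp add: ips)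
  next
    case False
    then have e: "u + 1 = n - 1" using u by auto
    consider "shape G = ShapeB" | "shape G = ShapeC" | "shape G = ShapeD" using os_shape osT by blast
    then show False
    proof cases
      case 1
      then show False using z u su sr_e(1)[OF _ 1] s_nz[of "u + 1"] e by (simp add: ips)
    next
      case 2
      then show False using z u su sr_e(2)[OF _ 2] s_nz[of "u + 1"] e by (simp add: ips)
    next
      case 3
      then show False using u False by simp
    qed
  qed
qed

text \<open>The last assumption covers an exception: if both end nodes of shape D are white, the
  highest weight at \<open>n - 1\<close> starts from the block of \<open>n - 2\<close>.\<close>

lemma TT_low:
  assumes "v \<in> Wh" "k < lo v" "shape G = ShapeD \<Longrightarrow> v = n - 1 \<Longrightarrow> n - 2 \<notin> Bl \<Longrightarrow> k < lo (n - 2)"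
  shows "ip (TT v) (Z k) = 0"
proof -
  have v: "v < n" "v \<notin> Bl" "n > 0" using assms(1) by (auto simp: Wh_iff)
  have kn: "k < n" "lo v < n" "k < v" using assms(2) lo_le[of v] v by auto
  consider "v + 1 < n" "hi (v + 1) < n" | "v + 1 < n" "\<not> hi (v + 1) < n" | "v = n - 1" using v by linarith
  then show ?thesis
  proof cases
    case 1
    then show ?thesis using TT_c[OF 1] hi_ge[of "v + 1"] kn assms(2) by (simp add: ips)
  next
    case 2
    then show ?thesis using TT_t[OF 2] kn assms(2) by (simp add: ips)
  next
    case 3
    consider "shape G = ShapeB" | "shape G = ShapeD" "n - 2 \<notin> Bl" | "shape G = ShapeC \<or> shape G = ShapeD \<and> n - 2 \<in> Bl"
      using os_shape osT by blast
    then show ?thesis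
    proof cases
      case a: 1
      then show ?thesis using TT_B[OF v(3) a] 3 kn assms(2) by (simp add: ips)
    next
      case a: 2
      have "k < lo (n - 2)" using assms(3) a 3 by blast
      moreover have "lo (n - 2) < n" "n - 1 < n" "k \<noteq> n - 1" using lo_le[of "n - 2"] v kn 3 by auto
      ultimately show ?thesis using TT_D[OF a] 3 kn by (simp add: ips)
    next
      case a: 3
      obtain b where "b = lo (n - 1) \<or> b = lo (n - 1) + 1" "b < n" "TT (n - 1) = Z (lo (n - 1)) + Z b"
        using TT_self[OF v(3) _ a] v(2) 3 by auto
      then show ?thesis using 3 kn assms(2) by (auto simp: ips)
    qed
  qed
qed

text \<open>Takes the largest moved node u below m. The later white nodes below m are fixed and
  those from m on are permuted among themselves, so u can only move to an earlier node. This is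
  excluded by \<open>no_moved\<close>, or by a comparison of lengths if u is the end node.\<close>

lemma fixed_below:
  assumes m: "m \<le> n" "shape G = ShapeD \<Longrightarrow> m \<le> n - 2"
    and fix': "\<And>v. v \<in> Wh \<Longrightarrow> m \<le> v \<Longrightarrow> \<pi> v = v \<or> shape G = ShapeD \<and> n - 2 \<notin> Bl \<and> \<pi> v \<in> {n - 2, n - 1} \<and> v \<in> {n - 2, n - 1}"
    and ends: "\<And>v. v \<in> Wh \<Longrightarrow> m \<le> v \<Longrightarrow> \<exists>v'\<in>Wh. m \<le> v' \<and> \<pi> v' = v"
    and i: "i \<in> Wh" "i < m"
  shows "\<pi> i = i"
proof (rule ccontr)
  assume ni: "\<pi> i \<noteq> i"
  let ?M = "{u \<in> Wh. u < m \<and> \<pi> u \<noteq> u}"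
  define u where "u = Max ?M"
  have fin: "finite ?M" "?M \<noteq> {}" using i ni by auto
  have u: "u \<in> Wh" "u < m" "\<pi> u \<noteq> u" using Max_in[OF fin] by (auto simp: u_def)
  have mx: "\<pi> v = v" if "v \<in> Wh" "u < v" "v < m" for v
  proof (rule ccontr)
    assume "\<pi> v \<noteq> v"
    then have "v \<in> ?M" using that by simp
    then have "v \<le> u" unfolding u_def by (rule Max_ge[OF fin(1)])
    then show False using that by simp
  qed
  have lt: "\<pi> u < u"
  proof (rule ccontr)
    assume "\<not> \<pi> u < u"
    then have g: "u < \<pi> u" using u by simp
    show False
    proof (cases "\<pi> u < m")
      case True
      then have "\<pi> (\<pi> u) = \<pi> u" using mx \<pi>(1)[OF u(1)] g by blast
      then show False using \<pi>_inj[OF \<pi>(1)[OF u(1)] u(1)] u(3) by simp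
    next
      case False
      then obtain v' where "v' \<in> Wh" "m \<le> v'" "\<pi> v' = \<pi> u" using ends[OF \<pi>(1)[OF u(1)]] by auto
      then show False using \<pi>_inj u by force
    qed
  qed
  have un: "u + 1 < n \<or> u = n - 1" using u m by linarith
  show False
  proof (cases "u + 1 < n")
    case True
    show False
    proof (rule no_moved[OF u(1) True lt])
      show "shape G = ShapeD \<Longrightarrow> u + 2 < n" using m u True by fastforce
      fix k assume v: "u + 1 \<in> Wh" and k: "k \<le> u"
      have ub: "u \<notin> Bl" using u(1) by (simp add: Wh_iff)
      have l1: "lo (u + 1) = u + 1" by (rule lo_eq) (use ub in simp)
      show "ip (TT (\<pi> (u + 1))) (Z k) = 0"
      proof (cases "\<pi> (u + 1) = u + 1")
        case True
        have D2: "k < lo (n - 2)" if "shape G = ShapeD" "u + 1 = n - 1" "n - 2 \<notin> Bl"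
          using m(2)[OF that(1)] u(2) that(2) by linarith
        show ?thesis unfolding True by (rule TT_low[OF v]) (use l1 k D2 in auto)
      next
        case False
        have "m \<le> u + 1" using False mx[OF v] by (meson not_le less_add_one)
        then have D: "shape G = ShapeD" "n - 2 \<notin> Bl" "\<pi> (u + 1) \<in> {n - 2, n - 1}" "u + 1 \<in> {n - 2, n - 1}"
          using fix'[OF v] False by auto
        have nn: "n \<ge> 2" using D_facts[OF D(1)] by simp
        have "u + 1 = n - 2" using m(2)[OF D(1)] u(2) D(4) nn by auto
        then have l: "lo (n - 2) = u + 1" using l1 by simp
        have w: "\<pi> (u + 1) \<in> Wh" using \<pi>(1)[OF v] .
        show ?thesis
        proof (rule TT_low[OF w])
          have "\<pi> (u + 1) = n - 1" using D(3) False \<open>u + 1 = n - 2\<close> by auto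
          moreover have "lo (n - 1) > n - 2" using lo_gt[OF D(2), of "n - 1"] nn by simp
          ultimately show "k < lo (\<pi> (u + 1))" using k \<open>u + 1 = n - 2\<close> by simp
        qed (use l k in simp)
      qed
    qed
  next
    case False
    then have e: "u = n - 1" using un by simp
    then have nD: "shape G \<noteq> ShapeD" using m(2) u(2) D_facts by fastforce
    define w where "w = \<pi> u"
    have w: "w < u" using lt by (simp add: w_def)
    have Tw: "TT w = Z (lo w) - Z (hi (w + 1))" "lo w < hi (w + 1)" "hi (w + 1) \<le> u" "hi (w + 1) < n" "lo w < n" "n > 0"
      using TT_w[OF w u(1)] hi_between[OF w u(1)] lo_le[of w] by auto
    have n1: "ip (sr u) (sr u) = ip (TT w) (TT w)" using super_sym_white(1)[OF u(1) u(1)] by (simp add: w_def)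
    also have "\<dots> = sn (lo w) + sn (hi (w + 1))" using Tw by (simp add: ips)
    \<comment> \<open>The end root has square \<open>\<plusminus>1\<close> in shape B and
      \<open>\<plusminus>4\<close> in shape C, while a difference of two weights has square 0 or
      \<open>\<plusminus>2\<close>.\<close>
    finally have q: "ip (sr u) (sr u) = sn (lo w) + sn (hi (w + 1))" .
    have c: "sn (lo w) = 1 \<or> sn (lo w) = -1" "sn (hi (w + 1)) = 1 \<or> sn (hi (w + 1)) = -1" "sn (n - 1) = 1 \<or> sn (n - 1) = -1"
      using s_cases Tw by auto
    consider "shape G = ShapeB" | "shape G = ShapeC" using os_shape osT nD by blast
    then show False
    proof cases
      case 1
      then have "ip (sr u) (sr u) = sn (n - 1)" using sr_e(1)[OF Tw(6) 1] e Tw(6) by (simp add: ips)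
      then show False using q c by (elim disjE) simp_all
    next
      case 2
      then have "ip (sr u) (sr u) = 4 * sn (n - 1)" using sr_e(2)[OF Tw(6) 2] e Tw(6) by (simp add: ips)
      then show False using q c by (elim disjE) simp_all
    qed
  qed
qed

lemma pi_id_not_D_end:
  assumes "shape G \<noteq> ShapeD \<or> n - 1 \<in> Bl \<or> (n - 2 \<in> Bl \<and> \<pi> (n - 1) = n - 1)" "i \<in> Wh"
  shows "\<pi> i = i"
proof (cases "shape G = ShapeD")
  case False
  then show ?thesis using fixed_below[of n i] assms by (auto simp: Wh_iff)
next
  case True
  then have n2: "n \<ge> 2" "n - 2 \<in> Bl" using D_facts assms nb by auto
  have big: "v = n - 1 \<and> \<pi> v = v" if "v \<in> Wh" "n - 2 \<le> v" for v
  proof -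
    have "v \<noteq> n - 2" "v < n" using that n2 by (auto simp: Wh_iff)
    then have "v = n - 1" using that by linarith
    then show ?thesis using assms that True by (auto simp: Wh_iff)
  qed
  show ?thesis
  proof (cases "i < n - 2")
    case True
    show ?thesis by (rule fixed_below[of "n - 2"]) (use big assms True n2 in \<open>auto intro!: bexI\<close>)
  next
    case False
    then show ?thesis using big[OF assms(2)] by (meson not_less)
  qed
qed

text \<open>If \<open>n - 1\<close> moved to an earlier node w, orthogonality to the black node
  \<open>n - 2\<close> would keep the highest weight at w away from the end and force
  \<open>n - 3\<close> to be white. By the isometry the highest weights at w and at the image of
  \<open>n - 3\<close> are not orthogonal. This leaves only the case that \<open>n - 3\<close> is
  fixed, and there it is an even white node with one single-linked black neighbour, which is
  \<open>config1\<close>.\<close>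

lemma pi_D_black:
  assumes D: "shape G = ShapeD" "n - 2 \<in> Bl" "n - 1 \<in> Wh" and G: "\<not> config1 G P \<tau>"
  shows "\<pi> (n - 1) = n - 1"
proof (rule ccontr)
  assume ne: "\<pi> (n - 1) \<noteq> n - 1"
  define w where "w = \<pi> (n - 1)"
  have wW: "w \<in> Wh" using \<pi>(1)[OF D(3)] by (simp add: w_def)
  have "w < n" "w \<noteq> n - 1" "w \<noteq> n - 2" using wW ne D(2) by (auto simp: Wh_iff w_def)
  then have "w < n - 2" by linarith
  define p where "p = n - 3"
  have n: "n = p + 3" "n - 2 = p + 1" "n - 1 = p + 2" and wp: "w \<le> p" using \<open>w < n - 2\<close> by (auto simp: p_def)
  have D2: "p + 1 \<in> Bl" "p + 2 \<in> Wh" "p + 2 \<notin> Bl" and nn: "n > 0"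
    using D n by (auto simp: Wh_iff)
  define b where "b = hi (w + 1)"
  have w1: "w < p + 2" using wp by simp
  have Tw: "TT w = Z (lo w) - Z b" "b \<le> p + 2" "w + 1 \<le> b" "lo w \<le> w"
    using TT_w[OF w1 D2(2)] hi_between[OF w1 D2(2)] lo_le[of w] by (auto simp: b_def)
  have bB: "b \<notin> Bl" using hi_white[of "w + 1"] wp n by (simp add: b_def)
  have se: "sr (p + 2) = Z (p + 1) + Z (p + 2)" using sr_e(3)[OF nn D(1)] n by simp
  have se': "sr (p + 1) = Z (p + 1) - Z (p + 2)" using sr_c[of "p + 1"] n by (simp add: numeral_2_eq_2)
  have o: "ip (sr (p + 2)) (sr j) + ip (TT w) (sr j) = 0" if "j \<in> Bl" for j
    using super_sym_black[OF D2(2) that] n by (simp add: w_def)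
  have lts: "p < n" "p + 1 < n" "p + 2 < n" "b < n" "lo w < n" "lo w \<le> p" using n Tw wp by auto
  have b3: "b \<noteq> p + 1" using bB D2(1) by auto
  have bn: "b \<noteq> p + 2"
  proof
    assume "b = p + 2"
    then have "ip (sr (p + 2)) (sr (p + 1)) + ip (TT w) (sr (p + 1)) = sn (p + 1)"
      unfolding se se' Tw(1) using lts by (simp add: ips)
    then show False using o[OF D2(1)] s_nz[of "p + 1"] lts by simp
  qed
  have b4: "b \<le> p" "w < p" using b3 bn Tw by linarith+
  have seq: "sn (p + 1) = sn (p + 2)"
  proof -
    have "ip (sr (p + 2)) (sr (p + 1)) + ip (TT w) (sr (p + 1)) = sn (p + 1) - sn (p + 2)"
      unfolding se se' Tw(1) using lts b4 by (simp add: ips)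
    then show ?thesis using o[OF D2(1)] by simp
  qed
  have sx: "sr p = Z p - Z (p + 1)" using sr_c[of p] n by simp
  have xB: "p \<notin> Bl"
  proof
    assume xb: "p \<in> Bl"
    then have "b \<noteq> p" using bB by auto
    then have "ip (sr (p + 2)) (sr p) + ip (TT w) (sr p) = - sn (p + 1)"
      unfolding se sx Tw(1) using lts b4 Tw(4) by (simp add: ips)
    then show False using o[OF xb] s_nz[of "p + 1"] lts by simp
  qed
  then have xW: "p \<in> Wh" using n by (simp add: Wh_iff)
  define y where "y = \<pi> p"
  have yW: "y \<in> Wh" using \<pi>(1)[OF xW] by (simp add: y_def)
  have i1: "ip (TT y) (TT w) = - sn (p + 1)"
  proof -
    have "ip (sr p) (sr (p + 2)) = - sn (p + 1)" unfolding sx se using lts by (simp add: ips)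
    then show ?thesis using super_sym_white(1)[OF xW D2(2)] n by (simp add: y_def w_def)
  qed
  have lo1: "lo (p + 2) = p + 1"
  proof -
    have "p < lo (p + 2)" using lo_gt[OF xB, of "p + 2"] by simp
    moreover have "lo (p + 2) \<noteq> p + 2" using lo_white[of "p + 2"] D2(1) by auto
    ultimately show ?thesis using lo_le[of "p + 2"] by linarith
  qed
  have "y < n" "y \<noteq> p + 1" using yW D2(1) by (auto simp: Wh_iff)
  then have "y = p + 2 \<or> y < p \<or> y = p" using n by linarith
  then consider "y = p + 2" | "y < p" | "y = p" by blast
  then show False
  proof cases
    case 1
    obtain c where c: "c = p + 1 \<or> c = p + 2" "TT (p + 2) = Z (p + 1) + Z c"
      using TT_self[OF nn] D D2(3) lo1 n by auto
    then have "ip (TT y) (TT w) = 0" unfolding 1 c(2) Tw(1) using Tw(4) lts b4 by (auto simp: ips)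
    then show False using i1 s_nz lts by simp
  next
    case 2
    then have h: "hi (y + 1) \<le> p" "TT y = Z (lo y) - Z (hi (y + 1))" "lo y \<le> y"
      using hi_between[OF 2 xW] TT_w[OF 2 xW] lo_le by auto
    have "ip (sr p) (sr (p + 1)) + ip (TT y) (sr (p + 1)) = - sn (p + 1)"
      unfolding sx se' h(2) using h(1,3) lts 2 by (simp add: ips)
    then show False using super_sym_black[OF xW D2(1)] s_nz[of "p + 1"] lts by (simp add: y_def)
  next
    case 3
    have hx: "hi (p + 1) = p + 2"
    proof -
      have "hi (p + 1) \<le> p + 2" using hi_least[of "p + 1" "p + 2"] D2(3) by simp
      moreover have "hi (p + 1) \<ge> p + 1" using hi_ge[of "p + 1"] n by simp
      moreover have "hi (p + 1) \<noteq> p + 1" using hi_white[of "p + 1"] n D2(1) by auto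
      ultimately show ?thesis by linarith
    qed
    have Tx: "TT p = Z (lo p) - Z (p + 2)" using TT_c[of p] hx n by simp
    have lox: "w < lo p" "lo p \<le> p" using lo_gt[of w p] wW b4 lo_le by (auto simp: Wh_iff)
    have "ip (TT y) (TT w) = - (if lo p = b then sn b else 0)"
      unfolding 3 Tx Tw(1) using lox lts Tw(4) b4 by (simp add: ips)
    then have lb: "lo p = b" "sn b = sn (p + 1)" using i1 s_nz[of "p + 1"] lts by (auto split: if_splits)
    then have lp: "lo p = p" using lo_Bl[OF xW] bB by simp
    then have sxx: "sn p = sn (p + 1)" using lb by simp
    have xm: "p - 1 \<notin> Bl" using lo_white[of p] lp b4 by auto
    have lk: "j = p + 1" if j: "j \<in> Bl" "ip (sr p) (sr j) \<noteq> 0" for j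
    proof (rule ccontr)
      assume jn: "j \<noteq> p + 1"
      have "j < n" "j \<noteq> p + 2" "j \<noteq> p" "j + 1 \<noteq> p" using Bl_less[OF j(1)] D2(3) j(1) xB xm by auto
      then have "j + 1 < p" using jn n by linarith
      then show False using j(2) sx sr_c[of j] lts by (simp add: ips)
    qed
    have lk2: "j = p + 1" if j: "j \<in> Bl" "ip (sr (p + 1)) (sr j) \<noteq> 0" for j
    proof (rule ccontr)
      assume jn: "j \<noteq> p + 1"
      have "j < n" "j \<noteq> p + 2" "j \<noteq> p" using Bl_less[OF j(1)] D2(3) j(1) xB by auto
      then have "j < p" using jn n by linarith
      then show False using j(2) se' sr_c[of j] lts by (simp add: ips)
    qed
    have srP: "sr (p + 1) \<in> P" using D2(1) by (simp add: Bl_def)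
    have tx: "\<tau> (sr p) = sr p" using \<pi>(2)[OF xW] 3 by (simp add: y_def)
    have Dg: "D_graph G P \<tau> (sr p) = {sr (p + 1), sr p}"
    proof (rule D_graph_single[OF xW tx D2(1)])
      show "ip (sr p) (sr (p + 1)) \<noteq> 0" unfolding sx se' using lts s_nz[of "p + 1"] by (simp add: ips)
    qed (fact lk, fact lk2)
    have sl: "single_link G (sr (p + 1)) (sr p)"
    proof -
      have "ip (sr (p + 1)) (sr (p + 1)) = sn (p + 1) + sn (p + 1)" "ip (sr (p + 1)) (sr p) = - sn (p + 1)"
        "ip (sr p) (sr p) = sn (p + 1) + sn (p + 1)"
        unfolding se' sx using lts seq sxx by (simp_all add: ips)
      then show ?thesis unfolding single_link_def using s_cases[of "p + 1"] lts by auto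
    qed
    have ev: "\<not> odd_root G (sr p)" using odd_sr_c[of p] n sxx by simp
    have "config1 G P \<tau>" unfolding config1_def using sr_white[OF xW] srP Dg sl ev by blast
    then show False using G by simp
  qed
qed

end

section \<open>Shape D with two white end nodes\<close>

context osat
begin

text \<open>The block that begins after x and the block that ends at w have an element in common, so
  they are the same block. Its last element equals its first one, hence it is a single
  weight.\<close>

lemma chain_adjacent:
  assumes "x \<in> Wh" "w \<in> Wh" "x < w" "hi (x + 1) = lo w"
  shows "w = x + 1" "lo w = w"
proof -
  have "x + 1 \<le> n" using assms by (simp add: Wh_iff)
  then have b: "lo w \<notin> Bl" using hi_white[of "x + 1"] assms(4) by simp
  show lw: "lo w = w" by (rule lo_Bl[OF assms(2) b])
  show "w = x + 1"
  proof (rule ccontr)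
    assume "w \<noteq> x + 1"
    then have "x + 1 \<le> w - 1" "w - 1 < hi (x + 1)" "w > 0" using assms(3,4) lw by linarith+
    then have "w - 1 \<in> Bl" using hi_black[of "x + 1"] \<open>x + 1 \<le> n\<close> by auto
    then show False using lo_white[of w] lw \<open>w > 0\<close> by simp
  qed
qed

text \<open>Suppose that an end node moves into the chain; by \<open>wl\<close> this can be taken to
  be the last one, with image w. The isometry has to reproduce the fork at node \<open>n - 3\<close>
  among the highest weights. The cases are the possible images of the other end node, and triality
  arises where that node is fixed.\<close>

lemma pi_D_white:
  assumes D: "shape G = ShapeD" "n - 1 \<in> Wh" "n - 2 \<in> Wh" and G: "\<not> config1 G P \<tau>"
  shows "(\<pi> (n - 1) = n - 1 \<and> \<pi> (n - 2) = n - 2) \<or> (\<pi> (n - 1) = n - 2 \<and> \<pi> (n - 2) = n - 1) \<or>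
    (n = 4 \<and> Bl = {} \<and> (\<forall>k<4. sn k = sn 0) \<and> \<pi> 0 = 3 \<and> \<pi> 1 = 1 \<and> \<pi> 2 = 2 \<and> \<pi> 3 = 0)"
proof (cases "\<pi> (n - 1) < n - 2 \<or> \<pi> (n - 2) < n - 2")
  case False
  have "\<pi> (n - 1) < n" "\<pi> (n - 2) < n" using \<pi>(1) D WhD by blast+
  moreover have "\<pi> (n - 1) \<noteq> \<pi> (n - 2)" using \<pi>_inj[OF D(2,3)] D_facts[OF D(1)] by fastforce
  ultimately show ?thesis using False by linarith
next
  case True
  define w where "w = \<pi> (n - 1)"
  have "w < n - 2" using True wl[OF D] by (auto simp: w_def)
  define p where "p = n - 3"
  have n: "n = p + 3" "n - 2 = p + 1" "n - 1 = p + 2" and wp: "w \<le> p" using \<open>w < n - 2\<close> by (auto simp: p_def)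
  have DW: "p + 2 \<in> Wh" "p + 1 \<in> Wh" "p + 2 \<notin> Bl" "p + 1 \<notin> Bl" and nn: "n > 0"
    using D n by (auto simp: Wh_iff)
  have pw: "\<pi> (p + 2) = w" using n by (simp add: w_def)
  have wW: "w \<in> Wh" "w \<notin> Bl" using \<pi>(1)[OF DW(1)] pw by (auto simp: Wh_iff)
  define b where "b = hi (w + 1)"
  define a where "a = lo (p + 1)"
  have w1: "w < p + 1" using wp by simp
  have Tw: "TT w = Z (lo w) - Z b" "b \<le> p + 1" "w + 1 \<le> b" "lo w \<le> w"
    using TT_w[OF w1 DW(2)] hi_between[OF w1 DW(2)] lo_le[of w] by (auto simp: b_def)
  have bB: "b \<notin> Bl" using hi_white[of "w + 1"] wp n by (simp add: b_def)
  have aw: "w < a" "a \<le> p + 1" using lo_gt[OF wW(2) w1] lo_le by (auto simp: a_def)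
  have se: "sr (p + 2) = Z (p + 1) + Z (p + 2)" using sr_e(3)[OF nn D(1)] n by simp
  have se': "sr (p + 1) = Z (p + 1) - Z (p + 2)" using sr_c[of "p + 1"] n by (simp add: numeral_2_eq_2)
  have sx: "sr p = Z p - Z (p + 1)" using sr_c[of p] n by simp
  have Te: "TT (p + 2) = Z a + Z (p + 2)" using TT_D[OF D(1)] DW(4) n by (simp add: a_def)
  have h2: "hi (p + 2) = p + 2" by (rule hi_eq) (use DW n in auto)
  have Te': "TT (p + 1) = Z a - Z (p + 2)" using TT_c[of "p + 1"] n h2 by (simp add: a_def numeral_2_eq_2)
  have lts: "p < n" "p + 1 < n" "p + 2 < n" "b < n" "lo w < n" "lo w \<le> p" "a < n" "lo w < a" "lo w < b" using n Tw wp aw by auto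
  have o: "ip (sr (p + 2)) (sr j) + ip (TT w) (sr j) = 0" if "j \<in> Bl" for j
    using super_sym_black[OF DW(1) that] pw by simp
  have s1: "sn (p + 1) = 1 \<or> sn (p + 1) = -1" "sn (p + 2) = 1 \<or> sn (p + 2) = -1" "sn b = 1 \<or> sn b = -1" "sn a = 1 \<or> sn a = -1"
    using s_cases lts by blast+
  have pB: "p \<notin> Bl" if "b \<le> p"
  proof
    assume xb: "p \<in> Bl"
    then have "b \<noteq> p" using bB by auto
    then have "ip (sr (p + 2)) (sr p) + ip (TT w) (sr p) = - sn (p + 1)"
      unfolding se sx Tw(1) using lts Tw \<open>b \<le> p\<close> by (simp add: ips)
    then show False using o[OF xb] s_nz[of "p + 1"] lts by simp
  qed
  have aeq: "a = p + 1" if "p \<notin> Bl" using lo_eq[of "p + 1"] that by (simp add: a_def)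
  have ee: "ip (sr (p + 2)) (sr (p + 1)) = sn (p + 1) - sn (p + 2)"
    unfolding se se' using lts by (simp add: ips)
  have black_a: "p \<in> Bl" if "a \<noteq> p + 1" using that lo_eq[of "p + 1"] by (auto simp: a_def)
  have inj: "\<pi> i \<noteq> \<pi> j" if "i \<in> Wh" "j \<in> Wh" "i \<noteq> j" for i j using \<pi>_inj that by blast
  have pe'W: "\<pi> (p + 1) \<in> Wh" "\<pi> (p + 1) < n" using \<pi>(1)[OF DW(2)] by (auto simp: Wh_iff)
  then consider (i) "\<pi> (p + 1) = p + 1" | (ii) "\<pi> (p + 1) = p + 2" | (iii) "\<pi> (p + 1) \<le> p" using n by linarith
  then show ?thesis
  proof cases
    \<comment> \<open>The other end node is fixed. If the block after w reaches up to
      \<open>p + 1\<close>, then p is black and \<open>config1\<close> occurs at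
      \<open>p + 1\<close>. Otherwise p turns out to be fixed too, and the diagram shrinks to rank
      four.\<close>
    case i
    have "sn (p + 1) - sn (p + 2) = ip (TT w) (TT (p + 1))" using super_sym_white(1)[OF DW(1,2)] pw i ee by simp
    also have "\<dots> = - (if b = a then sn b else 0)" unfolding Tw(1) Te' using lts Tw wp by (auto simp: ips)
    finally have "b \<noteq> a" "sn (p + 1) = sn (p + 2)" using s1 by (auto split: if_splits)
    note ba = this
    show ?thesis
    proof (cases "b = p + 1")
      case True
      have ap: "a \<noteq> p + 1" using ba True by simp
      have pBl: "p \<in> Bl" by (rule black_a[OF ap])
      have "ip (sr (p + 1)) (sr p) + ip (TT (p + 1)) (sr p) = 0" using super_sym_black[OF DW(2) pBl] i by simp
      moreover have "ip (sr (p + 1)) (sr p) + ip (TT (p + 1)) (sr p) = - sn (p + 1) + (if a = p then sn p else 0)"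
        unfolding se' sx Te' using lts ap by (auto simp: ips)
      ultimately have ap': "a = p" "sn p = sn (p + 1)" using s_nz[of "p + 1"] lts by (auto split: if_splits)
      have xm: "p = 0 \<or> p - 1 \<notin> Bl" using lo_white[of "p + 1"] ap' by (auto simp: a_def)
      have tx: "\<tau> (sr (p + 1)) = sr (p + 1)" using \<pi>(2)[OF DW(2)] i by simp
      have lk: "j = p" if j: "j \<in> Bl" "ip (sr (p + 1)) (sr j) \<noteq> 0" for j
      proof (rule ccontr)
        assume jn: "j \<noteq> p"
        have "j < n" "j \<noteq> p + 2" "j \<noteq> p + 1" using Bl_less[OF j(1)] DW j(1) by auto
        then have "j < p" using jn n by linarith
        then show False using j(2) se' sr_c[of j] lts by (simp add: ips)
      qed
      have lk2: "j = p" if j: "j \<in> Bl" "ip (sr p) (sr j) \<noteq> 0" for j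
      proof (rule ccontr)
        assume jn: "j \<noteq> p"
        have "j < n" "j \<noteq> p + 2" "j \<noteq> p + 1" "j + 1 \<noteq> p" using Bl_less[OF j(1)] DW j(1) xm by auto
        then have "j + 1 < p" using jn n by linarith
        then show False using j(2) sx sr_c[of j] lts by (simp add: ips)
      qed
      have Dg: "D_graph G P \<tau> (sr (p + 1)) = {sr p, sr (p + 1)}"
      proof (rule D_graph_single[OF DW(2) tx pBl])
        show "ip (sr (p + 1)) (sr p) \<noteq> 0" unfolding sx se' using lts s_nz[of "p + 1"] by (simp add: ips)
      qed (fact lk, fact lk2)
      have sl: "single_link G (sr p) (sr (p + 1))"
      proof -
        have "ip (sr p) (sr p) = sn (p + 1) + sn (p + 1)" "ip (sr p) (sr (p + 1)) = - sn (p + 1)"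
          "ip (sr (p + 1)) (sr (p + 1)) = sn (p + 1) + sn (p + 1)"
          unfolding se' sx using lts ba(2) ap'(2) by (simp_all add: ips)
        then show ?thesis unfolding single_link_def using s_cases[of "p + 1"] lts by auto
      qed
      have ev: "\<not> odd_root G (sr (p + 1))" using odd_sr_c[of "p + 1"] n ba(2) by (simp add: numeral_2_eq_2)
      have srP: "sr p \<in> P" using pBl by (simp add: Bl_def)
      have "config1 G P \<tau>" unfolding config1_def using sr_white[OF DW(2)] srP Dg sl ev by blast
      then show ?thesis using G by simp
    next
      case False
      then have bp: "b \<le> p" using Tw by simp
      have pBl: "p \<notin> Bl" by (rule pB[OF bp])
      have ap: "a = p + 1" by (rule aeq[OF pBl])
      have pW: "p \<in> Wh" using pBl n by (simp add: Wh_iff)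
      define x where "x = \<pi> p"
      have xW: "x \<in> Wh" "x \<notin> Bl" "x < n" using \<pi>(1)[OF pW] by (auto simp: x_def Wh_iff)
      have xne: "x \<noteq> w" "x \<noteq> p + 1" using inj[OF pW DW(1)] inj[OF pW DW(2)] pw i by (auto simp: x_def)
      have e1: "ip (TT x) (TT w) = - sn (p + 1)"
        using super_sym_white(1)[OF pW DW(1)] pw unfolding x_def[symmetric] sx se using lts by (simp add: ips)
      have e2: "ip (TT x) (TT (p + 1)) = - sn (p + 1)"
        using super_sym_white(1)[OF pW DW(2)] i unfolding x_def[symmetric] sx se' using lts by (simp add: ips)
      have "x \<noteq> p + 2"
      proof
        assume "x = p + 2"
        then have "ip (TT x) (TT w) = 0" unfolding Tw(1) using Te ap lts bp by (simp add: ips)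
        then show False using e1 s_nz lts by simp
      qed
      then have xp: "x \<le> p" using xne xW n by linarith
      have x1: "x < p + 1" using xp by simp
      have Tx: "TT x = Z (lo x) - Z (hi (x + 1))" "hi (x + 1) \<le> p + 1" "x + 1 \<le> hi (x + 1)" "lo x \<le> x"
        using TT_w[OF x1 DW(2)] hi_between[OF x1 DW(2)] lo_le[of x] by auto
      have hx: "hi (x + 1) = p + 1"
      proof (rule ccontr)
        assume "hi (x + 1) \<noteq> p + 1"
        then have "hi (x + 1) \<le> p" using Tx by simp
        then have "ip (TT x) (TT (p + 1)) = 0" unfolding Tx(1) Te' ap using lts Tx(3,4) xp by (simp add: ips)
        then show False using e2 s_nz lts by simp
      qed
      have "x = p"
      proof (rule ccontr)
        assume "x \<noteq> p"
        then have "hi (x + 1) \<le> p" using hi_least[of "x + 1" p] pBl xp by simp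
        then show False using hx by simp
      qed
      have lox: "w < lo p" "lo p \<le> p" using lo_gt[OF wW(2), of p] lo_le xne \<open>x = p\<close> wp by auto
      have "ip (TT x) (TT w) = - (if lo p = b then sn b else 0)"
        unfolding Tx(1) Tw(1) hx using \<open>x = p\<close> lox lts bp Tw(4) by (auto simp: ips)
      then have lb: "lo p = b" "sn b = sn (p + 1)" using e1 s_nz[of "p + 1"] lts by (auto split: if_splits)
      then have lp: "lo p = p" using lo_Bl[OF pW] bB by simp
      then have bp': "b = p" using lb by simp
      have s3: "sn (lo w) = sn (p + 1)"
      proof -
        have "ip (sr (p + 2)) (sr (p + 2)) = ip (TT w) (TT w)" using super_sym_white(1)[OF DW(1,1)] pw by simp
        moreover have "ip (sr (p + 2)) (sr (p + 2)) = sn (p + 1) + sn (p + 2)" unfolding se using lts by (simp add: ips)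
        moreover have "ip (TT w) (TT w) = sn (lo w) + sn b" unfolding Tw(1) using lts by (simp add: ips)
        ultimately show ?thesis using ba lb by simp
      qed
      \<comment> \<open>The preimage v of the last node must be linked to p, since the last highest
        weight is linked to the one at p; hence \<open>v + 1 = p\<close>. As no white node can lie
        between w and the end p of the block after it, v is w.\<close>
      obtain v where v: "v \<in> Wh" "\<pi> v = p + 2" using \<pi>_surj[OF DW(1)] by blast
      have "v \<noteq> p + 2" "v \<noteq> p + 1" "v \<noteq> p" "v < n" using v pw i wp \<open>x = p\<close> by (auto simp: x_def Wh_iff)
      then have vp: "v < p" using n by linarith
      have "ip (sr v) (sr p) = ip (TT (p + 2)) (TT p)" using super_sym_white(1)[OF v(1) pW] v(2) \<open>x = p\<close> by (simp add: x_def)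
      also have "\<dots> = - sn (p + 1)" using Te Tx(1) hx \<open>x = p\<close> lp ap lts by (simp add: ips)
      finally have vv: "ip (sr v) (sr p) = - sn (p + 1)" .
      have v1: "v + 1 = p"
      proof (rule ccontr)
        assume "v + 1 \<noteq> p"
        then have "ip (sr v) (sr p) = 0" using sr_c[of v] sx vp lts by (simp add: ips)
        then show False using vv s_nz lts by simp
      qed
      have vB: "v \<notin> Bl" using v by (simp add: Wh_iff)
      have wv: "w = v"
      proof (rule ccontr)
        assume "w \<noteq> v"
        then have "w + 1 \<le> v" using wp v1 lox lp by linarith
        then have "b \<le> v" unfolding b_def using hi_least vB by blast
        then show False using bp' vp by simp
      qed
      \<comment> \<open>A white node q before v would be linked to v, but its image lies before v as
        well and its highest weight shares no weight with that of the last node. A black one would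
        violate orthogonality.\<close>
      have v0: "v = 0"
      proof (rule ccontr)
        assume "v \<noteq> 0"
        then obtain q where q: "v = q + 1" using not0_implies_Suc by fastforce
        have sq: "sr q = Z q - Z v" "sr v = Z v - Z p" using sr_c[of q] sr_c[of v] q v1 lts by auto
        have qB: "q \<notin> Bl"
        proof
          assume qb: "q \<in> Bl"
          have "ip (sr v) (sr q) + ip (TT (p + 2)) (sr q) = - sn v"
            unfolding sq Te ap using q v1 lts by (simp add: ips)
          then show False using super_sym_black[OF v(1) qb] v(2) s_nz[of v] vp lts by simp
        qed
        have qW: "q \<in> Wh" using qB q vp n by (simp add: Wh_iff)
        define y where "y = \<pi> q"
        have yW: "y \<in> Wh" "y < n" using \<pi>(1)[OF qW] by (auto simp: y_def Wh_iff)
        have "y \<noteq> p + 2" "y \<noteq> p" "y \<noteq> p + 1" "y \<noteq> v"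
          using inj[OF qW v(1)] inj[OF qW pW] inj[OF qW DW(2)] inj[OF qW DW(1)] v pw i q v1 wv \<open>x = p\<close>
          by (auto simp: y_def x_def)
        then have yv: "y < v" using v1 yW n by linarith
        have Ty: "TT y = Z (lo y) - Z (hi (y + 1))" "hi (y + 1) \<le> v" "lo y \<le> y"
          using TT_w[OF yv v(1)] hi_between[OF yv v(1)] lo_le by auto
        have "ip (sr q) (sr v) = ip (TT y) (TT (p + 2))" using super_sym_white(1)[OF qW v(1)] v(2) by (simp add: y_def)
        also have "\<dots> = 0" unfolding Ty(1) Te ap using Ty(2,3) yv vp lts by (simp add: ips)
        finally have "ip (sr q) (sr v) = 0" .
        moreover have "ip (sr q) (sr v) = - sn v" unfolding sq using q v1 lts by (simp add: ips)
        ultimately show False using s_nz[of v] vp lts by simp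
      qed
      then have P: "p = 1" "v = 0" "w = 0" "n = 4" using v1 wv n by auto
      have DW': "p + 1 \<notin> Bl" "p + 2 \<notin> Bl" using DW unfolding Wh_iff by blast+
      have "Bl = {}"
      proof -
        have "j \<notin> Bl" for j
        proof
          assume "j \<in> Bl"
          then have "j < 4" "j \<noteq> v" "j \<noteq> p" "j \<noteq> p + 1" "j \<noteq> p + 2" using Bl_less[of j] P(4) pBl vB DW' by auto
          then show False using P by linarith
        qed
        then show ?thesis by blast
      qed
      moreover have "\<forall>k<4. sn k = sn 0"
      proof (intro allI impI)
        fix k :: nat assume "k < 4"
        then consider "k = 0" | "k = 1" | "k = 2" | "k = 3" by linarith
        then show "sn k = sn 0"
        proof cases
          case 2 then show ?thesis using s3 lb bp' P lo_le[of 0] by simp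
        next
          case 3 then show ?thesis using s3 P lo_le[of 0] by (simp add: numeral_2_eq_2)
        next
          case 4 then show ?thesis using s3 ba P lo_le[of 0] by (simp add: numeral_3_eq_3 numeral_2_eq_2)
        qed simp
      qed
      moreover have "\<pi> 0 = 3" "\<pi> 1 = 1" "\<pi> 2 = 2" "\<pi> 3 = 0"
        using v P \<open>x = p\<close> i pw by (simp_all add: x_def numeral_3_eq_3 numeral_2_eq_2)
      ultimately show ?thesis using P by blast
    qed
  next
    \<comment> \<open>The other end node moves to the last one. The isometry gives equal signs and
      \<open>b \<noteq> a\<close>, and then the symmetry of the mixed products fails.\<close>
    case ii
    have "sn (p + 1) - sn (p + 2) = ip (TT w) (TT (p + 2))" using super_sym_white(1)[OF DW(1,2)] pw ii ee by simp
    also have "\<dots> = - (if b = a then sn b else 0)" unfolding Tw(1) Te using lts Tw wp by (auto simp: ips)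
    finally have "b \<noteq> a" "sn (p + 1) = sn (p + 2)" using s1 by (auto split: if_splits)
    note ba = this
    have e: "ip (TT w) (sr (p + 1)) = ip (sr (p + 2)) (TT (p + 2))" using super_sym_white(2)[OF DW(1,2)] pw ii by simp
    show ?thesis
    proof (cases "b = p + 1")
      case True
      have "ip (TT w) (sr (p + 1)) = - sn (p + 1)" unfolding Tw(1) se' using True lts by (simp add: ips)
      moreover have "ip (sr (p + 2)) (TT (p + 2)) = sn (p + 2)" unfolding se Te using True ba aw lts by (simp add: ips)
      ultimately show ?thesis using e ba s1 by (elim disjE) simp_all
    next
      case False
      then have bp: "b \<le> p" using Tw by simp
      have ap: "a = p + 1" by (rule aeq[OF pB[OF bp]])
      have "ip (TT w) (sr (p + 1)) = 0" unfolding Tw(1) se' using bp lts by (simp add: ips)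
      moreover have "ip (sr (p + 2)) (TT (p + 2)) = sn (p + 1) + sn (p + 2)" unfolding se Te ap using lts by (simp add: ips)
      ultimately show ?thesis using e ba s1 by (elim disjE) simp_all
    qed
  next
    \<comment> \<open>Both end nodes move into the chain. The highest weight at the image x of p
      must be linked to those at both of their images, which are therefore \<open>x - 1\<close> and
      \<open>x + 1\<close>. The end node mapped to \<open>x + 1\<close> is linked at most to p and
      to the other end node, whereas \<open>x + 1\<close> acquires a further neighbour whose
      preimage is missing.\<close>
    case iii
    define w' where "w' = \<pi> (p + 1)"
    have w': "w' \<le> p" "w' \<in> Wh" "w' \<notin> Bl" "w' \<noteq> w" "w' < p + 1"
      using iii pe'W inj[OF DW(2) DW(1)] pw by (auto simp: w'_def Wh_iff)
    define b' where "b' = hi (w' + 1)"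
    have Tw': "TT w' = Z (lo w') - Z b'" "b' \<le> p + 1" "w' + 1 \<le> b'" "lo w' \<le> w'"
      using TT_w[OF w'(5) DW(2)] hi_between[OF w'(5) DW(2)] lo_le[of w'] by (auto simp: b'_def)
    have bB': "b' \<notin> Bl" using hi_white[of "w' + 1"] w' n by (simp add: b'_def)
    have o': "ip (sr (p + 1)) (sr j) + ip (TT w') (sr j) = 0" if "j \<in> Bl" for j
      using super_sym_black[OF DW(2) that] by (simp add: w'_def)
    have one: "b \<le> p \<or> b' \<le> p"
    proof (cases "w < w'")
      case True
      then have "b \<le> w'" unfolding b_def using hi_least[of "w + 1" w'] w' by simp
      then show ?thesis using w' by simp
    next
      case False
      then have "b' \<le> w" unfolding b'_def using hi_least[of "w' + 1" w] w' wW by simp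
      then show ?thesis using wp by simp
    qed
    have pBl: "p \<notin> Bl"
    proof
      assume xb: "p \<in> Bl"
      then have bb: "b' \<le> p" using one pB by auto
      have "b' \<noteq> p" using bB' xb by auto
      then have "ip (sr (p + 1)) (sr p) + ip (TT w') (sr p) = - sn (p + 1)"
        unfolding se' sx Tw'(1) using lts Tw'(3,4) bb by (simp add: ips)
      then show False using o'[OF xb] s_nz[of "p + 1"] lts by simp
    qed
    have ap: "a = p + 1" by (rule aeq[OF pBl])
    have pW: "p \<in> Wh" using pBl n by (simp add: Wh_iff)
    define x where "x = \<pi> p"
    have xW: "x \<in> Wh" "x \<notin> Bl" "x < n" using \<pi>(1)[OF pW] by (auto simp: x_def Wh_iff)
    have xne: "x \<noteq> w" "x \<noteq> w'" using inj[OF pW DW(1)] inj[OF pW DW(2)] pw by (auto simp: x_def w'_def)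
    have e1: "ip (TT x) (TT w) = - sn (p + 1)"
      using super_sym_white(1)[OF pW DW(1)] pw unfolding x_def[symmetric] sx se using lts by (simp add: ips)
    have e2: "ip (TT x) (TT w') = - sn (p + 1)"
      using super_sym_white(1)[OF pW DW(2)] unfolding x_def[symmetric] w'_def[symmetric] sx se' using lts by (simp add: ips)
    have xp: "x \<le> p"
    proof (rule ccontr)
      assume "\<not> x \<le> p"
      then have "x = p + 1 \<or> x = p + 2" using xW n by linarith
      then have T: "TT x = Z (p + 1) - Z (p + 2) \<or> TT x = Z (p + 1) + Z (p + 2)" using Te Te' ap by auto
      from one show False
      proof
        assume "b \<le> p"
        then have "ip (TT x) (TT w) = 0" using T unfolding Tw(1) using lts by (auto simp: ips)
        then show False using e1 s_nz lts by simp
      next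
        assume "b' \<le> p"
        then have "ip (TT x) (TT w') = 0" using T unfolding Tw'(1) using lts Tw'(4) w' by (auto simp: ips)
        then show False using e2 s_nz lts by simp
      qed
    qed
    have x1: "x < p + 1" using xp by simp
    have Tx: "TT x = Z (lo x) - Z (hi (x + 1))" "hi (x + 1) \<le> p + 1" "x + 1 \<le> hi (x + 1)" "lo x \<le> x"
      using TT_w[OF x1 DW(2)] hi_between[OF x1 DW(2)] lo_le[of x] by auto
    have nbr: "(c = x + 1 \<and> lo c = c) \<or> x = c + 1"
      if c: "c \<in> Wh" "c \<noteq> x" "c < p + 1" "ip (TT x) (TT c) \<noteq> 0" for c
    proof -
      have Tc: "TT c = Z (lo c) - Z (hi (c + 1))" "hi (c + 1) \<le> p + 1" "c + 1 \<le> hi (c + 1)" "lo c \<le> c"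
        using TT_w[OF c(3) DW(2)] hi_between[OF c(3) DW(2)] lo_le[of c] by auto
      show ?thesis
      proof (cases "x < c")
        case True
        have g: "x < lo c" "hi (x + 1) \<le> c" using lo_gt[OF xW(2) True] hi_least[of "x + 1" c] c True by (auto simp: Wh_iff)
        have "ip (TT x) (TT c) = (if hi (x + 1) = lo c then - sn (lo c) else 0)"
          unfolding Tx(1) Tc(1) using g Tx Tc lts n c by (auto simp: ips)
        then have "hi (x + 1) = lo c" using c(4) by (auto split: if_splits)
        then show ?thesis using chain_adjacent[OF xW(1) c(1) True] by simp
      next
        case False
        then have cx: "c < x" using c by simp
        have g: "c < lo x" "hi (c + 1) \<le> x" using lo_gt[of c x] hi_least[of "c + 1" x] c cx xW by (auto simp: Wh_iff)
        have "ip (TT x) (TT c) = (if hi (c + 1) = lo x then - sn (lo x) else 0)"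
          unfolding Tx(1) Tc(1) using g Tx Tc lts n c xp by (auto simp: ips)
        then have "hi (c + 1) = lo x" using c(4) by (auto split: if_splits)
        then show ?thesis using chain_adjacent[OF c(1) xW(1) cx] by simp
      qed
    qed
    have "ip (TT x) (TT w) \<noteq> 0" "ip (TT x) (TT w') \<noteq> 0" using e1 e2 s_nz lts by auto
    then have c: "(w = x + 1 \<and> lo w = w) \<or> x = w + 1" "(w' = x + 1 \<and> lo w' = w') \<or> x = w' + 1"
      using nbr[OF wW(1)] nbr[OF w'(2)] xne w1 w' by auto
    obtain y ey \<sigma> where y: "y = x + 1" "lo y = y" "y \<in> Wh" "y \<notin> Bl" "y \<le> p" "ey = p + 1 \<or> ey = p + 2" "\<pi> ey = y"
      "sr ey = Z (p + 1) + \<sigma> \<cdot>\<^sub>v Z (p + 2)" "{\<pi> (p + 1), \<pi> (p + 2)} \<subseteq> {y, x - 1}"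
    proof (cases "w = x + 1")
      case True
      then have "w' = x - 1" using c w' by auto
      have "sr (p + 2) = Z (p + 1) + 1 \<cdot>\<^sub>v Z (p + 2)" unfolding se by (rule eq_vecI) (auto simp: Z_def)
      then show ?thesis using True c wW wp pw \<open>w' = x - 1\<close> by (intro that[of w "p + 2" 1]) (auto simp: w'_def)
    next
      case False
      then have "w' = x + 1" "lo w' = w'" "w = x - 1" using c w' by auto
      have "sr (p + 1) = Z (p + 1) + (-1) \<cdot>\<^sub>v Z (p + 2)" unfolding se' by (rule eq_vecI) (auto simp: Z_def)
      then show ?thesis using \<open>w' = x + 1\<close> \<open>lo w' = w'\<close> \<open>w = x - 1\<close> w' pw by (intro that[of w' "p + 1" "-1"]) (auto simp: w'_def)
    qed
    have eyW: "ey \<in> Wh" using y DW by auto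
    have y1: "y < p + 1" using y by simp
    define c where "c = hi (y + 1)"
    have Ty: "TT y = Z y - Z c" "c \<le> p + 1" "y + 1 \<le> c"
      using TT_w[OF y1 DW(2)] hi_between[OF y1 DW(2)] y(2) by (auto simp: c_def)
    have cB: "c \<notin> Bl" using hi_white[of "y + 1"] y n by (simp add: c_def)
    show ?thesis
    proof (cases "c = p + 1")
      case True
      obtain g where g: "g \<in> Wh" "\<pi> g = p + 2" using \<pi>_surj[OF DW(1)] by blast
      have "g \<noteq> p + 1" "g \<noteq> p + 2" "g \<noteq> p" "g < n" using g y xp by (auto simp: x_def Wh_iff)
      then have gp: "g < p" using n by linarith
      have "ip (sr g) (sr ey) = ip (TT (p + 2)) (TT y)" using super_sym_white(1)[OF g(1) eyW] g y by simp
      moreover have "ip (sr g) (sr ey) = 0" using sr_c[of g] y(8) gp lts by (simp add: ips)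
      moreover have "ip (TT (p + 2)) (TT y) = - sn (p + 1)" unfolding Te ap Ty(1) True using y lts by (simp add: ips)
      ultimately show ?thesis using s_nz lts by simp
    next
      case False
      then have cp: "c \<le> p" using Ty by simp
      have c1: "c = y + 1"
      proof (rule ccontr)
        assume "c \<noteq> y + 1"
        then obtain q where q: "c = q + 1" "y + 1 \<le> q" using Ty(3) by (metis Suc_eq_plus1 le_antisym not_less_eq_eq Suc_le_D add_Suc_right)
        then have qb: "q \<in> Bl" using hi_black[of "y + 1"] y n by (auto simp: c_def)
        have "ip (sr ey) (sr q) + ip (TT y) (sr q) = sn c"
          unfolding y(8) Ty(1) using sr_c[of q] q cp lts by (simp add: ips)
        then show False using super_sym_black[OF eyW qb] y s_nz[of c] cp lts by simp
      qed
      have cW: "c \<in> Wh" using cB cp n by (simp add: Wh_iff)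
      obtain g where g: "g \<in> Wh" "\<pi> g = c" using \<pi>_surj[OF cW] by blast
      have c2: "c < p + 1" using cp by simp
      have lc: "lo c = c" by (rule lo_eq) (use c1 y in simp)
      have Tc: "TT c = Z c - Z (hi (c + 1))" "c + 1 \<le> hi (c + 1)" "hi (c + 1) < n"
        using TT_w[OF c2 DW(2)] hi_between[OF c2 DW(2)] lc by auto
      have "ip (sr g) (sr ey) = ip (TT c) (TT y)" using super_sym_white(1)[OF g(1) eyW] g y by simp
      also have "\<dots> = - sn c" unfolding Tc(1) Ty(1) using Tc(2,3) c1 cp lts by (simp add: ips)
      finally have ne: "ip (sr g) (sr ey) \<noteq> 0" using s_nz[of c] cp lts by simp
      have "\<not> g < p"
      proof
        assume "g < p"
        then have "ip (sr g) (sr ey) = 0" using sr_c[of g] y(8) lts by (simp add: ips)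
        then show False using ne by simp
      qed
      then have "g = p \<or> g = p + 1 \<or> g = p + 2" using g n by (auto simp: Wh_iff)
      then have "c \<in> {x, y, x - 1}" using g y by (auto simp: x_def)
      then show ?thesis using c1 y(1) by auto
    qed
  qed
qed

end

section \<open>Block sizes\<close>

context osat
begin

lemma lo_least: "a \<le> i \<Longrightarrow> {a..<i} \<subseteq> Bl \<Longrightarrow> lo i \<le> a"
  unfolding lo_def by (rule Least_le) simp

definition small_block :: "nat \<Rightarrow> bool" where
  "small_block i \<longleftrightarrow> lo i = i \<or> (lo i + 1 = i \<and> sn (lo i) = sn i)"

lemma small_blockI:
  assumes i: "i \<in> Wh" "\<And>j. j < i \<Longrightarrow> ip (sr i) (Z j) = 0" "ip (sr i) (Z i) = sn i"
    and T: "\<And>j. j \<le> i \<Longrightarrow> ip (TT (\<pi> i)) (Z j) = (if j = lo i then sn j else 0)"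
  shows "small_block i"
proof (cases "lo i = i")
  case False
  then have l: "lo i < i" using lo_le[of i] by simp
  then obtain p where p: "i = p + 1" using not0_implies_Suc by fastforce
  have pb: "p \<in> Bl" using lo_black[of i] l p by auto
  have pn: "p + 1 < n" using i p by (simp add: Wh_iff)
  have "ip (sr i) (sr p) = - sn i" using sr_c[OF pn] i(2)[of p] i(3) p by (simp add: inner_h_linear)
  moreover have "ip (TT (\<pi> i)) (sr p) = (if p = lo i then sn p else 0)"
    using sr_c[OF pn] T[of p] T[of i] p l by (simp add: inner_h_linear)
  ultimately have "(if p = lo i then sn p else 0) = sn i" using super_sym_black[OF i(1) pb] by simp
  then show ?thesis using s_nz[of i] pn p by (auto simp: small_block_def split: if_splits)
qed (simp add: small_block_def)

lemma small_chain:
  assumes i: "i \<in> Wh" "i + 1 < n"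
    and fx: "\<pi> i = i \<or> shape G = ShapeD \<and> i = n - 2 \<and> \<pi> i = n - 1"
  shows "small_block i"
proof (rule small_blockI[OF i(1)])
  have n: "i < n" "lo i < n" "lo i \<le> i" using i lo_le[of i] by auto
  show "ip (sr i) (Z j) = 0" if "j < i" for j using that sr_c[OF i(2)] i by (simp add: ips)
  show "ip (sr i) (Z i) = sn i" using sr_c[OF i(2)] i by (simp add: ips)
  fix j assume j: "j \<le> i"
  consider "\<pi> i = i" "hi (i + 1) < n" | "\<pi> i = i" "\<not> hi (i + 1) < n" | "shape G = ShapeD" "i = n - 2" "\<pi> i = n - 1"
    using fx by blast
  then show "ip (TT (\<pi> i)) (Z j) = (if j = lo i then sn j else 0)"
  proof cases
    case 1
    then show ?thesis using TT_c[OF i(2) 1(2)] hi_ge[of "i + 1"] n j i by (auto simp: ips)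
  next
    case 2
    then show ?thesis using TT_t[OF i(2) 2(2)] n j i by (auto simp: ips)
  next
    case 3
    have "n - 2 \<notin> Bl" using i 3(2) by (simp add: Wh_iff)
    moreover have "n - 1 < n" "j \<noteq> n - 1" "j < n" using i j 3(2) by auto
    ultimately show ?thesis using TT_D[OF 3(1)] 3 n by (auto simp: ips)
  qed
qed

lemma small_B:
  assumes "n - 1 \<in> Wh" "shape G = ShapeB" "\<pi> (n - 1) = n - 1"
  shows "small_block (n - 1)"
proof -
  have n: "n > 0" "lo (n - 1) < n" using assms(1) lo_le[of "n - 1"] by (auto simp: Wh_iff)
  show ?thesis
    by (rule small_blockI[OF assms(1)]) (use n assms sr_e(1) TT_B in \<open>simp_all add: ips\<close>)
qed

text \<open>At the end of shape C the product with the preceding black root is twice a sign. Only a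
  highest weight equal to twice \<open>Z (n - 2)\<close> can compensate it.\<close>

lemma small_C:
  assumes w: "n - 1 \<in> Wh" and C: "shape G = ShapeC" "\<pi> (n - 1) = n - 1"
  shows "small_block (n - 1)"
proof (cases "lo (n - 1) = n - 1")
  case False
  then have l: "lo (n - 1) < n - 1" using lo_le[of "n - 1"] by simp
  define p where "p = n - 2"
  have n: "n = p + 2" "n - 1 = p + 1" using l by (auto simp: p_def)
  have pb: "p \<in> Bl" using lo_black[of "n - 1"] l n by auto
  obtain b where b: "b = lo (p + 1) \<or> b = lo (p + 1) + 1" "b < n" "TT (p + 1) = Z (lo (p + 1)) + Z b"
    using TT_self[of] w C n by (auto simp: Wh_iff)
  have lt: "p < n" "p + 1 < n" "lo (p + 1) < n" "lo (p + 1) \<le> p" using n l by auto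
  have e: "sr (p + 1) = Z (p + 1) + Z (p + 1)" "sr p = Z p - Z (p + 1)" using sr_e(2) C n sr_c[of p] by auto
  have "ip (sr (p + 1)) (sr p) + ip (TT (p + 1)) (sr p) = 0" using super_sym_black[OF w pb] C n by simp
  then have o: "ip (sr (p + 1)) (sr p) = - ip (TT (p + 1)) (sr p)" by (simp add: eq_neg_iff_add_eq_0)
  have c: "sn p = 1 \<or> sn p = -1" "sn (p + 1) = 1 \<or> sn (p + 1) = -1" using s_cases lt by auto
  have 1: "ip (sr (p + 1)) (sr p) = - sn (p + 1) - sn (p + 1)" unfolding e using lt by (simp add: ips)
  have 2: "ip (TT (p + 1)) (sr p) =
      (if lo (p + 1) = p then sn p else 0) + (if b = p then sn p else 0) - (if b = p + 1 then sn (p + 1) else 0)"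
    unfolding e b(3) using lt b(2) by (auto simp: ips)
  have "lo (p + 1) = p \<and> sn p = sn (p + 1)"
    using o[unfolded 1 2] c b(1) lt by (auto split: if_splits)
  then show ?thesis using n by (simp add: small_block_def)
qed (simp add: small_block_def)

text \<open>The module at the end node is the exterior square of the block in the super sense, with
  lowest weight \<open>Z (n - 2) + Z (n - 1)\<close>. Self-duality leaves the block sizes two and
  four. A white node in front of a block of size four would carry its standard module, which is not
  self-dual, so then the whole diagram has rank four.\<close>

lemma small_D:
  assumes D: "shape G = ShapeD" "n - 2 \<in> Bl" and w: "n - 1 \<in> Wh" and fx: "\<And>i. i \<in> Wh \<Longrightarrow> \<pi> i = i"
  shows "small_block (n - 1) \<or> n = 4 \<and> Bl = {0, 1, 2} \<and> (\<forall>k<4. sn k = sn 0)"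
proof -
  define p where "p = n - 2"
  have n: "n = p + 2" "n - 1 = p + 1" "n - 2 = p" using D_facts[OF D(1)] by (auto simp: p_def)
  have pb: "p \<in> Bl" "p + 1 \<in> Wh" "p + 1 \<notin> Bl" using D w n by (auto simp: Wh_iff)
  define a where "a = lo (p + 1)"
  have ap: "a \<le> p"
  proof (rule ccontr)
    assume "\<not> a \<le> p"
    then have "lo (p + 1) = p + 1" using lo_le[of "p + 1"] by (simp add: a_def)
    then show False using lo_white[of "p + 1"] pb by simp
  qed
  obtain b where b: "b = a \<or> b = a + 1" "b < n" "TT (p + 1) = Z a + Z b"
    using TT_self D pb n by (auto simp: a_def)
  have lt: "p < n" "p + 1 < n" "a < n" using n ap by auto
  have e: "sr (p + 1) = Z p + Z (p + 1)" "sr p = Z p - Z (p + 1)" using sr_e(3) D n sr_c[of p] by auto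
  have o: "ip (sr (p + 1)) (sr j) = - ip (TT (p + 1)) (sr j)" if "j \<in> Bl" for j
    using super_sym_black[OF pb(2) that] fx[OF pb(2)] by (simp add: eq_neg_iff_add_eq_0)
  have c: "sn p = 1 \<or> sn p = -1" "sn (p + 1) = 1 \<or> sn (p + 1) = -1" using s_cases lt by auto
  have 1: "ip (sr (p + 1)) (sr p) = sn p - sn (p + 1)" unfolding e using lt by (simp add: ips)
  have 2: "ip (TT (p + 1)) (sr p) =
      (if a = p then sn p else 0) + (if b = p then sn p else 0) - (if b = p + 1 then sn (p + 1) else 0)"
    unfolding e b(3) using lt b(2) ap by (auto simp: ips)
  have "a \<noteq> p \<longrightarrow> b \<noteq> p" and eq: "sn p = sn (p + 1)"
    using o[OF pb(1), unfolded 1 2] c b(1) ap by (auto split: if_splits)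
  show ?thesis
  proof (cases "a = p")
    case True
    then show ?thesis using eq n by (simp add: small_block_def a_def)
  next
    case False
    then have bp: "b \<noteq> p" "a < p" using \<open>a \<noteq> p \<longrightarrow> b \<noteq> p\<close> ap by auto
    then obtain m where m: "p = m + 1" using not0_implies_Suc by fastforce
    have am: "a \<le> m" "b \<le> m" using bp b(1) m by auto
    have bl: "{a..p} \<subseteq> Bl" using lo_black[of "p + 1"] by (auto simp: a_def)
    have mb: "m \<in> Bl" using bl am m by auto
    have sm: "sr m = Z m - Z p" using sr_c[of m] m n by simp
    have 3: "ip (sr (p + 1)) (sr m) = - sn p" unfolding e sm using lt m by (simp add: ips)
    have 4: "ip (TT (p + 1)) (sr m) =
        (if a = m then sn m else 0) + (if b = m then sn m else 0)"
      unfolding sm b(3) using lt m am by (auto simp: ips)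
    have c': "sn m = 1 \<or> sn m = -1" using s_cases[of m] lt m by simp
    have bm: "b = m" "a \<noteq> m" "sn m = sn p"
      using o[OF mb, unfolded 3 4] c c' b(1) bp m by (auto split: if_splits)
    then have am1: "m = a + 1" using b(1) am by auto
    have ab: "a \<in> Bl" using bl ap by auto
    have sa: "sr a = Z a - Z m" using sr_c[of a] am1 m n by simp
    have "ip (sr (p + 1)) (sr a) = 0" "ip (TT (p + 1)) (sr a) = sn a - sn m"
      unfolding e sa b(3) using lt m am1 bm by (simp_all add: ips)
    then have sam: "sn a = sn m" using o[OF ab] by simp
    have a0: "a = 0"
    proof (rule ccontr)
      assume "a \<noteq> 0"
      then obtain x where x: "a = x + 1" using not0_implies_Suc by fastforce
      have xB: "x \<notin> Bl" using lo_white[of "p + 1"] x by (simp add: a_def)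
      have xn: "x + 1 < n" using x lt by simp
      have xW: "x \<in> Wh" using xB xn by (simp add: Wh_iff)
      have h: "hi (x + 1) = p + 1"
      proof (rule antisym)
        show "hi (x + 1) \<le> p + 1" by (rule hi_least) (use x ap pb in auto)
        have g: "x + 1 \<le> hi (x + 1)" "hi (x + 1) \<notin> Bl" using hi_ge hi_white xn by auto
        show "p + 1 \<le> hi (x + 1)"
        proof (rule ccontr)
          assume "\<not> p + 1 \<le> hi (x + 1)"
          then have "hi (x + 1) \<in> {a..p}" using g x by auto
          then show False using bl g by blast
        qed
      qed
      have T: "TT x = Z (lo x) - Z (p + 1)" using TT_c[OF xn] h lt by simp
      have "ip (sr x) (sr a) = - sn a" unfolding sa using sr_c[OF xn] x am1 m n by (simp add: ips)
      moreover have "ip (TT x) (sr a) = 0" unfolding T sa using lo_le[of x] x am1 m n by (simp add: ips)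
      ultimately show False using super_sym_black[OF xW ab] fx[OF xW] s_nz[of a] lt by simp
    qed
    have n4: "n = 4" "p = 2" "m = 1" using a0 am1 m n by auto
    have "Bl = {0, 1, 2}"
    proof
      show "{0, 1, 2} \<subseteq> Bl" using ab mb pb(1) a0 n4 by simp
      show "Bl \<subseteq> {0, 1, 2}"
      proof
        fix j assume "j \<in> Bl"
        then have "j < 4" "j \<noteq> p + 1" using Bl_less[of j] n4(1) pb(3) by auto
        then show "j \<in> {0, 1, 2}" using n4 by auto
      qed
    qed
    moreover have "\<forall>k<4. sn k = sn 0"
    proof (intro allI impI)
      fix k :: nat assume "k < 4"
      then have "k = a \<or> k = m \<or> k = p \<or> k = p + 1" using a0 n4 by linarith
      then have "sn k = sn a" using eq bm sam by auto
      then show "sn k = sn 0" using a0 by simp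
    qed
    ultimately show ?thesis using n4 by blast
  qed
qed

text \<open>\<open>q\<close> is the last white node; if \<open>\<tau>\<close> interchanges the end nodes of shape D, it is the last but one.\<close>

definition sized :: "nat \<Rightarrow> bool" where
  "sized q \<longleftrightarrow> q \<in> Wh \<and> (\<forall>i\<in>Wh. i < q \<longrightarrow> \<pi> i = i) \<and>
     (\<forall>k\<in>Bl. k < q \<longrightarrow> k + 1 \<notin> Bl \<and> sn (k + 1) = sn k) \<and>
     (\<pi> q = q \<and> Wh \<subseteq> {..q} \<or>
      shape G = ShapeD \<and> q + 2 = n \<and> q + 1 \<in> Wh \<and> \<pi> q = q + 1 \<and> \<pi> (q + 1) = q)"

text \<open>A black node k below q lies in the block that ends at the white node
  \<open>hi k\<close>; if that block is small, k is its first element.\<close>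

lemma small_blocks:
  assumes s: "\<And>i. i \<in> Wh \<Longrightarrow> i \<le> q \<Longrightarrow> small_block i" and q: "q \<in> Wh" and k: "k \<in> Bl" "k < q"
  shows "k + 1 \<notin> Bl \<and> sn (k + 1) = sn k"
proof -
  define i where "i = hi k"
  have kn: "k \<le> n" using q k by (simp add: Wh_iff)
  have i: "i \<le> q" "k \<le> i" "i \<notin> Bl" using hi_least[of k q] hi_ge[OF kn] hi_white[OF kn] k q by (auto simp: i_def Wh_iff)
  have ki: "k < i" using i(2,3) k(1) by (metis le_neq_implies_less)
  have iW: "i \<in> Wh" using i q by (simp add: Wh_iff)
  have "lo i \<le> k" by (rule lo_least) (use hi_black[OF kn] ki in \<open>auto simp: i_def\<close>)
  then have "lo i + 1 = i" "sn (lo i) = sn i" "k = lo i" using s[OF iW i(1)] ki by (auto simp: small_block_def)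
  then show ?thesis using i(3) by auto
qed

theorem sized_cases:
  assumes ne: "Wh \<noteq> {}" and G1: "\<not> config1 G P \<tau>"
  obtains q where "sized q"
  | "shape G = ShapeD" "n = 4" "Bl = {}" "\<forall>k<4. sn k = sn 0" "\<pi> 0 = 3" "\<pi> 1 = 1" "\<pi> 2 = 2" "\<pi> 3 = 0"
  | "shape G = ShapeD" "n = 4" "Bl = {0, 1, 2}" "\<forall>k<4. sn k = sn 0"
proof -
  have fin: "finite Wh" by (rule finite_subset[of _ "{..<n}"]) (auto simp: Wh_iff)
  define q where "q = Max Wh"
  have q: "q \<in> Wh" "Wh \<subseteq> {..q}" using Max_in[OF fin ne] Max_ge[OF fin] by (auto simp: q_def)
  note goals = that
  have all_fixed: thesis if fx: "\<And>i. i \<in> Wh \<Longrightarrow> \<pi> i = i"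
  proof (cases "shape G = ShapeD \<and> n = 4 \<and> Bl = {0, 1, 2} \<and> (\<forall>k<4. sn k = sn 0)")
    case True
    then show ?thesis using goals(3) by blast
  next
    case False
    have s: "small_block i" if "i \<in> Wh" for i
    proof (cases "i + 1 < n")
      case True
      then show ?thesis using small_chain[OF that] fx[OF that] by blast
    next
      case i: False
      have "i < n" using that by (simp add: Wh_iff)
      then have i': "i = n - 1" "n > 0" using i by linarith+
      have i'': "n - 1 \<in> Wh" using that i'(1) by simp
      note i' = i' i''
      consider "shape G = ShapeB" | "shape G = ShapeC" | "shape G = ShapeD" "n - 2 \<in> Bl" | "shape G = ShapeD" "n - 2 \<notin> Bl"
        using os_shape osT by blast
      then show ?thesis
      proof cases
        case 1
        then show ?thesis using small_B[OF i'(3) 1 fx[OF i'(3)]] i' by simp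
      next
        case 2
        then show ?thesis using small_C[OF i'(3) 2 fx[OF i'(3)]] i' by simp
      next
        case 3
        then show ?thesis using small_D[OF 3 i'(3) fx] False i' by auto
      next
        case 4
        then show ?thesis using lo_eq[of i] i' by (simp add: small_block_def numeral_2_eq_2)
      qed
    qed
    have "sized q" unfolding sized_def using q fx small_blocks[OF s q(1)] by blast
    then show ?thesis by (rule goals(1))
  qed
  show thesis
  proof (cases "shape G = ShapeD \<and> n - 1 \<in> Wh")
    case False
    then have "shape G \<noteq> ShapeD \<or> n - 1 \<in> Bl" using D_facts by (auto simp: Wh_iff)
    then show ?thesis using all_fixed pi_id_not_D_end by blast
  next
    case True
    then have D: "shape G = ShapeD" "n - 1 \<in> Wh" and nn: "n \<ge> 2" using D_facts by auto
    show ?thesis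
    proof (cases "n - 2 \<in> Bl")
      case True
      then show ?thesis using all_fixed pi_id_not_D_end pi_D_black[OF D(1) True D(2) G1] by blast
    next
      case False
      then have D2: "n - 2 \<in> Wh" using nn by (simp add: Wh_iff)
      have big: "v = n - 2 \<or> v = n - 1" if "v \<in> Wh" "n - 2 \<le> v" for v using that by (auto simp: Wh_iff)
      from pi_D_white[OF D D2 G1] show ?thesis
      proof (elim disjE conjE, goal_cases)
        case 1
        have "\<pi> i = i" if "i \<in> Wh" for i
        proof (cases "i < n - 2")
          case True
          show ?thesis
          proof (rule fixed_below[of "n - 2", OF _ _ _ _ that True])
            fix v assume v: "v \<in> Wh" "n - 2 \<le> v"
            from big[OF v] have pv: "\<pi> v = v" by (elim disjE) (simp_all only: 1)
            then show "\<pi> v = v \<or> shape G = ShapeD \<and> n - 2 \<notin> Bl \<and> \<pi> v \<in> {n - 2, n - 1} \<and> v \<in> {n - 2, n - 1}" ..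
            from pv v show "\<exists>v'\<in>Wh. n - 2 \<le> v' \<and> \<pi> v' = v" by blast
          qed simp_all
        next
          case False
          then show ?thesis using big[OF that] 1 by auto
        qed
        then show ?thesis by (rule all_fixed)
      next
        case 2
        define q where "q = n - 2"
        have n: "n = q + 2" "n - 1 = q + 1" "n - 2 = q" using nn by (auto simp: q_def)
        have fx: "\<pi> i = i" if "i \<in> Wh" "i < q" for i
        proof -
          have i: "i < n - 2" using that n by simp
          have f: "\<pi> v \<in> {n - 2, n - 1} \<and> v \<in> {n - 2, n - 1}" if "v \<in> Wh" "n - 2 \<le> v" for v
            using big[OF that] 2 by auto
          have s: "\<exists>v'\<in>Wh. n - 2 \<le> v' \<and> \<pi> v' = v" if "v \<in> Wh" "n - 2 \<le> v" for v
            using big[OF that]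
          proof
            assume "v = n - 2"
            then show ?thesis by (intro bexI[of _ "n - 1"]) (use 2 D in simp_all)
          next
            assume "v = n - 1"
            then show ?thesis by (intro bexI[of _ "n - 2"]) (use 2 D2 in simp_all)
          qed
          show ?thesis by (rule fixed_below[of "n - 2", OF _ _ _ _ that(1) i]) (use f s D False in auto)
        qed
        have qW: "q \<in> Wh" using D2 n by simp
        have s: "small_block i" if "i \<in> Wh" "i \<le> q" for i
        proof (rule small_chain[OF that(1)])
          show "\<pi> i = i \<or> shape G = ShapeD \<and> i = n - 2 \<and> \<pi> i = n - 1"
            using fx[OF that(1)] that(2) 2 D n by (cases "i = q") auto
        qed (use that n in simp)
        have "sized q" unfolding sized_def
          using qW fx small_blocks[OF s qW] D(1) 2 n D(2) by auto
        then show ?thesis by (rule goals(1))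
      next
        case 3
        then show ?thesis using goals(2) D by blast
      qed
    qed
  qed
qed

end

section \<open>Consequences of the selection rules\<close>

context super_algebra
begin

lemma t_inverse:
  assumes os "i < N" "k < N"
  shows "t i k * t k i = (if pr i = pr k then 1 else -1)"
  using t_mult[OF assms(1,2,3,2)] t_self[OF assms(1,2)] pr_cases[OF assms(2)] pr_cases[OF assms(3)]
  by (auto simp: sg_def)

lemma t_mult_even:
  assumes os "i < N" "k < N" "j < N" "pr i = pr k \<or> pr k = pr j"
  shows "t i k * t k j = - t i j"
  using t_mult[OF assms(1-4)] assms(5) pr_cases[OF assms(2)] pr_cases[OF assms(3)] pr_cases[OF assms(4)]
  by (auto simp: sg_def)

end

locale sat = osat +
  fixes q :: nat
  assumes GS: "graded_satake G P \<tau>" and C4: "\<not> config4 True G P \<tau>" and SZ: "sized q"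
begin

lemma qW: "q \<in> Wh" and fixed: "i \<in> Wh \<Longrightarrow> i < q \<Longrightarrow> \<pi> i = i"
  and small: "k \<in> Bl \<Longrightarrow> k < q \<Longrightarrow> k + 1 \<notin> Bl \<and> sn (k + 1) = sn k"
  and q_cases: "\<pi> q = q \<and> Wh \<subseteq> {..q} \<or>
    shape G = ShapeD \<and> q + 2 = n \<and> q + 1 \<in> Wh \<and> \<pi> q = q + 1 \<and> \<pi> (q + 1) = q"
  using SZ unfolding sized_def by blast+

lemma qn: "q < n" and qB: "q \<notin> Bl"
  using qW by (auto simp: Wh_iff)

lemma small': "k + 1 \<in> Bl \<Longrightarrow> k + 1 \<le> q \<Longrightarrow> k \<notin> Bl"
  using small[of k] by auto

lemma mir_q: "k \<le> q \<Longrightarrow> mir k \<le> q"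
  using qB by (auto simp: mir_def Suc_le_eq intro: le_neq_implies_less)

lemma mir_sn: "k \<le> q \<Longrightarrow> sn (mir k) = sn k"
  using small[of k] small[of "k - 1"] qB by (auto simp: mir_def intro: le_neq_implies_less)

lemma black_lt: "k \<in> Bl \<Longrightarrow> k \<le> q \<Longrightarrow> k < q"
  using qB by (metis le_neq_implies_less)

lemma lo_mir: "i \<in> Wh \<Longrightarrow> i \<le> q \<Longrightarrow> lo i = mir i"
proof -
  assume i: "i \<in> Wh" "i \<le> q"
  then have iB: "i \<notin> Bl" by (simp add: Wh_iff)
  show ?thesis
  proof (cases "i > 0 \<and> i - 1 \<in> Bl")
    case False
    then show ?thesis using lo_eq[of i] iB by (auto simp: mir_def)
  next
    case True
    define p where "p = i - 1"
    have p: "i = p + 1" "p \<in> Bl" using True by (auto simp: p_def)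
    have "{p..<i} \<subseteq> {p}" using p(1) by auto
    then have "{p..<i} \<subseteq> Bl" using p(2) by blast
    then have "lo i \<le> p" using lo_least[of p i] p(1) by simp
    moreover have "p \<le> lo i"
    proof (cases p)
      case (Suc m)
      then have "m \<notin> Bl" using small'[of m] p i by simp
      then show ?thesis using lo_gt[of m i] Suc p by simp
    qed simp
    ultimately show ?thesis using iB p by (simp add: mir_def)
  qed
qed

lemma hi_mir: "i \<notin> Bl \<Longrightarrow> i < q \<Longrightarrow> hi (i + 1) = mir (i + 1)"
proof -
  assume i: "i \<notin> Bl" "i < q"
  show ?thesis
  proof (cases "i + 1 \<in> Bl")
    case False
    then show ?thesis using hi_eq[of "i + 1"] i qn by (simp add: mir_def)
  next
    case True
    have l: "i + 1 < q" using black_lt[OF True] i by simp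
    have "hi (i + 1) \<le> i + 2" by (rule hi_least) (use small[OF True l] in auto)
    moreover have "i + 1 \<le> hi (i + 1)" "hi (i + 1) \<notin> Bl" using hi_ge[of "i + 1"] hi_white[of "i + 1"] i qn by auto
    ultimately have "hi (i + 1) = i + 2" using True by (metis Suc_eq_plus1 add_2_eq_Suc' le_SucE le_antisym)
    then show ?thesis using True by (simp add: mir_def)
  qed
qed

lemma black_end: "n - 1 \<in> Bl \<Longrightarrow> q < n - 1 \<and> (shape G = ShapeD \<longrightarrow> q < n - 2)"
proof -
  assume b: "n - 1 \<in> Bl"
  have q1: "q \<noteq> n - 1" using b qB by auto
  have "q \<noteq> n - 2" if "shape G = ShapeD" using nb[OF that b] qB by auto
  then show ?thesis using q1 qn by linarith
qed

lemma ip_Z_black: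
  assumes j: "j \<in> Bl" and k: "k \<le> q"
  shows "ip (Z k) (sr j) = (if k = j then sn k else if k = j + 1 then - sn k else 0)"
proof (cases "j + 1 < n")
  case True
  then show ?thesis using sr_c[OF True] k qn by (auto simp: ips)
next
  case False
  then have jn: "j = n - 1" "n > 0" using Bl_less[OF j] by auto
  then have e: "q < n - 1" "shape G = ShapeD \<longrightarrow> q < n - 2" using black_end j by auto
  consider "shape G = ShapeB" | "shape G = ShapeC" | "shape G = ShapeD" using os_shape osT by blast
  then show ?thesis
    by cases (use jn e k sr_e in \<open>auto simp: ips\<close>)
qed

lemma linked_small:
  assumes j: "j \<in> Bl" "j < q" and j': "j' \<in> Bl" "ip (sr j) (sr j') \<noteq> 0"
  shows "j' = j"
proof (rule ccontr)
  assume ne: "j' \<noteq> j"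
  have "ip (sr j) (sr j') = ip (Z j) (sr j') - ip (Z (j + 1)) (sr j')"
    using sr_c[of j] j(2) qn by (simp add: inner_h_linear)
  then have "j = j' + 1 \<or> j + 1 = j'"
    using j'(2) ip_Z_black[OF j'(1), of j] ip_Z_black[OF j'(1), of "j + 1"] j(2) ne by (auto split: if_splits)
  then show False using small'[of j'] small[OF j] j j' by auto
qed

lemma linked_white:
  assumes i: "i \<in> Wh" "i < q" and j: "j \<in> Bl"
  shows "ip (sr i) (sr j) \<noteq> 0 \<longleftrightarrow> j = i + 1 \<or> j + 1 = i"
proof -
  have "i \<noteq> j" using i j by (auto simp: Wh_iff)
  moreover have "ip (sr i) (sr j) = ip (Z i) (sr j) - ip (Z (i + 1)) (sr j)"
    using sr_c[of i] i(2) qn by (simp add: inner_h_linear)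
  ultimately show ?thesis
    using ip_Z_black[OF j, of i] ip_Z_black[OF j, of "i + 1"] i(2) s_nz[of i] s_nz[of "i + 1"] qn by auto
qed

lemma D_graph_white:
  assumes i: "i \<in> Wh" "i < q"
  shows "D_graph G P \<tau> (sr i) = {sr i} \<union> sr ` {j \<in> Bl. j = i + 1 \<or> j + 1 = i}"
proof (rule D_graph_eq[OF i(1)])
  show "\<tau> (sr i) = sr i" using \<pi>(2)[OF i(1)] fixed[OF i] by simp
  show "j' = j" if "j \<in> {j \<in> Bl. j = i + 1 \<or> j + 1 = i}" "j' \<in> Bl" "ip (sr j) (sr j') \<noteq> 0" for j j'
  proof -
    have "j \<in> Bl" "j < q" using that(1) i(2) black_lt[of j] by auto
    then show ?thesis using linked_small that by blast
  qed
qed (use linked_white[OF i] in auto)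

lemma sr_P: "j \<in> Bl \<Longrightarrow> sr j \<in> P"
  by (simp add: Bl_def)

lemma sr_ne: "i < n \<Longrightarrow> j < n \<Longrightarrow> i \<noteq> j \<Longrightarrow> sr i \<noteq> sr j"
  using sr_inj by blast

lemma end_odd: "shape G = ShapeD \<Longrightarrow> odd_root G (sr (n - 1)) \<longleftrightarrow> sn (n - 2) \<noteq> sn (n - 1)"
proof -
  assume D: "shape G = ShapeD"
  have n: "n \<ge> 2" "n - 2 < n" "n - 1 < n" "n - 2 \<noteq> n - 1" using D_facts[OF D] by auto
  then have c: "cc (n - 2) < N" "bar (cc (n - 1)) < N" "cc (n - 2) \<noteq> bar (cc (n - 1))" "cc (n - 1) < N"
    using cc_less cc_bar[OF osT, of "n - 2" "n - 1"] rn by auto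
  have s: "sr (n - 1) = wt (cc (n - 2)) - wt (bar (cc (n - 1)))"
    using sr_ced[of "n - 1"] n rn D by (simp add: ced_def)
  have "odd_root G (sr (n - 1)) \<longleftrightarrow> pr (cc (n - 2)) \<noteq> pr (cc (n - 1))"
    unfolding s using odd_root_iff[OF c(1-3) F_cc_bar_nonzero[OF osT]] n rn pr_bar[OF osT c(4)] by simp
  then show ?thesis using pr_cases[OF c(1)] pr_cases[OF c(4)] by (auto simp: sn_def)
qed

lemma sn_neg: "i < n \<Longrightarrow> j < n \<Longrightarrow> sn i \<noteq> sn j \<Longrightarrow> sn i + sn j = 0"
  using s_cases[of i] s_cases[of j] by auto

text \<open>Delicate only in shape D with \<open>i = n - 2\<close>: there the product is
  \<open>sn i - sn (i + 1)\<close>, non-zero precisely because the signs differ.\<close>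

lemma next_white_linked:
  assumes i: "i + 1 \<in> Wh" "sn i \<noteq> sn (i + 1)"
  shows "ip (sr (i + 1)) (sr i) \<noteq> 0"
proof -
  have n: "i + 1 < n" using i by (simp add: Wh_iff)
  have si: "sr i = Z i - Z (i + 1)" using sr_c[OF n] .
  have z: "sn (i + 1) \<noteq> 0" "sn i + sn (i + 1) = 0" using s_nz[OF n] sn_neg[of i "i + 1"] n i(2) by auto
  show ?thesis
  proof (cases "i + 2 < n")
    case True
    then show ?thesis using sr_c[of "i + 1"] si n z by (simp add: ips)
  next
    case False
    then have e: "n - 1 = i + 1" "n - 2 = i" "n > 0" using n by auto
    consider "shape G = ShapeB" | "shape G = ShapeC" | "shape G = ShapeD" using os_shape osT by blast
    then show ?thesis
    proof cases
      case 3
      have "ip (sr (i + 1)) (sr i) = sn i - sn (i + 1)" using sr_e(3)[OF e(3) 3] e si n by (simp add: ips)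
      then show ?thesis using i(2) by simp
    qed (use sr_e(1,2)[OF e(3)] e si n z in \<open>simp_all add: ips\<close>)
  qed
qed

text \<open>An odd white node between two blocks of size one would be isotropic with
  \<open>D_graph\<close> reduced to itself, and the next white node is linked to it: this is
  \<open>config2\<close>.\<close>

lemma parity_11:
  assumes i: "i \<in> Wh" "i < q" and w: "i = 0 \<or> i - 1 \<notin> Bl" "i + 1 \<notin> Bl"
  shows "sn i = sn (i + 1)"
proof (rule ccontr)
  assume ne: "sn i \<noteq> sn (i + 1)"
  have n: "i + 1 < n" using i qn by simp
  have w1: "i + 1 \<in> Wh" using w n by (simp add: Wh_iff)
  have e: "{j \<in> Bl. j = i + 1 \<or> j + 1 = i} = {}" using w by auto
  have "D_graph G P \<tau> (sr i) = {sr i}" using D_graph_white[OF i] unfolding e by simp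
  moreover have "ip (sr i) (sr i) = 0" using sr_c[OF n] sn_neg[OF _ n ne] n by (simp add: ips)
  moreover have "odd_root G (sr i)" using odd_sr_c[OF n] ne by simp
  moreover have "ip (sr (i + 1)) (sr i) \<noteq> 0" by (rule next_white_linked[OF w1 ne])
  moreover have "sr (i + 1) \<noteq> sr i" using sr_ne n by simp
  ultimately have "config2 G P \<tau>" unfolding config2_def using sr_white[OF i(1)] sr_white[OF w1] by blast
  then show False using GS by (simp add: graded_satake_def)
qed

lemma single_linkI:
  assumes "a < n" "b < n" "c < n" "ip x x = sn a + sn b" "ip x y = - sn b" "ip y y = sn b + sn c"
  shows "single_link G x y"
  unfolding single_link_def using assms(4-6) s_cases[OF assms(1)] s_cases[OF assms(2)] s_cases[OF assms(3)]
  by (intro bexI[of _ "sn a"] bexI[of _ "sn b"] bexI[of _ "sn c"]) auto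

lemma config1I:
  assumes "i \<in> Wh" "j \<in> Bl" "D_graph G P \<tau> (sr i) = {sr j, sr i}" "single_link G (sr j) (sr i)" "\<not> odd_root G (sr i)"
  shows False
proof -
  have "config1 G P \<tau>" unfolding config1_def using assms sr_white[OF assms(1)] sr_P[OF assms(2)] by blast
  then show False using GS by (simp add: graded_satake_def)
qed

text \<open>With equal signs the white node would be even with exactly one black neighbour, joined
  by a single link: this is \<open>config1\<close>.\<close>

lemma parity_21:
  assumes i: "i + 1 \<in> Wh" "i + 1 < q" and w: "i \<in> Bl" "i + 2 \<notin> Bl"
  shows "sn (i + 1) \<noteq> sn (i + 2)"
proof
  assume eq: "sn (i + 1) = sn (i + 2)"
  have n: "i + 2 < n" using i qn by simp
  have e: "{j \<in> Bl. j = i + 1 + 1 \<or> j + 1 = i + 1} = {i}" using w by auto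
  have s: "sr i = Z i - Z (i + 1)" "sr (i + 1) = Z (i + 1) - Z (i + 2)"
    using sr_c[of i] sr_c[of "i + 1"] n by auto
  show False
  proof (rule config1I[OF i(1) w(1)])
    show "D_graph G P \<tau> (sr (i + 1)) = {sr i, sr (i + 1)}" using D_graph_white[OF i] unfolding e by auto
    show "\<not> odd_root G (sr (i + 1))" using odd_sr_c[of "i + 1"] eq n by simp
    show "single_link G (sr i) (sr (i + 1))"
      by (rule single_linkI[of i "i + 1" "i + 2"], unfold s) (use n in \<open>simp_all add: ips\<close>)
  qed
qed

text \<open>The preceding argument with the black neighbour on the other side.\<close>

lemma parity_12:
  assumes i: "i \<in> Wh" "i < q" and w: "i = 0 \<or> i - 1 \<notin> Bl" "i + 1 \<in> Bl"
  shows "sn i \<noteq> sn (i + 1)"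
proof
  assume eq: "sn i = sn (i + 1)"
  have n: "i + 2 < n" using i black_lt[OF w(2)] qn by simp
  have e: "{j \<in> Bl. j = i + 1 \<or> j + 1 = i} = {i + 1}" using w by auto
  have s: "sr i = Z i - Z (i + 1)" "sr (i + 1) = Z (i + 1) - Z (i + 2)"
    using sr_c[of i] sr_c[of "i + 1"] n by auto
  show False
  proof (rule config1I[OF i(1) w(2)])
    show "D_graph G P \<tau> (sr i) = {sr (i + 1), sr i}" using D_graph_white[OF i] unfolding e by auto
    show "\<not> odd_root G (sr i)" using odd_sr_c[of i] eq n by simp
    show "single_link G (sr (i + 1)) (sr i)"
      by (rule single_linkI[of "i + 2" "i + 1" i], unfold s) (use n in \<open>simp_all add: ips\<close>)
  qed
qed

lemma black_links_above:
  assumes "(\<gamma>, \<beta>) \<in> (black_links G P)\<^sup>*" "\<gamma> \<in> sr ` {j \<in> Bl. m < j}" "m \<in> Wh" "m < q"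
  shows "\<beta> \<in> sr ` {j \<in> Bl. m < j}"
  using assms(1)
proof (induction rule: rtrancl_induct)
  case (step y z)
  then obtain j where j: "y = sr j" "j \<in> Bl" "m < j" by auto
  have "z \<in> P" "ip y z \<noteq> 0" using step(2) by (auto simp: black_links_def)
  moreover then obtain k where k: "k < n" "z = sr k" using P_sub simple_roots_sr by auto
  ultimately have kB: "k \<in> Bl" and l: "ip (sr j) (sr k) \<noteq> 0" using j by (auto simp: Bl_def)
  have "m < k"
  proof (rule ccontr)
    assume "\<not> m < k"
    then have "k < m" using kB assms(3) by (metis Wh_iff linorder_neqE_nat)
    then have "k < q" "k + 1 \<le> m" using assms(4) by auto
    then have "j = k" using linked_small[OF kB _ j(2)] l inner_h_sym by metis
    then show False using \<open>k < m\<close> j by simp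
  qed
  then show ?case using k kB by blast
qed (use assms in simp)

lemma sr_far:
  assumes "j + 1 < k" "k < n" "shape G = ShapeD \<Longrightarrow> k = n - 1 \<Longrightarrow> j + 2 < k"
  shows "ip (sr j) (sr k) = 0"
proof -
  have sj: "sr j = Z j - Z (j + 1)" using sr_c[of j] assms by simp
  consider "k + 1 < n" | "k = n - 1" "shape G = ShapeB" | "k = n - 1" "shape G = ShapeC" | "k = n - 1" "shape G = ShapeD"
    using os_shape osT assms(2) by linarith
  then show ?thesis
  proof cases
    case 1
    then show ?thesis using sj sr_c[OF 1] assms by (simp add: ips)
  next
    case 2
    then show ?thesis using sj sr_e(1) assms by (simp add: ips)
  next
    case 3
    then show ?thesis using sj sr_e(2) assms by (simp add: ips)
  next
    case 4
    have "n - 1 < n" "n - 2 < n" "j + 1 < n - 2" "n - 2 < n - 1" using 4 assms by auto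
    then show ?thesis using sj sr_e(3) 4 by (simp add: ips)
  qed
qed

lemma sr_simple: "j + 2 < n \<Longrightarrow> sr j = simple_root G j"
proof -
  assume "j + 2 < n"
  then have "j \<noteq> n - 1" "j \<noteq> n - 2" by linarith+
  then show ?thesis by (simp add: sr_def \<rho>_def)
qed

lemma sr_ends:
  "(sr (n - 1) = simple_root G (n - 1) \<and> sr (n - 2) = simple_root G (n - 2)) \<or>
    (sr (n - 1) = simple_root G (n - 2) \<and> sr (n - 2) = simple_root G (n - 1))" if "n \<ge> 2"
  using that by (auto simp: sr_def \<rho>_def)

text \<open>An odd node between two blocks of size two is excluded by the selection rule that fits
  the next white node \<open>i + 3\<close>: \<open>config5\<close> if this is a fixed end node of
  shape D, \<open>config3\<close> with \<open>i + 3\<close> in the role of \<sigma> if it is fixed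
  otherwise, and \<open>config4\<close> if it is exchanged with the other end node.\<close>

lemma parity_22:
  assumes i: "i + 1 \<in> Wh" "i + 1 < q" and w: "i \<in> Bl" "i + 2 \<in> Bl"
  shows "sn (i + 1) = sn (i + 2)"
proof (rule ccontr)
  assume ne: "sn (i + 1) \<noteq> sn (i + 2)"
  have q3: "i + 3 \<le> q" "i + 2 < q" using black_lt[OF w(2)] i by auto
  have s: "sr i = Z i - Z (i + 1)" "sr (i + 1) = Z (i + 1) - Z (i + 2)" "sr (i + 2) = Z (i + 2) - Z (i + 3)"
    using sr_c[of i] sr_c[of "i + 1"] sr_c[of "i + 2"] q3 qn by (auto simp: numeral_2_eq_2 numeral_3_eq_3)
  have lt: "i < n" "i + 1 < n" "i + 2 < n" "i + 3 < n" using q3 qn by auto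
  have sm: "sn (i + 1) = sn i" "sn (i + 3) = sn (i + 2)" "i + 3 \<notin> Bl"
    using small[OF w(1)] small[OF w(2)] q3 by (auto simp: numeral_3_eq_3)
  have W3: "i + 3 \<in> Wh" using sm(3) lt by (simp add: Wh_iff)
  have e: "{j \<in> Bl. j = i + 1 + 1 \<or> j + 1 = i + 1} = {i, i + 2}" using w by auto
  have D: "D_graph G P \<tau> (sr (i + 1)) = {sr i, sr (i + 1), sr (i + 2)}"
    using D_graph_white[OF i] unfolding e by auto
  have odd: "odd_root G (sr (i + 1))" "\<not> odd_root G (sr i)" "\<not> odd_root G (sr (i + 2))"
    using odd_sr_c[of i] odd_sr_c[of "i + 1"] odd_sr_c[of "i + 2"] ne sm lt by (auto simp: numeral_2_eq_2 numeral_3_eq_3)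
  note P' = sr_P[OF w(1)] sr_P[OF w(2)]
  have G': "\<not> config3 G P \<tau>" "\<not> config4 False G P \<tau>" "\<not> config5 G P \<tau>"
    using GS unfolding graded_satake_def by blast+
  show False
  proof (cases "\<pi> (i + 3) = i + 3")
    case True
    then have t3: "\<tau> (sr (i + 3)) = sr (i + 3)" using \<pi>(2)[OF W3] by simp
    show False
    proof (cases "shape G = ShapeD \<and> i + 4 = n")
      case True
      then have n: "n - 4 = i" "n - 3 = i + 1" "n - 2 = i + 2" "n - 1 = i + 3" and D': "shape G = ShapeD" by auto
      have si: "sr i = simple_root G i" "sr (i + 1) = simple_root G (i + 1)" using sr_simple[of i] sr_simple[of "i + 1"] True by auto
      have o3: "\<not> odd_root G (sr (i + 3))" using end_odd[OF D'] sm unfolding n by simp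
      have ends: "{sr (i + 2), sr (i + 3)} = {simple_root G (i + 2), simple_root G (i + 3)}"
        "\<not> odd_root G (simple_root G (i + 2))" "\<not> odd_root G (simple_root G (i + 3))"
        using sr_ends o3 odd(3) lt unfolding n by auto
      have w1: "sr (i + 1) \<notin> P" "sr (i + 3) \<notin> P" using sr_white[OF i(1)] sr_white[OF W3] by auto
      have "config5 G P \<tau>" unfolding config5_def Let_def n
        using D' True P' w1 D odd ends(2,3) unfolding si
        by (intro conjI exI[of _ "sr (i + 2)"] exI[of _ "sr (i + 3)"]) (use ends(1) in simp_all)
      then show False using G' by simp
    next
      case F: False
      have "ip (sr (i + 2)) (sr (i + 3)) \<noteq> 0"
      proof (cases "i + 4 < n")
        case True
        then show ?thesis using sr_c[of "i + 3"] s lt s_nz[of "i + 3"] by (simp add: ips)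
      next
        case False
        then have n: "n - 1 = i + 3" "n > 0" using lt by auto
        then have "shape G = ShapeB \<or> shape G = ShapeC" using F os_shape osT lt by auto
        then show ?thesis using sr_e(1,2)[OF n(2)] s lt s_nz[of "i + 3"] unfolding n by (auto simp: ips)
      qed
      moreover have "sr i \<notin> D_graph G P \<tau> (sr (i + 3))"
      proof
        assume "sr i \<in> D_graph G P \<tau> (sr (i + 3))"
        then consider "sr i = sr (i + 3)" |
          \<gamma> where "\<gamma> \<in> P" "ip (sr (i + 3)) \<gamma> \<noteq> 0" "(\<gamma>, sr i) \<in> (black_links G P)\<^sup>*"
          unfolding D_graph_def t3 by blast
        then show False
        proof cases
          case 1
          then show False using sr_ne[of i "i + 3"] lt by simp
        next
          case 2
          obtain j where j: "j < n" "\<gamma> = sr j" using 2(1) P_sub simple_roots_sr by auto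
          then have jB: "j \<in> Bl" using 2(1) by (simp add: Bl_def)
          have "i + 1 < j"
          proof (rule ccontr)
            assume "\<not> i + 1 < j"
            moreover have "j \<noteq> i + 1" using jB i by (auto simp: Wh_iff)
            ultimately have "j \<le> i" by simp
            then have "ip (sr j) (sr (i + 3)) = 0" using sr_far[of j "i + 3"] lt by simp
            then show False using 2(2) j inner_h_sym by metis
          qed
          then have "sr i \<in> sr ` {j \<in> Bl. i + 1 < j}"
            using black_links_above[OF 2(3) _ i] j jB by blast
          then obtain k where "sr i = sr k" "i + 1 < k" "k \<in> Bl" by auto
          then show False using sr_ne[of i k] Bl_less[of k] lt by simp
        qed
      qed
      moreover have "single_link G (sr i) (sr (i + 1))"
        by (rule single_linkI[of i "i + 1" "i + 2"], unfold s) (use lt in \<open>simp_all add: ips\<close>)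
      moreover have "single_link G (sr (i + 1)) (sr (i + 2))"
        by (rule single_linkI[of "i + 1" "i + 2" "i + 3"], unfold s) (use lt in \<open>simp_all add: ips\<close>)
      moreover have "ip (sr i) (sr (i + 2)) = 0" unfolding s using lt by (simp add: ips)
      moreover have "sr i \<noteq> sr (i + 2)" "sr (i + 3) \<noteq> sr (i + 1)" using sr_ne lt by simp_all
      ultimately have "config3 G P \<tau>" unfolding config3_def
        using sr_white[OF i(1)] sr_white[OF W3] P' odd D t3 by blast
      then show False using G' by simp
    qed
  next
    case False
    then have "i + 3 = q" using fixed[OF W3] q3(1) by (cases "i + 3 = q") auto
    then have sw: "shape G = ShapeD" "q + 2 = n" "q + 1 \<in> Wh" "\<pi> q = q + 1" "\<pi> (q + 1) = q" and q: "q = i + 3"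
      using q_cases False by auto
    have n: "n - 5 = i" "n - 4 = i + 1" "n - 3 = i + 2" "n - 2 = q" "n - 1 = q + 1" "n > 0" "n \<ge> 5" using sw(2) q by auto
    have si: "sr i = simple_root G i" "sr (i + 1) = simple_root G (i + 1)" "sr (i + 2) = simple_root G (i + 2)"
      using sr_simple[of i] sr_simple[of "i + 1"] sr_simple[of "i + 2"] sw(2) q by auto
    have ts: "\<tau> (sr q) = sr (q + 1)" "\<tau> (sr (q + 1)) = sr q" using \<pi>(2)[OF qW] \<pi>(2)[OF sw(3)] sw(4,5) by auto
    have sq: "sr q = Z q - Z (q + 1)" "sr (q + 1) = Z q + Z (q + 1)"
      using sr_c[of q] sr_e(3)[OF n(6) sw(1)] sw(2) unfolding n by auto
    have oq: "odd_root G (sr q) \<longleftrightarrow> sn q \<noteq> sn (q + 1)" "odd_root G (sr (q + 1)) \<longleftrightarrow> sn q \<noteq> sn (q + 1)"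
      using odd_sr_c[of q] end_odd[OF sw(1)] sw(2) unfolding n by auto
    have link: "ip x (sr j) \<noteq> 0 \<longleftrightarrow> j = i + 2" if "j \<in> Bl" "x \<in> {sr q, sr (q + 1)}" for x j
    proof -
      have j: "j < n" "j \<noteq> q" "j \<noteq> q + 1" using Bl_less[OF that(1)] that(1) qB sw(3) by (auto simp: Wh_iff)
      then have "j + 1 \<le> q" using sw(2) by linarith
      moreover have "sr j = Z j - Z (j + 1)" using sr_c[of j] calculation sw(2) by simp
      ultimately have "ip x (sr j) = (if q = j + 1 then - sn q else 0)"
        using that(2) sq sw(2) by (auto simp: ips)
      then show ?thesis using s_nz[of q] q qn by auto
    qed
    have Dq: "D_graph G P \<tau> x = {sr (i + 2), sr q, sr (q + 1)}" if x: "x \<in> {sr q, sr (q + 1)}" for x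
    proof -
      have tx: "\<tau> x \<in> {sr q, sr (q + 1)}" "{x, \<tau> x} = {sr q, sr (q + 1)}" using x ts by auto
      have "(\<exists>\<gamma>\<in>P. (ip x \<gamma> \<noteq> 0 \<or> ip (\<tau> x) \<gamma> \<noteq> 0) \<and> (\<gamma>, \<beta>) \<in> (black_links G P)\<^sup>*) \<longleftrightarrow> \<beta> = sr (i + 2)" for \<beta>
      proof
        assume "\<exists>\<gamma>\<in>P. (ip x \<gamma> \<noteq> 0 \<or> ip (\<tau> x) \<gamma> \<noteq> 0) \<and> (\<gamma>, \<beta>) \<in> (black_links G P)\<^sup>*"
        then obtain \<gamma> where g: "\<gamma> \<in> P" "ip x \<gamma> \<noteq> 0 \<or> ip (\<tau> x) \<gamma> \<noteq> 0" "(\<gamma>, \<beta>) \<in> (black_links G P)\<^sup>*" by blast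
        obtain j where j: "j < n" "\<gamma> = sr j" using g(1) P_sub simple_roots_sr by auto
        then have jB: "j \<in> Bl" using g(1) by (simp add: Bl_def)
        have "j = i + 2" using link[OF jB x] link[OF jB tx(1)] g(2) j by auto
        then show "\<beta> = sr (i + 2)"
          using black_links_rtrancl[OF g(3) j(2)] linked_small[OF w(2) q3(2)] by blast
      next
        assume "\<beta> = sr (i + 2)"
        then show "\<exists>\<gamma>\<in>P. (ip x \<gamma> \<noteq> 0 \<or> ip (\<tau> x) \<gamma> \<noteq> 0) \<and> (\<gamma>, \<beta>) \<in> (black_links G P)\<^sup>*"
          using link[OF w(2) x] P'(2) by blast
      qed
      then show ?thesis unfolding D_graph_def tx(2) by auto
    qed
    have w1: "sr (i + 1) \<notin> P" "sr q \<notin> P" "sr (q + 1) \<notin> P"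
      using sr_white[OF i(1)] sr_white[OF qW] sr_white[OF sw(3)] by auto
    have ends: "simple_root G q \<in> {sr q, sr (q + 1)}" "simple_root G (q + 1) \<in> {sr q, sr (q + 1)}"
      "{simple_root G q, simple_root G (q + 1)} = {sr q, sr (q + 1)}"
      "\<tau> (simple_root G q) = simple_root G (q + 1)" "\<tau> (simple_root G (q + 1)) = simple_root G q"
      using sr_ends ts n(7) unfolding n(4,5) by auto
    \<comment> \<open>The common parity of the end nodes is not determined at this point. An even
      pair contradicts the selection rules, an odd pair the additional assumption
      \<open>C4\<close>.\<close>
    have "config4 (sn q \<noteq> sn (q + 1)) G P \<tau>"
      unfolding config4_def Let_def n(1-5)
    proof (intro conjI)
      show "D_graph G P \<tau> (simple_root G (q + 1)) = {simple_root G (i + 2), simple_root G q, simple_root G (q + 1)}"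
        unfolding Dq[OF ends(2)] ends(3) si(3) ..
      show "simple_root G q \<notin> P" "simple_root G (q + 1) \<notin> P" using ends(1,2) w1 by auto
      show "odd_root G (simple_root G q) = (sn q \<noteq> sn (q + 1))" "odd_root G (simple_root G (q + 1)) = (sn q \<noteq> sn (q + 1))"
        using ends(1,2) oq by auto
      show "D_graph G P \<tau> (simple_root G (i + 1)) = {simple_root G i, simple_root G (i + 1), simple_root G (i + 2)}"
        using D unfolding si .
    qed (use sw n P' w1 odd ends si in auto)
    then show False using G'(2) C4 by (cases "sn q = sn (q + 1)") auto
  qed
qed

end

section \<open>The coefficients of the graph\<close>

context sat
begin

text \<open>Solves the recursion that the black and the white generators impose on consecutive
  coefficients, where \<open>C k\<close> is the ratio of the two terms of the generator at a white
  node k. The initial value is a mere choice, as the whole sequence can still be multiplied by a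
  constant.\<close>

primrec kap :: "(nat \<Rightarrow> complex) \<Rightarrow> nat \<Rightarrow> complex" where
  "kap C 0 = 1"
| "kap C (Suc k) = t (cc k) (cc (Suc k)) * kap C k / (if k \<in> Bl then 1 else C k)"

lemma ccN: "k < n \<Longrightarrow> cc k < N"
  using cc_less rn by simp

lemma kap_nz: "(\<And>j. C j \<noteq> 0) \<Longrightarrow> k < n \<Longrightarrow> kap C k \<noteq> 0"
  by (induction k) (use t_nz osT ccN in auto)

lemma sn_pr: "i < n \<Longrightarrow> j < n \<Longrightarrow> sn i = sn j \<longleftrightarrow> pr (cc i) = pr (cc j)"
  using pr_cases[OF ccN, of i] pr_cases[OF ccN, of j] by (auto simp: sn_def)

lemma wstab_kap:
  assumes "\<And>j. C j \<noteq> 0" "s \<noteq> 0"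
  shows "wstab G P \<Phi> (q + 1) (\<lambda>k. s * kap C k)"
proof (unfold_locales)
  fix k assume k: "k \<in> Bl" "k < q + 1"
  then have l: "k < q" using black_lt[of k] by simp
  show "k + 1 < q + 1 \<and> k + 1 \<notin> Bl \<and> pr (cc (k + 1)) = pr (cc k)"
    using small[OF k(1) l] sn_pr[of k "k + 1"] l qn by simp
  show "s * kap C (k + 1) = t (cc k) (cc (k + 1)) * (s * kap C k)" using k by simp
next
  fix k assume "k < q + 1"
  then show "s * kap C k \<noteq> 0" using kap_nz[of C k] assms qn by simp
qed (use osT qn in auto)

end

locale satw = sat G P \<Phi> \<tau> q + W: wstab G P \<Phi> "q + 1" \<kappa> for G P \<Phi> \<tau> q \<kappa> +
  fixes C :: "nat \<Rightarrow> complex"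
  assumes \<kappa>C: "\<And>i. i \<in> Wh \<Longrightarrow> i < q \<Longrightarrow> C i * \<kappa> (i + 1) = t (cc i) (cc (i + 1)) * \<kappa> i"
begin

lemma \<kappa>_blk: "k \<in> Bl \<Longrightarrow> k \<le> q \<Longrightarrow> \<kappa> (k + 1) = t (cc k) (cc (k + 1)) * \<kappa> k"
  using W.\<kappa>blk by simp

text \<open>The indices i, \<open>i + 1\<close>, \<open>mir (i + 1)\<close> and \<open>mir i\<close>
  form a square. Inserting the recursion turns the claim into a product of duality factors around
  it, whose sign depends on the parities of the two adjacent blocks; the parity lemmas make it
  +1.\<close>

lemma white_cycle:
  assumes i: "i \<in> Wh" "i < q"
  shows "C i * t (cc (mir (i + 1))) (cc (mir i)) * \<kappa> (mir (i + 1)) = \<kappa> (mir i)"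
proof -
  have iB: "i \<notin> Bl" using i by (simp add: Wh_iff)
  have n: "i + 1 < n" "i < n" using i qn by auto
  have pe: "sn i = sn (i + 1) \<longleftrightarrow> pr (cc i) = pr (cc (i + 1))" using sn_pr[of i "i + 1"] n by simp
  note mu = t_mult_even[OF osT] and inv = t_inverse[OF osT]
  consider (11) "i = 0 \<or> i - 1 \<notin> Bl" "i + 1 \<notin> Bl" | (12) "i = 0 \<or> i - 1 \<notin> Bl" "i + 1 \<in> Bl"
    | (2) p where "i = p + 1" "p \<in> Bl"
    using not0_implies_Suc by fastforce
  then show ?thesis
  proof cases
    case 11
    have m: "mir i = i" "mir (i + 1) = i + 1" using 11 iB by (auto simp: mir_def)
    have p: "pr (cc i) = pr (cc (i + 1))" using parity_11[OF i 11] pe by simp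
    have "C i * t (cc (i + 1)) (cc i) * \<kappa> (i + 1) = t (cc (i + 1)) (cc i) * (C i * \<kappa> (i + 1))" by simp
    also have "\<dots> = (t (cc (i + 1)) (cc i) * t (cc i) (cc (i + 1))) * \<kappa> i" using \<kappa>C[OF i] by simp
    also have "t (cc (i + 1)) (cc i) * t (cc i) (cc (i + 1)) = 1" using inv[of "cc (i + 1)" "cc i"] p ccN n by simp
    finally show ?thesis unfolding m mult_1_left .
  next
    case 12
    have m: "mir i = i" "mir (i + 1) = i + 2" using 12 iB by (auto simp: mir_def)
    have p: "pr (cc i) \<noteq> pr (cc (i + 1))" using parity_12[OF i 12] pe by simp
    have l: "i + 1 < q" using black_lt[OF 12(2)] i by simp
    then have n2: "i + 2 < n" using qn by simp
    have b: "pr (cc (i + 1)) = pr (cc (i + 2))" using small[OF 12(2) l] sn_pr[of "i + 1" "i + 2"] n n2 by simp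
    have k2: "\<kappa> (i + 2) = t (cc (i + 1)) (cc (i + 2)) * \<kappa> (i + 1)" using \<kappa>_blk[OF 12(2)] l by simp
    have "C i * t (cc (i + 2)) (cc i) * \<kappa> (i + 2) = t (cc (i + 2)) (cc i) * t (cc (i + 1)) (cc (i + 2)) * (C i * \<kappa> (i + 1))"
      unfolding k2 by simp
    also have "\<dots> = t (cc (i + 2)) (cc i) * (t (cc i) (cc (i + 1)) * t (cc (i + 1)) (cc (i + 2))) * \<kappa> i"
      unfolding \<kappa>C[OF i] by simp
    also have "\<dots> = - (t (cc (i + 2)) (cc i) * t (cc i) (cc (i + 2))) * \<kappa> i"
      using mu[of "cc i" "cc (i + 1)" "cc (i + 2)"] b ccN n n2 by simp
    finally show ?thesis unfolding m using inv[of "cc (i + 2)" "cc i"] p b ccN n n2 by simp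
  next
    case 2
    have mi: "mir i = p" using 2 iB by (simp add: mir_def)
    have pq: "p < q" "p \<le> q" "p < n" using 2 i n by auto
    have bp: "pr (cc p) = pr (cc i)" using small[OF 2(2) pq(1)] sn_pr[of p i] 2 n by simp
    have k1: "\<kappa> i = t (cc p) (cc i) * \<kappa> p" using \<kappa>_blk[OF 2(2) pq(2)] 2 by simp
    have e1: "t (cc p) (cc i) * t (cc i) (cc (i + 1)) = - t (cc p) (cc (i + 1))"
      using mu[of "cc p" "cc i" "cc (i + 1)"] bp ccN n pq by simp
    show ?thesis
    proof (cases "i + 1 \<in> Bl")
      case False
      have m: "mir (i + 1) = i + 1" using False iB by (simp add: mir_def)
      have p: "pr (cc i) \<noteq> pr (cc (i + 1))" using parity_21[of p] i 2 False pe by simp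
      have "C i * t (cc (i + 1)) (cc p) * \<kappa> (i + 1) = t (cc (i + 1)) (cc p) * (C i * \<kappa> (i + 1))" by simp
      also have "\<dots> = t (cc (i + 1)) (cc p) * (t (cc p) (cc i) * t (cc i) (cc (i + 1))) * \<kappa> p"
        unfolding \<kappa>C[OF i] k1 by simp
      finally show ?thesis unfolding m mi e1 using inv[of "cc (i + 1)" "cc p"] p bp ccN n pq by simp
    next
      case True
      have m: "mir (i + 1) = i + 2" using True by (simp add: mir_def)
      have p: "pr (cc i) = pr (cc (i + 1))" using parity_22[of p] i 2 True pe by simp
      have l: "i + 1 < q" using black_lt[OF True] i by simp
      then have n2: "i + 2 < n" using qn by simp
      have b: "pr (cc (i + 1)) = pr (cc (i + 2))" using small[OF True l] sn_pr[of "i + 1" "i + 2"] n n2 by simp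
      have k2: "\<kappa> (i + 2) = t (cc (i + 1)) (cc (i + 2)) * \<kappa> (i + 1)" using \<kappa>_blk[OF True] l by simp
      have e2: "t (cc p) (cc (i + 1)) * t (cc (i + 1)) (cc (i + 2)) = - t (cc p) (cc (i + 2))"
        using mu[of "cc p" "cc (i + 1)" "cc (i + 2)"] b ccN n n2 pq by simp
      have "C i * t (cc (i + 2)) (cc p) * \<kappa> (i + 2) = t (cc (i + 2)) (cc p) * t (cc (i + 1)) (cc (i + 2)) * (C i * \<kappa> (i + 1))"
        unfolding k2 by simp
      also have "\<dots> = t (cc (i + 2)) (cc p) * t (cc (i + 1)) (cc (i + 2)) * (t (cc p) (cc i) * t (cc i) (cc (i + 1))) * \<kappa> p"
        unfolding \<kappa>C[OF i] k1 by simp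
      also have "\<dots> = - t (cc (i + 2)) (cc p) * (t (cc p) (cc (i + 1)) * t (cc (i + 1)) (cc (i + 2))) * \<kappa> p"
        unfolding e1 by simp
      also have "\<dots> = t (cc (i + 2)) (cc p) * t (cc p) (cc (i + 2)) * \<kappa> p" unfolding e2 by simp
      also have "t (cc (i + 2)) (cc p) * t (cc p) (cc (i + 2)) = 1"
        using inv[of "cc (i + 2)" "cc p"] p bp b ccN n n2 pq by simp
      finally show ?thesis unfolding m mi mult_1_left .
    qed
  qed
qed

definition white_gen :: "nat \<Rightarrow> complex mat" where
  "white_gen j = F (fst (ced j)) (snd (ced j)) + C j \<cdot>\<^sub>m F (snd (hp (\<pi> j))) (fst (hp (\<pi> j)))"

text \<open>The sum \<open>Z k + Z (mir k)\<close> is invariant under the mirror, and mirrored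
  weights have equal signs.\<close>

lemma ip_mir: "k \<le> q \<Longrightarrow> i \<le> q \<Longrightarrow> ip (Z k + Z (mir k)) (Z (mir i)) = ip (Z k + Z (mir k)) (Z i)"
proof -
  assume a: "k \<le> q" "i \<le> q"
  have m: "mir k \<le> q" "mir i \<le> q" "sn (mir i) = sn i" "mir (mir i) = i" "mir (mir k) = k"
    using mir_q mir_sn W.mir_mir a by auto
  have "k = mir i \<longleftrightarrow> mir k = i" "mir k = mir i \<longleftrightarrow> k = i" using m(4,5) by auto
  then show ?thesis using m a qn by (auto simp: ips)
qed

lemma ip_high: "k \<le> q \<Longrightarrow> q < i \<Longrightarrow> i < n \<Longrightarrow> ip (Z k + Z (mir k)) (Z i) = 0"
  using mir_q[of k] by (simp add: ips)

lemma cc_tail: "q < m \<Longrightarrow> m < n \<Longrightarrow> cc m \<in> tail (q + 1) \<and> bar (cc m) \<in> tail (q + 1)"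
proof -
  assume m: "q < m" "m < n"
  have "cc m \<in> tail (q + 1)" unfolding tail_def using m qn ccN[OF m(2)] cc_inj cc_bar[OF osT] rn by auto
  then show ?thesis using W.tailD by blast
qed

lemma mid_tail: "shape G = ShapeB \<Longrightarrow> n \<in> tail (q + 1)"
proof -
  assume B: "shape G = ShapeB"
  then have "\<not> fl" using fl by auto
  then have c: "cc k = k" for k by (simp add: cc_def)
  show ?thesis using shape_B_N[OF B] qn by (auto simp: tail_def c bar_def)
qed

text \<open>A black node below q belongs to a block of size two; the root vectors of one above q
  live on the tail and annihilate W.\<close>

lemma black_stab:
  assumes "bs k l"
  shows "F k l \<in> W.stabW \<and> F l k \<in> W.stabW"
proof -
  have main: "F (fst (ced j)) (snd (ced j)) \<in> W.stabW \<and> F (snd (ced j)) (fst (ced j)) \<in> W.stabW" if j: "j \<in> Bl" for j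
  proof (cases "j < q")
    case True
    then have "ced j = (cc j, cc (j + 1))" using qn rn by (simp add: ced_def)
    then show ?thesis using W.stab_black[OF j] True by simp
  next
    case False
    then have jq: "q < j" "j < n" using j qB Bl_less by (auto intro: le_neq_implies_less)
    have "fst (ced j) \<in> tail (q + 1) \<and> snd (ced j) \<in> tail (q + 1)"
    proof (cases "j + 1 < n")
      case True
      then show ?thesis using cc_tail jq rn by (simp add: ced_def)
    next
      case e: False
      then have jn: "j = n - 1" "n > 0" using jq by auto
      have be: "q < n - 1" "shape G = ShapeD \<longrightarrow> q < n - 2" using black_end j jn by auto
      consider "shape G = ShapeB" | "shape G = ShapeC" | "shape G = ShapeD" using os_shape osT by blast
      then show ?thesis
      proof cases
        case 1
        then have "\<not> fl" using fl by auto
        then have "cc (n - 1) = n - 1" by (simp add: cc_def)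
        then show ?thesis using cc_tail[of "n - 1"] mid_tail[OF 1] be jn 1 rn by (simp add: ced_def)
      next
        case 2
        then have "\<not> fl" using fl by auto
        then have "cc (n - 1) = n - 1" by (simp add: cc_def)
        moreover have "bar (n - 1) = n" using shape_CD_N 2 jn by (simp add: bar_def)
        ultimately show ?thesis using cc_tail[of "n - 1"] be jn 2 rn by (simp add: ced_def)
      next
        case 3
        have "n - 2 < n" using D_facts[OF 3] by linarith
        then show ?thesis using cc_tail[of "n - 1"] cc_tail[of "n - 2"] be jn 3 rn by (simp add: ced_def)
      qed
    qed
    then show ?thesis using W.stab_F_tail by blast
  qed
  show ?thesis using assms
  proof (rule bs_cedE)
    fix j assume "j \<in> Bl" "k = fst (ced j)" "l = snd (ced j)"
    then show ?thesis using main by simp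
  next
    fix j assume j: "j \<in> Bl" "k = bar (snd (ced j))" "l = bar (fst (ced j))"
    have c: "fst (ced j) < N" "snd (ced j) < N" using ced_less Bl_less[OF j(1)] by auto
    show ?thesis unfolding j(2,3) F_bars[OF osT c] F_bars[OF osT c(2,1)]
      using main[OF j(1)] W.stab_smult by blast
  qed
qed

lemma chain_hp:
  assumes i: "i \<in> Wh" "i < q"
  shows "hp i = (cc (mir i), cc (mir (i + 1)))" "ced i = (cc i, cc (i + 1))" "sr i = Z i - Z (i + 1)"
    "TT i = Z (mir i) - Z (mir (i + 1))"
proof -
  have h: "hi (i + 1) = mir (i + 1)" "lo i = mir i" using hi_mir lo_mir i by (auto simp: Wh_iff)
  have m: "mir (i + 1) < n" using mir_q[of "i + 1"] i qn by simp
  show h1: "hp i = (cc (mir i), cc (mir (i + 1)))" using i qn rn h m by (simp add: hp_def)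
  show "ced i = (cc i, cc (i + 1))" using i qn rn by (simp add: ced_def)
  show "sr i = Z i - Z (i + 1)" using sr_c i qn by simp
  show "TT i = Z (mir i) - Z (mir (i + 1))" unfolding TT_def h1 by (simp add: Z_def)
qed

definition cartan_ok :: "nat \<Rightarrow> bool" where
  "cartan_ok j \<longleftrightarrow> (\<forall>k\<le>q. ip (Z k + Z (mir k)) (sr j) = ip (Z k + Z (mir k)) (TT (\<pi> j)))"

lemma chain_good:
  assumes i: "i \<in> Wh" "i < q"
  shows "white_gen i \<in> W.stabW" "cartan_ok i"
proof -
  have iB: "i \<notin> Bl" using i by (simp add: Wh_iff)
  show "white_gen i \<in> W.stabW" unfolding white_gen_def fixed[OF i] chain_hp[OF i] fst_conv snd_conv
    by (rule W.stab_white[OF iB]) (use i \<kappa>C[OF i] white_cycle[OF i] in simp_all)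
  show "cartan_ok i" unfolding cartan_ok_def fixed[OF i] chain_hp(3,4)[OF i]
    using i ip_mir by (simp add: inner_h_minus_right)
qed

lemma tail_ip: "l \<in> tail (q + 1) \<Longrightarrow> k \<le> q \<Longrightarrow> ip (Z k + Z (mir k)) (wt l) = 0"
proof -
  assume l: "l \<in> tail (q + 1)" and k: "k \<le> q"
  have "l < N" using l by (simp add: tail_def)
  then consider m where "m < n" "l = cc m \<or> l = bar (cc m)" | "shape G = ShapeB" "l = n"
    using os_cover[OF osT] rn by auto
  then show ?thesis
  proof cases
    case 1
    have "\<not> m < q + 1" using l 1(2) by (auto simp: tail_def)
    then have z: "ip (Z k + Z (mir k)) (Z m) = 0" using ip_high k 1 by simp
    show ?thesis using 1(2)
    proof
      assume "l = cc m"
      then show ?thesis using z by (simp add: Z_def)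
    next
      assume "l = bar (cc m)"
      then have "wt l = - Z m" using wt_bar_Z[OF 1(1)] by simp
      then show ?thesis using z by (simp add: inner_h_uminus_right)
    qed
  next
    case 2
    have "bar n = n" "n < N" using shape_B_N[OF 2(1)] by (auto simp: bar_def)
    then show ?thesis using wt_mid osT 2 by (simp add: inner_h_def)
  qed
qed

lemma tail_good:
  assumes j: "ced j = (cc q, l)" "hp (\<pi> j) = (cc (mir q), bar l)" "j < n" and l: "l \<in> tail (q + 1)"
    and \<kappa>: "t (cc q) l * \<kappa> q + C j = 0"
  shows "white_gen j \<in> W.stabW" "cartan_ok j"
proof -
  show "white_gen j \<in> W.stabW" unfolding white_gen_def j(1,2) fst_conv snd_conv
    using W.stab_white_tail[OF l] \<kappa> by simp
  have lN: "l < N" "bar l \<in> tail (q + 1)" using W.tailD[OF l] by auto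
  show "cartan_ok j" unfolding cartan_ok_def
  proof (intro allI impI)
    fix k assume k: "k \<le> q"
    show "ip (Z k + Z (mir k)) (sr j) = ip (Z k + Z (mir k)) (TT (\<pi> j))"
      unfolding sr_ced[OF j(3)] TT_def j(1,2) fst_conv snd_conv Z_def[symmetric, of q] Z_def[symmetric, of "mir q"]
      using ip_mir[OF k order_refl] tail_ip[OF l k] tail_ip[OF lN(2) k] by (simp add: inner_h_minus_right)
  qed
qed

lemma proper:
  assumes r: "rooted e f"
    and x: "\<And>j. j \<in> Wh \<Longrightarrow> \<exists>a. e (sr j) + c (sr j) \<cdot>\<^sub>m f (TT (\<pi> j)) = a \<cdot>\<^sub>m white_gen j"
    and ends: "\<And>j. j \<in> Wh \<Longrightarrow> q \<le> j \<Longrightarrow> white_gen j \<in> W.stabW \<and> cartan_ok j"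
  shows "k_alg G P \<tau> e f c \<noteq> lie_alg G"
proof -
  have all: "white_gen j \<in> W.stabW \<and> cartan_ok j" if "j \<in> Wh" for j
    using ends[OF that] chain_good[OF that] by (cases "j < q") auto
  have "k_alg G P \<tau> e f c \<subseteq> W.stabW"
  proof (rule k_alg_subset[OF r W.stabW_subalgebra black_stab])
    fix j assume j: "j \<in> Wh"
    obtain a where "e (sr j) + c (sr j) \<cdot>\<^sub>m f (TT (\<pi> j)) = a \<cdot>\<^sub>m white_gen j" using x[OF j] by blast
    then show "e (sr j) + c (sr j) \<cdot>\<^sub>m f (TT (\<pi> j)) \<in> W.stabW" using W.stab_smult all[OF j] by simp
    show "hmat (sr j) - hmat (TT (\<pi> j)) \<in> W.stabW"
      by (rule W.stab_cartan) (use all[OF j] in \<open>auto simp: cartan_ok_def\<close>)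
  qed
  moreover have "F (cc 0) (cc 0) \<in> lie_alg G" using ccN qn by simp
  ultimately show ?thesis using W.stabW_proper by blast
qed

end

lemma smult_smult_mat: "a \<cdot>\<^sub>m (b \<cdot>\<^sub>m A) = (a * b) \<cdot>\<^sub>m (A :: complex mat)"
  by (rule eq_matI) (auto simp: mult.assoc)

text \<open>A white end node of shape C or D leads to an equation that is quadratic in the common
  factor of the coefficients.\<close>

lemma complex_square_scaling:
  fixes C d :: complex
  assumes "C \<noteq> 0" "d \<noteq> 0"
  obtains s where "s \<noteq> 0" "C = s * s * d"
proof (rule that)
  have "csqrt (C / d) * csqrt (C / d) = C / d" by (metis power2_csqrt power2_eq_square)
  then show "C = csqrt (C / d) * csqrt (C / d) * d" using assms by simp
  then show "csqrt (C / d) \<noteq> 0" using assms by auto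
qed

section \<open>Scalars of the root vectors and their rescaling\<close>

context satake
begin

definition scalars :: "(complex vec \<Rightarrow> complex mat) \<Rightarrow> (complex vec \<Rightarrow> complex mat) \<Rightarrow> (nat \<Rightarrow> complex) \<Rightarrow> (nat \<Rightarrow> complex) \<Rightarrow> bool" where
  "scalars e f A B \<longleftrightarrow> (\<forall>j\<in>Wh. A j \<noteq> 0 \<and> B j \<noteq> 0 \<and> e (sr j) = A j \<cdot>\<^sub>m F (fst (ced j)) (snd (ced j)) \<and>
     f (TT (\<pi> j)) = B j \<cdot>\<^sub>m F (snd (hp (\<pi> j))) (fst (hp (\<pi> j))))"

lemma scalars_exist: "rooted e f \<Longrightarrow> \<exists>A B. scalars e f A B"
proof -
  assume r: "rooted e f"
  have "\<forall>j\<in>Wh. \<exists>ab. fst ab \<noteq> 0 \<and> snd ab \<noteq> 0 \<and> e (sr j) = fst ab \<cdot>\<^sub>m F (fst (ced j)) (snd (ced j)) \<and>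
     f (TT (\<pi> j)) = snd ab \<cdot>\<^sub>m F (snd (hp (\<pi> j))) (fst (hp (\<pi> j)))"
  proof
    fix j assume "j \<in> Wh"
    then obtain a b where "a \<noteq> 0" "b \<noteq> 0" "e (sr j) = a \<cdot>\<^sub>m F (fst (ced j)) (snd (ced j))"
      "f (TT (\<pi> j)) = b \<cdot>\<^sub>m F (snd (hp (\<pi> j))) (fst (hp (\<pi> j)))"
      using rooted_scalars[OF r] by metis
    then show "\<exists>ab. fst ab \<noteq> 0 \<and> snd ab \<noteq> 0 \<and> e (sr j) = fst ab \<cdot>\<^sub>m F (fst (ced j)) (snd (ced j)) \<and>
     f (TT (\<pi> j)) = snd ab \<cdot>\<^sub>m F (snd (hp (\<pi> j))) (fst (hp (\<pi> j)))"
      by (intro exI[of _ "(a, b)"]) simp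
  qed
  then obtain h where "\<forall>j\<in>Wh. fst (h j) \<noteq> 0 \<and> snd (h j) \<noteq> 0 \<and> e (sr j) = fst (h j) \<cdot>\<^sub>m F (fst (ced j)) (snd (ced j)) \<and>
     f (TT (\<pi> j)) = snd (h j) \<cdot>\<^sub>m F (snd (hp (\<pi> j))) (fst (hp (\<pi> j)))" by (rule bchoice[THEN exE])
  then have "scalars e f (fst \<circ> h) (snd \<circ> h)" unfolding scalars_def comp_def .
  then show ?thesis by blast
qed

lemma scalars_rescale:
  assumes "scalars e f A B" "z \<noteq> 0"
  shows "scalars e (f(\<xi> := z \<cdot>\<^sub>m f \<xi>)) A (\<lambda>j. if TT (\<pi> j) = \<xi> then z * B j else B j)"
  unfolding scalars_def
proof (intro ballI conjI)
  fix j assume j: "j \<in> Wh"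
  note sj = assms(1)[unfolded scalars_def, rule_format, OF j]
  show "A j \<noteq> 0" "(if TT (\<pi> j) = \<xi> then z * B j else B j) \<noteq> 0" "e (sr j) = A j \<cdot>\<^sub>m F (fst (ced j)) (snd (ced j))"
    using sj assms(2) by auto
  show "(f(\<xi> := z \<cdot>\<^sub>m f \<xi>)) (TT (\<pi> j)) =
      (if TT (\<pi> j) = \<xi> then z * B j else B j) \<cdot>\<^sub>m F (snd (hp (\<pi> j))) (fst (hp (\<pi> j)))"
  proof (cases "TT (\<pi> j) = \<xi>")
    case True
    have "z \<cdot>\<^sub>m f (TT (\<pi> j)) = (z * B j) \<cdot>\<^sub>m F (snd (hp (\<pi> j))) (fst (hp (\<pi> j)))" using sj by (simp add: smult_smult_mat)
    then show ?thesis using True by simp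
  next
    case False
    then show ?thesis using sj by simp
  qed
qed

lemma rooted_rescale:
  assumes r: "rooted e f" and z: "z \<noteq> 0" and \<xi>: "\<xi> \<in> carrier_vec rk"
  shows "rooted e (f(\<xi> := z \<cdot>\<^sub>m f \<xi>))"
proof -
  have sm: "z \<cdot>\<^sub>m X \<in> root_space G (- \<xi>) - {0\<^sub>m N N}" if "X \<in> root_space G (- \<xi>) - {0\<^sub>m N N}" for X
  proof -
    have X: "X \<in> lie_alg G" "X \<noteq> 0\<^sub>m N N" using that root_space_lie_alg by auto
    have c: "- \<xi> \<in> carrier_vec rk" using \<xi> by simp
    have "z \<cdot>\<^sub>m X \<in> lie_alg G" using lie_alg_graded X unfolding graded_subspace_def by blast
    moreover have "z \<cdot>\<^sub>m X \<noteq> 0\<^sub>m N N"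
    proof
      assume e: "z \<cdot>\<^sub>m X = 0\<^sub>m N N"
      have "X = inverse z \<cdot>\<^sub>m (z \<cdot>\<^sub>m X)" using z by (intro eq_matI) auto
      also have "\<dots> = 0\<^sub>m N N" unfolding e by (rule eq_matI) auto
      finally show False using X by simp
    qed
    ultimately show ?thesis using that X unfolding root_space_iff[OF c] by (auto simp: root_space_iff[OF c])
  qed
  show ?thesis unfolding rooted_def
  proof (intro ballI conjI)
    fix \<alpha> assume a: "\<alpha> \<in> white G P"
    have ra: "e \<alpha> \<in> root_space G \<alpha> - {0\<^sub>m N N}"
      "f (tilde G P \<tau> \<alpha>) \<in> root_space G (- tilde G P \<tau> \<alpha>) - {0\<^sub>m N N}"
      using r a unfolding rooted_def by blast+
    show "e \<alpha> \<in> root_space G \<alpha> - {0\<^sub>m N N}" by (fact ra(1))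
    show "(f(\<xi> := z \<cdot>\<^sub>m f \<xi>)) (tilde G P \<tau> \<alpha>) \<in> root_space G (- tilde G P \<tau> \<alpha>) - {0\<^sub>m N N}"
      using ra(2) sm by (cases "tilde G P \<tau> \<alpha> = \<xi>") auto
  qed
qed

end

section \<open>The generators at the end node\<close>

context sat
begin

lemma eps_eq: "i < N \<Longrightarrow> k < N \<Longrightarrow> pr i = pr k \<Longrightarrow> eps i = eps k"
  using eps_props(2)[OF osT, of i k] eps_props(1)[OF osT, of i] eps_props(1)[OF osT, of k]
  by (auto simp flip: mult_2)

lemma eps_end_D: "shape G = ShapeD \<Longrightarrow> eps (cc (n - 1)) = 1"
proof -
  assume D: "shape G = ShapeD"
  have b: "bar n = n - 1" "n < N" using D_facts[OF D] by auto
  have "eps (n - 1) = 1" "eps (bar n) = eps n" using eps_props(5)[OF osT D] eps_props(6)[OF osT b(2)] by auto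
  then have "eps (n - 1) = 1" "eps n = 1" unfolding b(1) by simp_all
  then show ?thesis by (simp add: cc_def)
qed

lemma pr_mir: "k \<le> q \<Longrightarrow> pr (cc (mir k)) = pr (cc k)"
  using mir_sn[of k] sn_pr[of "mir k" k] mir_q[of k] qn by simp

lemma end_hp_C:
  assumes C: "shape G = ShapeC" "q + 1 = n"
  shows "ced q = (cc q, bar (cc q))" "hp q = (cc (mir q), bar (cc (mir q)))" "eps (cc q) = -1" "eps (cc (mir q)) = -1"
proof -
  have nf: "\<not> fl" using fl C by auto
  have q: "q = n - 1" "n > 0" "cc q = n - 1" using C nf by (auto simp: cc_def)
  have b: "bar (n - 1) = n" using shape_CD_N C q by (simp add: bar_def)
  show "ced q = (cc q, bar (cc q))" using q b C rn by (simp add: ced_def)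
  show e: "eps (cc q) = -1" using eps_props(4)[OF osT C(1)] q by simp
  show e': "eps (cc (mir q)) = -1"
    using eps_eq[OF ccN ccN pr_mir[OF order_refl]] mir_q[of q] qn e by simp
  show "hp q = (cc (mir q), bar (cc (mir q)))"
    using lo_mir[OF qW order_refl] e' q C rn by (simp add: hp_def)
qed

lemma end_ced_D:
  assumes D: "shape G = ShapeD" "p + 2 = n"
  shows "ced (p + 1) = (cc p, bar (cc (p + 1)))"
proof -
  have "n - 1 = p + 1" "n - 2 = p" using D by auto
  then show ?thesis using D rn by (simp add: ced_def)
qed

lemma end_hp_D_self:
  assumes D: "shape G = ShapeD" "p + 2 = n" "q = p + 1" "p \<in> Bl"
  shows "hp q = (cc p, bar (cc q))" "eps (cc q) = 1" "eps (cc p) = 1" "pr (cc p) = pr (cc q)"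
proof -
  have m: "mir q = p" "lo q = p" using D qB lo_mir[OF qW order_refl] by (simp_all add: mir_def)
  have n: "n - 1 = q" "n - 2 = p" "p < n" using D by auto
  show e: "eps (cc q) = 1" using eps_end_D[OF D(1)] n by simp
  show pe: "pr (cc p) = pr (cc q)" using pr_mir[OF order_refl] m by simp
  show e': "eps (cc p) = 1" using eps_eq[OF ccN ccN pe] n qn e by simp
  show "hp q = (cc p, bar (cc q))" using m n D rn e' by (simp add: hp_def)
qed

lemma end_hp_D:
  assumes D: "shape G = ShapeD" "p + 2 = n" "p \<in> Wh" "p \<le> q"
  shows "hp (p + 1) = (cc (mir p), bar (cc (p + 1)))"
proof -
  have "n - 1 = p + 1" "n - 2 = p" using D by auto
  then show ?thesis using D rn lo_mir[OF D(3,4)] by (simp add: hp_def Wh_iff)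
qed

lemma satw_kap:
  assumes "\<And>j. C j \<noteq> 0" "s \<noteq> 0"
  shows "satw G P \<Phi> \<tau> q (\<lambda>k. s * kap C k) C"
proof -
  interpret W: wstab G P \<Phi> "q + 1" "\<lambda>k. s * kap C k" by (rule wstab_kap[OF assms])
  show ?thesis
    by unfold_locales (use assms in \<open>simp add: Wh_iff field_simps\<close>)
qed

end

context satw
begin

lemma cartan_ok_bar:
  assumes "ced j = (cc a, bar (cc b))" "hp (\<pi> j) = (cc a', bar (cc b'))" "j < n" "a < n" "b < n" "a' < n" "b' < n"
    and "\<And>k. k \<le> q \<Longrightarrow> ip (Z k + Z (mir k)) (Z a) + ip (Z k + Z (mir k)) (Z b) =
      ip (Z k + Z (mir k)) (Z a') + ip (Z k + Z (mir k)) (Z b')"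
  shows "cartan_ok j"
  unfolding cartan_ok_def sr_ced[OF assms(3)] TT_def assms(1,2) fst_conv snd_conv
  using assms(4-) by (simp add: inner_h_minus_right wt_bar_Z inner_h_uminus_right Z_def[symmetric])

lemma end_good_C:
  assumes C: "shape G = ShapeC" "q + 1 = n" "\<pi> q = q" and \<kappa>: "C q = \<kappa> (mir q) * \<kappa> q"
  shows "white_gen q \<in> W.stabW" "cartan_ok q"
proof -
  note h = end_hp_C[OF C(1,2)]
  have m: "mir q < n" "mir q \<le> q" using mir_q[of q] qn by auto
  show "white_gen q \<in> W.stabW" unfolding white_gen_def C(3) h(1,2) fst_conv snd_conv
    by (rule W.stab_white_end_C) (use h \<kappa> in simp_all)
  show "cartan_ok q" by (rule cartan_ok_bar[of q q q "mir q" "mir q"]) (use h C m qn ip_mir in simp_all)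
qed

text \<open>V+ is the exterior square of a block of size two, hence a line, and the lower term is
  opposite to the upper one. It is rewritten as a multiple of \<open>F (bar (cc p)) (cc q)\<close>
  to fit \<open>stab_white_end\<close>, where the mirror exchanges p and q.\<close>

lemma end_good_D_self:
  assumes D: "shape G = ShapeD" "p + 2 = n" "q = p + 1" "p \<in> Bl" "\<pi> q = q"
    and \<kappa>: "C q * t (bar (cc q)) (cc p) = \<kappa> p * (t (cc p) (bar (cc q)) * \<kappa> p)"
  shows "white_gen q \<in> W.stabW" "cartan_ok q"
proof -
  note h = end_hp_D_self[OF D(1-4)]
  note c = end_ced_D[OF D(1,2), folded D(3)]
  have l: "cc p < N" "cc q < N" "p < n" "p \<le> q" using ccN D(2,3) by auto
  have mq: "mir q = p" "mir p = q" using D qB by (auto simp: mir_def)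
  have Fb: "F (bar (cc q)) (cc p) = t (bar (cc q)) (cc p) \<cdot>\<^sub>m F (bar (cc p)) (cc q)"
    using F_bars[OF osT, of "bar (cc p)" "cc q"] l by simp
  have e1: "t (cc p) (bar (cc q)) = t (cc p) (cc q)"
    using t_mult_even[OF osT l(1,2) bar_less[OF l(2)]] h(4) t_bar[OF osT l(2)] h(2) by simp
  have e2: "t (bar (cc p)) (cc q) = t (cc p) (cc q)"
    using t_mult_even[OF osT bar_less[OF l(1)] l(1,2)] h(4) t_bar[OF osT bar_less[OF l(1)]] l(1)
      eps_props(6)[OF osT l(1)] h(3) by simp
  have k: "\<kappa> q = t (cc p) (cc q) * \<kappa> p" using \<kappa>_blk[OF D(4) l(4)] D(3) by simp
  have "F (cc p) (bar (cc q)) + (C q * t (bar (cc q)) (cc p)) \<cdot>\<^sub>m F (bar (cc (mir q))) (cc (mir p)) \<in> W.stabW"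
  proof (rule W.stab_white_end)
    show "C q * t (bar (cc q)) (cc p) * t (bar (cc (mir q))) (cc (mir p)) = \<kappa> (mir p) * \<kappa> q"
      unfolding mq \<kappa> e1 e2 k by simp
  qed (use \<kappa> mq D(3) in simp_all)
  then show "white_gen q \<in> W.stabW" unfolding white_gen_def D(5) h(1) c fst_conv snd_conv Fb mq
    by (simp add: smult_smult_mat)
  show "cartan_ok q" by (rule cartan_ok_bar[of q p q p q]) (use h c D l qn in simp_all)
qed

text \<open>The end node also involves the weight p, which may close a block of size one or two. The
  parity lemma for node p is needed once more to get the sign in the second condition right.\<close>

lemma end_good_D_both:
  assumes D: "shape G = ShapeD" "p + 2 = n" "q = p + 1" "p \<notin> Bl" "\<pi> q = q"
    and \<kappa>: "C q = \<kappa> q * (t (cc p) (bar (cc q)) * \<kappa> p)"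
  shows "white_gen q \<in> W.stabW" "cartan_ok q"
proof -
  have pW: "p \<in> Wh" "p < q" "p \<le> q" "p < n" using D by (auto simp: Wh_iff)
  have h: "hp q = (cc (mir p), bar (cc q))" using end_hp_D[OF D(1,2) pW(1,3)] D(3) by simp
  note c = end_ced_D[OF D(1,2), folded D(3)]
  have mq: "mir q = q" using D qB by (simp add: mir_def)
  have m: "mir p < n" "mir p \<le> q" using mir_q[of p] pW qn by auto
  have l: "cc p < N" "cc q < N" "bar (cc q) < N" "pr (bar (cc q)) = pr (cc q)"
    using ccN pW qn pr_bar[OF osT] by auto
  have cyc: "C q * t (bar (cc q)) (cc (mir p)) = \<kappa> (mir p) * \<kappa> q"
  proof (cases "p = 0 \<or> p - 1 \<notin> Bl")
    case True
    have "sn p = sn q" using parity_11[OF pW(1,2) True] qB D(3) by simp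
    then have "pr (bar (cc q)) = pr (cc p)" using sn_pr[OF pW(4) qn] l by simp
    then have "t (bar (cc q)) (cc p) * t (cc p) (bar (cc q)) = 1" using t_inverse[OF osT l(3,1)] by simp
    then have "C q * t (bar (cc q)) (cc p) = \<kappa> p * \<kappa> q" unfolding \<kappa> by (simp add: mult_ac)
    moreover have "mir p = p" using True D(4) by (auto simp: mir_def)
    ultimately show ?thesis by simp
  next
    case False
    then obtain v where v: "p = v + 1" "v \<in> Bl" using not0_implies_Suc by fastforce
    have mp: "mir p = v" "v \<le> q" "v < n" "v < q" using v D(4) pW by (auto simp: mir_def)
    have w: "v + 1 \<in> Wh" "v + 1 < q" "v + 2 \<notin> Bl" "v + 2 = q" using pW v qB D(3) by auto
    have "sn p \<noteq> sn q" using parity_21[OF w(1,2) v(2) w(3)] v(1) w(4) by simp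
    then have p1: "pr (cc p) \<noteq> pr (cc q)" using sn_pr[OF pW(4) qn] by simp
    have p2: "pr (cc v) = pr (cc p)" using small[OF v(2) mp(4)] sn_pr[of v p] v(1) mp pW by simp
    have vN: "cc v < N" using ccN mp by simp
    have k: "\<kappa> p = t (cc v) (cc p) * \<kappa> v" using \<kappa>_blk[OF v(2) mp(2)] v(1) by simp
    have e: "t (cc v) (cc p) * t (cc p) (bar (cc q)) = - t (cc v) (bar (cc q))"
      using t_mult_even[OF osT vN l(1,3)] p2 by simp
    have i: "t (bar (cc q)) (cc v) * t (cc v) (bar (cc q)) = -1"
      using t_inverse[OF osT l(3) vN] p1 p2 l(4) by simp
    have "C q * t (bar (cc q)) (cc v) =
        t (bar (cc q)) (cc v) * (t (cc v) (cc p) * t (cc p) (bar (cc q))) * \<kappa> v * \<kappa> q"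
      unfolding \<kappa> k by simp
    also have "\<dots> = - (t (bar (cc q)) (cc v) * t (cc v) (bar (cc q))) * \<kappa> v * \<kappa> q" unfolding e by simp
    finally show ?thesis unfolding mp(1) i by simp
  qed
  have "F (cc p) (bar (cc q)) + C q \<cdot>\<^sub>m F (bar (cc (mir q))) (cc (mir p)) \<in> W.stabW"
  proof (rule W.stab_white_end)
    show "C q * t (bar (cc (mir q))) (cc (mir p)) = \<kappa> (mir p) * \<kappa> q" unfolding mq by (rule cyc)
  qed (use \<kappa> mq D(3) in simp_all)
  then show "white_gen q \<in> W.stabW" unfolding white_gen_def D(5) h c fst_conv snd_conv mq .
  show "cartan_ok q"
  proof (rule cartan_ok_bar)
    show "ced q = (cc p, bar (cc q))" by (fact c)
    show "hp (\<pi> q) = (cc (mir p), bar (cc q))" unfolding D(5) by (fact h)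
  qed (use m pW qn ip_mir in simp_all)
qed

end

section \<open>Choice of the common factor\<close>

context sat
begin

text \<open>The ratio of the two terms of a white generator. The default 1 elsewhere keeps the
  function nowhere zero, as \<open>satw_kap\<close> demands.\<close>

definition mix :: "(complex vec \<Rightarrow> complex) \<Rightarrow> (nat \<Rightarrow> complex) \<Rightarrow> (nat \<Rightarrow> complex) \<Rightarrow> nat \<Rightarrow> complex" where
  "mix c A B j = (if j \<in> Wh then c (sr j) * B j / A j else 1)"

lemma proper_by:
  assumes r: "rooted e f" and s: "scalars e f A B" and c: "\<And>\<alpha>. \<alpha> \<in> white G P \<Longrightarrow> c \<alpha> \<noteq> 0" and z: "z \<noteq> 0"
    and ends: "satw G P \<Phi> \<tau> q (\<lambda>k. z * kap (mix c A B) k) (mix c A B) \<Longrightarrow>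
      \<forall>j\<in>Wh. q \<le> j \<longrightarrow> satw.white_gen G P \<Phi> \<tau> (mix c A B) j \<in> wstab.stabW G P \<Phi> (q + 1) (\<lambda>k. z * kap (mix c A B) k) \<and>
        satw.cartan_ok G P \<Phi> \<tau> q j"
  shows "k_alg G P \<tau> e f c \<noteq> lie_alg G"
proof -
  have C: "mix c A B j \<noteq> 0" for j
    using s c[OF sr_white, of j] by (auto simp: mix_def scalars_def)
  interpret S: satw G P \<Phi> \<tau> q "\<lambda>k. z * kap (mix c A B) k" "mix c A B" by (rule satw_kap[OF C z])
  show ?thesis
  proof (rule S.proper[OF r])
    fix j assume j: "j \<in> Wh"
    note sj = s[unfolded scalars_def, rule_format, OF j]
    have "e (sr j) + c (sr j) \<cdot>\<^sub>m f (TT (\<pi> j)) = A j \<cdot>\<^sub>m S.white_gen j"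
      unfolding S.white_gen_def using sj j by (intro eq_matI) (auto simp: mix_def field_simps)
    then show "\<exists>a. e (sr j) + c (sr j) \<cdot>\<^sub>m f (TT (\<pi> j)) = a \<cdot>\<^sub>m S.white_gen j" ..
  next
    fix j assume "j \<in> Wh" "q \<le> j"
    then show "S.white_gen j \<in> S.W.stabW \<and> S.cartan_ok j" using ends[OF S.satw_axioms] by blast
  qed
qed

lemma last_hp:
  assumes w: "Wh \<subseteq> {..q}" "\<pi> q = q" and sh: "q + 1 < n \<or> shape G = ShapeB"
  obtains l where "ced q = (cc q, l)" "hp q = (cc (mir q), bar l)"
    "\<And>\<kappa> C. satw G P \<Phi> \<tau> q \<kappa> C \<Longrightarrow> l \<in> tail (q + 1)" "l < N"
proof (cases "q + 1 < n")
  case True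
  have "hi (q + 1) = n"
  proof (rule ccontr)
    assume "hi (q + 1) \<noteq> n"
    then have "hi (q + 1) \<in> Wh" "q < hi (q + 1)"
      using hi_le[of "q + 1"] hi_ge[of "q + 1"] hi_white[of "q + 1"] True by (auto simp: Wh_iff)
    then show False using w by auto
  qed
  then show ?thesis
    using that[of "cc (q + 1)"] satw.cc_tail[of G P \<Phi> \<tau> q _ _ "q + 1"] True rn ccN[OF True] lo_mir[OF qW order_refl]
    by (simp add: ced_def hp_def)
next
  case False
  then have B: "shape G = ShapeB" and q: "q = n - 1" "n > 0" "q + 1 = n" using sh qn by auto
  have "\<not> fl" using fl B by auto
  then have c: "cc q = q" by (simp add: cc_def)
  have "bar n = n" "n < N" using shape_B_N[OF B] by (auto simp: bar_def)
  note b = this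
  show ?thesis
  proof (rule that)
    show "ced q = (cc q, n)" using q c B rn by (simp add: ced_def)
    show "hp q = (cc (mir q), bar n)" using q(1,2) B b rn lo_mir[OF qW order_refl] by (simp add: hp_def)
    show "n \<in> tail (q + 1)" if "satw G P \<Phi> \<tau> q \<kappa> C" for \<kappa> C by (rule satw.mid_tail[OF that B])
    show "n < N" by (fact b(2))
  qed
qed

lemma fixed_proper:
  assumes w: "Wh \<subseteq> {..q}" "\<pi> q = q"
    and r: "rooted e f" and c: "\<And>\<alpha>. \<alpha> \<in> white G P \<Longrightarrow> c \<alpha> \<noteq> 0"
  shows "k_alg G P \<tau> e f c \<noteq> lie_alg G"
proof -
  obtain A B where s: "scalars e f A B" using scalars_exist[OF r] by blast
  let ?C = "mix c A B" and ?K = "kap (mix c A B)"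
  have C: "?C j \<noteq> 0" for j
    using s c[OF sr_white, of j] by (auto simp: mix_def scalars_def)
  have K: "?K k \<noteq> 0" if "k \<le> q" for k using kap_nz[of ?C k] C that qn by simp
  have only: "(\<forall>j\<in>Wh. q \<le> j \<longrightarrow> Q j) \<longleftrightarrow> Q q" for Q using w(1) qW by (metis atMost_iff order_antisym order_refl subsetD)
  note pb = proper_by[OF r s c, unfolded only]
  consider "q + 1 < n \<or> shape G = ShapeB" | "shape G = ShapeC" "q + 1 = n"
    | "shape G = ShapeD" "q + 1 = n" "q - 1 \<in> Bl" | "shape G = ShapeD" "q + 1 = n" "q - 1 \<notin> Bl"
    using os_shape osT qn by linarith
  then show ?thesis
  proof cases
    case 1
    obtain l where l: "ced q = (cc q, l)" "hp q = (cc (mir q), bar l)"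
      "\<And>\<kappa> C. satw G P \<Phi> \<tau> q \<kappa> C \<Longrightarrow> l \<in> tail (q + 1)" "l < N"
      using last_hp[OF w 1] by blast
    have l2: "hp (\<pi> q) = (cc (mir q), bar l)" using l(2) w(2) by simp
    have t: "t (cc q) l \<noteq> 0" using t_nz[OF osT ccN[OF qn] l(4)] .
    show ?thesis
    proof (rule pb)
      \<comment> \<open>The common factor is the solution of the linear equation of
        \<open>tail_good\<close>.\<close>
      show "- ?C q / (t (cc q) l * ?K q) \<noteq> 0" using C K t by simp
      assume "satw G P \<Phi> \<tau> q (\<lambda>k. - ?C q / (t (cc q) l * ?K q) * ?K k) ?C"
      then interpret S: satw G P \<Phi> \<tau> q "\<lambda>k. - ?C q / (t (cc q) l * ?K q) * ?K k" ?C .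
      have e: "t (cc q) l * (- ?C q / (t (cc q) l * ?K q) * ?K q) + ?C q = 0" using K[of q] t by (simp add: field_simps)
      show "S.white_gen q \<in> S.W.stabW \<and> S.cartan_ok q"
        using S.tail_good[OF l(1) l2 qn l(3)[OF S.satw_axioms] e] by blast
    qed
  next
    case 2
    have "?K (mir q) * ?K q \<noteq> 0" using K[of q] K[of "mir q"] mir_q[of q] by simp
    then obtain z where z: "z \<noteq> 0" "?C q = z * z * (?K (mir q) * ?K q)" using complex_square_scaling[OF C] by blast
    show ?thesis
    proof (rule pb[OF _ z(1)])
      assume "satw G P \<Phi> \<tau> q (\<lambda>k. z * ?K k) ?C"
      then interpret S: satw G P \<Phi> \<tau> q "\<lambda>k. z * ?K k" ?C .
      have e: "?C q = z * ?K (mir q) * (z * ?K q)" using z(2) by simp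
      show "S.white_gen q \<in> S.W.stabW \<and> S.cartan_ok q" using S.end_good_C[OF 2 w(2) e] by blast
    qed
  next
    case 3
    have "n \<ge> 2" using D_facts[OF 3(1)] by simp
    then obtain p where p: "q = p + 1" "p + 2 = n" using 3(2) not0_implies_Suc[of q] by fastforce
    have pB: "p \<in> Bl" using 3(3) p by simp
    have l: "cc p < N" "bar (cc q) < N" using ccN p by auto
    have d: "?K p * t (cc p) (bar (cc q)) * ?K p \<noteq> 0" "?C q * t (bar (cc q)) (cc p) \<noteq> 0"
      using K[of p] C t_nz[OF osT l] t_nz[OF osT l(2,1)] p by simp_all
    obtain z where z: "z \<noteq> 0" "?C q * t (bar (cc q)) (cc p) = z * z * (?K p * t (cc p) (bar (cc q)) * ?K p)"
      using complex_square_scaling[OF d(2,1)] by blast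
    show ?thesis
    proof (rule pb[OF _ z(1)])
      assume "satw G P \<Phi> \<tau> q (\<lambda>k. z * ?K k) ?C"
      then interpret S: satw G P \<Phi> \<tau> q "\<lambda>k. z * ?K k" ?C .
      have e: "?C q * t (bar (cc q)) (cc p) = z * ?K p * (t (cc p) (bar (cc q)) * (z * ?K p))" using z(2) by simp
      show "S.white_gen q \<in> S.W.stabW \<and> S.cartan_ok q" using S.end_good_D_self[OF 3(1) p(2,1) pB w(2) e] by blast
    qed
  next
    case 4
    have "n \<ge> 2" using D_facts[OF 4(1)] by simp
    then obtain p where p: "q = p + 1" "p + 2 = n" using 4(2) not0_implies_Suc[of q] by fastforce
    have pB: "p \<notin> Bl" using 4(3) p by simp
    have l: "cc p < N" "bar (cc q) < N" using ccN p by auto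
    have d: "?K q * t (cc p) (bar (cc q)) * ?K p \<noteq> 0"
      using K[of p] K[of q] t_nz[OF osT l] p by simp
    obtain z where z: "z \<noteq> 0" "?C q = z * z * (?K q * t (cc p) (bar (cc q)) * ?K p)"
      using complex_square_scaling[OF C d] by blast
    show ?thesis
    proof (rule pb[OF _ z(1)])
      assume "satw G P \<Phi> \<tau> q (\<lambda>k. z * ?K k) ?C"
      then interpret S: satw G P \<Phi> \<tau> q "\<lambda>k. z * ?K k" ?C .
      have e: "?C q = z * ?K q * (t (cc p) (bar (cc q)) * (z * ?K p))" using z(2) by simp
      show "S.white_gen q \<in> S.W.stabW \<and> S.cartan_ok q" using S.end_good_D_both[OF 4(1) p(2,1) pB w(2) e] by blast
    qed
  qed
qed

text \<open>Each of the two end generators determines the common factor, one through the index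
  \<open>cc (q + 1)\<close> and the other through its reflection. \<open>AB\<close> together with
  the equality of the two mixture parameters makes these values agree.\<close>

lemma swapped_proper:
  assumes w: "shape G = ShapeD" "q + 2 = n" "q + 1 \<in> Wh" "\<pi> q = q + 1" "\<pi> (q + 1) = q"
    and r: "rooted e f" and c: "\<And>\<alpha>. \<alpha> \<in> white G P \<Longrightarrow> c \<alpha> \<noteq> 0" "c (sr (q + 1)) = c (sr q)"
    and s: "scalars e f A B"
    and AB: "B q * A (q + 1) * t (cc q) (bar (cc (q + 1))) = B (q + 1) * A q * t (cc q) (cc (q + 1))"
  shows "k_alg G P \<tau> e f c \<noteq> lie_alg G"
proof -
  let ?C = "mix c A B" and ?K = "kap (mix c A B)"
  let ?y = "cc (q + 1)"
  have C: "?C j \<noteq> 0" for j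
    using s c(1)[OF sr_white, of j] by (auto simp: mix_def scalars_def)
  have K: "?K q \<noteq> 0" using kap_nz[of ?C q] C qn by simp
  have only: "j = q \<or> j = q + 1" if "j \<in> Wh" "q \<le> j" for j using that w(2) by (auto simp: Wh_iff)
  have y: "?y < N" "bar ?y < N" "bar (bar ?y) = ?y" using ccN w(2) by simp_all
  have t: "t (cc q) ?y \<noteq> 0" "t (cc q) (bar ?y) \<noteq> 0" using t_nz[OF osT ccN[OF qn]] y by auto
  have nz: "A q \<noteq> 0" "A (q + 1) \<noteq> 0" "B q \<noteq> 0" "B (q + 1) \<noteq> 0" "c (sr q) \<noteq> 0"
    using s c(1)[OF sr_white] qW w(3) by (auto simp: scalars_def)
  have Ceq: "?C (q + 1) * t (cc q) ?y = ?C q * t (cc q) (bar ?y)"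
    using qW w(3) c(2) nz AB by (simp add: mix_def field_simps)
  have "hi (q + 1) = q + 1" by (rule hi_eq) (use w in \<open>auto simp: Wh_iff\<close>)
  then have h: "ced q = (cc q, ?y)" "hp (\<pi> q) = (cc (mir q), bar ?y)"
    "ced (q + 1) = (cc q, bar ?y)" "hp (\<pi> (q + 1)) = (cc (mir q), bar (bar ?y))"
    using end_hp_D[OF w(1,2) qW order_refl] end_ced_D[OF w(1,2)] w rn y(3) lo_mir[OF qW order_refl]
    by (simp_all add: ced_def[of q] hp_def[of q])
  let ?z = "- ?C q / (t (cc q) ?y * ?K q)"
  show ?thesis
  proof (rule proper_by[OF r s c(1)])
    show z: "?z \<noteq> 0" using C K t by simp
    assume "satw G P \<Phi> \<tau> q (\<lambda>k. ?z * ?K k) ?C"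
    then interpret S: satw G P \<Phi> \<tau> q "\<lambda>k. ?z * ?K k" ?C .
    have tl: "?y \<in> tail (q + 1)" "bar ?y \<in> tail (q + 1)" using S.cc_tail[of "q + 1"] w(2) by auto
    have zz: "?z * ?K q = - ?C q / t (cc q) ?y" using K by simp
    have e1: "t (cc q) ?y * (?z * ?K q) + ?C q = 0" unfolding zz using t by simp
    have e2: "t (cc q) (bar ?y) * (?z * ?K q) + ?C (q + 1) = 0" unfolding zz using t Ceq by (simp add: field_simps)
    have "S.white_gen q \<in> S.W.stabW \<and> S.cartan_ok q" using S.tail_good[OF h(1,2) qn tl(1) e1] by blast
    moreover have "S.white_gen (q + 1) \<in> S.W.stabW \<and> S.cartan_ok (q + 1)"
      using S.tail_good[OF h(3,4) _ tl(2) e2] w(2) by simp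
    ultimately show "\<forall>j\<in>Wh. q \<le> j \<longrightarrow> S.white_gen j \<in> S.W.stabW \<and> S.cartan_ok j" using only by blast
  qed
qed

theorem sized_proper:
  "\<exists>e f. rooted e f \<and> (\<forall>c. (\<forall>\<alpha>\<in>white G P. c \<alpha> \<noteq> 0 \<and> c (\<tau> \<alpha>) = c \<alpha>) \<longrightarrow> k_alg G P \<tau> e f c \<noteq> lie_alg G)"
proof -
  obtain e f where r: "rooted e f" using rooted_exists by blast
  show ?thesis
    using q_cases
  proof
    assume w: "\<pi> q = q \<and> Wh \<subseteq> {..q}"
    show ?thesis
    proof (intro exI conjI allI impI)
      fix c :: "complex vec \<Rightarrow> complex" assume "\<forall>\<alpha>\<in>white G P. c \<alpha> \<noteq> 0 \<and> c (\<tau> \<alpha>) = c \<alpha>"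
      then show "k_alg G P \<tau> e f c \<noteq> lie_alg G" by (intro fixed_proper[OF _ _ r]) (use w in auto)
    qed (rule r)
  next
    assume sw: "shape G = ShapeD \<and> q + 2 = n \<and> q + 1 \<in> Wh \<and> \<pi> q = q + 1 \<and> \<pi> (q + 1) = q"
    obtain A B where s: "scalars e f A B" using scalars_exist[OF r] by blast
    let ?y = "cc (q + 1)"
    \<comment> \<open>The correction that establishes \<open>AB\<close> for
      \<open>swapped_proper\<close>. It is applied to the lower root vector in the generator at q,
      whose weight is minus the highest weight at \<open>q + 1\<close>.\<close>
    define z where "z = B (q + 1) * A q * t (cc q) ?y / (B q * A (q + 1) * t (cc q) (bar ?y))"
    have n: "q < n" "q + 1 < n" using sw by auto
    have t: "t (cc q) ?y \<noteq> 0" "t (cc q) (bar ?y) \<noteq> 0" using t_nz[OF osT ccN[OF qn]] ccN[OF n(2)] by auto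
    have nz: "A q \<noteq> 0" "A (q + 1) \<noteq> 0" "B q \<noteq> 0" "B (q + 1) \<noteq> 0" using s qW sw by (auto simp: scalars_def)
    then have z0: "z \<noteq> 0" using t by (simp add: z_def)
    define f' where "f' = f(TT (q + 1) := z \<cdot>\<^sub>m f (TT (q + 1)))"
    define B' where "B' = (\<lambda>j. if TT (\<pi> j) = TT (q + 1) then z * B j else B j)"
    \<comment> \<open>If the two weights were equal, rescaling one lower root vector would rescale
      the other as well.\<close>
    have ne: "TT q \<noteq> TT (q + 1)"
    proof
      assume e: "TT q = TT (q + 1)"
      have n': "n - 1 = q + 1" "n - 2 = q" using sw by auto
      have "n - 2 \<notin> Bl" unfolding n'(2) by (fact qB)
      note 1 = n' this
      have "hi (q + 1) = q + 1" by (rule hi_eq) (use sw in \<open>auto simp: Wh_iff\<close>)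
      then have "TT q = Z (lo q) - Z (q + 1)" using TT_c[of q] n by simp
      moreover have "TT (q + 1) = Z (lo q) + Z (q + 1)" using TT_D[OF _ 1(3)] sw 1 by simp
      moreover have "lo q < n" "lo q \<noteq> q + 1" using lo_le[of q] n by auto
      ultimately have "ip (Z (lo q) - Z (q + 1)) (Z (q + 1)) = ip (Z (lo q) + Z (q + 1)) (Z (q + 1))"
        and "lo q < n" "lo q \<noteq> q + 1" using e by simp_all
      then have "- sn (q + 1) = sn (q + 1)" using n by (simp add: ips)
      then show False using s_nz[OF n(2)] by simp
    qed
    have sc: "scalars e f' A B'" unfolding f'_def B'_def by (rule scalars_rescale[OF s z0])
    have r': "rooted e f'" unfolding f'_def by (rule rooted_rescale[OF r z0 TT_carrier])
    have AB: "B' q * A (q + 1) * t (cc q) (bar ?y) = B' (q + 1) * A q * t (cc q) ?y"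
      using sw ne nz t by (simp add: B'_def z_def)
    show ?thesis
    proof (intro exI conjI allI impI)
      fix c :: "complex vec \<Rightarrow> complex" assume c: "\<forall>\<alpha>\<in>white G P. c \<alpha> \<noteq> 0 \<and> c (\<tau> \<alpha>) = c \<alpha>"
      have "c (sr (q + 1)) = c (sr q)" using c sr_white[OF qW] \<pi>(2)[OF qW] sw by metis
      then show "k_alg G P \<tau> e f' c \<noteq> lie_alg G"
        using c sw by (intro swapped_proper[OF _ _ _ _ _ r' _ _ sc AB]) auto
    qed (rule r')
  qed
qed

end

section \<open>The exceptions in rank four\<close>

text \<open>The orthogonal algebra so(8) of the form with ones on the antidiagonal.\<close>

definition skew8 :: "(nat \<Rightarrow> nat \<Rightarrow> complex) \<Rightarrow> bool" where
  "skew8 u \<longleftrightarrow> (\<forall>i<8. \<forall>j<8. u (7 - j) (7 - i) = - u i j)"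

definition comm8 :: "(nat \<Rightarrow> nat \<Rightarrow> complex) \<Rightarrow> (nat \<Rightarrow> nat \<Rightarrow> complex) \<Rightarrow> nat \<Rightarrow> nat \<Rightarrow> complex" where
  "comm8 u v i j = (\<Sum>k<8. u i k * v k j - v i k * u k j)"

lemma comm8_expand: "comm8 u v i j =
    (u i 0 * v 0 j - v i 0 * u 0 j) + (u i 1 * v 1 j - v i 1 * u 1 j) +
    (u i 2 * v 2 j - v i 2 * u 2 j) + (u i 3 * v 3 j - v i 3 * u 3 j) +
    (u i 4 * v 4 j - v i 4 * u 4 j) + (u i 5 * v 5 j - v i 5 * u 5 j) +
    (u i 6 * v 6 j - v i 6 * u 6 j) + (u i 7 * v 7 j - v i 7 * u 7 j)"
proof -
  have "{..<8 :: nat} = {0, 1, 2, 3, 4, 5, 6, 7}" by auto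
  then show ?thesis by (simp add: comm8_def)
qed

text \<open>Eliminates all but 28 independent entries, so that relations between the entries of a
  commutator become polynomial identities that can be checked by expansion.\<close>

lemma skew8_rules:
  assumes "skew8 u"
  shows
    "u 7 7 = - u 0 0" "u 6 7 = - u 0 1" "u 5 7 = - u 0 2" "u 4 7 = - u 0 3" "u 3 7 = - u 0 4"
    "u 2 7 = - u 0 5" "u 1 7 = - u 0 6" "u 7 6 = - u 1 0" "u 6 6 = - u 1 1" "u 5 6 = - u 1 2"
    "u 4 6 = - u 1 3" "u 3 6 = - u 1 4" "u 2 6 = - u 1 5" "u 7 5 = - u 2 0" "u 6 5 = - u 2 1"
    "u 5 5 = - u 2 2" "u 4 5 = - u 2 3" "u 3 5 = - u 2 4" "u 7 4 = - u 3 0" "u 6 4 = - u 3 1"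
    "u 5 4 = - u 3 2" "u 4 4 = - u 3 3" "u 7 3 = - u 4 0" "u 6 3 = - u 4 1" "u 5 3 = - u 4 2"
    "u 7 2 = - u 5 0" "u 6 2 = - u 5 1" "u 7 1 = - u 6 0" "u 0 7 = 0" "u 1 6 = 0" "u 2 5 = 0" "u 3 4 = 0"
    "u 4 3 = 0" "u 5 2 = 0" "u 6 1 = 0" "u 7 0 = 0"
proof -
  have A: "u (7 - j) (7 - i) = - u i j" if "i < 8" "j < 8" for i j using assms that by (simp add: skew8_def)
  have Z: "u i (7 - i) = 0" if "i < 8" for i
    using A[of i "7 - i"] that by (simp add: eq_neg_iff_add_eq_0 mult_2[symmetric])
  show "u 7 7 = - u 0 0" using A[of 0 0] by simp
  show "u 6 7 = - u 0 1" using A[of 0 1] by simp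
  show "u 5 7 = - u 0 2" using A[of 0 2] by simp
  show "u 4 7 = - u 0 3" using A[of 0 3] by simp
  show "u 3 7 = - u 0 4" using A[of 0 4] by simp
  show "u 2 7 = - u 0 5" using A[of 0 5] by simp
  show "u 1 7 = - u 0 6" using A[of 0 6] by simp
  show "u 7 6 = - u 1 0" using A[of 1 0] by simp
  show "u 6 6 = - u 1 1" using A[of 1 1] by simp
  show "u 5 6 = - u 1 2" using A[of 1 2] by simp
  show "u 4 6 = - u 1 3" using A[of 1 3] by simp
  show "u 3 6 = - u 1 4" using A[of 1 4] by simp
  show "u 2 6 = - u 1 5" using A[of 1 5] by simp
  show "u 7 5 = - u 2 0" using A[of 2 0] by simp
  show "u 6 5 = - u 2 1" using A[of 2 1] by simp
  show "u 5 5 = - u 2 2" using A[of 2 2] by simp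
  show "u 4 5 = - u 2 3" using A[of 2 3] by simp
  show "u 3 5 = - u 2 4" using A[of 2 4] by simp
  show "u 7 4 = - u 3 0" using A[of 3 0] by simp
  show "u 6 4 = - u 3 1" using A[of 3 1] by simp
  show "u 5 4 = - u 3 2" using A[of 3 2] by simp
  show "u 4 4 = - u 3 3" using A[of 3 3] by simp
  show "u 7 3 = - u 4 0" using A[of 4 0] by simp
  show "u 6 3 = - u 4 1" using A[of 4 1] by simp
  show "u 5 3 = - u 4 2" using A[of 4 2] by simp
  show "u 7 2 = - u 5 0" using A[of 5 0] by simp
  show "u 6 2 = - u 5 1" using A[of 5 1] by simp
  show "u 7 1 = - u 6 0" using A[of 6 0] by simp
  show "u 0 7 = 0" using Z[of 0] by simp
  show "u 1 6 = 0" using Z[of 1] by simp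
  show "u 2 5 = 0" using Z[of 2] by simp
  show "u 3 4 = 0" using Z[of 3] by simp
  show "u 4 3 = 0" using Z[of 4] by simp
  show "u 5 2 = 0" using Z[of 5] by simp
  show "u 6 1 = 0" using Z[of 6] by simp
  show "u 7 0 = 0" using Z[of 7] by simp
qed

text \<open>
  The relations \<open>u\<^bsub>-\<tau>\<beta>\<^esub> = \<gamma>\<^bsub>\<beta>\<^esub> u\<^bsub>\<beta>\<^esub>\<close> for all positive roots \<open>\<beta>\<close>, where \<open>\<tau>\<close> interchanges the first and the last simple
  root, with the coefficients forced by the parameters \<open>a, b, c\<close> at the simple roots.
\<close>

definition tri8 :: "complex \<Rightarrow> complex \<Rightarrow> complex \<Rightarrow> (nat \<Rightarrow> nat \<Rightarrow> complex) \<Rightarrow> bool" where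
  "tri8 a b c u \<longleftrightarrow>
    u 4 2 = a * u 0 1 \<and> u 4 1 = a * b * u 0 2 \<and> u 5 1 = a * b * c * u 0 3 \<and>
    u 4 0 = a * a * b * u 0 4 \<and> u 5 0 = - (a * a * b * c * u 0 5) \<and>
    u 6 0 = a * a * b * b * c * u 0 6 \<and> u 1 0 = a * u 2 4 \<and> u 2 1 = b * u 1 2 \<and>
    u 3 1 = - (b * c * u 1 3) \<and> u 2 0 = a * b * u 1 4 \<and> u 3 0 = a * b * c * u 1 5 \<and>
    u 3 2 = c * u 2 3 \<and> u 1 1 = - u 0 0 \<and> u 2 2 = - u 0 0 \<and> u 3 3 = - u 0 0"

text \<open>The 15 relations leave 13 of the 28 entries free, the dimension of so(5) plus so(3). The
  verification is a direct expansion in these free entries.\<close>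

lemma tri8_comm8:
  assumes "skew8 u" "skew8 v" "tri8 a b c u" "tri8 a b c v"
  shows "tri8 a b c (comm8 u v)"
proof -
  note r = skew8_rules[OF assms(1)] skew8_rules[OF assms(2)] assms(3,4)[unfolded tri8_def]
  show ?thesis unfolding tri8_def
    by (intro conjI; unfold comm8_expand; simp only: r; simp add: algebra_simps)
qed

lemma tri8_linear: "tri8 a b c u \<Longrightarrow> tri8 a b c v \<Longrightarrow> tri8 a b c (\<lambda>i j. u i j + v i j)"
  "tri8 a b c u \<Longrightarrow> tri8 a b c (\<lambda>i j. z * u i j)" "tri8 a b c (\<lambda>i j. 0)"
  unfolding tri8_def by (simp_all only: distrib_left mult.left_commute[of z] add_0 mult_zero_right) (auto simp: algebra_simps)

text \<open>
  The upper right block of size four determines the lower left one through the Hodge star of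
  \<open>\<Lambda>\<^sup>2 \<complex>\<^sup>4\<close>, and the diagonal block is traceless.
\<close>

definition spin8 :: "complex \<Rightarrow> (nat \<Rightarrow> nat \<Rightarrow> complex) \<Rightarrow> bool" where
  "spin8 d u \<longleftrightarrow>
    u 5 1 = d * u 0 4 \<and> u 4 1 = - (d * u 0 5) \<and> u 4 2 = d * u 0 6 \<and>
    u 5 0 = - (d * u 1 4) \<and> u 4 0 = d * u 1 5 \<and> u 6 0 = d * u 2 4 \<and>
    u 3 3 = - (u 0 0 + u 1 1 + u 2 2)"

text \<open>The 7 relations leave 21 of the 28 entries free, the dimension of so(7).\<close>

lemma spin8_comm8:
  assumes "skew8 u" "skew8 v" "spin8 d u" "spin8 d v"
  shows "spin8 d (comm8 u v)"
proof -
  note r = skew8_rules[OF assms(1)] skew8_rules[OF assms(2)] assms(3,4)[unfolded spin8_def]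
  show ?thesis unfolding spin8_def
    by (intro conjI; unfold comm8_expand; simp only: r; simp add: algebra_simps)
qed

lemma spin8_linear: "spin8 d u \<Longrightarrow> spin8 d v \<Longrightarrow> spin8 d (\<lambda>i j. u i j + v i j)"
  "spin8 d u \<Longrightarrow> spin8 d (\<lambda>i j. z * u i j)" "spin8 d (\<lambda>i j. 0)"
  unfolding spin8_def by (simp_all only: distrib_left mult.left_commute[of z] add_0 mult_zero_right) (auto simp: algebra_simps)

lemma two_term_scale:
  fixes A B r w :: complex
  assumes "p \<Longrightarrow> A / B = r" "p' \<Longrightarrow> A * w / B = r"
  shows "A * (of_bool p + (if p' then - w else 0)) / B = r * (of_bool p - of_bool p')"
  using assms by (cases p; cases p') (simp_all add: right_diff_distrib diff_divide_distrib)

text \<open>Constant signs mean constant parity, so every matrix is even and the bracket is the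
  commutator. To reach \<open>skew8\<close> it remains to normalise the form.\<close>

locale so8 = osat +
  assumes D4: "shape G = ShapeD" "nodes G = 4" and par4: "\<forall>k<4. sn k = sn 0"
begin

lemma minus8 [simp]: "7 - i < (8 :: nat)"
  by (rule le_less_trans[OF diff_le_self]) simp

lemma N8: "N = 8"
  using shape_CD_N D4 by simp

text \<open>Lists the four chain weights and then their reflections in reverse order: the identity,
  or under the flip the exchange of 3 and 4.\<close>

definition ix :: "nat \<Rightarrow> nat" where
  "ix i = (if i < 4 then cc i else bar (cc (7 - i)))"

lemma ix_eq: "i < 8 \<Longrightarrow> ix i = (if fl \<and> (i = 3 \<or> i = 4) then 7 - i else i)"
  using N8 D4 by (auto simp: ix_def cc_def bar_def)

lemma ix_less: "i < 8 \<Longrightarrow> ix i < 8"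
  by (simp add: ix_eq)

lemma ix_ix: "i < 8 \<Longrightarrow> ix (ix i) = i"
  by (auto simp: ix_eq)

lemma ix_inj: "i < 8 \<Longrightarrow> j < 8 \<Longrightarrow> ix i = ix j \<longleftrightarrow> i = j"
  using ix_ix by metis

lemma bar_ix: "i < 8 \<Longrightarrow> bar (ix i) = ix (7 - i)"
  using N8 by (auto simp: ix_eq bar_def)

lemma sum_ix: "(\<Sum>k<N. h k) = (\<Sum>k<8. h (ix k))" for h :: "nat \<Rightarrow> complex"
  unfolding N8 by (rule sum.reindex_bij_witness[of _ ix ix]) (auto simp: ix_ix ix_less)

lemma pr_same: "i < N \<Longrightarrow> j < N \<Longrightarrow> pr i = pr j"
proof -
  have c: "pr (cc k) = pr (cc 0)" if "k < 4" for k
    using par4 that pr_cases[of "cc k"] pr_cases[of "cc 0"] cc_less rn D4(2) by (auto simp: sn_def)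
  have "pr i = pr (cc 0)" if i: "i < N" for i
  proof -
    obtain k where "k < 4" "i = cc k \<or> i = bar (cc k)" using os_cover[OF osT i] rn D4 by auto
    then show ?thesis using c[of k] pr_bar[OF osT, of "cc k"] cc_less[of k] rn D4 by auto
  qed
  then show "i < N \<Longrightarrow> j < N \<Longrightarrow> pr i = pr j" by metis
qed

definition \<phi> :: "nat \<Rightarrow> complex" where "\<phi> i = form G $$ (bar (ix i), ix i)"

text \<open>Factors of a diagonal change of basis that brings the form to ones on the antidiagonal:
  the factors at opposite indices multiply to the value \<open>\<phi>\<close> of the form.\<close>

definition \<beta> :: "nat \<Rightarrow> complex" where "\<beta> i = (if i < 4 then \<phi> i else 1)"

lemma \<phi>_nz: "i < 8 \<Longrightarrow> \<phi> i \<noteq> 0"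
  using form_nz(2)[OF osT] ix_less N8 by (simp add: \<phi>_def)

lemma \<beta>_nz: "i < 8 \<Longrightarrow> \<beta> i \<noteq> 0"
  using \<phi>_nz by (simp add: \<beta>_def)

lemma eps_ix: "i < 8 \<Longrightarrow> eps (ix i) = 1"
proof -
  assume i: "i < 8"
  have "eps (n - 1) = 1" using eps_props(5)[OF osT D4(1)] .
  moreover have "eps (ix i) * eps (n - 1) = 1"
    using eps_props(2)[OF osT, of "ix i" "n - 1"] pr_same[of "ix i" "n - 1"] ix_less[OF i] N8 D4(2)
    by (simp flip: mult_2)
  ultimately show ?thesis by simp
qed

lemma \<phi>_bar: "i < 8 \<Longrightarrow> \<phi> (7 - i) = \<phi> i"
proof -
  assume i: "i < 8"
  have "eps (ix i) = 1" by (rule eps_ix[OF i])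
  moreover have "form G $$ (ix i, bar (ix i)) \<noteq> 0" using form_nz(1)[OF osT] ix_less[OF i] N8 by simp
  ultimately have "form G $$ (bar (ix i), ix i) = form G $$ (ix i, bar (ix i))" by (simp add: eps_def)
  moreover have "bar (ix (7 - i)) = ix i" using bar_ix[of "7 - i"] i by simp
  ultimately show ?thesis using bar_ix[OF i] by (simp add: \<phi>_def)
qed

lemma \<beta>_bar: "i < 8 \<Longrightarrow> \<beta> i * \<beta> (7 - i) = \<phi> i"
  using \<phi>_bar[of i] by (auto simp: \<beta>_def)

lemma t_ix: "i < 8 \<Longrightarrow> j < 8 \<Longrightarrow> t (ix i) (ix j) = - \<phi> i / \<phi> j"
  using pr_same[of "ix i" "ix j"] ix_less N8 by (simp add: t_def \<phi>_def flip: mult_2)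

text \<open>The matrix in the reordered and rescaled basis. The value 0 outside the range allows
  identities between functions instead of statements about bounded indices.\<close>

definition mt :: "complex mat \<Rightarrow> nat \<Rightarrow> nat \<Rightarrow> complex" where
  "mt X i j = (if i < 8 \<and> j < 8 then \<beta> i * X $$ (ix i, ix j) / \<beta> j else 0)"

lemma \<beta>_ratio: "i < 8 \<Longrightarrow> j < 8 \<Longrightarrow> \<beta> (7 - j) * (\<phi> i / \<phi> j) / \<beta> (7 - i) = \<beta> i / \<beta> j"
proof -
  assume "i < 8" "j < 8"
  then have "\<beta> (7 - j) = \<phi> j / \<beta> j" "\<beta> (7 - i) = \<phi> i / \<beta> i" "\<phi> i \<noteq> 0" "\<phi> j \<noteq> 0"
    using \<beta>_bar[of i] \<beta>_bar[of j] \<beta>_nz[of i] \<beta>_nz[of j] \<phi>_nz[of i] \<phi>_nz[of j] by (simp_all add: field_simps)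
  then show ?thesis by simp
qed

lemma skew8_mt: "X \<in> lie_alg G \<Longrightarrow> skew8 (mt X)"
  unfolding skew8_def
proof (intro allI impI)
  fix i j :: nat assume X: "X \<in> lie_alg G" and ij: "i < 8" "j < 8"
  have "X $$ (ix (7 - j), ix (7 - i)) = - (\<phi> i / \<phi> j) * X $$ (ix i, ix j)"
    using lie_alg_dual[OF X osT, of "ix i" "ix j"] t_ix[OF ij] bar_ix ij ix_less N8 by simp
  then have "mt X (7 - j) (7 - i) = - (\<beta> (7 - j) * (\<phi> i / \<phi> j) / \<beta> (7 - i)) * X $$ (ix i, ix j)"
    using ij by (simp add: mt_def)
  then show "mt X (7 - j) (7 - i) = - mt X i j" unfolding \<beta>_ratio[OF ij] using ij by (simp add: mt_def)
qed

lemma mt_add: "X \<in> lie_alg G \<Longrightarrow> Y \<in> lie_alg G \<Longrightarrow> mt (X + Y) = (\<lambda>i j. mt X i j + mt Y i j)"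
proof (intro ext)
  fix i j assume l: "X \<in> lie_alg G" "Y \<in> lie_alg G"
  show "mt (X + Y) i j = mt X i j + mt Y i j"
  proof (cases "i < 8 \<and> j < 8")
    case True
    then have "(X + Y) $$ (ix i, ix j) = X $$ (ix i, ix j) + Y $$ (ix i, ix j)" using l ix_less N8 by simp
    then show ?thesis using True by (simp add: mt_def distrib_left add_divide_distrib)
  next
    case False
    then show ?thesis by (auto simp: mt_def)
  qed
qed

lemma mt_smult: "X \<in> lie_alg G \<Longrightarrow> mt (z \<cdot>\<^sub>m X) = (\<lambda>i j. z * mt X i j)"
proof (intro ext)
  fix i j assume l: "X \<in> lie_alg G"
  show "mt (z \<cdot>\<^sub>m X) i j = z * mt X i j"
  proof (cases "i < 8 \<and> j < 8")
    case True
    then have "(z \<cdot>\<^sub>m X) $$ (ix i, ix j) = z * X $$ (ix i, ix j)" using l ix_less N8 by simp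
    then show ?thesis using True by (simp add: mt_def)
  next
    case False
    then show ?thesis by (auto simp: mt_def)
  qed
qed

lemma mt_zero: "mt (0\<^sub>m N N) = (\<lambda>i j. 0)"
  using ix_less N8 by (intro ext) (simp add: mt_def)

lemma mt_sbracket:
  assumes "X \<in> lie_alg G" "Y \<in> lie_alg G"
  shows "mt (sbracket G X Y) = comm8 (mt X) (mt Y)"
proof (intro ext)
  fix i j
  have sg1: "sg a k b = 1" if "a < N" "k < N" "b < N" for a k b
    using pr_same[of a k] pr_same[of k b] that by (simp add: sg_def power_mult flip: mult_2)
  show "mt (sbracket G X Y) i j = comm8 (mt X) (mt Y) i j"
  proof (cases "i < 8 \<and> j < 8")
    case True
    then have l: "i < 8" "j < 8" "ix i < N" "ix j < N" using ix_less N8 by auto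
    have "sbracket G X Y $$ (ix i, ix j) =
        (\<Sum>k<N. X $$ (ix i, k) * Y $$ (k, ix j) - sg (ix i) k (ix j) * (Y $$ (ix i, k) * X $$ (k, ix j)))"
      by (rule sbracket_index) (use assms l in auto)
    also have "\<dots> = (\<Sum>k<N. X $$ (ix i, k) * Y $$ (k, ix j) - Y $$ (ix i, k) * X $$ (k, ix j))"
      by (rule sum.cong) (use sg1 l in simp_all)
    also have "\<dots> = (\<Sum>k<8. X $$ (ix i, ix k) * Y $$ (ix k, ix j) - Y $$ (ix i, ix k) * X $$ (ix k, ix j))"
      by (rule sum_ix)
    finally have e: "sbracket G X Y $$ (ix i, ix j) = \<dots>" .
    have "mt (sbracket G X Y) i j = \<beta> i / \<beta> j * sbracket G X Y $$ (ix i, ix j)" using l by (simp add: mt_def)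
    also have "\<dots> = (\<Sum>k<8. \<beta> i / \<beta> j *
        (X $$ (ix i, ix k) * Y $$ (ix k, ix j) - Y $$ (ix i, ix k) * X $$ (ix k, ix j)))"
      unfolding e by (rule sum_distrib_left)
    also have "\<dots> = comm8 (mt X) (mt Y) i j" unfolding comm8_def
    proof (rule sum.cong)
      fix k :: nat assume "k \<in> {..<8}"
      then have "k < 8" "\<beta> k \<noteq> 0" using \<beta>_nz by auto
      then show "\<beta> i / \<beta> j * (X $$ (ix i, ix k) * Y $$ (ix k, ix j) - Y $$ (ix i, ix k) * X $$ (ix k, ix j)) =
          mt X i k * mt Y k j - mt Y i k * mt X k j"
        using l by (simp add: mt_def right_diff_distrib)
    qed simp
    finally show ?thesis .
  next
    case False
    then show ?thesis by (auto simp: mt_def comm8_def)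
  qed
qed

lemma subalgebra8:
  assumes comm: "\<And>u v. skew8 u \<Longrightarrow> skew8 v \<Longrightarrow> Q u \<Longrightarrow> Q v \<Longrightarrow> Q (comm8 u v)"
    and add: "\<And>u v. Q u \<Longrightarrow> Q v \<Longrightarrow> Q (\<lambda>i j. u i j + v i j)"
    and smult: "\<And>z u. Q u \<Longrightarrow> Q (\<lambda>i j. z * u i j)" and zero: "Q (\<lambda>i j. 0)"
  shows "subalgebra G {X \<in> lie_alg G. Q (mt X)}"
proof -
  note L = lie_alg_graded[unfolded graded_subspace_def]
  have ev: "even_part G X = X" if X: "X \<in> lie_alg G" for X
  proof (rule eq_matI)
    fix i j assume "i < dim_row X" "j < dim_col X"
    then have "i < N" "j < N" using X by auto
    then show "even_part G X $$ (i, j) = X $$ (i, j)" using pr_same[of i j] by (simp add: even_part_def)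
  qed (use X in \<open>simp_all add: even_part_def\<close>)
  show ?thesis unfolding subalgebra_def graded_subspace_def
    using L ev sbracket_lie_alg comm[OF skew8_mt skew8_mt] add smult zero by (simp add: mt_add mt_smult mt_zero mt_sbracket)
qed

definition unit8 :: "nat \<Rightarrow> nat \<Rightarrow> nat \<Rightarrow> nat \<Rightarrow> complex" where
  "unit8 i j a b = of_bool (a = i \<and> b = j) - of_bool (a = 7 - j \<and> b = 7 - i)"

lemma mt_F:
  assumes "i < 8" "j < 8" "a < 8" "b < 8"
  shows "mt (F (ix i) (ix j)) a b = \<beta> i / \<beta> j * unit8 i j a b"
proof -
  have i8: "ix a < N" "ix b < N" using assms ix_less N8 by auto
  have "F (ix i) (ix j) $$ (ix a, ix b) =
      of_bool (ix a = ix i \<and> ix b = ix j) + (if ix a = ix (7 - j) \<and> ix b = ix (7 - i) then t (ix i) (ix j) else 0)"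
    using F_index[OF i8, of "ix i" "ix j"] osT bar_ix[OF assms(1)] bar_ix[OF assms(2)] by simp
  also have "\<dots> = of_bool (a = i \<and> b = j) + (if a = 7 - j \<and> b = 7 - i then - (\<phi> i / \<phi> j) else 0)"
    using ix_inj assms t_ix[OF assms(1,2)] by simp
  finally have e: "mt (F (ix i) (ix j)) a b =
      \<beta> a * (of_bool (a = i \<and> b = j) + (if a = 7 - j \<and> b = 7 - i then - (\<phi> i / \<phi> j) else 0)) / \<beta> b"
    using assms by (simp add: mt_def)
  show ?thesis unfolding e unit8_def
  proof (rule two_term_scale)
    assume "a = i \<and> b = j"
    then show "\<beta> a / \<beta> b = \<beta> i / \<beta> j" by (elim conjE) (simp only:)
  next
    assume "a = 7 - j \<and> b = 7 - i"
    then have "a = 7 - j" "b = 7 - i" by auto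
    then show "\<beta> a * (\<phi> i / \<phi> j) / \<beta> b = \<beta> i / \<beta> j" using \<beta>_ratio[OF assms(1,2)] by (simp only:)
  qed
qed

lemma mt_FF:
  assumes "i < 8" "j < 8" "k < 8" "l < 8" "a < 8" "b < 8"
  shows "mt (p \<cdot>\<^sub>m F (ix i) (ix j) + r \<cdot>\<^sub>m F (ix k) (ix l)) a b =
    p * (\<beta> i / \<beta> j) * unit8 i j a b + r * (\<beta> k / \<beta> l) * unit8 k l a b"
proof -
  have F: "F (ix i) (ix j) \<in> lie_alg G" "F (ix k) (ix l) \<in> lie_alg G" using assms ix_less N8 by simp_all
  have "z \<cdot>\<^sub>m X \<in> lie_alg G" if "X \<in> lie_alg G" for z X
    using lie_alg_graded that unfolding graded_subspace_def by blast
  then have "mt (p \<cdot>\<^sub>m F (ix i) (ix j) + r \<cdot>\<^sub>m F (ix k) (ix l)) a b =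
      p * mt (F (ix i) (ix j)) a b + r * mt (F (ix k) (ix l)) a b"
    using F by (simp add: mt_add mt_smult)
  then show ?thesis by (simp only: mt_F[OF assms(1,2,5,6)] mt_F[OF assms(3,4,5,6)] mult.assoc)
qed

lemma mt_hmat: "mt (hmat \<xi> - hmat \<eta>) a b =
    (if a < 8 \<and> a = b then inner_h G (wt (ix a)) \<xi> - inner_h G (wt (ix a)) \<eta> else 0)"
  using ix_less N8 ix_inj[of a b] \<beta>_nz[of a] by (auto simp: mt_def hmat_def)

lemma ix_cc: "k < 4 \<Longrightarrow> cc k = ix k" "k < 4 \<Longrightarrow> bar (cc k) = ix (7 - k)"
  by (auto simp: ix_def)

end

section \<open>The spin representation and triality\<close>

context so8
begin

lemma Z_ix: "k < 4 \<Longrightarrow> wt (ix k) = Z k"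
  by (simp add: Z_def ix_def)

lemma n4: "n = 4"
  by (fact D4(2))

lemma ced4: "ced 0 = (ix 0, ix 1)" "ced 1 = (ix 1, ix 2)" "ced 2 = (ix 2, ix 3)" "ced 3 = (ix 2, ix 4)"
  using rn D4 by (simp_all add: ced_def ix_def flip: numeral_2_eq_2)

lemma proper8:
  assumes Q: "subalgebra G {X \<in> lie_alg G. Q (mt X)}" and r: "rooted e f"
    and bl: "\<And>k l. bs k l \<Longrightarrow> Q (mt (F k l)) \<and> Q (mt (F l k))"
    and x: "\<And>j. j \<in> Wh \<Longrightarrow> Q (mt (e (sr j) + c (sr j) \<cdot>\<^sub>m f (TT (\<pi> j))))"
    and y: "\<And>j. j \<in> Wh \<Longrightarrow> Q (mt (hmat (sr j) - hmat (TT (\<pi> j))))"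
    and nQ: "\<not> Q (mt (F (ix 0) (ix 0)))"
  shows "k_alg G P \<tau> e f c \<noteq> lie_alg G"
proof -
  let ?S = "{X \<in> lie_alg G. Q (mt X)}"
  have "k_alg G P \<tau> e f c \<subseteq> ?S"
  proof (rule k_alg_subset[OF r Q])
    show "F k l \<in> ?S \<and> F l k \<in> ?S" if "bs k l" for k l using bl[OF that] bs_less[OF that] by simp
    fix j assume j: "j \<in> Wh"
    have g: "e (sr j) + c (sr j) \<cdot>\<^sub>m f (TT (\<pi> j)) \<in> gens e f c" "hmat (sr j) - hmat (TT (\<pi> j)) \<in> gens e f c"
      using sr_white[OF j] unfolding gens_def tilde_sr[OF j, symmetric] h_vec_eq by blast+
    show "e (sr j) + c (sr j) \<cdot>\<^sub>m f (TT (\<pi> j)) \<in> ?S" "hmat (sr j) - hmat (TT (\<pi> j)) \<in> ?S"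
      using g subsetD[OF gens_lie[OF r]] x[OF j] y[OF j] by simp_all
  qed
  moreover have "F (ix 0) (ix 0) \<in> lie_alg G" using ix_less N8 by simp
  ultimately show ?thesis using nQ by blast
qed

lemma x_scalars:
  assumes "scalars e f A B" "j \<in> Wh"
  shows "e (sr j) + c (sr j) \<cdot>\<^sub>m f (TT (\<pi> j)) =
    A j \<cdot>\<^sub>m F (fst (ced j)) (snd (ced j)) + (c (sr j) * B j) \<cdot>\<^sub>m F (snd (hp (\<pi> j))) (fst (hp (\<pi> j)))"
  using assms unfolding scalars_def by (simp add: smult_smult_mat)

lemma sn4: "k < 4 \<Longrightarrow> sn k = sn 0"
  using par4 by blast

lemma ipZ: "k < 4 \<Longrightarrow> j < 4 \<Longrightarrow> ip (Z k) (Z j) = (if k = j then sn 0 else 0)"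
proof -
  assume "k < 4" "j < 4"
  then have "ip (Z k) (Z j) = (if k = j then sn k else 0)" "sn k = sn 0" using iZ[of k j] n4 sn4[of k] by auto
  then show ?thesis by (simp only:)
qed

lemma sr4: "sr 0 = Z 0 - Z 1" "sr 1 = Z 1 - Z 2" "sr 2 = Z 2 - Z 3" "sr 3 = Z 2 + Z 3"
proof -
  show "sr 0 = Z 0 - Z 1" using sr_c[of 0] n4 by simp
  show "sr 1 = Z 1 - Z 2" using sr_c[of 1] unfolding one_add_one n4 by simp
  have "(2 :: nat) + 1 = 3" by simp
  then show "sr 2 = Z 2 - Z 3" using sr_c[of 2] n4 by simp
  have "n - 1 = 3" "n - 2 = 2" "n > 0" using n4 by simp_all
  then show "sr 3 = Z 2 + Z 3" using sr_e(3)[OF _ D4(1)] by metis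
qed

theorem spin_proper:
  assumes B3: "Bl = {0, 1, 2}" and r: "rooted e f" and c: "\<And>\<alpha>. \<alpha> \<in> white G P \<Longrightarrow> c \<alpha> \<noteq> 0"
  shows "k_alg G P \<tau> e f c \<noteq> lie_alg G"
proof -
  have W: "Wh = {3}"
  proof -
    have "j < 4 \<and> j \<notin> {0, 1, 2} \<longleftrightarrow> j = 3" for j :: nat by (simp, linarith)
    then show ?thesis unfolding Wh_def B3 n4 by blast
  qed
  then have p3: "\<pi> 3 = 3" using \<pi>(1)[of 3] by simp
  have "{0..<3 :: nat} = {0, 1, 2}" by auto
  then have "lo 3 = 0" using lo_least[of 0 3] B3 by simp
  moreover have "eps (cc 0) = 1" using eps_ix[of 0] ix_cc(1)[of 0] by simp
  ultimately have h: "hp 3 = (ix 0, ix 6)"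
    using rn D4 B3 ix_cc(1)[of 0] ix_cc(2)[of 1] by (simp add: hp_def)
  obtain A B where s: "scalars e f A B" using scalars_exist[OF r] by blast
  have nz: "A 3 \<noteq> 0" "B 3 \<noteq> 0" using s W by (auto simp: scalars_def)
  \<comment> \<open>Read off from the relation \<open>u 6 0 = d * u 2 4\<close> for the single white
    generator; the quotients of \<open>\<beta>\<close> come from the change of basis.\<close>
  define d where "d = c (sr 3) * B 3 * (\<beta> 6 / \<beta> 0) / (A 3 * (\<beta> 2 / \<beta> 4))"
  have d: "d * (A 3 * (\<beta> 2 / \<beta> 4)) = c (sr 3) * B 3 * (\<beta> 6 / \<beta> 0)"
    using nz \<beta>_nz[of 2] \<beta>_nz[of 4] by (simp add: d_def)
  show ?thesis
  proof (rule proper8[OF _ r])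
    show "subalgebra G {X \<in> lie_alg G. spin8 d (mt X)}"
      by (rule subalgebra8) (simp_all add: spin8_comm8 spin8_linear)
    have un: "spin8 d (mt (F (ix i) (ix j))) \<and> spin8 d (mt (F (ix j) (ix i)))"
      if "(i, j) \<in> {(0, 1), (1, 2), (2, 3), (6, 7), (5, 6), (4, 5)}" for i j
      using that by (elim insertE) (simp_all add: spin8_def mt_F unit8_def)
    fix k l assume "bs k l"
    then show "spin8 d (mt (F k l)) \<and> spin8 d (mt (F l k))"
    proof (rule bs_cedE)
      fix j assume j: "j \<in> Bl" "k = fst (ced j)" "l = snd (ced j)"
      have "j = 0 \<or> j = 1 \<or> j = 2" using j(1) B3 by blast
      then show ?thesis unfolding j(2,3)
        by (elim disjE; simp only: ced4 fst_conv snd_conv; intro un; simp)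
    next
      fix j assume j: "j \<in> Bl" "k = bar (snd (ced j))" "l = bar (fst (ced j))"
      have b: "bar (ix 0) = ix 7" "bar (ix 1) = ix 6" "bar (ix 2) = ix 5" "bar (ix 3) = ix 4"
        using bar_ix[of 0] bar_ix[of 1] bar_ix[of 2] bar_ix[of 3] by simp_all
      have "j = 0 \<or> j = 1 \<or> j = 2" using j(1) B3 by blast
      then show ?thesis unfolding j(2,3)
        by (elim disjE; simp only: ced4 fst_conv snd_conv b; intro un; simp)
    qed
  next
    fix j assume "j \<in> Wh"
    then have j: "j = 3" using W by simp
    have x: "e (sr 3) + c (sr 3) \<cdot>\<^sub>m f (TT (\<pi> 3)) = A 3 \<cdot>\<^sub>m F (ix 2) (ix 4) + (c (sr 3) * B 3) \<cdot>\<^sub>m F (ix 6) (ix 0)"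
      using x_scalars[OF s, of 3 c] W p3 h ced4 by simp
    show "spin8 d (mt (e (sr j) + c (sr j) \<cdot>\<^sub>m f (TT (\<pi> j))))"
      unfolding j x spin8_def using d by (simp add: mt_FF unit8_def)
    have T: "TT 3 = Z 0 + Z 1"
    proof -
      have "TT 3 = wt (ix 0) - wt (bar (cc 1))" using h ix_cc(2)[of 1] by (simp add: TT_def)
      then show ?thesis using wt_bar_Z[of 1] n4 Z_ix[of 0] vec_minus_uminus[OF Z_carrier Z_carrier] by simp
    qed
    show "spin8 d (mt (hmat (sr j) - hmat (TT (\<pi> j))))"
      unfolding j p3 T sr4 spin8_def by (simp add: mt_hmat Z_ix inner_h_linear ipZ)
  next
    show "\<not> spin8 d (mt (F (ix 0) (ix 0)))"
      using \<beta>_nz[of 0] by (simp add: spin8_def mt_F unit8_def)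
  qed
qed

theorem tri_proper:
  assumes B0: "Bl = {}" and p: "\<pi> 0 = 3" "\<pi> 1 = 1" "\<pi> 2 = 2" "\<pi> 3 = 0"
  shows "\<exists>e f. rooted e f \<and> (\<forall>c. (\<forall>\<alpha>\<in>white G P. c \<alpha> \<noteq> 0 \<and> c (\<tau> \<alpha>) = c \<alpha>) \<longrightarrow> k_alg G P \<tau> e f c \<noteq> lie_alg G)"
proof -
  have W: "Wh = {0, 1, 2, 3}" using n4 B0 by (auto simp: Wh_def)
  have lo: "lo j = j" for j using lo_eq[of j] B0 by simp
  have hi: "hi j = j" if "j \<le> 4" for j using hi_eq[of j] that n4 B0 by simp
  have h: "hp 0 = (ix 0, ix 1)" "hp 1 = (ix 1, ix 2)" "hp 2 = (ix 2, ix 3)" "hp 3 = (ix 2, ix 4)"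
    using rn D4 B0 lo hi by (simp_all add: hp_def ix_def flip: numeral_2_eq_2)
  obtain e f where r: "rooted e f" using rooted_exists by blast
  obtain A B where s: "scalars e f A B" using scalars_exist[OF r] by blast
  have nz: "A j \<noteq> 0" "B j \<noteq> 0" if "j \<in> Wh" for j using s that by (auto simp: scalars_def)
  \<comment> \<open>The nodes 0 and 3 both determine the first parameter of \<open>tri8\<close>,
    through \<open>u 4 2 = a * u 0 1\<close> and \<open>u 1 0 = a * u 2 4\<close>. The rescaling
    makes the two values agree as soon as the mixture parameters at these nodes are equal.\<close>
  define z where "z = B 3 * A 0 / (B 0 * A 3)"
  have z0: "z \<noteq> 0" using nz[of 0] nz[of 3] W by (simp add: z_def)
  define f' where "f' = f(TT 3 := z \<cdot>\<^sub>m f (TT 3))"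
  define B' where "B' = (\<lambda>j. if TT (\<pi> j) = TT 3 then z * B j else B j)"
  have r': "rooted e f'" unfolding f'_def by (rule rooted_rescale[OF r z0 TT_carrier])
  have s': "scalars e f' A B'" unfolding f'_def B'_def by (rule scalars_rescale[OF s z0])
  have Teq: "TT 0 = sr 0" "TT 1 = sr 1" "TT 2 = sr 2" "TT 3 = sr 3"
    using sr_ced[of 0] sr_ced[of 1] sr_ced[of 2] sr_ced[of 3] n4 h ced4 by (simp_all add: TT_def)
  have "sr 0 \<noteq> sr 3" using sr_inj[of 0 3] n4 by auto
  then have b: "B' 0 = z * B 0" "B' 3 = B 3" using p Teq by (simp_all add: B'_def)
  have AB: "B' 0 * A 3 = B' 3 * A 0" using nz[of 0] nz[of 3] W by (simp add: b z_def)
  have "k_alg G P \<tau> e f' c \<noteq> lie_alg G" if c: "\<forall>\<alpha>\<in>white G P. c \<alpha> \<noteq> 0 \<and> c (\<tau> \<alpha>) = c \<alpha>" for c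
  proof -
    have c3: "c (sr 3) = c (sr 0)" using c sr_white[of 0] \<pi>(2)[of 0] W p by auto
    have nz': "A 0 \<noteq> 0" "A 1 \<noteq> 0" "A 2 \<noteq> 0" "A 3 \<noteq> 0" using nz W by auto
    have \<beta>nz: "\<beta> 0 \<noteq> 0" "\<beta> 1 \<noteq> 0" "\<beta> 2 \<noteq> 0" "\<beta> 3 \<noteq> 0" "\<beta> 4 \<noteq> 0" by (simp_all add: \<beta>_nz)
    define d0 where "d0 = c (sr 0) * B' 0 * (\<beta> 4 / \<beta> 2) / (A 0 * (\<beta> 0 / \<beta> 1))"
    define d1 where "d1 = c (sr 1) * B' 1 * (\<beta> 2 / \<beta> 1) / (A 1 * (\<beta> 1 / \<beta> 2))"
    define d2 where "d2 = c (sr 2) * B' 2 * (\<beta> 3 / \<beta> 2) / (A 2 * (\<beta> 2 / \<beta> 3))"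
    have d0: "c (sr 0) * B' 0 * (\<beta> 4 / \<beta> 2) = d0 * (A 0 * (\<beta> 0 / \<beta> 1))"
      using nz' \<beta>nz by (simp add: d0_def)
    have d1: "c (sr 1) * B' 1 * (\<beta> 2 / \<beta> 1) = d1 * (A 1 * (\<beta> 1 / \<beta> 2))"
      using nz' \<beta>nz by (simp add: d1_def)
    have d2: "c (sr 2) * B' 2 * (\<beta> 3 / \<beta> 2) = d2 * (A 2 * (\<beta> 2 / \<beta> 3))"
      using nz' \<beta>nz by (simp add: d2_def)
    have B3: "B' 3 = B' 0 * A 3 / A 0" using AB nz' by (simp add: field_simps)
    have d3: "c (sr 3) * B' 3 * (\<beta> 1 / \<beta> 0) = d0 * (A 3 * (\<beta> 2 / \<beta> 4))"
      unfolding c3 B3 d0_def using nz' \<beta>nz by (simp add: field_simps)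
    have x: "e (sr 0) + c (sr 0) \<cdot>\<^sub>m f' (TT (\<pi> 0)) = A 0 \<cdot>\<^sub>m F (ix 0) (ix 1) + (c (sr 0) * B' 0) \<cdot>\<^sub>m F (ix 4) (ix 2)"
      "e (sr 1) + c (sr 1) \<cdot>\<^sub>m f' (TT (\<pi> 1)) = A 1 \<cdot>\<^sub>m F (ix 1) (ix 2) + (c (sr 1) * B' 1) \<cdot>\<^sub>m F (ix 2) (ix 1)"
      "e (sr 2) + c (sr 2) \<cdot>\<^sub>m f' (TT (\<pi> 2)) = A 2 \<cdot>\<^sub>m F (ix 2) (ix 3) + (c (sr 2) * B' 2) \<cdot>\<^sub>m F (ix 3) (ix 2)"
      "e (sr 3) + c (sr 3) \<cdot>\<^sub>m f' (TT (\<pi> 3)) = A 3 \<cdot>\<^sub>m F (ix 2) (ix 4) + (c (sr 3) * B' 3) \<cdot>\<^sub>m F (ix 1) (ix 0)"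
      using x_scalars[OF s', of 0 c] x_scalars[OF s', of 1 c] x_scalars[OF s', of 2 c] x_scalars[OF s', of 3 c] W
      unfolding p h ced4 by simp_all
    show ?thesis
    proof (rule proper8[OF _ r'])
      show "subalgebra G {X \<in> lie_alg G. tri8 d0 d1 d2 (mt X)}"
        by (rule subalgebra8) (simp_all add: tri8_comm8 tri8_linear)
      show "tri8 d0 d1 d2 (mt (F k l)) \<and> tri8 d0 d1 d2 (mt (F l k))" if "bs k l" for k l
        using that B0 by (auto elim: bs_cedE)
    next
      fix j assume "j \<in> Wh"
      then have j: "j = 0 \<or> j = 1 \<or> j = 2 \<or> j = 3" using W by auto
      then show "tri8 d0 d1 d2 (mt (e (sr j) + c (sr j) \<cdot>\<^sub>m f' (TT (\<pi> j))))"
      proof (elim disjE)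
        assume j: "j = 0"
        show ?thesis unfolding j x(1) tri8_def using d0 by (simp add: mt_FF unit8_def)
      next
        assume j: "j = 1"
        show ?thesis unfolding j x(2) tri8_def using d1 by (simp add: mt_FF unit8_def)
      next
        assume j: "j = 2"
        show ?thesis unfolding j x(3) tri8_def using d2 by (simp add: mt_FF unit8_def)
      next
        assume j: "j = 3"
        show ?thesis unfolding j x(4) tri8_def using d3 by (simp add: mt_FF unit8_def)
      qed
      show "tri8 d0 d1 d2 (mt (hmat (sr j) - hmat (TT (\<pi> j))))"
        using j
      proof (elim disjE)
        assume j: "j = 0"
        show ?thesis unfolding j p Teq sr4 tri8_def by (simp add: mt_hmat Z_ix inner_h_linear ipZ)
      next
        assume j: "j = 1"
        show ?thesis unfolding j p Teq sr4 tri8_def by (simp add: mt_hmat)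
      next
        assume j: "j = 2"
        show ?thesis unfolding j p Teq sr4 tri8_def by (simp add: mt_hmat)
      next
        assume j: "j = 3"
        show ?thesis unfolding j p Teq sr4 tri8_def by (simp add: mt_hmat Z_ix inner_h_linear ipZ)
      qed
    next
      show "\<not> tri8 d0 d1 d2 (mt (F (ix 0) (ix 0)))"
        using \<beta>_nz[of 0] by (simp add: tri8_def mt_F unit8_def)
    qed
  qed
  then show ?thesis using r' by blast
qed

end

section \<open>The theorem\<close>

context osat
begin

theorem os_proper:
  assumes GS: "graded_satake G P \<tau>" and C4: "\<not> config4 True G P \<tau>" and ne: "Wh \<noteq> {}"
  shows "\<exists>e f. rooted e f \<and> (\<forall>c. (\<forall>\<alpha>\<in>white G P. c \<alpha> \<noteq> 0 \<and> c (\<tau> \<alpha>) = c \<alpha>) \<longrightarrow> k_alg G P \<tau> e f c \<noteq> lie_alg G)"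
proof -
  have G1: "\<not> config1 G P \<tau>" using GS by (simp add: graded_satake_def)
  show ?thesis
  proof (rule sized_cases[OF ne G1])
    fix q assume "sized q"
    then interpret sat G P \<Phi> \<tau> q by unfold_locales (use GS C4 in auto)
    show ?thesis by (rule sized_proper)
  next
    assume a: "shape G = ShapeD" "n = 4" "Bl = {}" "\<forall>k<4. sn k = sn 0" "\<pi> 0 = 3" "\<pi> 1 = 1" "\<pi> 2 = 2" "\<pi> 3 = 0"
    interpret so8 G P \<Phi> \<tau> by unfold_locales (fact a)+
    show ?thesis by (rule tri_proper) (fact a)+
  next
    assume a: "shape G = ShapeD" "n = 4" "Bl = {0, 1, 2}" "\<forall>k<4. sn k = sn 0"
    interpret so8 G P \<Phi> \<tau> by unfold_locales (fact a)+
    obtain e f where "rooted e f" using rooted_exists by blast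
    then show ?thesis using spin_proper[OF a(3)] by blast
  qed
qed

end

context satake
begin

text \<open>The numbering behind \<open>\<pi>\<close> depends on the flip, but the nodes before the
  two end nodes keep their numbers. The property can thus be expressed by the original roots and
  used to decide about the flip.\<close>

lemma \<pi>_small:
  assumes j: "j \<in> Wh"
  shows "\<pi> j < n - 2 \<longleftrightarrow> \<tau> (sr j) \<in> simple_root G ` {..<n - 2}"
proof
  have s: "sr k = simple_root G k" if "k < n - 2" for k using that by (auto simp: sr_def \<rho>_def)
  show "\<tau> (sr j) \<in> simple_root G ` {..<n - 2}" if "\<pi> j < n - 2" using \<pi>(2)[OF j] s[OF that] that by force
  assume "\<tau> (sr j) \<in> simple_root G ` {..<n - 2}"
  then obtain k where k: "k < n - 2" "sr (\<pi> j) = sr k" using \<pi>(2)[OF j] s by auto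
  then show "\<pi> j < n - 2" using sr_inj[of "\<pi> j" k] WhD(1)[OF \<pi>(1)[OF j]] by simp
qed

lemma proper_conclusion:
  assumes "rooted e f"
    and "\<And>c. \<forall>\<alpha>\<in>white G P. c \<alpha> \<noteq> 0 \<and> c (\<tau> \<alpha>) = c \<alpha> \<Longrightarrow> k_alg G P \<tau> e f c \<noteq> lie_alg G"
  shows "\<exists>e f.
    (\<forall>\<alpha>\<in>white G P.
       e \<alpha> \<in> root_space G \<alpha> - {0\<^sub>m (dimV G) (dimV G)} \<and>
       f (tilde G P \<tau> \<alpha>) \<in> root_space G (- tilde G P \<tau> \<alpha>) - {0\<^sub>m (dimV G) (dimV G)}) \<and>
    (\<forall>c. (\<forall>\<alpha>\<in>white G P. c \<alpha> \<noteq> 0 \<and> c (\<tau> \<alpha>) = c \<alpha>) \<longrightarrow>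
       subalgebra G (k_alg G P \<tau> e f c) \<and>
       spherical G (k_alg G P \<tau> e f c) \<and>
       k_alg G P \<tau> e f c \<noteq> lie_alg G)"
proof (rule exI[of _ e], rule exI[of _ f], intro conjI allI impI)
  show "\<forall>\<alpha>\<in>white G P. e \<alpha> \<in> root_space G \<alpha> - {0\<^sub>m N N} \<and>
      f (tilde G P \<tau> \<alpha>) \<in> root_space G (- tilde G P \<tau> \<alpha>) - {0\<^sub>m N N}"
    using assms(1) by (simp only: rooted_def)
  fix c :: "complex vec \<Rightarrow> complex" assume c: "\<forall>\<alpha>\<in>white G P. c \<alpha> \<noteq> 0 \<and> c (\<tau> \<alpha>) = c \<alpha>"
  then have nz: "\<And>\<alpha>. \<alpha> \<in> white G P \<Longrightarrow> c \<alpha> \<noteq> 0" by blast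
  show "subalgebra G (k_alg G P \<tau> e f c)" "spherical G (k_alg G P \<tau> e f c)"
    by (rule k_alg_spherical[OF assms(1) nz]; assumption)+
  show "k_alg G P \<tau> e f c \<noteq> lie_alg G" by (rule assms(2)[OF c])
qed

end

text \<open>The flip is made in two situations, which exclude each other: if the last node is black
  and \<open>n - 2\<close> is white, and if both are white and only \<open>n - 2\<close> is mapped
  into the chain. The first secures \<open>nb\<close>, the second \<open>wl\<close>.\<close>

lemma choose_end_order:
  fixes G :: super_data and P :: "complex vec set"
  assumes adm: "admissible G" and P: "P \<subseteq> simple_roots G" and b: "bij_betw \<tau> (white G P) (white G P)"
    and SS: "super_symmetric G P \<tau>" and os: "shape G \<noteq> ShapeA"
  shows "\<exists>\<Phi>. osat G P \<Phi> \<tau>"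
proof -
  interpret levi_data G P by unfold_locales (fact adm, fact P)
  let ?S = "simple_root G ` {..<n - 2}"
  define \<Phi> :: "nat set" where "\<Phi> = (if shape G = ShapeD \<and>
      (simple_root G (n - 1) \<in> P \<and> simple_root G (n - 2) \<notin> P \<or>
       simple_root G (n - 1) \<notin> P \<and> simple_root G (n - 2) \<notin> P \<and>
         \<tau> (simple_root G (n - 2)) \<in> ?S \<and> \<tau> (simple_root G (n - 1)) \<notin> ?S)
    then {n - 1} else {})"
  interpret chain G P \<Phi> by unfold_locales (auto simp: \<Phi>_def split: if_splits)
  have sr_end: "sr (n - 1) = simple_root G (if n - 1 \<in> \<Phi> then n - 2 else n - 1)"
    "sr (n - 2) = simple_root G (if n - 1 \<in> \<Phi> then n - 1 else n - 2)" if "shape G = ShapeD"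
    using D_facts[OF that] by (auto simp: sr_def \<rho>_def)
  interpret good_chain G P \<Phi>
  proof
    assume D: "shape G = ShapeD" and B: "n - 1 \<in> Bl"
    have "n - 1 \<notin> \<Phi>"
    proof
      assume "n - 1 \<in> \<Phi>"
      then have "sr (n - 1) \<notin> P" using sr_end[OF D] by (auto simp: \<Phi>_def split: if_splits)
      then show False using B by (simp add: Bl_def)
    qed
    then have "sr (n - 1) = simple_root G (n - 1)" "sr (n - 2) = simple_root G (n - 2)" "sr (n - 1) \<in> P"
      using sr_end[OF D] B by (auto simp: Bl_def)
    then have "sr (n - 2) \<in> P" using \<open>n - 1 \<notin> \<Phi>\<close> D by (auto simp: \<Phi>_def split: if_splits)
    then show "n - 2 \<in> Bl" using D_facts[OF D] by (simp add: Bl_def)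
  qed
  interpret satake G P \<Phi> \<tau> by unfold_locales (fact b)
  have "osat G P \<Phi> \<tau>"
  proof (unfold_locales)
    show "shape G \<noteq> ShapeA" by (fact os)
    show "super_symmetric G P \<tau>" by (fact SS)
    assume D: "shape G = ShapeD" and W: "n - 1 \<in> Wh" "n - 2 \<in> Wh" and small: "\<pi> (n - 2) < n - 2"
    have w: "sr (n - 1) \<notin> P" "sr (n - 2) \<notin> P" using sr_white[OF W(1)] sr_white[OF W(2)] by auto
    have "\<tau> (sr (n - 2)) \<in> ?S" using \<pi>_small[OF W(2)] small by simp
    then have "\<tau> (sr (n - 1)) \<in> ?S"
      using w sr_end[OF D] D by (auto simp: \<Phi>_def split: if_splits)
    then show "\<pi> (n - 1) < n - 2" using \<pi>_small[OF W(1)] by simp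
  qed
  then show ?thesis by blast
qed

text \<open>The ortho-symplectic case with all nodes black is left out, because then l is already
  all of g. For gl(V) the supertrace vanishes on l, so that case is included.\<close>

theorem theorem4p7:
  fixes G :: super_data
    and P :: "complex vec set"
    and \<tau> :: "complex vec \<Rightarrow> complex vec"
  assumes "admissible G"
    and "P \<subseteq> simple_roots G"
    and "shape G \<noteq> ShapeA \<longrightarrow> P \<noteq> simple_roots G"
    and "bij_betw \<tau> (white G P) (white G P)"
    and "super_symmetric G P \<tau>"
    and "graded_satake G P \<tau>"
    and "\<not> config4 True G P \<tau>"
  shows "\<exists>e f.
    (\<forall>\<alpha>\<in>white G P.
       e \<alpha> \<in> root_space G \<alpha> - {0\<^sub>m (dimV G) (dimV G)} \<and>
       f (tilde G P \<tau> \<alpha>) \<in> root_space G (- tilde G P \<tau> \<alpha>) - {0\<^sub>m (dimV G) (dimV G)}) \<and>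
    (\<forall>c. (\<forall>\<alpha>\<in>white G P. c \<alpha> \<noteq> 0 \<and> c (\<tau> \<alpha>) = c \<alpha>) \<longrightarrow>
       subalgebra G (k_alg G P \<tau> e f c) \<and>
       spherical G (k_alg G P \<tau> e f c) \<and>
       k_alg G P \<tau> e f c \<noteq> lie_alg G)"
proof (cases "shape G = ShapeA")
  case True
  interpret levi_data G P by unfold_locales (fact assms)+
  interpret satake G P "{}" \<tau> by unfold_locales (use assms(4) True in auto)
  obtain e f where "rooted e f" using rooted_exists by blast
  then show ?thesis using shape_A_proper True by (intro proper_conclusion) auto
next
  case False
  obtain \<Phi> where "osat G P \<Phi> \<tau>" using choose_end_order[OF assms(1,2,4,5) False] by blast
  then interpret osat G P \<Phi> \<tau> .
  have "Wh \<noteq> {}" using white_eq assms(2,3) False by auto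
  then obtain e f where "rooted e f"
    "\<forall>c. (\<forall>\<alpha>\<in>white G P. c \<alpha> \<noteq> 0 \<and> c (\<tau> \<alpha>) = c \<alpha>) \<longrightarrow> k_alg G P \<tau> e f c \<noteq> lie_alg G"
    using os_proper[OF assms(6,7)] by blast
  then show ?thesis by (intro proper_conclusion) auto
qed

end
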